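(* Let $0<a\le1$. Then, with the constants $\widetilde c_l=2/a-3$, $\widetilde c_\omega=2-2/a$, $\widetilde c_\theta=-2$, there exists a nontrivial symmetric whole-space profile $(\widetilde\Omega,\widetilde U,\widetilde\Theta)$ of functions on $\mathbb R$ solving the profile system $$(\widetilde c_l X+a\widetilde U)\widetilde\Theta_X=(\widetilde c_\theta+2\widetilde U_X)\widetilde\Theta,\qquad (\widetilde c_l X+a\widetilde U)\widetilde\Omega_X=\widetilde c_\omega\widetilde\Omega+\widetilde\Theta_X,\qquad -\widetilde U_{XX}=2\widetilde\Omega,\quad \widetilde U(0)=0,$$ and satisfying the Neumann condition $\lim_{|X|\to+\infty}\widetilde U_X(X)=0$, with the following properties: (1) $\widetilde U$ and $\widetilde\Omega$ are odd, and $\widetilde\Theta$ is even. (2) $\widetilde U_X(0)>0$, $\widetilde\Omega_X(0)>0$, $\widetilde\Theta_{XX}(0)>0$. (3) If $2/3<a\le1$, then $\widetilde U(X)/X$ and $\widetilde\Theta(X)/X^2$ are monotone decreasing on the positive half-line. (4) If $0<a\le2/3$, then $\operatorname{supp}\widetilde\Omega=\operatorname{supp}\widetilde\Theta=\mathbb R$. If $2/3<a\le1$, then there exists $L>0$ such that $\operatorname{supp}\widetilde\Omega\cup\operatorname{supp}\widetilde\Theta\subset[-L,L]$. (5) For $0<a\le2/3$, $\widetilde\Omega,\widetilde U,\widetilde\Theta\in C^\infty(\mathbb R)$. For $2/3<a<1$, $\widetilde\Omega$ and $\widetilde\Theta$ are compactly supported and, with $\beta:=\frac{1-a}{3a-2}$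 and $\gamma:=\frac2a+\frac{2(1-a)}{3a-2}$, $$\widetilde\Omega\in C^{\lceil\beta\rceil-1,\beta-\lceil\beta\rceil+1}(\mathbb R)\cap C^\infty(\mathbb R\setminus\{\pm L\}),$$ $$\widetilde U\in C^{1+\lceil\beta\rceil,\beta-\lceil\beta\rceil+1}(\mathbb R)\cap C^\infty(\mathbb R\setminus\{\pm L\}),$$ $$\widetilde\Theta\in C^{\lceil\gamma\rceil-1,\gamma-\lceil\gamma\rceil+1}(\mathbb R)\cap C^\infty(\mathbb R\setminus\{\pm L\}).$$ For $a=1$, with $\widetilde\Omega$ and $\widetilde\Theta$ extended by zero outside their support, $$\widetilde\Omega\in C^{0,1}(\mathbb R)\cap C^\infty(\mathbb R\setminus\{\pm L\}),\quad \widetilde U\in C^{2,1}(\mathbb R)\cap C^\infty(\mathbb R\setminus\{\pm L\}),\quad \widetilde\Theta\in C^{1,1}(\mathbb R)\cap C^\infty(\mathbb R\setminus\{\pm L\}).$$ Moreover, within the class of nontrivial symmetric whole-space profiles solving this profile system and satisfying the Neumann condition $\lim_{|X|\to+\infty}\widetilde U_X(X)=0$ and properties (1)–(5), the profile is unique up to the natural scaling invariance of the profile system. Furthermore, for any $T>0$, the functions $$\omega(x,t)=(T-t)^{\widetilde c_\omega}\,\widetilde\Omega\!\left(\frac{x}{(T-t)^{\widetilde c_l}}\right),\quad u(x,t)=(T-t)^{\widetilde c_l-1}\,\widetilde U\!\left(\frac{x}{(T-t)^{\widetilde c_l}}\right),\quad \theta(x,t)=(T-t)^{-2}\,\widetilde\Theta\!\left(\frac{x}{(T-t)^{\widetilde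 c_l}}\right)$$ define a solution on $\mathbb R\times[0,T)$ of the evolution system $$\theta_t+a u\theta_x=2u_x\theta,\qquad \omega_t+a u\omega_x=\theta_x,\qquad -u_{xx}=2\omega,\quad u(0,t)=0,$$ with the Neumann condition ($u_x(x,t)\to0$ as $|x|\to\infty$), which blows up at $t=T$. The blowup is focusing for $0<a<2/3$, neither focusing nor expanding for $a=2/3$, and expanding for $2/3<a\le1$.
   Context: The natural scaling invariance of the profile system is: if $(\omega,u,\theta,c_l,c_\omega,c_\theta)$ solves the profile system, then for any $\lambda_1\in\mathbb R$ and $\lambda_2>0$ so does $\big(\lambda_1\omega(\lambda_2x),\ \frac{\lambda_1}{\lambda_2^2}u(\lambda_2x),\ \frac{\lambda_1^2}{\lambda_2^2}\theta(\lambda_2x),\ \frac{\lambda_1}{\lambda_2}c_l,\ \frac{\lambda_1}{\lambda_2}c_\omega,\ \frac{\lambda_1}{\lambda_2}c_\theta\big)$. Standing structural assumption on profiles: $\widetilde U$ is odd and $\widetilde\Theta$ is the square of an odd function. The support is the closure of the set where the function is nonzero. $C^{k,\alpha}(\mathbb R)$ denotes functions with $k$ continuous derivatives, the $k$-th being Hölder continuous with exponent $\alpha\in(0,1]$ (Lipschitz if $\alpha=1$). "Monotone decreasing" means nonincreasing. The blowup is called focusing if the length scale $(T-t)^{\widetilde c_l}$ tends to $0$ as $t\to T^-$ ($\widetilde c_l>0$), neither focusing nor expanding if it is constant ($\widetilde c_l=0$), and expanding if it tends to $+\infty$ ($\widetilde c_l<0$). For $2/3<a\le 1$, equations containing derivatives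 of $\widetilde\Omega$ (respectively $\omega$) are understood pointwise away from $X=\pm L$ (respectively $x=\pm L(T-t)^{\widetilde c_l}$), where $\widetilde\Omega$ need not be differentiable. *)

theory Defs
  imports "HOL-Analysis.Analysis"
begin

definition odd_fun :: "(real \<Rightarrow> real) \<Rightarrow> bool" where
  "odd_fun f \<longleftrightarrow> (\<forall>x. f (- x) = - f x)"

definition even_fun :: "(real \<Rightarrow> real) \<Rightarrow> bool" where
  "even_fun f \<longleftrightarrow> (\<forall>x. f (- x) = f x)"

definition supp :: "(real \<Rightarrow> real) \<Rightarrow> real set" where
  "supp f = closure {x. f x \<noteq> 0}"

text \<open>The next two predicates are meant for open sets \<open>S\<close>: \<open>deriv\<close> is a two-sided derivative.\<close>

definition Ck_on :: "nat \<Rightarrow> (real \<Rightarrow> real) \<Rightarrow> real set \<Rightarrow> bool" where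
  "Ck_on k f S \<longleftrightarrow>
     (\<forall>j<k. \<forall>x\<in>S. (deriv ^^ j) f differentiable (at x)) \<and> continuous_on S ((deriv ^^ k) f)"

definition smooth_on :: "(real \<Rightarrow> real) \<Rightarrow> real set \<Rightarrow> bool" where
  "smooth_on f S \<longleftrightarrow> (\<forall>k. Ck_on k f S)"

text \<open>The class \<open>C\<^bsup>k,\<alpha>\<^esup>\<close> on the whole line, with a global Hoelder bound on the \<open>k\<close>-th derivative.\<close>

definition holder_class :: "nat \<Rightarrow> real \<Rightarrow> (real \<Rightarrow> real) \<Rightarrow> bool" where
  "holder_class k \<alpha> f \<longleftrightarrow> Ck_on k f UNIV \<and>
     (\<exists>C. \<forall>x y. \<bar>(deriv ^^ k) f x - (deriv ^^ k) f y\<bar> \<le> C * \<bar>x - y\<bar> powr \<alpha>)"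

definition coeff_l :: "real \<Rightarrow> real" where "coeff_l a = 2 / a - 3"
definition coeff_omega :: "real \<Rightarrow> real" where "coeff_omega a = 2 - 2 / a"
definition coeff_theta :: real where "coeff_theta = - 2"

text \<open>\<open>S\<close> is the set of points at which the equation containing the derivative of \<open>\<Omega>\<close> is not imposed.\<close>

definition solves_profile_system ::
  "real \<Rightarrow> real \<Rightarrow> real \<Rightarrow> real \<Rightarrow> real set
     \<Rightarrow> (real \<Rightarrow> real) \<Rightarrow> (real \<Rightarrow> real) \<Rightarrow> (real \<Rightarrow> real) \<Rightarrow> bool" where
  "solves_profile_system a cl c\<omega> c\<theta> S \<Omega> U \<Theta> \<longleftrightarrow>
     (\<forall>X. U differentiable (at X) \<and> deriv U differentiable (at X) \<and> \<Theta> differentiable (at X)) \<and>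
     (\<forall>X. (cl * X + a * U X) * deriv \<Theta> X = (c\<theta> + 2 * deriv U X) * \<Theta> X) \<and>
     (\<forall>X. X \<notin> S \<longrightarrow> \<Omega> differentiable (at X) \<and>
           (cl * X + a * U X) * deriv \<Omega> X = c\<omega> * \<Omega> X + deriv \<Theta> X) \<and>
     (\<forall>X. - deriv (deriv U) X = 2 * \<Omega> X) \<and>
     U 0 = 0"

definition exceptional :: "real \<Rightarrow> real \<Rightarrow> real set" where
  "exceptional a L = (if a \<le> 2 / 3 then {} else {- L, L})"

definition nontrivial ::
  "(real \<Rightarrow> real) \<Rightarrow> (real \<Rightarrow> real) \<Rightarrow> (real \<Rightarrow> real) \<Rightarrow> bool" where
  "nontrivial \<Omega> U \<Theta> \<longleftrightarrow> \<not> ((\<forall>X. \<Omega> X = 0) \<and> (\<forall>X. U X = 0) \<and> (\<forall>X. \<Theta> X = 0))"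

definition symmetric_structure :: "(real \<Rightarrow> real) \<Rightarrow> (real \<Rightarrow> real) \<Rightarrow> bool" where
  "symmetric_structure U \<Theta> \<longleftrightarrow> odd_fun U \<and> (\<exists>\<psi>. odd_fun \<psi> \<and> (\<forall>X. \<Theta> X = (\<psi> X)\<^sup>2))"

definition symmetric_profile ::
  "real \<Rightarrow> real \<Rightarrow> (real \<Rightarrow> real) \<Rightarrow> (real \<Rightarrow> real) \<Rightarrow> (real \<Rightarrow> real) \<Rightarrow> bool" where
  "symmetric_profile a L \<Omega> U \<Theta> \<longleftrightarrow>
     nontrivial \<Omega> U \<Theta> \<and> symmetric_structure U \<Theta> \<and>
     solves_profile_system a (coeff_l a) (coeff_omega a) coeff_theta (exceptional a L) \<Omega> U \<Theta> \<and>
     (deriv U \<longlongrightarrow> 0) at_infinity"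

definition parity_property where
  "parity_property \<Omega> U \<Theta> \<longleftrightarrow> odd_fun U \<and> odd_fun \<Omega> \<and> even_fun \<Theta>"

definition origin_property where
  "origin_property \<Omega> U \<Theta> \<longleftrightarrow>
     deriv U 0 > 0 \<and> deriv \<Omega> 0 > 0 \<and> deriv (deriv \<Theta>) (0::real) > (0::real)"

definition monotonicity_property ::
  "real \<Rightarrow> (real \<Rightarrow> real) \<Rightarrow> (real \<Rightarrow> real) \<Rightarrow> bool" where
  "monotonicity_property a U \<Theta> \<longleftrightarrow>
     (2 / 3 < a \<and> a \<le> 1 \<longrightarrow>
        antimono_on {0<..} (\<lambda>X. U X / X) \<and> antimono_on {0<..} (\<lambda>X. \<Theta> X / X\<^sup>2))"

definition support_property where
  "support_property a L \<Omega> \<Theta> \<longleftrightarrow>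
     (0 < a \<and> a \<le> (2::real) / 3 \<longrightarrow> supp \<Omega> = UNIV \<and> supp \<Theta> = UNIV) \<and>
     (2 / 3 < a \<and> a \<le> 1 \<longrightarrow> supp \<Omega> \<union> supp \<Theta> \<subseteq> {- L..L})"

definition beta :: "real \<Rightarrow> real" where
  "beta a = (1 - a) / (3 * a - 2)"

definition gamma :: "real \<Rightarrow> real" where
  "gamma a = 2 / a + 2 * (1 - a) / (3 * a - 2)"

text \<open>For \<open>2/3 < a < 1\<close> both \<open>beta a\<close> and \<open>gamma a\<close> are positive, so \<open>nat\<close> does not truncate below.\<close>

definition regularity_property ::
  "real \<Rightarrow> real \<Rightarrow> (real \<Rightarrow> real) \<Rightarrow> (real \<Rightarrow> real) \<Rightarrow> (real \<Rightarrow> real) \<Rightarrow> bool" where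
  "regularity_property a L \<Omega> U \<Theta> \<longleftrightarrow>
     (0 < a \<and> a \<le> 2 / 3 \<longrightarrow>
        smooth_on \<Omega> UNIV \<and> smooth_on U UNIV \<and> smooth_on \<Theta> UNIV) \<and>
     (2 / 3 < a \<and> a < 1 \<longrightarrow>
        compact (supp \<Omega>) \<and> compact (supp \<Theta>) \<and>
        holder_class (nat (\<lceil>beta a\<rceil> - 1)) (beta a - \<lceil>beta a\<rceil> + 1) \<Omega> \<and>
        holder_class (nat (1 + \<lceil>beta a\<rceil>)) (beta a - \<lceil>beta a\<rceil> + 1) U \<and>
        holder_class (nat (\<lceil>gamma a\<rceil> - 1)) (gamma a - \<lceil>gamma a\<rceil> + 1) \<Theta> \<and>
        smooth_on \<Omega> (UNIV - {- L, L}) \<and> smooth_on U (UNIV - {- L, L}) \<and>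
        smooth_on \<Theta> (UNIV - {- L, L})) \<and>
     (a = 1 \<longrightarrow>
        holder_class 0 1 \<Omega> \<and> holder_class 2 1 U \<and> holder_class 1 1 \<Theta> \<and>
        smooth_on \<Omega> (UNIV - {- L, L}) \<and> smooth_on U (UNIV - {- L, L}) \<and>
        smooth_on \<Theta> (UNIV - {- L, L}))"

text \<open>
  For \<open>2/3 < a \<le> 1\<close> one and the same \<open>L\<close> enters the support bound, the smoothness away from
  \<open>L\<close> and \<open>-L\<close>, and the points excluded in the equation for \<open>\<Omega>\<close>; for \<open>a \<le> 2/3\<close> the
  parameter \<open>L\<close> plays no role.
\<close>

definition admissible_profile ::
  "real \<Rightarrow> real \<Rightarrow> (real \<Rightarrow> real) \<Rightarrow> (real \<Rightarrow> real) \<Rightarrow> (real \<Rightarrow> real) \<Rightarrow> bool" where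
  "admissible_profile a L \<Omega> U \<Theta> \<longleftrightarrow>
     symmetric_profile a L \<Omega> U \<Theta> \<and>
     parity_property \<Omega> U \<Theta> \<and>
     origin_property \<Omega> U \<Theta> \<and>
     monotonicity_property a U \<Theta> \<and>
     support_property a L \<Omega> \<Theta> \<and>
     regularity_property a L \<Omega> U \<Theta>"

type_synonym profile =
  "(real \<Rightarrow> real) \<times> (real \<Rightarrow> real) \<times> (real \<Rightarrow> real) \<times> real \<times> real \<times> real"

text \<open>The tuple is \<open>(\<omega>, u, \<theta>, c\<^sub>l, c\<^sub>\<omega>, c\<^sub>\<theta>)\<close>.\<close>

definition rescale :: "real \<Rightarrow> real \<Rightarrow> profile \<Rightarrow> profile" where
  "rescale lam1 lam2 = (\<lambda>(\<omega>, u, \<theta>, cl, c\<omega>, c\<theta>).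
     (\<lambda>x. lam1 * \<omega> (lam2 * x),
      \<lambda>x. lam1 / lam2\<^sup>2 * u (lam2 * x),
      \<lambda>x. lam1\<^sup>2 / lam2\<^sup>2 * \<theta> (lam2 * x),
      lam1 / lam2 * cl, lam1 / lam2 * c\<omega>, lam1 / lam2 * c\<theta>))"

text \<open>
  Functions of space and time take the space variable first. Time derivatives are taken within
  \<open>[0, T)\<close>, hence one-sided at \<open>0\<close>. \<open>S t\<close> is the set of points at which the equation containing
  derivatives of \<open>\<omega>\<close> is not imposed at time \<open>t\<close>.
\<close>

definition solves_evolution_system ::
  "real \<Rightarrow> real \<Rightarrow> (real \<Rightarrow> real set) \<Rightarrow>
   (real \<Rightarrow> real \<Rightarrow> real) \<Rightarrow> (real \<Rightarrow> real \<Rightarrow> real) \<Rightarrow> (real \<Rightarrow> real \<Rightarrow> real) \<Rightarrow> bool" where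
  "solves_evolution_system a T S \<omega> u \<theta> \<longleftrightarrow>
     (\<forall>t\<in>{0..<T}.
        (\<forall>x. \<exists>\<theta>t \<theta>x ux.
           ((\<lambda>s. \<theta> x s) has_real_derivative \<theta>t) (at t within {0..<T}) \<and>
           ((\<lambda>y. \<theta> y t) has_real_derivative \<theta>x) (at x) \<and>
           ((\<lambda>y. u y t) has_real_derivative ux) (at x) \<and>
           \<theta>t + a * u x t * \<theta>x = 2 * ux * \<theta> x t) \<and>
        (\<forall>x. x \<notin> S t \<longrightarrow> (\<exists>\<omega>t \<omega>x \<theta>x.
           ((\<lambda>s. \<omega> x s) has_real_derivative \<omega>t) (at t within {0..<T}) \<and>
           ((\<lambda>y. \<omega> y t) has_real_derivative \<omega>x) (at x) \<and>
           ((\<lambda>y. \<theta> y t) has_real_derivative \<theta>x) (at x) \<and>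
           \<omega>t + a * u x t * \<omega>x = \<theta>x)) \<and>
        (\<forall>x. deriv (\<lambda>y. u y t) differentiable (at x) \<and>
           - deriv (deriv (\<lambda>y. u y t)) x = 2 * \<omega> x t) \<and>
        u 0 t = 0 \<and>
        (deriv (\<lambda>y. u y t) \<longlongrightarrow> 0) at_infinity)"

text \<open>
  Blowup at time \<open>T\<close>: the spatial sup norms of the velocity gradient and of \<open>\<theta>\<close> tend to
  infinity. (The sup norm of \<open>\<omega>\<close> itself is constant in time when \<open>a = 1\<close>.)
\<close>

definition blows_up_at ::
  "real \<Rightarrow> (real \<Rightarrow> real \<Rightarrow> real) \<Rightarrow> (real \<Rightarrow> real \<Rightarrow> real) \<Rightarrow> bool" where
  "blows_up_at T u \<theta> \<longleftrightarrow>
     (\<forall>M. \<forall>\<^sub>F t in at_left T.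
        (\<exists>x. \<bar>deriv (\<lambda>y. u y t) x\<bar> > M) \<and> (\<exists>x. \<bar>\<theta> x t\<bar> > M))"

definition self_similar :: "real \<Rightarrow> real \<Rightarrow> real \<Rightarrow> (real \<Rightarrow> real) \<Rightarrow> real \<Rightarrow> real \<Rightarrow> real" where
  "self_similar T c cl F x t = (T - t) powr c * F (x / (T - t) powr cl)"

definition length_scale :: "real \<Rightarrow> real \<Rightarrow> real \<Rightarrow> real" where
  "length_scale T cl t = (T - t) powr cl"

definition focusing :: "real \<Rightarrow> real \<Rightarrow> bool" where
  "focusing T cl \<longleftrightarrow> (length_scale T cl \<longlongrightarrow> 0) (at_left T)"

definition expanding :: "real \<Rightarrow> real \<Rightarrow> bool" where
  "expanding T cl \<longleftrightarrow> filterlim (length_scale T cl) at_top (at_left T)"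

definition neither_focusing_nor_expanding :: "real \<Rightarrow> real \<Rightarrow> bool" where
  "neither_focusing_nor_expanding T cl \<longleftrightarrow>
     (\<forall>s\<in>{0..<T}. \<forall>t\<in>{0..<T}. length_scale T cl s = length_scale T cl t)"

end

theory Submission
  imports Defs
begin

text \<open>
  Write \<open>V = c\<^sub>l X + a U\<close> for the transport speed and \<open>y = a U'\<close>, so that \<open>V' = c\<^sub>l + y\<close> and \<open>\<Omega> = - y' / (2 a)\<close>. With the
  given constants the profile system has a conservation law: \<open>V y' - y (y - 2) / 2 + 2 a \<Theta>\<close> is constant, and the constant
  is \<open>0\<close> because \<open>y(0) = 2\<close>. What remains is
    \<open>V y' = y (y - 2) / 2 - 2 a \<Theta>\<close> and \<open>V \<Theta>' = (2 / a) (y - a) \<Theta>\<close>,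
  an autonomous planar system in the time \<open>\<tau>\<close> with \<open>d\<tau> = dX / V\<close> (\<open>reduced_system\<close>).

  Existence. A profile is the orbit that leaves the unstable node \<open>(y, \<Theta>) = (2, 0)\<close> along its strong unstable direction, where
  it is analytic in \<open>X\<^sup>2\<close> (\<open>local_solution\<close>). It exists for all times because a Lyapunov function bounds \<open>\<Theta>\<close>
  (\<open>planar_orbit_exists\<close>), and it tends to the stable node \<open>(0, 0)\<close> exponentially fast (\<open>planar_orbit_decays\<close>). Along it \<open>V\<close> behaves
  like \<open>exp (c\<^sub>l \<tau>)\<close>, so \<open>X = \<integral> V d\<tau>\<close> exhausts the half-line if \<open>c\<^sub>l \<ge> 0\<close>, that is \<open>a \<le> 2/3\<close>, and stops at a finite \<open>L\<close>
  otherwise (\<open>outer_solution\<close>); there the profile is continued by zero vorticity. The regularity at \<open>\<plusminus>L\<close> is decided by the rates at which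
  \<open>y\<close> and \<open>\<Theta>\<close> vanish as powers of \<open>V\<close> (\<open>boundary_decay\<close>). They pass to all derivatives, because \<open>f \<mapsto> V f'\<close> preserves the
  ideals generated by \<open>y, \<Theta>\<close> and by \<open>\<Theta>\<close> in the polynomials in \<open>y\<close> and \<open>\<Theta>\<close> (\<open>orbit_ideal\<close>). For \<open>a = 1\<close> the orbit is explicit:
  \<open>V = sin X\<close>, \<open>y = 1 + cos X\<close>, \<open>\<Theta> = (sin X)\<^sup>2 / 4\<close> on \<open>[-\<pi>, \<pi>]\<close>.

  Uniqueness. Every admissible profile satisfies the conservation law with constant \<open>0\<close> (\<open>admissible_reduced_system\<close>): the constant is read off from the far
  field if \<open>a > 2/3\<close> and from a second order expansion at the origin if \<open>a \<le> 2/3\<close>. The resulting differential equation is singular at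
  \<open>0\<close>, but a weighted energy estimate shows that \<open>\<Theta>''(0)\<close> determines the solution as long as \<open>V > 0\<close> (\<open>unique_from_origin\<close>), and the scaling
  adjusts \<open>\<Theta>''(0)\<close>. Beyond the first zero of \<open>V\<close>, if there is one, the zero data at infinity are transported back and the profile is trivial
  (\<open>trivial_beyond_zero\<close>).

  The statements on the evolution system are the chain rule and the sign of \<open>c\<^sub>l\<close>.
\<close>

section \<open>Calculus on the line\<close>

text \<open>
  Otherwise look at the last point before \<open>b\<close> at which \<open>f\<close> is still nonnegative: beyond it \<open>f\<close> is negative,
  hence nondecreasing, and cannot have become negative. The invariant regions of the planar system below and
  the monotonicity of the profile are all instances.
\<close>

lemma nonneg_barrier:
  fixes f :: "real \<Rightarrow> real"
  assumes ab: "a \<le> b" and cont: "continuous_on {a..b} f" and fa: "0 \<le> f a"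
    and barrier: "\<And>x. a < x \<Longrightarrow> x < b \<Longrightarrow> f x < 0 \<Longrightarrow>
                    \<exists>D. (f has_real_derivative D) (at x) \<and> 0 \<le> D"
  shows "0 \<le> f b"
proof (rule ccontr)
  assume neg: "\<not> 0 \<le> f b"
  define Z where "Z = {x \<in> {a..b}. 0 \<le> f x}"
  have "closed Z"
    unfolding Z_def by (rule continuous_on_closed_Collect_le[OF continuous_on_const cont closed_atLeastAtMost])
  moreover have "bounded Z"
    unfolding Z_def by (rule bounded_subset[of "{a..b}"]) auto
  ultimately have "compact Z" by (simp add: compact_eq_bounded_closed)
  moreover have "Z \<noteq> {}" using ab fa by (auto simp: Z_def)
  ultimately obtain s where s: "s \<in> Z" "\<And>x. x \<in> Z \<Longrightarrow> x \<le> s"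
    using compact_attains_sup[of Z] by metis
  have sb: "a \<le> s" "s \<le> b" "0 \<le> f s" using s(1) by (auto simp: Z_def)
  have "f s \<le> f b"
  proof (rule DERIV_nonneg_imp_increasing_open[OF sb(2)])
    fix x assume x: "s < x" "x < b"
    then have "x \<notin> Z" "x \<in> {a..b}" using s(2)[of x] sb by auto
    then have "f x < 0" by (auto simp: Z_def)
    then show "\<exists>y. (f has_real_derivative y) (at x) \<and> 0 \<le> y"
      using barrier[of x] x sb by auto
  next
    show "continuous_on {s..b} f" by (rule continuous_on_subset[OF cont]) (use sb in auto)
  qed
  then show False using neg sb by simp
qed

lemma deriv_funpow_eq:
  assumes S: "open S"
    and g: "\<And>k x. x \<in> S \<Longrightarrow> (g k has_real_derivative g (Suc k) x) (at x)"
    and f: "\<And>x. x \<in> S \<Longrightarrow> f x = g 0 x"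
    and x: "x \<in> S"
  shows "(deriv ^^ k) f x = g k x"
  using x
proof (induction k arbitrary: x)
  case 0
  then show ?case using f by simp
next
  case (Suc k)
  have "((deriv ^^ k) f has_real_derivative g (Suc k) x) (at x)"
    by (rule has_field_derivative_transform_within_open[OF g[OF Suc.prems] S Suc.prems])
       (simp add: Suc.IH)
  then show ?case by (simp add: DERIV_imp_deriv)
qed

lemma deriv_funpow_cong:
  assumes "open S" "\<And>x. x \<in> S \<Longrightarrow> f x = g x" "x \<in> S"
  shows "(deriv ^^ k) f x = (deriv ^^ k) g x"
  using assms(3)
proof (induction k arbitrary: x)
  case 0
  then show ?case using assms by simp
next
  case (Suc k)
  have "\<forall>\<^sub>F y in nhds x. (deriv ^^ k) f y = (deriv ^^ k) g y"
    using eventually_nhds_in_open[OF assms(1) Suc.prems] by eventually_elim (rule Suc.IH)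
  then show ?case by (simp add: deriv_cong_ev)
qed

lemma smooth_on_iff:
  "smooth_on f S \<longleftrightarrow> (\<forall>k. \<forall>x\<in>S. (deriv ^^ k) f differentiable (at x))"
proof
  assume "smooth_on f S"
  then show "\<forall>k. \<forall>x\<in>S. (deriv ^^ k) f differentiable (at x)"
    unfolding smooth_on_def Ck_on_def by blast
next
  assume r: "\<forall>k. \<forall>x\<in>S. (deriv ^^ k) f differentiable (at x)"
  have "continuous_on S ((deriv ^^ k) f)" for k
    using r by (intro continuous_at_imp_continuous_on ballI differentiable_imp_continuous_within) blast
  then show "smooth_on f S" using r unfolding smooth_on_def Ck_on_def by blast
qed

lemma smooth_on_has_derivative:
  assumes "smooth_on f S" "x \<in> S"
  shows "((deriv ^^ k) f has_real_derivative (deriv ^^ Suc k) f x) (at x)"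
  using assms by (simp add: smooth_on_iff DERIV_deriv_iff_real_differentiable)

lemma smooth_on_derivatives:
  assumes "open S" and "\<And>k x. x \<in> S \<Longrightarrow> (g k has_real_derivative g (Suc k) x) (at x)"
    and "\<And>x. x \<in> S \<Longrightarrow> f x = g 0 x"
  shows "smooth_on f S"
  unfolding smooth_on_iff
proof (intro allI ballI)
  fix k x assume x: "x \<in> S"
  have "((deriv ^^ k) f has_real_derivative g (Suc k) x) (at x)"
    by (rule has_field_derivative_transform_within_open[OF assms(2)[OF x] assms(1) x])
       (simp add: deriv_funpow_eq[OF assms])
  then show "(deriv ^^ k) f differentiable (at x)"
    using real_differentiable_def by blast
qed

text \<open>
  Smoothness without computing derivatives: iterate a choice of derivatives inside the class. It is applied
  to even and odd power series and to polynomials in the orbit divided by powers of the transport speed.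
\<close>

lemma smooth_on_closed_class:
  assumes S: "open S" and F: "f \<in> F"
    and closed: "\<And>h. h \<in> F \<Longrightarrow> \<exists>h'\<in>F. \<forall>x\<in>S. (h has_real_derivative h' x) (at x)"
  shows "smooth_on f S"
proof -
  obtain d where d: "\<And>h. h \<in> F \<Longrightarrow> d h \<in> F \<and> (\<forall>x\<in>S. (h has_real_derivative d h x) (at x))"
    using closed by metis
  define g where "g k = (d ^^ k) f" for k
  have gF: "g k \<in> F" for k by (induction k) (auto simp: g_def F d)
  show ?thesis
    by (rule smooth_on_derivatives[OF S, of g]) (use d gF in \<open>auto simp: g_def\<close>)
qed

lemma smooth_on_cong:
  assumes "open S" "\<And>x. x \<in> S \<Longrightarrow> f x = g x" "smooth_on g S"
  shows "smooth_on f S"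
  by (rule smooth_on_derivatives[OF assms(1), of "\<lambda>k. (deriv ^^ k) g"])
     (use smooth_on_has_derivative[OF assms(3)] assms(2) in auto)

lemma smooth_on_Un: "smooth_on f S \<Longrightarrow> smooth_on f T \<Longrightarrow> smooth_on f (S \<union> T)"
  by (auto simp: smooth_on_iff)

lemma smooth_on_subset: "smooth_on f S \<Longrightarrow> T \<subseteq> S \<Longrightarrow> smooth_on f T"
  by (auto simp: smooth_on_iff)

lemma smooth_on_const: "open S \<Longrightarrow> smooth_on (\<lambda>x. c) S"
  by (rule smooth_on_closed_class[of _ _ "range (\<lambda>c x. c)"]) (auto intro: exI[of _ 0])

lemma smooth_on_antiderivative:
  assumes S: "open S" and f: "\<And>x. x \<in> S \<Longrightarrow> (f has_real_derivative g x) (at x)"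
    and g: "smooth_on g S"
  shows "smooth_on f S"
proof (rule smooth_on_derivatives[OF S, of "\<lambda>k. case k of 0 \<Rightarrow> f | Suc j \<Rightarrow> (deriv ^^ j) g"])
  fix k x assume "x \<in> S"
  then show "((case k of 0 \<Rightarrow> f | Suc j \<Rightarrow> (deriv ^^ j) g) has_real_derivative
      (case Suc k of 0 \<Rightarrow> f | Suc j \<Rightarrow> (deriv ^^ j) g) x) (at x)"
    using f smooth_on_has_derivative[OF g, of x] by (cases k) auto
qed auto

lemma smooth_on_deriv: "smooth_on f S \<Longrightarrow> smooth_on (deriv f) S"
  unfolding smooth_on_iff
proof (intro allI)
  fix k assume "\<forall>k. \<forall>x\<in>S. (deriv ^^ k) f differentiable (at x)"
  from this[rule_format, of _ "Suc k"]
  show "\<forall>x\<in>S. (deriv ^^ k) (deriv f) differentiable (at x)"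
    by (simp only: funpow_Suc_right comp_apply) simp
qed

lemma smooth_on_cmult:
  assumes "open S" "smooth_on f S" shows "smooth_on (\<lambda>x. c * f x) S"
  by (rule smooth_on_derivatives[OF assms(1), of "\<lambda>k x. c * (deriv ^^ k) f x"])
     (use smooth_on_has_derivative[OF assms(2)] in \<open>auto intro!: derivative_eq_intros\<close>)

lemma smooth_on_add:
  assumes "open S" "smooth_on f S" "smooth_on g S" shows "smooth_on (\<lambda>x. f x + g x) S"
  by (rule smooth_on_derivatives[OF assms(1), of "\<lambda>k x. (deriv ^^ k) f x + (deriv ^^ k) g x"])
     (use smooth_on_has_derivative[OF assms(2)] smooth_on_has_derivative[OF assms(3)]
       in \<open>auto intro!: derivative_eq_intros\<close>)

section \<open>Global solutions of Lipschitz differential equations\<close>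

text \<open>
  Needed at a point where a function is defined by different formulas on the two sides.
\<close>

lemma glue_derivative:
  fixes f g :: "real \<Rightarrow> real"
  assumes f: "(f has_real_derivative D) (at c within {..c})"
    and g: "(g has_real_derivative D) (at c within {c..})" and eq: "f c = g c"
  shows "((\<lambda>x. if x \<le> c then f x else g x) has_real_derivative D) (at c)"
proof -
  let ?h = "\<lambda>x. if x \<le> c then f x else g x"
  have l: "(?h has_real_derivative D) (at c within {..c})"
    by (rule has_field_derivative_transform_within[OF f zero_less_one]) auto
  have r: "(?h has_real_derivative D) (at c within {c..})"
    by (rule has_field_derivative_transform_within[OF g zero_less_one]) (auto simp: eq)
  have U: "{..c} \<union> {c..} = (UNIV :: real set)" by auto
  have "(?h has_real_derivative D) (at c within ({..c} \<union> {c..}))"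
    using l r unfolding has_field_derivative_iff by (simp only: Lim_within_Un)
  then show ?thesis unfolding U .
qed

lemma at_within_atLeast: "c < (t::real) \<Longrightarrow> at t within {c..} = at t"
  by (rule at_within_interior) simp

text \<open>
  A globally Lipschitz vector field has solutions for all positive times. In the variable
  \<open>exp (- 2 K t) (x - x0)\<close> the integral operator of the equation is a contraction with factor \<open>1/2\<close> in the
  supremum norm on the whole half-line, so that no continuation argument is needed; boundedness of \<open>f\<close> keeps
  the operator inside the bounded continuous functions.
\<close>

theorem picard_global:
  fixes f :: "'a::banach \<Rightarrow> 'a"
  assumes K: "0 < K" and lip: "\<And>x y. norm (f x - f y) \<le> K * norm (x - y)"
    and bdd: "\<And>x. norm (f x) \<le> B"
  obtains x where "x 0 = x0"
    and "\<And>t. 0 \<le> t \<Longrightarrow> (x has_vector_derivative f (x t)) (at t within {0..})"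
proof -
  have B: "0 \<le> B" using bdd norm_ge_zero order_trans by blast
  have contf: "continuous_on UNIV f"
    by (rule lipschitz_on_continuous_on[of K], rule lipschitz_onI)
      (use K lip in \<open>auto simp: dist_norm\<close>)
  \<comment> \<open>the unknown \<open>b\<close> is \<open>exp (- 2 K t) (x - x0)\<close>\<close>
  define h where "h b s = f (x0 + exp (2 * K * s) *\<^sub>R apply_bcontfun b s)"
    for b :: "real \<Rightarrow>\<^sub>C 'a" and s
  have conth: "continuous_on S (h b)" for b S
    unfolding h_def
    by (rule continuous_on_compose2[OF contf]) (auto intro!: continuous_intros)
  have hint: "h b integrable_on {0..t}" for b t
    by (rule integrable_continuous_real[OF conth])
  define P where "P b t = exp (- 2 * K * max t 0) *\<^sub>R integral {0..max t 0} (h b)" for b t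
  have normI: "norm (integral {0..s} (h b)) \<le> B * s" if "0 \<le> s" for b s
    using integral_bound[of 0 s "h b" B] that conth bdd by (simp add: h_def)
  have P: "P b \<in> bcontfun" for b
  proof (rule bcontfun_normI)
    have ci: "continuous_on {0..} (\<lambda>s. integral {0..s} (h b))"
      unfolding continuous_on_eq_continuous_within
    proof
      fix s :: real assume s: "s \<in> {0..}"
      have "((\<lambda>s. integral {0..s} (h b)) has_vector_derivative h b s) (at s within {0..s+1})"
        by (rule integral_has_vector_derivative) (use s conth in auto)
      then have "continuous (at s within {0..s+1}) (\<lambda>s. integral {0..s} (h b))"
        by (rule has_vector_derivative_continuous)
      moreover have "at s within {0..s+1} = at s within {0..}"
        by (rule at_within_nhd[of _ "{..<s+1}"]) auto
      ultimately show "continuous (at s within {0..}) (\<lambda>s. integral {0..s} (h b))" by simp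
    qed
    show "continuous_on UNIV (P b)"
      unfolding P_def
      by (intro continuous_intros continuous_on_compose2[OF ci]) auto
    fix t :: real
    define s where "s = max t 0"
    have s: "0 \<le> s" by (simp add: s_def)
    have "2 * K * s \<le> exp (2 * K * s)" using exp_ge_add_one_self[of "2 * K * s"] by linarith
    then have "B * s * exp (- 2 * K * s) \<le> B / (2 * K)"
      using K B s by (simp add: exp_minus field_simps)
        (metis mult_left_mono mult.assoc mult.commute)
    moreover have "norm (P b t) \<le> exp (- 2 * K * s) * (B * s)"
      unfolding P_def s_def[symmetric] using normI[OF s] by simp
    ultimately show "norm (P b t) \<le> B / (2 * K)" by (simp add: mult.commute)
  qed
  define Q where "Q b = Bcontfun (P b)" for b
  have Q: "apply_bcontfun (Q b) = P b" for b
    unfolding Q_def by (rule Bcontfun_inverse[OF P])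
  have contr: "dist (Q b) (Q c) \<le> 1/2 * dist b c" for b c
  proof (rule dist_bound)
    fix t :: real
    define s where "s = max t 0"
    have s: "0 \<le> s" by (simp add: s_def)
    have "norm (integral {0..s} (\<lambda>r. h b r - h c r)) \<le> integral {0..s} (\<lambda>r. K * dist b c * exp (2 * K * r))"
    proof (rule integral_norm_bound_integral)
      show "(\<lambda>r. h b r - h c r) integrable_on {0..s}" by (intro integrable_diff hint)
      show "(\<lambda>r. K * dist b c * exp (2 * K * r)) integrable_on {0..s}"
        by (intro integrable_continuous_real continuous_intros)
      fix r
      have "norm (h b r - h c r) \<le> K * norm (exp (2 * K * r) *\<^sub>R (b r - c r))"
        unfolding h_def using lip by (metis add_diff_cancel_left scaleR_diff_right)
      also have "\<dots> = K * (exp (2 * K * r) * dist (b r) (c r))" by (simp add: dist_norm)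
      also have "\<dots> \<le> K * (exp (2 * K * r) * dist b c)"
        using K dist_bounded[of b r c] by (intro mult_left_mono) auto
      finally show "norm (h b r - h c r) \<le> K * dist b c * exp (2 * K * r)"
        by (simp add: mult_ac)
    qed
    also have "integral {0..s} (\<lambda>r. K * dist b c * exp (2 * K * r))
        = dist b c / 2 * exp (2 * K * s) - dist b c / 2 * exp (2 * K * 0)"
      by (rule integral_unique, rule fundamental_theorem_of_calculus[OF s])
         (use K in \<open>auto intro!: derivative_eq_intros simp: has_real_derivative_iff_has_vector_derivative[symmetric]\<close>)
    also have "\<dots> \<le> dist b c / 2 * exp (2 * K * s)" by simp
    finally have "norm (integral {0..s} (h b) - integral {0..s} (h c)) \<le> dist b c / 2 * exp (2 * K * s)"
      by (simp add: integral_diff hint)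
    then have "exp (- 2 * K * s) * norm (integral {0..s} (h b) - integral {0..s} (h c)) \<le> dist b c / 2"
      by (simp add: exp_minus field_simps)
    then show "dist (apply_bcontfun (Q b) t) (apply_bcontfun (Q c) t) \<le> 1/2 * dist b c"
      by (simp add: Q P_def s_def[symmetric] dist_norm scaleR_diff_right[symmetric])
  qed
  obtain b where b: "Q b = b"
    using banach_fix_type[of "1/2" Q] contr by auto
  define x where "x t = x0 + exp (2 * K * t) *\<^sub>R apply_bcontfun b t" for t
  have hx: "h b t = f (x t)" for t by (simp add: h_def x_def)
  have xint: "x t = x0 + integral {0..t} (h b)" if "0 \<le> t" for t
  proof -
    have "apply_bcontfun b t = P b t" using Q[of b] b by simp
    also have "\<dots> = exp (- 2 * K * t) *\<^sub>R integral {0..t} (h b)" using that by (simp add: P_def max_def)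
    finally show ?thesis by (simp add: x_def mult_exp_exp)
  qed
  show thesis
  proof
    show "x 0 = x0" using xint[of 0] by simp
    fix t :: real assume t: "0 \<le> t"
    have "((\<lambda>s. x0 + integral {0..s} (h b)) has_vector_derivative h b t) (at t within {0..t+1})"
      by (auto intro!: derivative_eq_intros integral_has_vector_derivative conth simp: t)
    moreover have "at t within {0..t+1} = at t within {0..}"
      by (rule at_within_nhd[of _ "{..<t+1}"]) auto
    ultimately have "((\<lambda>s. x0 + integral {0..s} (h b)) has_vector_derivative h b t) (at t within {0..})"
      by simp
    then show "(x has_vector_derivative f (x t)) (at t within {0..})"
      unfolding hx[symmetric]
      by (rule has_vector_derivative_transform[rotated 2]) (use t xint in auto)
  qed
qed

section \<open>The planar orbit\<close>

lemma nonneg_barrier_atLeast: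
  fixes f f' :: "real \<Rightarrow> real"
  assumes der: "\<And>s. c \<le> s \<Longrightarrow> (f has_real_derivative f' s) (at s within {c..})"
    and start: "0 \<le> f c" and barrier: "\<And>s. c \<le> s \<Longrightarrow> f s < 0 \<Longrightarrow> 0 \<le> f' s" and t: "c \<le> t"
  shows "0 \<le> f t"
proof (rule nonneg_barrier[where a = c and b = t and f = f])
  show "c \<le> t" by (rule t)
  show "0 \<le> f c" by (rule start)
  show "continuous_on {c..t} f"
    unfolding continuous_on_eq_continuous_within
    using der by (meson DERIV_continuous DERIV_subset atLeastAtMost_iff atLeast_iff subsetI)
  fix x assume x: "c < x" "x < t" "f x < 0"
  then have "(f has_real_derivative f' x) (at x)" using der[of x] at_within_atLeast[OF x(1)] by simp
  then show "\<exists>D. (f has_real_derivative D) (at x) \<and> 0 \<le> D" using barrier[of x] x by auto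
qed

lemma exp_lipschitz_below:
  fixes u v :: real
  assumes "u \<le> c" "v \<le> c"
  shows "\<bar>exp u - exp v\<bar> \<le> exp c * \<bar>u - v\<bar>"
proof -
  have *: "exp p - exp q \<le> exp c * (p - q)" if "q \<le> p" "p \<le> c" for p q :: real
  proof -
    have "exp p - exp q = exp p * (1 - exp (q - p))" by (simp add: algebra_simps mult_exp_exp)
    also have "\<dots> \<le> exp p * (p - q)"
      using exp_ge_add_one_self[of "q - p"] by (intro mult_left_mono; linarith?) simp
    also have "\<dots> \<le> exp c * (p - q)" using that by (intro mult_right_mono) auto
    finally show ?thesis .
  qed
  show ?thesis
    using *[of u v] *[of v u] assms by (cases "v \<le> u") auto
qed

lemma has_derivative_pos_part_square:
  "((\<lambda>u::real. (max u 0)\<^sup>2) has_real_derivative 2 * max u 0) (at u)"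
proof -
  consider "u < 0" | "u > 0" | "u = 0" by linarith
  then show ?thesis
  proof cases
    case 1
    show ?thesis
      by (rule has_field_derivative_transform_within_open[where f = "\<lambda>_. 0" and S = "{..<0}"])
         (use 1 in auto)
  next
    case 2
    show ?thesis
      by (rule has_field_derivative_transform_within_open[where f = "\<lambda>u. u\<^sup>2" and S = "{0<..}"])
         (use 2 in \<open>auto intro!: derivative_eq_intros\<close>)
  next
    case 3
    have "((\<lambda>x::real. if x \<le> 0 then 0 else x\<^sup>2) has_real_derivative 0) (at 0)"
      by (rule glue_derivative) (auto intro!: derivative_eq_intros)
    moreover have "(\<lambda>x::real. if x \<le> 0 then 0 else x\<^sup>2) = (\<lambda>u. (max u 0)\<^sup>2)"
      by (auto simp: max_def)
    ultimately show ?thesis using 3 by simp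
  qed
qed

text \<open>
  A primitive of the exponential truncated at height \<open>exp c\<close>. It replaces \<open>exp\<close> in a Lyapunov function for
  the truncated planar system.
\<close>

lemma has_derivative_linearised_exp:
  "((\<lambda>u::real. if u \<le> c then exp u else exp c * (1 + u - c)) has_real_derivative exp (min u c)) (at u)"
proof -
  consider "u < c" | "u > c" | "u = c" by linarith
  then show ?thesis
  proof cases
    case 1
    show ?thesis
      by (rule has_field_derivative_transform_within_open[where f = exp and S = "{..<c}"])
         (use 1 in \<open>auto intro!: derivative_eq_intros\<close>)
  next
    case 2
    show ?thesis
      by (rule has_field_derivative_transform_within_open[where f = "\<lambda>u. exp c * (1 + u - c)" and S = "{c<..}"])
         (use 2 in \<open>auto intro!: derivative_eq_intros\<close>)
  next
    case 3
    show ?thesis unfolding 3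
      by (rule glue_derivative) (auto intro!: derivative_eq_intros)
  qed
qed

text \<open>
  In the variables \<open>y\<close> and \<open>g = ln h\<close> the planar system becomes globally Lipschitz and bounded once \<open>y\<close> is
  clamped to an interval \<open>[-M, 2]\<close> and \<open>exp g\<close> is truncated at \<open>exp G\<close>; the logarithm also makes \<open>h\<close> positive
  automatically. The solution of the modified system never leaves the region in which nothing was modified.
  Upwards, \<open>y\<close> is nonincreasing as long as \<open>0 \<le> y \<le> 2\<close>; downwards, the quadratic term wins against the
  bounded forcing \<open>2 a h\<close>; and \<open>h\<close> stays bounded because the growth of \<open>h\<close> for \<open>y > a\<close> is paid for by
  the decrease of \<open>y\<close>: the function \<open>h + (max (y - a) 0)\<^sup>2 / (2 a\<^sup>2)\<close> is nonincreasing, since in its derivative the terms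
  with \<open>h\<close> cancel for \<open>y > a\<close>.
\<close>

theorem planar_orbit_exists:
  fixes a y0 h0 :: real
  assumes a: "0 < a" "a \<le> 1" and y0: "0 < y0" "y0 < 2" and h0: "0 < h0"
  obtains y h where "y 0 = y0" "h 0 = h0"
    and "\<And>t. 0 \<le> t \<Longrightarrow> (y has_real_derivative y t * (y t - 2) / 2 - 2 * a * h t) (at t within {0..})"
    and "\<And>t. 0 \<le> t \<Longrightarrow> (h has_real_derivative 2 / a * (y t - a) * h t) (at t within {0..})"
    and "\<And>t. 0 \<le> t \<Longrightarrow> y t \<le> y0" and "\<And>t. 0 \<le> t \<Longrightarrow> 0 < h t"
proof -
  \<comment> \<open>the initial value of the Lyapunov function; the truncation level \<open>exp G = S0 + 1\<close> lies strictly above it\<close>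
  define S0 where "S0 = h0 + 1 / (2 * a\<^sup>2) * (max (y0 - a) 0)\<^sup>2"
  define G where "G = ln (S0 + 1)"
  define M where "M = 2 + 4 * a * exp G"
  define Y where "Y u = max (- M) (min u 2)" for u
  define T where "T g = exp (min g G)" for g
  define f where "f = (\<lambda>(u, g). (Y u * (Y u - 2) / 2 - 2 * a * T g, 2 / a * (Y u - a)))"
  have S0: "0 < S0" unfolding S0_def using h0 by (simp add: add_pos_nonneg)
  have M: "2 \<le> M" using a by (simp add: M_def)
  have Yb: "- M \<le> Y u" "Y u \<le> 2" for u using M by (auto simp: Y_def)
  have Yl: "\<bar>Y u - Y v\<bar> \<le> \<bar>u - v\<bar>" for u v by (auto simp: Y_def)
  have Tb: "0 < T g" "T g \<le> exp G" for g by (auto simp: T_def)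
  have Tl: "\<bar>T u - T v\<bar> \<le> exp G * \<bar>u - v\<bar>" for u v
  proof -
    have "\<bar>T u - T v\<bar> \<le> exp G * \<bar>min u G - min v G\<bar>"
      unfolding T_def by (rule exp_lipschitz_below) auto
    also have "\<dots> \<le> exp G * \<bar>u - v\<bar>" by (intro mult_left_mono) auto
    finally show ?thesis .
  qed
  define K where "K = (M + 3) + 2 * a * exp G + 2 / a"
  have K: "0 < K" using M a by (auto simp: K_def add_pos_pos)
  have lip: "norm (f p - f q) \<le> K * norm (p - q)" for p q
  proof (cases p; cases q)
    fix u g v k assume p: "p = (u, g)" "q = (v, k)"
    have 1: "\<bar>u - v\<bar> \<le> norm (p - q)" "\<bar>g - k\<bar> \<le> norm (p - q)"
      using norm_fst_le[of "u - v" "g - k"] norm_snd_le[of "g - k" "u - v"] by (auto simp: p)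
    have e1: "Y u * (Y u - 2) / 2 - Y v * (Y v - 2) / 2 = (Y u - Y v) * ((Y u + Y v - 2) / 2)"
      by (simp add: field_simps)
    have "\<bar>Y u * (Y u - 2) / 2 - Y v * (Y v - 2) / 2\<bar> \<le> \<bar>u - v\<bar> * (M + 3)"
      unfolding e1 abs_mult using Yb[of u] Yb[of v] M by (intro mult_mono Yl) auto
    also have "\<dots> \<le> norm (p - q) * (M + 3)" using 1 M by (intro mult_right_mono) auto
    finally have A: "\<bar>Y u * (Y u - 2) / 2 - Y v * (Y v - 2) / 2\<bar> \<le> norm (p - q) * (M + 3)" .
    have "\<bar>T g - T k\<bar> \<le> exp G * norm (p - q)"
      using Tl[of g k] 1 by (meson exp_ge_zero mult_left_mono order_trans)
    then have B: "2 * a * \<bar>T g - T k\<bar> \<le> 2 * a * (exp G * norm (p - q))"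
      using a by (intro mult_left_mono) auto
    have C: "2 / a * \<bar>Y u - Y v\<bar> \<le> 2 / a * norm (p - q)"
      using a Yl[of u v] 1 by (intro mult_left_mono) auto
    have "norm (f p - f q) \<le> \<bar>(Y u * (Y u - 2) / 2 - 2 * a * T g) - (Y v * (Y v - 2) / 2 - 2 * a * T k)\<bar>
        + \<bar>2 / a * (Y u - a) - 2 / a * (Y v - a)\<bar>"
      using norm_Pair_le[of "(Y u * (Y u - 2) / 2 - 2 * a * T g) - (Y v * (Y v - 2) / 2 - 2 * a * T k)"
          "2 / a * (Y u - a) - 2 / a * (Y v - a)"]
      by (simp add: p f_def)
    also have "\<bar>2 / a * (Y u - a) - 2 / a * (Y v - a)\<bar> = 2 / a * \<bar>Y u - Y v\<bar>"
    proof -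
      have "2 / a * (Y u - a) - 2 / a * (Y v - a) = 2 / a * (Y u - Y v)" using a by (simp add: field_simps)
      then show ?thesis using a by (simp only: abs_mult) simp
    qed
    also have "\<bar>(Y u * (Y u - 2) / 2 - 2 * a * T g) - (Y v * (Y v - 2) / 2 - 2 * a * T k)\<bar>
        \<le> \<bar>Y u * (Y u - 2) / 2 - Y v * (Y v - 2) / 2\<bar> + \<bar>2 * a * (T g - T k)\<bar>"
      by (simp add: right_diff_distrib)
    also have "\<bar>2 * a * (T g - T k)\<bar> = 2 * a * \<bar>T g - T k\<bar>" using a by (simp add: abs_mult)
    finally show ?thesis using A B C by (simp add: K_def algebra_simps)
  qed
  have bdd: "norm (f p) \<le> (M + 2) * (M + 2) + 2 * a * exp G + 2 / a * (M + 3)" for p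
  proof (cases p)
    fix u g assume p: "p = (u, g)"
    have A: "\<bar>Y u * (Y u - 2) / 2\<bar> \<le> (M + 2) * (M + 2)"
      unfolding times_divide_eq_right[symmetric] abs_mult using Yb[of u] M by (intro mult_mono) auto
    have B: "\<bar>2 * a * T g\<bar> \<le> 2 * a * exp G" using Tb[of g] a by (auto simp: abs_mult)
    have C: "\<bar>2 / a * (Y u - a)\<bar> \<le> 2 / a * (M + 3)"
      unfolding abs_mult using Yb[of u] M a by (intro mult_mono) auto
    have "norm (f p) \<le> \<bar>Y u * (Y u - 2) / 2 - 2 * a * T g\<bar> + \<bar>2 / a * (Y u - a)\<bar>"
      using norm_Pair_le[of "Y u * (Y u - 2) / 2 - 2 * a * T g" "2 / a * (Y u - a)"]
      by (simp add: p f_def)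
    then show ?thesis using A B C by linarith
  qed
  obtain x where x0: "x 0 = (y0, ln h0)"
    and x: "\<And>t. 0 \<le> t \<Longrightarrow> (x has_vector_derivative f (x t)) (at t within {0..})"
    using picard_global[OF K lip bdd, of "(y0, ln h0)"] by blast
  define y where "y t = fst (x t)" for t
  define g where "g t = snd (x t)" for t
  have dy: "(y has_real_derivative Y (y t) * (Y (y t) - 2) / 2 - 2 * a * T (g t)) (at t within {0..})"
    if "0 \<le> t" for t
    using bounded_linear.has_vector_derivative[OF bounded_linear_fst x[OF that]]
    by (simp add: y_def[abs_def] g_def f_def split_beta has_real_derivative_iff_has_vector_derivative)
  have dg: "(g has_real_derivative 2 / a * (Y (y t) - a)) (at t within {0..})" if "0 \<le> t" for t
    using bounded_linear.has_vector_derivative[OF bounded_linear_snd x[OF that]]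
    by (simp add: y_def g_def[abs_def] f_def split_beta has_real_derivative_iff_has_vector_derivative)
  have init: "y 0 = y0" "g 0 = ln h0" by (auto simp: y_def g_def x0)
  have y_le: "y t \<le> y0" if "0 \<le> t" for t
  proof -
    have "0 \<le> y0 - y t"
    proof (rule nonneg_barrier_atLeast[OF _ _ _ that])
      fix s :: real assume s: "0 \<le> s"
      show "((\<lambda>s. y0 - y s) has_real_derivative - (Y (y s) * (Y (y s) - 2) / 2 - 2 * a * T (g s))) (at s within {0..})"
        by (auto intro!: derivative_eq_intros dy s)
      assume "y0 - y s < 0"
      then have "0 \<le> Y (y s)" using y0 M by (auto simp: Y_def)
      then have "Y (y s) * (Y (y s) - 2) \<le> 0" using Yb[of "y s"] by (intro mult_nonneg_nonpos) auto
      moreover have "0 \<le> 2 * a * T (g s)" using a Tb(1)[of "g s"] by simp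
      ultimately show "0 \<le> - (Y (y s) * (Y (y s) - 2) / 2 - 2 * a * T (g s))" by linarith
    qed (simp add: init)
    then show ?thesis by simp
  qed
  have y_ge: "- M \<le> y t" if "0 \<le> t" for t
  proof -
    have "0 \<le> y t + M"
    proof (rule nonneg_barrier_atLeast[OF _ _ _ that])
      fix s :: real assume s: "0 \<le> s"
      show "((\<lambda>s. y s + M) has_real_derivative Y (y s) * (Y (y s) - 2) / 2 - 2 * a * T (g s)) (at s within {0..})"
        by (auto intro!: derivative_eq_intros dy s)
      assume "y s + M < 0"
      then have Ym: "Y (y s) = - M" using M by (auto simp: Y_def)
      have "2 * a * T (g s) \<le> 2 * a * exp G" using Tb(2) a by auto
      moreover have "0 \<le> M * M" using M by simp
      moreover have "4 * a * exp G \<le> M" using a by (simp add: M_def)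
      moreover have "- M * (- M - 2) = M * M + 2 * M" by (simp add: algebra_simps)
      ultimately show "0 \<le> Y (y s) * (Y (y s) - 2) / 2 - 2 * a * T (g s)"
        unfolding Ym using M by linarith
    qed (use init y0 M in simp)
    then show ?thesis by simp
  qed
  define P where "P u = (if u \<le> G then exp u else exp G * (1 + u - G))" for u
  have g_le: "g t \<le> G" if "0 \<le> t" for t
  proof (rule ccontr)
    assume gt: "\<not> g t \<le> G"
    let ?S = "\<lambda>t. P (g t) + 1 / (2 * a\<^sup>2) * (max (y t - a) 0)\<^sup>2"
    have "0 \<le> ?S 0 - ?S t"
    proof (rule nonneg_barrier_atLeast[OF _ _ _ that])
      fix s :: real assume s: "0 \<le> s"
      let ?D = "T (g s) * (2 / a * (Y (y s) - a)) + 1 / (2 * a\<^sup>2) * (2 * max (y s - a) 0 *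
          (Y (y s) * (Y (y s) - 2) / 2 - 2 * a * T (g s)))"
      have d1: "((\<lambda>s. P (g s)) has_real_derivative T (g s) * (2 / a * (Y (y s) - a))) (at s within {0..})"
        using DERIV_chain2[OF has_derivative_linearised_exp[of G "g s"] dg[OF s]]
        by (simp add: P_def[abs_def] T_def)
      have d2: "((\<lambda>s. (max (y s - a) 0)\<^sup>2) has_real_derivative 2 * max (y s - a) 0 *
          (Y (y s) * (Y (y s) - 2) / 2 - 2 * a * T (g s))) (at s within {0..})"
        by (rule DERIV_chain2[OF has_derivative_pos_part_square])
           (auto intro!: derivative_eq_intros dy s)
      show "((\<lambda>t. ?S 0 - ?S t) has_real_derivative - ?D) (at s within {0..})"
        by (rule derivative_eq_intros d1 d2 refl DERIV_cmult | simp)+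
      have Ye: "Y (y s) = y s" using y_ge[OF s] y_le[OF s] y0 by (simp add: Y_def)
      show "0 \<le> - ?D"
      proof (cases "y s \<le> a")
        case True
        have "T (g s) * (2 / a * (y s - a)) \<le> 0"
          using True a Tb(1)[of "g s"] by (intro mult_nonneg_nonpos) (auto intro: mult_nonneg_nonpos)
        then show ?thesis using True by (simp add: Ye)
      next
        case False
        have "?D = 1 / (2 * a\<^sup>2) * ((y s - a) * (y s * (y s - 2)))"
          using a False by (simp add: Ye max_def field_simps power2_eq_square)
        also have "\<dots> \<le> 0"
          using False y_le[OF s] y0 a by (intro mult_nonneg_nonpos) auto
        finally show ?thesis by simp
      qed
    qed simp
    moreover have "?S 0 \<le> S0"
    proof -
      have "h0 \<le> S0 + 1" by (simp add: S0_def)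
      then have "ln h0 \<le> G" using h0 by (simp add: G_def)
      then show ?thesis using h0 by (simp add: P_def init S0_def)
    qed
    moreover have "S0 + 1 < P (g t)"
    proof -
      have "exp G * 1 < exp G * (1 + g t - G)" using gt by (intro mult_strict_left_mono) auto
      then show ?thesis using gt S0 by (simp add: P_def G_def)
    qed
    moreover have "0 \<le> 1 / (2 * a\<^sup>2) * (max (y t - a) 0)\<^sup>2" by simp
    ultimately show False by linarith
  qed
  have Ye: "Y (y t) = y t" if "0 \<le> t" for t using y_ge[OF that] y_le[OF that] y0 by (simp add: Y_def)
  have Te: "T (g t) = exp (g t)" if "0 \<le> t" for t using g_le[OF that] by (simp add: T_def)
  show thesis
  proof (rule that[of y "\<lambda>t. exp (g t)"])
    fix t :: real assume t: "0 \<le> t"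
    show "(y has_real_derivative y t * (y t - 2) / 2 - 2 * a * exp (g t)) (at t within {0..})"
      using dy[OF t] by (simp add: Ye Te t)
    show "((\<lambda>t. exp (g t)) has_real_derivative 2 / a * (y t - a) * exp (g t)) (at t within {0..})"
      using DERIV_chain2[OF DERIV_exp dg[OF t]] by (simp add: Ye t mult.commute)
    show "y t \<le> y0" by (rule y_le[OF t])
    show "0 < exp (g t)" by simp
  qed (use init h0 in auto)
qed

text \<open>
  As long as \<open>y > a / 2\<close>, the function \<open>y\<close> decreases at a rate bounded away from \<open>0\<close>, so \<open>a / 2\<close> is reached in
  finite time, and \<open>y\<close> remains below it. From then on \<open>h\<close> is damped, and \<open>y\<^sup>2 + M h\<^sup>2\<close> with large \<open>M\<close> decays
  exponentially: the weight \<open>M\<close> absorbs the cross term \<open>y h\<close>.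
\<close>

lemma planar_orbit_decays:
  fixes a y0 :: real
  assumes a: "0 < a" and y0: "y0 < 2"
    and dy: "\<And>t. 0 \<le> t \<Longrightarrow> (y has_real_derivative y t * (y t - 2) / 2 - 2 * a * h t) (at t within {0..})"
    and dh: "\<And>t. 0 \<le> t \<Longrightarrow> (h has_real_derivative 2 / a * (y t - a) * h t) (at t within {0..})"
    and y_le: "\<And>t. 0 \<le> t \<Longrightarrow> y t \<le> y0" and h_pos: "\<And>t. 0 \<le> t \<Longrightarrow> 0 < h t"
  obtains C e where "0 < e" "\<And>t. 0 \<le> t \<Longrightarrow> \<bar>y t\<bar> \<le> C * exp (- e * t)"
    "\<And>t. 0 \<le> t \<Longrightarrow> h t \<le> C * exp (- e * t)"
proof -
  define d where "d = 2 - y0"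
  have d: "0 < d" using y0 by (simp add: d_def)
  have "\<exists>t1\<ge>0. y t1 \<le> a / 2"
  proof (rule ccontr)
    assume "\<not> (\<exists>t1\<ge>0. y t1 \<le> a / 2)"
    then have big: "a / 2 < y t" if "0 \<le> t" for t using that by force
    have "0 \<le> y0 - d * a / 4 * t - y t" if t: "0 \<le> t" for t
    proof (rule nonneg_barrier_atLeast[OF _ _ _ t])
      fix s :: real assume s: "0 \<le> s"
      show "((\<lambda>s. y0 - d * a / 4 * s - y s) has_real_derivative
          - (d * a / 4) - (y s * (y s - 2) / 2 - 2 * a * h s)) (at s within {0..})"
        by (auto intro!: derivative_eq_intros dy s)
      have "a / 2 * d \<le> y s * (2 - y s)"
        using big[OF s] y_le[OF s] d a by (intro mult_mono) (auto simp: d_def)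
      moreover have "0 \<le> 2 * a * h s" using h_pos[OF s] a by simp
      moreover have "y s * (y s - 2) = - (y s * (2 - y s))" by (simp add: algebra_simps)
      moreover have "d * a / 4 = a / 2 * d / 2" by simp
      ultimately show "0 \<le> - (d * a / 4) - (y s * (y s - 2) / 2 - 2 * a * h s)"
        by linarith
    qed (use y_le[of 0] in simp)
    note bound = this
    define r where "r = 4 * (\<bar>y0\<bar> + 1) / (d * a)"
    have "0 \<le> r" "d * a / 4 * r = \<bar>y0\<bar> + 1" using d a by (auto simp: r_def)
    then show False using bound[of r] big[of r] a by linarith
  qed
  then obtain t1 where t1: "0 \<le> t1" "y t1 \<le> a / 2" by blast
  have small: "y t \<le> a / 2" if "t1 \<le> t" for t
  proof -
    have "0 \<le> a / 2 - y t"
    proof (rule nonneg_barrier_atLeast[OF _ _ _ that])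
      fix s :: real assume s: "t1 \<le> s"
      show "((\<lambda>s. a / 2 - y s) has_real_derivative
          - (y s * (y s - 2) / 2 - 2 * a * h s)) (at s within {t1..})"
        using s t1 by (auto intro!: derivative_eq_intros DERIV_subset[OF dy])
      assume "a / 2 - y s < 0"
      then have "y s * (y s - 2) \<le> 0" using y_le[of s] y0 s t1 a by (intro mult_nonneg_nonpos) auto
      moreover have "0 \<le> 2 * a * h s" using h_pos[of s] s t1 a by simp
      ultimately show "0 \<le> - (y s * (y s - 2) / 2 - 2 * a * h s)" by linarith
    qed (use t1 in simp)
    then show ?thesis by simp
  qed
  define M where "M = 8 * a\<^sup>2 / d + 1"
  define e where "e = min (d / 2) 1"
  have M: "0 < M" "8 * a\<^sup>2 / d \<le> M" using d a by (auto simp: M_def add_nonneg_pos)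
  have e: "0 < e" "e \<le> d / 2" "e \<le> 1" using d by (auto simp: e_def)
  define E where "E t = (y t)\<^sup>2 + M * (h t)\<^sup>2" for t
  have Edec: "E t \<le> E t1 * exp (- e * (t - t1))" if "t1 \<le> t" for t
  proof -
    have "0 \<le> E t1 - E t * exp (e * (t - t1))"
    proof (rule nonneg_barrier_atLeast[OF _ _ _ that])
      fix s :: real assume s: "t1 \<le> s"
      let ?D = "2 * y s * (y s * (y s - 2) / 2 - 2 * a * h s) + M * (2 * h s * (2 / a * (y s - a) * h s))"
      have dE: "(E has_real_derivative ?D) (at s within {t1..})"
        unfolding E_def[abs_def] using s t1
        by (auto intro!: derivative_eq_intros DERIV_subset[OF dy] DERIV_subset[OF dh])
      show "((\<lambda>s. E t1 - E s * exp (e * (s - t1))) has_real_derivative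
          - ((?D + e * E s) * exp (e * (s - t1)))) (at s within {t1..})"
        by (rule derivative_eq_intros dE refl | simp add: algebra_simps)+
      have 1: "y s * (y s * (y s - 2)) \<le> - d * (y s)\<^sup>2"
      proof -
        have "(y s)\<^sup>2 * (y s - 2) \<le> (y s)\<^sup>2 * (- d)"
          using y_le[of s] s t1 by (intro mult_left_mono) (auto simp: d_def)
        then show ?thesis by (simp add: power2_eq_square algebra_simps)
      qed
      have 2: "M * (2 * h s * (2 / a * (y s - a) * h s)) \<le> - 2 * M * (h s)\<^sup>2"
      proof -
        have "2 / a * (y s - a) \<le> - 1" using small[OF s] a by (simp add: field_simps)
        then have "2 * M * (h s)\<^sup>2 * (2 / a * (y s - a)) \<le> 2 * M * (h s)\<^sup>2 * (- 1)"
          using M by (intro mult_left_mono) auto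
        then show ?thesis by (simp add: power2_eq_square mult_ac)
      qed
      have 3: "- 4 * a * (y s * h s) \<le> d / 2 * (y s)\<^sup>2 + 8 * a\<^sup>2 / d * (h s)\<^sup>2"
      proof -
        have "0 \<le> (d * y s + 4 * a * h s)\<^sup>2 / (2 * d)" using d by simp
        also have "\<dots> = d / 2 * (y s)\<^sup>2 + 8 * a\<^sup>2 / d * (h s)\<^sup>2 + 4 * a * (y s * h s)"
          using d by (simp add: field_simps power2_eq_square)
        finally show ?thesis by simp
      qed
      have 4: "8 * a\<^sup>2 / d * (h s)\<^sup>2 \<le> M * (h s)\<^sup>2" using M(2) by (intro mult_right_mono) auto
      have 5: "e * E s \<le> d / 2 * (y s)\<^sup>2 + M * (h s)\<^sup>2"
      proof -
        have "e * (y s)\<^sup>2 \<le> d / 2 * (y s)\<^sup>2" using e by (intro mult_right_mono) auto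
        moreover have "e * (M * (h s)\<^sup>2) \<le> 1 * (M * (h s)\<^sup>2)" using e M by (intro mult_right_mono) auto
        ultimately show ?thesis by (simp add: E_def algebra_simps)
      qed
      have "?D + e * E s \<le> 0"
      proof -
        have "?D = y s * (y s * (y s - 2)) - 4 * a * (y s * h s) + M * (2 * h s * (2 / a * (y s - a) * h s))"
          by (simp add: field_simps)
        then show ?thesis using 1 2 3 4 5 by linarith
      qed
      then show "0 \<le> - ((?D + e * E s) * exp (e * (s - t1)))"
        by (simp add: mult_nonpos_nonneg)
    qed simp
    then have "E t * exp (e * (t - t1)) * exp (- e * (t - t1)) \<le> E t1 * exp (- e * (t - t1))"
      by (intro mult_right_mono) auto
    then show ?thesis by (simp add: mult.assoc mult_exp_exp)
  qed
  have "continuous_on {0..t1} (\<lambda>t. E t * exp (e * t))"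
  proof -
    have "continuous_on {0..} y" "continuous_on {0..} h"
      unfolding continuous_on_eq_continuous_within using dy dh DERIV_continuous by (meson atLeast_iff)+
    then have "continuous_on {0..t1} y" "continuous_on {0..t1} h"
      by (auto elim!: continuous_on_subset)
    then show ?thesis unfolding E_def by (intro continuous_intros)
  qed
  then have "bounded ((\<lambda>t. E t * exp (e * t)) ` {0..t1})"
    by (intro compact_imp_bounded compact_continuous_image) auto
  then obtain B where B: "0 < B" "\<And>t. t \<in> {0..t1} \<Longrightarrow> \<bar>E t * exp (e * t)\<bar> \<le> B"
    unfolding bounded_pos by auto
  have Eb: "E t \<le> B * exp (- e * t)" if t: "0 \<le> t" for t
  proof (cases "t \<le> t1")
    case True
    then have "E t * exp (e * t) \<le> B" using B(2)[of t] t by auto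
    then show ?thesis by (simp add: exp_minus field_simps)
  next
    case False
    have "E t \<le> E t1 * exp (e * t1) * exp (- e * t)"
      using Edec[of t] False by (simp add: mult.assoc mult_exp_exp algebra_simps)
    also have "\<dots> \<le> B * exp (- e * t)" using B(2)[of t1] t1 by (intro mult_right_mono) auto
    finally show ?thesis .
  qed
  have sq: "\<bar>u\<bar> \<le> sqrt c * exp (- (e / 2) * t)" if "u\<^sup>2 \<le> c * exp (- e * t)" for u c t
  proof -
    have "\<bar>u\<bar> \<le> sqrt (c * exp (- e * t))" using that real_le_rsqrt[of "\<bar>u\<bar>"] by simp
    also have "\<dots> = sqrt c * sqrt ((exp (- (e / 2) * t))\<^sup>2)"
      by (simp add: real_sqrt_mult power2_eq_square mult_exp_exp)
    finally show ?thesis by simp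
  qed
  define C where "C = max (sqrt B) (sqrt (B / M))"
  show thesis
  proof (rule that[of "e / 2" C])
    show "0 < e / 2" using e by simp
    fix t :: real assume t: "0 \<le> t"
    have "0 \<le> M * (h t)\<^sup>2" using M by simp
    then have "(y t)\<^sup>2 \<le> B * exp (- e * t)" using Eb[OF t] unfolding E_def by linarith
    from sq[OF this] show "\<bar>y t\<bar> \<le> C * exp (- (e / 2) * t)"
      by (rule order_trans) (auto simp: C_def intro!: mult_right_mono)
    have "M * (h t)\<^sup>2 \<le> B * exp (- e * t)" using Eb[OF t] unfolding E_def by (smt (verit) zero_le_power2)
    then have "(h t)\<^sup>2 \<le> B / M * exp (- e * t)" using M by (simp add: field_simps)
    from sq[OF this] h_pos[OF t] have "h t \<le> sqrt (B / M) * exp (- (e / 2) * t)" by simp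
    then show "h t \<le> C * exp (- (e / 2) * t)"
      by (rule order_trans) (auto simp: C_def intro!: mult_right_mono)
  qed
qed

section \<open>The reduced system in the space variable\<close>

text \<open>
  Here \<open>V = c\<^sub>l X + a U\<close> is the transport speed, \<open>y = a U'\<close> and \<open>h = \<Theta>\<close>. The equations are stated as
  products with \<open>V\<close> because \<open>V\<close> vanishes at the origin and at the boundary of the support. Away from the zeros
  of \<open>V\<close> the last two equations are the planar system in the time \<open>\<tau>\<close> with \<open>d\<tau> = dX / V\<close>.
\<close>

definition reduced_system ::
  "real \<Rightarrow> real set \<Rightarrow> (real \<Rightarrow> real) \<Rightarrow> (real \<Rightarrow> real) \<Rightarrow> (real \<Rightarrow> real) \<Rightarrow> bool" where
  "reduced_system a S V y h \<longleftrightarrow> (\<forall>x\<in>S.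
     (V has_real_derivative coeff_l a + y x) (at x) \<and>
     (\<exists>y'. (y has_real_derivative y') (at x) \<and> V x * y' = y x * (y x - 2) / 2 - 2 * a * h x) \<and>
     (\<exists>h'. (h has_real_derivative h') (at x) \<and> V x * h' = 2 / a * (y x - a) * h x))"

lemma reduced_systemD:
  assumes "reduced_system a S V y h" "x \<in> S"
  shows "(V has_real_derivative coeff_l a + y x) (at x)"
    and "V x \<noteq> 0 \<Longrightarrow> (y has_real_derivative (y x * (y x - 2) / 2 - 2 * a * h x) / V x) (at x)"
    and "V x \<noteq> 0 \<Longrightarrow> (h has_real_derivative (2 / a * (y x - a) * h x) / V x) (at x)"
proof -
  show "(V has_real_derivative coeff_l a + y x) (at x)"
    using assms by (auto simp: reduced_system_def)
  obtain y' h' where *: "(y has_real_derivative y') (at x)" "V x * y' = y x * (y x - 2) / 2 - 2 * a * h x"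
    "(h has_real_derivative h') (at x)" "V x * h' = 2 / a * (y x - a) * h x"
    using assms unfolding reduced_system_def by blast
  assume V: "V x \<noteq> 0"
  have "y' = (y x * (y x - 2) / 2 - 2 * a * h x) / V x" "h' = (2 / a * (y x - a) * h x) / V x"
    unfolding *(2)[symmetric] *(4)[symmetric] using V by auto
  then show "(y has_real_derivative (y x * (y x - 2) / 2 - 2 * a * h x) / V x) (at x)"
    "(h has_real_derivative (2 / a * (y x - a) * h x) / V x) (at x)"
    using *(1,3) by simp_all
qed

lemma reduced_systemI:
  assumes "\<And>x. x \<in> S \<Longrightarrow> V x \<noteq> 0"
    and "\<And>x. x \<in> S \<Longrightarrow> (V has_real_derivative coeff_l a + y x) (at x)"
    and "\<And>x. x \<in> S \<Longrightarrow> (y has_real_derivative (y x * (y x - 2) / 2 - 2 * a * h x) / V x) (at x)"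
    and "\<And>x. x \<in> S \<Longrightarrow> (h has_real_derivative (2 / a * (y x - a) * h x) / V x) (at x)"
  shows "reduced_system a S V y h"
  unfolding reduced_system_def
proof (intro ballI conjI exI)
  fix x assume x: "x \<in> S"
  show "(V has_real_derivative coeff_l a + y x) (at x)" by (rule assms(2)[OF x])
  show "(y has_real_derivative (y x * (y x - 2) / 2 - 2 * a * h x) / V x) (at x)" by (rule assms(3)[OF x])
  show "(h has_real_derivative (2 / a * (y x - a) * h x) / V x) (at x)" by (rule assms(4)[OF x])
qed (use assms(1) in auto)

lemma reduced_system_subset: "reduced_system a S V y h \<Longrightarrow> T \<subseteq> S \<Longrightarrow> reduced_system a T V y h"
  unfolding reduced_system_def by blast

lemma continuous_antiderivative:
  fixes f :: "real \<Rightarrow> real"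
  assumes "continuous_on UNIV f"
  obtains F where "F c = d" "\<And>x. (F has_real_derivative f x) (at x)"
proof -
  have "\<exists>F. \<forall>x::real. - \<infinity> < ereal x \<longrightarrow> ereal x < \<infinity> \<longrightarrow> (F has_vector_derivative f x) (at x)"
    by (rule einterval_antiderivative) (use assms in \<open>auto simp: continuous_on_eq_continuous_at\<close>)
  then obtain F where F: "\<And>x. (F has_real_derivative f x) (at x)"
    by (auto simp: has_real_derivative_iff_has_vector_derivative)
  show thesis
    by (rule that[of "\<lambda>x. F x - F c + d"]) (auto intro!: derivative_eq_intros F)
qed

lemma interval_image_bounded:
  fixes X :: "real \<Rightarrow> real"
  assumes mono: "\<And>s t. 0 \<le> s \<Longrightarrow> s < t \<Longrightarrow> X s < X t" and cont: "continuous_on {0..} X"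
    and bdd: "\<And>t. 0 \<le> t \<Longrightarrow> X t \<le> B"
  obtains L where "X 0 < L" "X ` {0..} = {X 0..<L}"
proof -
  define L where "L = Sup (X ` {0..})"
  have bd: "bdd_above (X ` {0..})" using bdd by (auto intro!: bdd_aboveI[of _ B])
  have lt: "X t < L" if "0 \<le> t" for t
  proof -
    have "X t < X (t + 1)" using that by (intro mono) auto
    also have "\<dots> \<le> L" unfolding L_def using that by (intro cSup_upper bd) auto
    finally show ?thesis .
  qed
  have "X ` {0..} = {X 0..<L}"
  proof (intro equalityI subsetI)
    fix x assume "x \<in> X ` {0..}"
    then show "x \<in> {X 0..<L}"
      using lt by (auto simp: le_less) (metis less_eq_real_def mono order_refl)
  next
    fix x assume x: "x \<in> {X 0..<L}"
    then have "x < Sup (X ` {0..})" by (simp add: L_def)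
    then obtain t where t: "0 \<le> t" "x < X t"
      using less_cSup_iff[OF _ bd, of x] by auto
    have "\<exists>s\<ge>0. s \<le> t \<and> X s = x"
      by (rule IVT') (use t x in \<open>auto intro: continuous_on_subset[OF cont]\<close>)
    then show "x \<in> X ` {0..}" by auto
  qed
  then show thesis using that lt[of 0] by auto
qed

lemma interval_image_unbounded:
  fixes X :: "real \<Rightarrow> real"
  assumes mono: "\<And>s t. 0 \<le> s \<Longrightarrow> s < t \<Longrightarrow> X s < X t" and cont: "continuous_on {0..} X"
    and unbdd: "\<And>B. \<exists>t\<ge>0. B \<le> X t"
  shows "X ` {0..} = {X 0..}"
proof (intro equalityI subsetI)
  fix x assume "x \<in> X ` {0..}"
  then show "x \<in> {X 0..}"
    by (auto simp: le_less) (metis less_eq_real_def mono order_refl)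
next
  fix x assume x: "x \<in> {X 0..}"
  obtain t where t: "0 \<le> t" "x \<le> X t" using unbdd by blast
  have "\<exists>s\<ge>0. s \<le> t \<and> X s = x"
    by (rule IVT') (use t x in \<open>auto intro: continuous_on_subset[OF cont]\<close>)
  then show "x \<in> X ` {0..}" by auto
qed

text \<open>
  The planar orbit is transported back to the space variable. Along the orbit \<open>ln V\<close> equals \<open>c\<^sub>l \<tau>\<close> plus the
  integral of \<open>y\<close>, which is bounded by exponential decay; so \<open>V\<close> is comparable to \<open>exp (c\<^sub>l \<tau>)\<close>, and
  \<open>X = X0 + \<integral> V d\<tau>\<close> runs through the whole half-line if \<open>c\<^sub>l \<ge> 0\<close>, that is \<open>a \<le> 2/3\<close>, and only up to a finite
  \<open>L\<close> if \<open>c\<^sub>l < 0\<close>. This is the origin of the dichotomy between full and compact support.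
\<close>

theorem outer_solution:
  fixes a X0 V0 y0 h0 :: real
  assumes a: "0 < a" "a \<le> 1" and V0: "0 < V0" and y0: "0 < y0" "y0 < 2" and h0: "0 < h0"
  obtains J V y h where "V X0 = V0" "y X0 = y0" "h X0 = h0"
    and "\<And>x. x \<in> J \<Longrightarrow> (V has_real_derivative coeff_l a + y x) (at x within {X0..})"
    and "\<And>x. x \<in> J \<Longrightarrow> (y has_real_derivative (y x * (y x - 2) / 2 - 2 * a * h x) / V x) (at x within {X0..})"
    and "\<And>x. x \<in> J \<Longrightarrow> (h has_real_derivative (2 / a * (y x - a) * h x) / V x) (at x within {X0..})"
    and "\<And>x. x \<in> J \<Longrightarrow> 0 < V x \<and> 0 < h x \<and> y x \<le> y0"
    and "a \<le> 2 / 3 \<Longrightarrow> J = {X0..} \<and> (y \<longlongrightarrow> 0) at_top"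
    and "2 / 3 < a \<Longrightarrow> \<exists>L>X0. J = {X0..<L} \<and> (V \<longlongrightarrow> 0) (at_left L) \<and>
            (y \<longlongrightarrow> 0) (at_left L) \<and> (h \<longlongrightarrow> 0) (at_left L)"
proof -
  note finish = that
  obtain y h where init: "y 0 = y0" "h 0 = h0"
    and dy: "\<And>t. 0 \<le> t \<Longrightarrow> (y has_real_derivative y t * (y t - 2) / 2 - 2 * a * h t) (at t within {0..})"
    and dh: "\<And>t. 0 \<le> t \<Longrightarrow> (h has_real_derivative 2 / a * (y t - a) * h t) (at t within {0..})"
    and y_le: "\<And>t. 0 \<le> t \<Longrightarrow> y t \<le> y0" and h_pos: "\<And>t. 0 \<le> t \<Longrightarrow> 0 < h t"
    using planar_orbit_exists[OF a y0 h0] by metis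
  obtain C e where e: "0 < e" and Cy: "\<And>t. 0 \<le> t \<Longrightarrow> \<bar>y t\<bar> \<le> C * exp (- e * t)"
    and Ch: "\<And>t. 0 \<le> t \<Longrightarrow> h t \<le> C * exp (- e * t)"
    using planar_orbit_decays[OF a(1) y0(2) dy dh y_le h_pos] by metis
  have conty: "continuous_on {0..} y"
    unfolding continuous_on_eq_continuous_within using dy DERIV_continuous by (meson atLeast_iff)
  have contym: "continuous_on UNIV (\<lambda>t. y (max t 0))"
    by (rule continuous_on_compose2[OF conty]) (auto intro!: continuous_intros)
  obtain Q where Q: "Q 0 = 0" "\<And>t. (Q has_real_derivative y (max t 0)) (at t)"
    using continuous_antiderivative[OF contym, of 0 0] by metis
  have contQ: "continuous_on UNIV Q" by (rule DERIV_continuous_on[OF Q(2)])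
  define v where "v t = V0 * exp (coeff_l a * t + Q t)" for t
  have v_pos: "0 < v t" for t using V0 by (simp add: v_def)
  have dv: "(v has_real_derivative (coeff_l a + y t) * v t) (at t)" if "0 \<le> t" for t
    unfolding v_def[abs_def] using that by (auto intro!: derivative_eq_intros Q(2) simp: max_def)
  have "continuous_on UNIV v"
    unfolding v_def[abs_def]
    by (intro continuous_intros contQ)
  then have contvm: "continuous_on UNIV (\<lambda>t. v (max t 0))"
    by (rule continuous_on_compose2) (auto intro!: continuous_intros)
  obtain X where X: "X 0 = X0" "\<And>t. (X has_real_derivative v (max t 0)) (at t)"
    using continuous_antiderivative[OF contvm, of 0 X0] by metis
  have mono: "X s < X t" if "s < t" for s t
    by (rule DERIV_pos_imp_increasing[OF that]) (use X v_pos in blast)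
  have inj: "inj X" by (rule strict_mono_imp_inj_on) (auto intro: strict_monoI mono)
  define T where "T = inv X"
  have TX: "T (X t) = t" for t unfolding T_def by (rule inv_f_f[OF inj])
  have contX: "continuous_on S X" for S
    by (rule DERIV_continuous_on) (use X in \<open>auto intro: DERIV_subset\<close>)
  have dT: "(T has_real_derivative inverse (v (max t 0))) (at (X t))" for t
    unfolding has_field_derivative_def
    by (rule has_derivative_inverse_strong[of UNIV t X T "(*) (v (max t 0))"])
       (use X(2)[of t] v_pos[of "max t 0"] contX TX in \<open>auto simp: has_field_derivative_def fun_eq_iff\<close>)
  define J where "J = X ` {0..}"
  have Q_bdd: "\<bar>Q t\<bar> \<le> C / e" if "0 \<le> t" for t
  proof -
    have *: "0 \<le> C / e * (1 - exp (- e * t)) - c * Q t" if c: "\<bar>c\<bar> = 1" for c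
    proof (rule nonneg_barrier_atLeast[OF _ _ _ \<open>0 \<le> t\<close>])
      fix s :: real assume s: "0 \<le> s"
      show "((\<lambda>s. C / e * (1 - exp (- e * s)) - c * Q s) has_real_derivative
          C * exp (- e * s) - c * y s) (at s within {0..})"
        using e s by (auto intro!: derivative_eq_intros DERIV_subset[OF Q(2)] simp: max_def)
      have "\<bar>c * y s\<bar> \<le> C * exp (- e * s)" using Cy[OF s] c by (simp add: abs_mult)
      then show "0 \<le> C * exp (- e * s) - c * y s" by linarith
    qed (simp add: Q)
    have "0 \<le> C" using Cy[of 0] by simp
    then have "C / e * (1 - exp (- e * t)) \<le> C / e * 1" using e by (intro mult_left_mono) auto
    then show ?thesis using *[of 1] *[of "-1"] by simp
  qed
  have J_deriv: "at x within {X0..} = at x within J" if J: "J = {X0..} \<or> (\<exists>L. J = {X0..<L})" "x \<in> J" for x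
    using J
  proof (elim disjE exE)
    fix L assume "J = {X0..<L}"
    then show ?thesis using J(2) by (intro at_within_nhd[of _ "{..<L}"]) auto
  qed auto
  have main: thesis if J: "J = {X0..} \<or> (\<exists>L. J = {X0..<L})"
    and J1: "a \<le> 2 / 3 \<Longrightarrow> J = {X0..} \<and> ((y \<circ> T) \<longlongrightarrow> 0) at_top"
    and J2: "2 / 3 < a \<Longrightarrow> \<exists>L>X0. J = {X0..<L} \<and> ((v \<circ> T) \<longlongrightarrow> 0) (at_left L) \<and>
            ((y \<circ> T) \<longlongrightarrow> 0) (at_left L) \<and> ((h \<circ> T) \<longlongrightarrow> 0) (at_left L)"
  proof (rule finish[of "v \<circ> T" "y \<circ> T" "h \<circ> T" J])
    have T0: "T X0 = 0" using TX[of 0] X by simp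
    show "(v \<circ> T) X0 = V0" "(y \<circ> T) X0 = y0" "(h \<circ> T) X0 = h0"
      by (auto simp: T0 init v_def Q)
    fix x assume x: "x \<in> J"
    then obtain t where t: "0 \<le> t" "x = X t" by (auto simp: J_def)
    have TJ: "T ` J \<subseteq> {0..}" by (auto simp: J_def TX)
    have dTx: "(T has_real_derivative inverse (v t)) (at x within J)"
      using dT[of t] t by (auto simp: max_def intro: DERIV_subset)
    have chain: "((f \<circ> T) has_real_derivative D * inverse (v t)) (at x within J)"
      if "(f has_real_derivative D) (at t within {0..})" for f D
      by (rule DERIV_image_chain[OF _ dTx]) (use t TX that TJ in \<open>auto intro: DERIV_subset\<close>)
    note atJ = J_deriv[OF J x]
    show "((v \<circ> T) has_real_derivative coeff_l a + (y \<circ> T) x) (at x within {X0..})"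
      unfolding atJ using chain[OF DERIV_subset[OF dv[OF t(1)]]] t v_pos[of t] by (simp add: TX mult.assoc)
    show "((y \<circ> T) has_real_derivative ((y \<circ> T) x * ((y \<circ> T) x - 2) / 2 - 2 * a * (h \<circ> T) x) / (v \<circ> T) x) (at x within {X0..})"
      unfolding atJ using chain[OF dy[OF t(1)]] t by (simp add: TX divide_inverse[symmetric])
    show "((h \<circ> T) has_real_derivative (2 / a * ((y \<circ> T) x - a) * (h \<circ> T) x) / (v \<circ> T) x) (at x within {X0..})"
      unfolding atJ using chain[OF dh[OF t(1)]] t by (simp add: TX divide_inverse[symmetric])
    show "0 < (v \<circ> T) x \<and> 0 < (h \<circ> T) x \<and> (y \<circ> T) x \<le> y0"
      using t v_pos h_pos y_le by (simp add: TX)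
  qed (use J1 J2 in auto)
  have decay0: "((\<lambda>t. C * exp (- e * t)) \<longlongrightarrow> 0) at_top"
  proof -
    have "filterlim (\<lambda>t. - e * t) at_bot at_top"
      using e by (intro filterlim_tendsto_neg_mult_at_bot[OF tendsto_const] filterlim_ident) auto
    from filterlim_compose[OF exp_at_bot this] show ?thesis
      by (intro tendsto_mult_right_zero) simp
  qed
  have y0t: "(y \<longlongrightarrow> 0) at_top"
    by (rule Lim_null_comparison[OF _ decay0], rule eventually_at_top_linorderI[of 0]) (use Cy in auto)
  have h0t: "(h \<longlongrightarrow> 0) at_top"
    by (rule Lim_null_comparison[OF _ decay0], rule eventually_at_top_linorderI[of 0])
       (use Ch h_pos in \<open>auto simp: abs_of_pos\<close>)
  show thesis
  proof (cases "a \<le> 2 / 3")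
    case True
    then have cl: "0 \<le> coeff_l a" using a by (simp add: coeff_l_def field_simps)
    define c where "c = V0 * exp (- (C / e))"
    have c: "0 < c" using V0 by (simp add: c_def)
    have vc: "c \<le> v t" if "0 \<le> t" for t
    proof -
      have "0 \<le> coeff_l a * t" using cl that by simp
      then have "- (C / e) \<le> coeff_l a * t + Q t" using Q_bdd[OF that] by linarith
      then show ?thesis unfolding c_def v_def using V0 by simp
    qed
    have Xc: "X0 + c * t \<le> X t" if "0 \<le> t" for t
    proof -
      have "0 \<le> X t - (X0 + c * t)"
      proof (rule nonneg_barrier_atLeast[OF _ _ _ that])
        fix s :: real assume s: "0 \<le> s"
        show "((\<lambda>t. X t - (X0 + c * t)) has_real_derivative v s - c) (at s within {0..})"
          using s by (auto intro!: derivative_eq_intros DERIV_subset[OF X(2)] simp: max_def)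
        show "0 \<le> v s - c" using vc[OF s] by simp
      qed (simp add: X)
      then show ?thesis by simp
    qed
    have "J = {X0..}"
      unfolding J_def X(1)[symmetric]
    proof (rule interval_image_unbounded)
      fix B
      define r where "r = \<bar>B - X0\<bar> / c"
      have "0 \<le> r" "c * r = \<bar>B - X0\<bar>" using c by (auto simp: r_def)
      then show "\<exists>t\<ge>0. B \<le> X t" using Xc[of r] by (intro exI[of _ r]) auto
    qed (use mono contX in auto)
    moreover have "filterlim T at_top at_top"
      unfolding filterlim_at_top
    proof
      fix Z
      show "\<forall>\<^sub>F x in at_top. Z \<le> T x"
      proof (rule eventually_at_top_linorderI[of "max X0 (X Z)"])
        fix x assume x: "max X0 (X Z) \<le> x"
        then obtain t where "x = X t" "0 \<le> t" using \<open>J = {X0..}\<close> unfolding J_def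
          by (metis atLeast_iff imageE max.boundedE)
        then show "Z \<le> T x" using x mono[of t Z] by (cases "t < Z") (auto simp: TX)
      qed
    qed
    ultimately show ?thesis
      using True by (intro main) (auto simp: comp_def intro: filterlim_compose[OF y0t])
  next
    case False
    then have cl: "coeff_l a < 0" using a by (simp add: coeff_l_def field_simps)
    define k where "k = - coeff_l a"
    have k: "0 < k" using cl by (simp add: k_def)
    define B where "B = V0 * exp (C / e)"
    have B: "0 < B" using V0 by (simp add: B_def)
    have vB: "v t \<le> B * exp (- k * t)" if "0 \<le> t" for t
      unfolding v_def B_def mult.assoc mult_exp_exp using Q_bdd[OF that] V0 by (auto simp: k_def)
    have XB: "X t \<le> X0 + B / k * (1 - exp (- k * t))" if "0 \<le> t" for t
    proof -
      have "0 \<le> X0 + B / k * (1 - exp (- k * t)) - X t"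
      proof (rule nonneg_barrier_atLeast[OF _ _ _ that])
        fix s :: real assume s: "0 \<le> s"
        show "((\<lambda>t. X0 + B / k * (1 - exp (- k * t)) - X t) has_real_derivative B * exp (- k * s) - v s) (at s within {0..})"
          using s k by (auto intro!: derivative_eq_intros DERIV_subset[OF X(2)] simp: max_def)
        show "0 \<le> B * exp (- k * s) - v s" using vB[OF s] by simp
      qed (simp add: X)
      then show ?thesis by simp
    qed
    have XB': "X t \<le> X0 + B / k" if "0 \<le> t" for t
    proof -
      have "B / k * (1 - exp (- k * t)) \<le> B / k * 1" using B k by (intro mult_left_mono) auto
      then show ?thesis using XB[OF that] by simp
    qed
    obtain L where L: "X 0 < L" "X ` {0..} = {X 0..<L}"
      using interval_image_bounded[of X, OF _ contX XB'] mono by blast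
    then have JL: "J = {X0..<L}" "X0 < L" by (auto simp: J_def X)
    have Tlim: "filterlim T at_top (at_left L)"
      unfolding filterlim_at_top
    proof
      fix Z
      have "X (max Z 0) < L" using L(2) by (metis atLeastLessThan_iff atLeast_iff image_eqI max.cobounded2)
      then have "\<forall>\<^sub>F x in at_left L. x \<in> {X (max Z 0)<..<L}" by (rule eventually_at_leftI[rotated]) auto
      then show "\<forall>\<^sub>F x in at_left L. Z \<le> T x"
      proof eventually_elim
        case (elim x)
        have "X 0 \<le> X (max Z 0)" using mono[of 0 "max Z 0"] by (cases "Z \<le> 0") (auto simp: max_def)
        then have "x \<in> X ` {0..}" using elim L(2) by auto
        then obtain t where "x = X t" "0 \<le> t" by auto
        then show "Z \<le> T x" using elim mono[of t "max Z 0"] by (cases "t < max Z 0") (auto simp: TX max_def split: if_splits)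
      qed
    qed
    have v0t: "(v \<longlongrightarrow> 0) at_top"
    proof (rule Lim_null_comparison)
      show "\<forall>\<^sub>F t in at_top. norm (v t) \<le> B * exp (- k * t)"
        by (rule eventually_at_top_linorderI[of 0]) (use vB v_pos in \<open>auto simp: abs_of_pos\<close>)
      have "filterlim (\<lambda>t. - k * t) at_bot at_top"
        using k by (intro filterlim_tendsto_neg_mult_at_bot[OF tendsto_const] filterlim_ident) auto
      from filterlim_compose[OF exp_at_bot this] show "((\<lambda>t. B * exp (- k * t)) \<longlongrightarrow> 0) at_top"
        by (intro tendsto_mult_right_zero) simp
    qed
    show ?thesis
      using False JL Tlim
      by (intro main) (auto simp: comp_def intro!: exI[of _ L] filterlim_compose[OF y0t] filterlim_compose[OF h0t] filterlim_compose[OF v0t])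
  qed
qed

section \<open>Power series at the origin\<close>

text \<open>
  Put \<open>s = X\<^sup>2\<close>, \<open>h = \<Sum> \<theta>\<^sub>n s\<^sup>n\<close> and \<open>2 - y = \<Sum> \<zeta>\<^sub>n s\<^sup>n\<close>. Integrating \<open>V' = c\<^sub>l + y\<close> gives
  \<open>V / X = (2/a - 1) - \<Sum> \<zeta>\<^sub>n s\<^sup>n / (2 n + 1)\<close>, and \<open>X d/dX\<close> multiplies the \<open>n\<close>-th coefficient by \<open>2 n\<close>. Comparing
  coefficients in the reduced system yields the recursion below. The factor of \<open>\<theta>\<^sub>n\<close> vanishes for \<open>n = 1\<close>: this
  is the resonance that leaves \<open>\<theta>\<^sub>1 = \<Theta>''(0) / 2\<close> free, and it is normalised to \<open>1\<close>. All other factors are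
  positive. The congruence rule lets the termination proof see the summation ranges.
\<close>

declare sum.cong [fundef_cong]

function theta_coeff :: "real \<Rightarrow> nat \<Rightarrow> real" and zeta_coeff :: "real \<Rightarrow> nat \<Rightarrow> real" where
  "theta_coeff a n = (if n = 0 then 0 else if n = 1 then 1 else
     (\<Sum>i\<in>{1..<n}. theta_coeff a i * zeta_coeff a (n - i) * (2 * real i / (2 * real (n - i) + 1) - 2 / a))
       / (2 * (real n - 1) * (2 / a - 1)))"
| "zeta_coeff a n = (if n = 0 then 0 else
     (2 * a * theta_coeff a n
       + (\<Sum>i\<in>{1..<n}. zeta_coeff a i * zeta_coeff a (n - i) * (2 * real i / (2 * real (n - i) + 1) - 1 / 2)))
       / (2 * real n * (2 / a - 1) - 1))"
  by pat_completeness auto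
termination
  by (relation "Wellfounded.measure (case_sum (\<lambda>(a, n). 2 * n) (\<lambda>(a, n). 2 * n + 1))") auto

declare theta_coeff.simps [simp del] zeta_coeff.simps [simp del]

lemma convolution_le_product:
  fixes u w :: "nat \<Rightarrow> real"
  assumes "\<And>i. 0 \<le> u i" "\<And>i. 0 \<le> w i"
  shows "(\<Sum>n\<in>{2..Suc N}. \<Sum>i\<in>{1..<n}. u i * w (n - i)) \<le> (\<Sum>i\<in>{1..N}. u i) * (\<Sum>j\<in>{1..N}. w j)"
proof -
  have "(\<Sum>n\<in>{2..Suc N}. \<Sum>i\<in>{1..<n}. u i * w (n - i))
      = (\<Sum>(n, i)\<in>(SIGMA n:{2..Suc N}. {1..<n}). u i * w (n - i))"
    by (rule sum.Sigma) auto
  also have "\<dots> = (\<Sum>(i, j)\<in>(\<lambda>(n, i). (i, n - i)) ` (SIGMA n:{2..Suc N}. {1..<n}). u i * w j)"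
    by (subst sum.reindex) (auto simp: inj_on_def split_beta)
  also have "\<dots> \<le> (\<Sum>(i, j)\<in>{1..N} \<times> {1..N}. u i * w j)"
    by (rule sum_mono2) (use assms in auto)
  also have "\<dots> = (\<Sum>i\<in>{1..N}. u i) * (\<Sum>j\<in>{1..N}. w j)"
    by (simp add: sum_product sum.cartesian_product)
  finally show ?thesis .
qed

lemma weight_le:
  assumes "i < (n :: nat)"
  shows "2 * real i / (2 * real (n - i) + 1) \<le> real n"
proof -
  have "1 \<le> n - i" using assms by simp
  then have "1 \<le> real (n - i)" by linarith
  then have "2 * real i / (2 * real (n - i) + 1) \<le> 2 * real i / 2"
    by (intro divide_left_mono) auto
  also have "\<dots> \<le> real n" using assms by simp
  finally show ?thesis .
qed

context
  fixes a :: real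
  assumes a: "0 < a" "a < 1"
begin

lemma p0_gt_1: "1 < 2 / a - 1"
  using a by (simp add: field_simps)

lemma abs_theta_coeff_le:
  assumes n: "2 \<le> n"
  shows "\<bar>theta_coeff a n\<bar> \<le> (1 + 2 / a) * (\<Sum>i\<in>{1..<n}. \<bar>theta_coeff a i\<bar> * \<bar>zeta_coeff a (n - i)\<bar>)"
proof -
  let ?S = "\<Sum>i\<in>{1..<n}. theta_coeff a i * zeta_coeff a (n - i) * (2 * real i / (2 * real (n - i) + 1) - 2 / a)"
  have den: "real n \<le> 2 * (real n - 1) * (2 / a - 1)"
  proof -
    have "2 * (real n - 1) * 1 \<le> 2 * (real n - 1) * (2 / a - 1)"
      using p0_gt_1 n by (intro mult_left_mono) auto
    moreover have "real n \<le> 2 * (real n - 1) * 1" using n by simp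
    ultimately show ?thesis by (rule order_trans[rotated])
  qed
  have "\<bar>?S\<bar> \<le> (\<Sum>i\<in>{1..<n}. \<bar>theta_coeff a i\<bar> * \<bar>zeta_coeff a (n - i)\<bar> * (real n * (1 + 2 / a)))"
  proof (rule order_trans[OF sum_abs sum_mono])
    fix i assume i: "i \<in> {1..<n}"
    have "2 * real i / (2 * real (n - i) + 1) \<le> real n"
      using i by (intro weight_le) auto
    moreover have "2 / a \<le> real n * (2 / a)" using n a by (simp add: field_simps)
    moreover have "0 \<le> 2 * real i / (2 * real (n - i) + 1)" "0 < 2 / a" using a by auto
    ultimately have "\<bar>2 * real i / (2 * real (n - i) + 1) - 2 / a\<bar> \<le> real n * (1 + 2 / a)"
      unfolding distrib_left abs_le_iff using n by linarith
    then show "\<bar>theta_coeff a i * zeta_coeff a (n - i) * (2 * real i / (2 * real (n - i) + 1) - 2 / a)\<bar>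
        \<le> \<bar>theta_coeff a i\<bar> * \<bar>zeta_coeff a (n - i)\<bar> * (real n * (1 + 2 / a))"
      unfolding abs_mult by (intro mult_left_mono) auto
  qed
  also have "\<dots> = real n * ((1 + 2 / a) * (\<Sum>i\<in>{1..<n}. \<bar>theta_coeff a i\<bar> * \<bar>zeta_coeff a (n - i)\<bar>))"
    by (simp add: sum_distrib_left mult_ac)
  finally have S: "\<bar>?S\<bar> \<le> real n * ((1 + 2 / a) * (\<Sum>i\<in>{1..<n}. \<bar>theta_coeff a i\<bar> * \<bar>zeta_coeff a (n - i)\<bar>))" .
  have "\<bar>theta_coeff a n\<bar> = \<bar>?S\<bar> / (2 * (real n - 1) * (2 / a - 1))"
    using n den by (subst theta_coeff.simps) (simp add: abs_divide)
  also have "\<dots> \<le> \<bar>?S\<bar> / real n"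
    using den n by (intro divide_left_mono) auto
  also have "\<dots> \<le> (1 + 2 / a) * (\<Sum>i\<in>{1..<n}. \<bar>theta_coeff a i\<bar> * \<bar>zeta_coeff a (n - i)\<bar>)"
    using S n by (simp add: divide_le_eq mult.commute)
  finally show ?thesis .
qed

lemma abs_zeta_coeff_le:
  assumes n: "1 \<le> n"
  shows "\<bar>zeta_coeff a n\<bar> \<le> 2 * \<bar>theta_coeff a n\<bar> + 2 * (\<Sum>i\<in>{1..<n}. \<bar>zeta_coeff a i\<bar> * \<bar>zeta_coeff a (n - i)\<bar>)"
proof -
  let ?S = "\<Sum>i\<in>{1..<n}. zeta_coeff a i * zeta_coeff a (n - i) * (2 * real i / (2 * real (n - i) + 1) - 1 / 2)"
  have den: "real n \<le> 2 * real n * (2 / a - 1) - 1"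
  proof -
    have "2 * real n * 1 \<le> 2 * real n * (2 / a - 1)"
      using p0_gt_1 n by (intro mult_left_mono) auto
    moreover have "1 \<le> real n" using n by simp
    ultimately show ?thesis using n by linarith
  qed
  have "\<bar>?S\<bar> \<le> (\<Sum>i\<in>{1..<n}. \<bar>zeta_coeff a i\<bar> * \<bar>zeta_coeff a (n - i)\<bar> * (real n * 2))"
  proof (rule order_trans[OF sum_abs sum_mono])
    fix i assume i: "i \<in> {1..<n}"
    have "2 * real i / (2 * real (n - i) + 1) \<le> real n"
      using i by (intro weight_le) auto
    moreover have "0 \<le> 2 * real i / (2 * real (n - i) + 1)" by auto
    ultimately have "\<bar>2 * real i / (2 * real (n - i) + 1) - 1 / 2\<bar> \<le> real n * 2"
      unfolding abs_le_iff using n by linarith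
    then show "\<bar>zeta_coeff a i * zeta_coeff a (n - i) * (2 * real i / (2 * real (n - i) + 1) - 1 / 2)\<bar>
        \<le> \<bar>zeta_coeff a i\<bar> * \<bar>zeta_coeff a (n - i)\<bar> * (real n * 2)"
      unfolding abs_mult by (intro mult_left_mono) auto
  qed
  also have "\<dots> = real n * (2 * (\<Sum>i\<in>{1..<n}. \<bar>zeta_coeff a i\<bar> * \<bar>zeta_coeff a (n - i)\<bar>))"
    by (simp add: sum_distrib_left mult_ac)
  finally have S: "\<bar>?S\<bar> \<le> real n * (2 * (\<Sum>i\<in>{1..<n}. \<bar>zeta_coeff a i\<bar> * \<bar>zeta_coeff a (n - i)\<bar>))" .
  have "2 * a * \<bar>theta_coeff a n\<bar> \<le> 2 * 1 * \<bar>theta_coeff a n\<bar>"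
    using a by (intro mult_right_mono) auto
  also have "\<dots> \<le> real n * (2 * \<bar>theta_coeff a n\<bar>)"
    using n mult_right_mono[of 1 "real n" "2 * \<bar>theta_coeff a n\<bar>"] by simp
  finally have T: "\<bar>2 * a * theta_coeff a n\<bar> \<le> real n * (2 * \<bar>theta_coeff a n\<bar>)"
    using a by (simp add: abs_mult)
  have "\<bar>zeta_coeff a n\<bar> = \<bar>2 * a * theta_coeff a n + ?S\<bar> / (2 * real n * (2 / a - 1) - 1)"
    using n den by (subst zeta_coeff.simps) (simp add: abs_divide)
  also have "\<dots> \<le> \<bar>2 * a * theta_coeff a n + ?S\<bar> / real n"
    using den n by (intro divide_left_mono) auto
  also have "\<dots> \<le> (real n * (2 * \<bar>theta_coeff a n\<bar>) +
      real n * (2 * (\<Sum>i\<in>{1..<n}. \<bar>zeta_coeff a i\<bar> * \<bar>zeta_coeff a (n - i)\<bar>))) / real n"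
    using S T n by (intro divide_right_mono order_trans[OF abs_triangle_ineq] add_mono) auto
  finally show ?thesis using n by (simp add: distrib_left[symmetric] del: distrib_left_numeral)
qed

text \<open>
  Geometric convergence. Both partial sums are bounded simultaneously by induction: the quadratic terms of the
  recursion are products of the partial sums up to \<open>N\<close>, hence of size \<open>r\<^sup>2\<close>, and for small \<open>r\<close> they fit into
  the room between the linear contribution \<open>\<theta>\<^sub>1 r = r\<close> and the asserted bounds.
\<close>

lemma coeff_sums_bounded:
  assumes r: "0 < r" "r \<le> 1 / 32" "16 * (1 + 2 / a) * r \<le> 1"
  shows "(\<Sum>n\<in>{1..N}. \<bar>theta_coeff a n\<bar> * r ^ n) \<le> 2 * r \<and> (\<Sum>n\<in>{1..N}. \<bar>zeta_coeff a n\<bar> * r ^ n) \<le> 8 * r"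
proof (induction N)
  case 0
  then show ?case using r by simp
next
  case (Suc N)
  define A where "A N = (\<Sum>n\<in>{1..N}. \<bar>zeta_coeff a n\<bar> * r ^ n)" for N
  define B where "B N = (\<Sum>n\<in>{1..N}. \<bar>theta_coeff a n\<bar> * r ^ n)" for N
  have AB: "0 \<le> A N" "0 \<le> B N" for N unfolding A_def B_def using r by (auto intro!: sum_nonneg)
  have IH: "A N \<le> 8 * r" "B N \<le> 2 * r" using Suc unfolding A_def B_def by auto
  have t1: "theta_coeff a 1 = 1" by (subst theta_coeff.simps) simp
  have conv: "(\<Sum>i\<in>{1..<n}. x i * y (n - i)) * r ^ n = (\<Sum>i\<in>{1..<n}. (x i * r ^ i) * (y (n - i) * r ^ (n - i)))"
    for x y :: "nat \<Rightarrow> real" and n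
    by (simp add: sum_distrib_right) (auto intro!: sum.cong simp: power_add[symmetric] mult_ac)
  have split: "{1..Suc N} = insert 1 {2..Suc N}" by auto
  have "B (Suc N) = r + (\<Sum>n\<in>{2..Suc N}. \<bar>theta_coeff a n\<bar> * r ^ n)"
    unfolding B_def split by (subst sum.insert) (auto simp: t1[simplified])
  also have "(\<Sum>n\<in>{2..Suc N}. \<bar>theta_coeff a n\<bar> * r ^ n) \<le>
      (\<Sum>n\<in>{2..Suc N}. (1 + 2 / a) * ((\<Sum>i\<in>{1..<n}. \<bar>theta_coeff a i\<bar> * \<bar>zeta_coeff a (n - i)\<bar>) * r ^ n))"
    unfolding mult.assoc[symmetric] using r by (intro sum_mono mult_right_mono abs_theta_coeff_le) auto
  also have "\<dots> = (1 + 2 / a) * (\<Sum>n\<in>{2..Suc N}. \<Sum>i\<in>{1..<n}. (\<bar>theta_coeff a i\<bar> * r ^ i) * (\<bar>zeta_coeff a (n - i)\<bar> * r ^ (n - i)))"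
    unfolding conv[of "\<lambda>i. \<bar>theta_coeff a i\<bar>" "\<lambda>i. \<bar>zeta_coeff a i\<bar>"] by (simp only: sum_distrib_left)
  also have "\<dots> \<le> (1 + 2 / a) * (B N * A N)"
    unfolding A_def B_def using a r
    by (intro mult_left_mono convolution_le_product[where u = "\<lambda>i. \<bar>theta_coeff a i\<bar> * r ^ i" and w = "\<lambda>i. \<bar>zeta_coeff a i\<bar> * r ^ i"]) auto
  also have "\<dots> \<le> (1 + 2 / a) * ((2 * r) * (8 * r))"
    using IH AB a r by (intro mult_left_mono mult_mono) auto
  also have "\<dots> = 16 * (1 + 2 / a) * r * r" by (simp add: algebra_simps)
  also have "\<dots> \<le> 1 * r" using r by (intro mult_right_mono) auto
  finally have Bs: "B (Suc N) \<le> 2 * r" by simp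
  have "A (Suc N) \<le> (\<Sum>n\<in>{1..Suc N}. (2 * \<bar>theta_coeff a n\<bar> + 2 * (\<Sum>i\<in>{1..<n}. \<bar>zeta_coeff a i\<bar> * \<bar>zeta_coeff a (n - i)\<bar>)) * r ^ n)"
    unfolding A_def using r by (intro sum_mono mult_right_mono abs_zeta_coeff_le) auto
  also have "\<dots> = 2 * B (Suc N) + 2 * (\<Sum>n\<in>{1..Suc N}. (\<Sum>i\<in>{1..<n}. \<bar>zeta_coeff a i\<bar> * \<bar>zeta_coeff a (n - i)\<bar>) * r ^ n)"
  proof -
    have "(\<Sum>n\<in>M. (2 * x n + 2 * S n) * r ^ n) = 2 * (\<Sum>n\<in>M. x n * r ^ n) + 2 * (\<Sum>n\<in>M. S n * r ^ n)"
      for M :: "nat set" and x S :: "nat \<Rightarrow> real"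
      by (simp add: distrib_right sum.distrib sum_distrib_left mult.assoc)
    then show ?thesis unfolding B_def .
  qed
  also have "(\<Sum>n\<in>{1..Suc N}. (\<Sum>i\<in>{1..<n}. \<bar>zeta_coeff a i\<bar> * \<bar>zeta_coeff a (n - i)\<bar>) * r ^ n)
      = (\<Sum>n\<in>{1..Suc N}. \<Sum>i\<in>{1..<n}. (\<bar>zeta_coeff a i\<bar> * r ^ i) * (\<bar>zeta_coeff a (n - i)\<bar> * r ^ (n - i)))"
    by (rule sum.cong[OF refl conv])
  also have "(\<Sum>n\<in>{1..Suc N}. \<Sum>i\<in>{1..<n}. (\<bar>zeta_coeff a i\<bar> * r ^ i) * (\<bar>zeta_coeff a (n - i)\<bar> * r ^ (n - i)))
     = (\<Sum>n\<in>{2..Suc N}. \<Sum>i\<in>{1..<n}. (\<bar>zeta_coeff a i\<bar> * r ^ i) * (\<bar>zeta_coeff a (n - i)\<bar> * r ^ (n - i)))"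
    unfolding split by (subst sum.insert) auto
  also have "\<dots> \<le> A N * A N"
    unfolding A_def using r
    by (intro convolution_le_product[where u = "\<lambda>i. \<bar>zeta_coeff a i\<bar> * r ^ i" and w = "\<lambda>i. \<bar>zeta_coeff a i\<bar> * r ^ i"]) auto
  also have "\<dots> \<le> (8 * r) * (8 * r)" using IH AB r by (intro mult_mono) auto
  also have "\<dots> = 64 * r * r" by simp
  also have "64 * r * r \<le> 2 * r" using r by (intro mult_right_mono) auto
  finally have "A (Suc N) \<le> 8 * r" using Bs by simp
  with Bs show ?case unfolding A_def B_def by simp
qed

definition theta_fps :: "real fps" where "theta_fps = Abs_fps (theta_coeff a)"
definition zeta_fps :: "real fps" where "zeta_fps = Abs_fps (zeta_coeff a)"
definition slope_fps :: "real fps" where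
  "slope_fps = Abs_fps (\<lambda>n. if n = 0 then 2 / a - 1 else - zeta_coeff a n / (2 * real n + 1))"

definition rad :: real where "rad = 1 / (32 * (1 + 2 / a))"

lemma rad: "0 < rad" "rad \<le> 1 / 32" "16 * (1 + 2 / a) * rad \<le> 1"
proof -
  have "1 \<le> 1 + 2 / a" using a by simp
  then show "0 < rad" "rad \<le> 1 / 32" "16 * (1 + 2 / a) * rad \<le> 1"
    unfolding rad_def by (auto simp: divide_simps)
qed

lemma conv_radius_ge_rad:
  assumes c: "\<And>n. \<bar>c n\<bar> \<le> \<bar>d n\<bar>" and N: "\<And>N. (\<Sum>n\<in>{1..N}. \<bar>d n\<bar> * rad ^ n) \<le> B"
  shows "ereal rad \<le> fps_conv_radius (Abs_fps c)"
proof -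
  have "summable (\<lambda>n. \<bar>d n\<bar> * rad ^ n)"
  proof (rule summableI_nonneg_bounded)
    fix n show "(\<Sum>i<n. \<bar>d i\<bar> * rad ^ i) \<le> \<bar>d 0\<bar> + B"
    proof (cases n)
      case 0
      then show ?thesis using N[of 0] by simp
    next
      case (Suc m)
      have "{..<n} = insert 0 {1..m}" unfolding Suc by auto
      then show ?thesis using N[of m] by simp
    qed
  qed (use rad in auto)
  then have "summable (\<lambda>n. c n * rad ^ n)"
    by (rule summable_comparison_test'[where N = 0])
       (use c rad in \<open>auto simp: abs_mult intro!: mult_right_mono\<close>)
  then have "norm rad \<le> conv_radius c"
    by (rule conv_radius_geI)
  then show ?thesis using rad by (simp add: fps_conv_radius_def Abs_fps_inverse fps_nth_Abs_fps)
qed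

lemma conv_radius_coeffs:
  "ereal rad \<le> fps_conv_radius theta_fps"
  "ereal rad \<le> fps_conv_radius zeta_fps"
  "ereal rad \<le> fps_conv_radius slope_fps"
proof -
  note bd = coeff_sums_bounded[OF rad]
  show "ereal rad \<le> fps_conv_radius theta_fps" unfolding theta_fps_def
    by (rule conv_radius_ge_rad[where d = "theta_coeff a" and B = "2 * rad"]) (use bd in auto)
  show "ereal rad \<le> fps_conv_radius zeta_fps" unfolding zeta_fps_def
    by (rule conv_radius_ge_rad[where d = "zeta_coeff a" and B = "8 * rad"]) (use bd in auto)
  show "ereal rad \<le> fps_conv_radius slope_fps" unfolding slope_fps_def
  proof (rule conv_radius_ge_rad[where d = "\<lambda>n. if n = 0 then 2 / a - 1 else zeta_coeff a n" and B = "8 * rad"])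
    fix n show "\<bar>if n = 0 then 2 / a - 1 else - zeta_coeff a n / (2 * real n + 1)\<bar> \<le> \<bar>if n = 0 then 2 / a - 1 else zeta_coeff a n\<bar>"
      by (auto simp: abs_divide divide_le_eq mult_le_cancel_left1)
  next
    fix N
    have "(\<Sum>n\<in>{1..N}. \<bar>if n = 0 then 2 / a - 1 else zeta_coeff a n\<bar> * rad ^ n) = (\<Sum>n\<in>{1..N}. \<bar>zeta_coeff a n\<bar> * rad ^ n)"
      by (intro sum.cong) auto
    then show "(\<Sum>n\<in>{1..N}. \<bar>if n = 0 then 2 / a - 1 else zeta_coeff a n\<bar> * rad ^ n) \<le> 8 * rad"
      using bd[of N] by simp
  qed
qed

lemma fps_X_deriv_nth: "fps_nth (fps_X * fps_deriv f) n = real n * fps_nth f n" for f :: "real fps"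
  by (cases n) auto

text \<open>
  The equation \<open>V' = c\<^sub>l + y\<close> in terms of the slope \<open>V / X\<close> as a series in \<open>s = X\<^sup>2\<close>, with
  \<open>X d/dX = 2 s d/ds\<close>.
\<close>

lemma slope_fps_identity:
  "fps_const 2 * (fps_X * fps_deriv slope_fps) + slope_fps = fps_const (2 / a - 1) - zeta_fps"
proof (rule fps_ext)
  fix n
  let ?w = "fps_nth slope_fps n"
  have "fps_nth (fps_const 2 * (fps_X * fps_deriv slope_fps) + slope_fps) n = (2 * real n + 1) * ?w"
    by (simp add: fps_X_deriv_nth distrib_right del: fps_X_mult_nth)
  also have "\<dots> = fps_nth (fps_const (2 / a - 1) - zeta_fps) n"
    by (cases "n = 0") (auto simp: slope_fps_def zeta_fps_def zeta_coeff.simps[of a 0] add_nonneg_eq_0_iff)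
  finally show "fps_nth (fps_const 2 * (fps_X * fps_deriv slope_fps) + slope_fps) n
    = fps_nth (fps_const (2 / a - 1) - zeta_fps) n" .
qed

lemma product_slope_nth:
  fixes c :: "nat \<Rightarrow> real"
  assumes c0: "c 0 = 0" and n: "1 \<le> n"
  shows "fps_nth (slope_fps * (fps_const 2 * (fps_X * fps_deriv (Abs_fps c)))) n
     = 2 * real n * (2 / a - 1) * c n - (\<Sum>i\<in>{1..<n}. c i * zeta_coeff a (n - i) * (2 * real i / (2 * real (n - i) + 1)))"
proof -
  have split: "{0..n} = insert n (insert 0 {1..<n})" using n by auto
  have "fps_nth (slope_fps * (fps_const 2 * (fps_X * fps_deriv (Abs_fps c)))) n
      = (\<Sum>i=0..n. (2 * (real i * c i)) * fps_nth slope_fps (n - i))"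
    by (subst mult.commute, subst fps_mult_nth) (simp add: fps_X_deriv_nth del: fps_X_mult_nth)
  also have "\<dots> = 2 * (real n * c n) * (2 / a - 1) + (\<Sum>i\<in>{1..<n}. (2 * (real i * c i)) * fps_nth slope_fps (n - i))"
    unfolding split using n by (simp add: slope_fps_def)
  also have "(\<Sum>i\<in>{1..<n}. (2 * (real i * c i)) * fps_nth slope_fps (n - i))
      = (\<Sum>i\<in>{1..<n}. - (c i * zeta_coeff a (n - i) * (2 * real i / (2 * real (n - i) + 1))))"
    by (intro sum.cong) (auto simp: slope_fps_def)
  finally show ?thesis by (simp add: sum_negf algebra_simps)
qed

lemma product_zeta_nth:
  fixes c :: "nat \<Rightarrow> real"
  assumes c0: "c 0 = 0" and n: "1 \<le> n"
  shows "fps_nth (Abs_fps c * zeta_fps) n = (\<Sum>i\<in>{1..<n}. c i * zeta_coeff a (n - i))"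
proof -
  have split: "{0..n} = insert n (insert 0 {1..<n})" using n by auto
  show ?thesis
    unfolding fps_mult_nth split using n c0 by (simp add: zeta_fps_def zeta_coeff.simps[of a 0])
qed

text \<open>
  The equation for \<open>y\<close> as an identity between formal power series in \<open>s = X\<^sup>2\<close>.
\<close>

lemma zeta_fps_identity:
  "slope_fps * (fps_const 2 * (fps_X * fps_deriv zeta_fps))
     = zeta_fps - fps_const (1 / 2) * (zeta_fps * zeta_fps) + fps_const (2 * a) * theta_fps"
proof (rule fps_ext)
  fix n
  have z0: "zeta_coeff a 0 = 0" "theta_coeff a 0 = 0" by (simp_all add: zeta_coeff.simps theta_coeff.simps)
  show "fps_nth (slope_fps * (fps_const 2 * (fps_X * fps_deriv zeta_fps))) n
     = fps_nth (zeta_fps - fps_const (1 / 2) * (zeta_fps * zeta_fps) + fps_const (2 * a) * theta_fps) n"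
  proof (cases "n = 0")
    case True
    then show ?thesis by (simp add: fps_mult_nth zeta_fps_def theta_fps_def z0)
  next
    case False
    then have n: "1 \<le> n" by simp
    have "1 < 2 * real n * (2 / a - 1)"
    proof -
      have "2 * real n * 1 \<le> 2 * real n * (2 / a - 1)" using p0_gt_1 n by (intro mult_left_mono) auto
      moreover have "1 \<le> real n" using n by simp
      ultimately show ?thesis by linarith
    qed
    then have "(2 * real n * (2 / a - 1) - 1) * zeta_coeff a n = 2 * a * theta_coeff a n
       + (\<Sum>i\<in>{1..<n}. zeta_coeff a i * zeta_coeff a (n - i) * (2 * real i / (2 * real (n - i) + 1) - 1 / 2))"
      using n by (subst zeta_coeff.simps) simp
    also have "(\<Sum>i\<in>{1..<n}. zeta_coeff a i * zeta_coeff a (n - i) * (2 * real i / (2 * real (n - i) + 1) - 1 / 2))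
      = (\<Sum>i\<in>{1..<n}. zeta_coeff a i * zeta_coeff a (n - i) * (2 * real i / (2 * real (n - i) + 1)))
        - 1 / 2 * (\<Sum>i\<in>{1..<n}. zeta_coeff a i * zeta_coeff a (n - i))"
      by (simp add: right_diff_distrib sum_subtractf sum_distrib_left)
    finally show ?thesis
      using product_slope_nth[of "zeta_coeff a", OF z0(1) n] product_zeta_nth[of "zeta_coeff a", OF z0(1) n]
      by (simp add: zeta_fps_def[symmetric]) (simp add: zeta_fps_def theta_fps_def left_diff_distrib)
  qed
qed

text \<open>
  The equation for \<open>h\<close> as an identity between formal power series in \<open>s = X\<^sup>2\<close>.
\<close>

lemma theta_fps_identity:
  "slope_fps * (fps_const 2 * (fps_X * fps_deriv theta_fps))
     = fps_const (2 * (2 / a - 1)) * theta_fps - fps_const (2 / a) * (theta_fps * zeta_fps)"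
proof (rule fps_ext)
  fix n
  have t0: "theta_coeff a 0 = 0" by (simp add: theta_coeff.simps)
  show "fps_nth (slope_fps * (fps_const 2 * (fps_X * fps_deriv theta_fps))) n
     = fps_nth (fps_const (2 * (2 / a - 1)) * theta_fps - fps_const (2 / a) * (theta_fps * zeta_fps)) n"
  proof (cases "n = 0")
    case True
    then show ?thesis by (simp add: fps_mult_nth zeta_fps_def theta_fps_def t0)
  next
    case False
    then have n: "1 \<le> n" by simp
    have "2 * (real n - 1) * (2 / a - 1) * theta_coeff a n =
       (\<Sum>i\<in>{1..<n}. theta_coeff a i * zeta_coeff a (n - i) * (2 * real i / (2 * real (n - i) + 1) - 2 / a))"
    proof (cases "n = 1")
      case False
      then have "0 < 2 * (real n - 1) * (2 / a - 1)" using n p0_gt_1 by (intro mult_pos_pos) auto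
      then have D: "2 * (real n - 1) * (2 / a - 1) \<noteq> 0" by (rule less_imp_neq[THEN not_sym])
      have eq: "theta_coeff a n = (\<Sum>i\<in>{1..<n}. theta_coeff a i * zeta_coeff a (n - i) * (2 * real i / (2 * real (n - i) + 1) - 2 / a))
         / (2 * (real n - 1) * (2 / a - 1))"
        using n False by (subst theta_coeff.simps) auto
      show ?thesis
        by (simp only: eq times_divide_eq_right nonzero_mult_div_cancel_left[OF D])
    qed simp
    also have "\<dots> = (\<Sum>i\<in>{1..<n}. theta_coeff a i * zeta_coeff a (n - i) * (2 * real i / (2 * real (n - i) + 1)))
        - 2 / a * (\<Sum>i\<in>{1..<n}. theta_coeff a i * zeta_coeff a (n - i))"
      by (simp add: right_diff_distrib sum_subtractf sum_distrib_left mult_ac)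
    finally have "2 * (real n - 1) * (2 / a - 1) * theta_coeff a n =
      (\<Sum>i\<in>{1..<n}. theta_coeff a i * zeta_coeff a (n - i) * (2 * real i / (2 * real (n - i) + 1)))
        - 2 / a * (\<Sum>i\<in>{1..<n}. theta_coeff a i * zeta_coeff a (n - i))" .
    moreover have "2 * (real n - 1) * (2 / a - 1) * theta_coeff a n
      = 2 * real n * (2 / a - 1) * theta_coeff a n - 2 * (2 / a - 1) * theta_coeff a n"
      by (simp add: algebra_simps)
    moreover have "fps_nth (fps_const (2 * (2 / a - 1)) * theta_fps - fps_const (2 / a) * (theta_fps * zeta_fps)) n
      = 2 * (2 / a - 1) * theta_coeff a n - 2 / a * (\<Sum>i\<in>{1..<n}. theta_coeff a i * zeta_coeff a (n - i))"
      using product_zeta_nth[of "theta_coeff a", OF t0 n]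
      by (simp only: theta_fps_def[symmetric] fps_sub_nth fps_mult_left_const_nth) (simp add: theta_fps_def)
    ultimately show ?thesis
      using product_slope_nth[of "theta_coeff a", OF t0 n] unfolding theta_fps_def[symmetric] by linarith
  qed
qed

lemma coeffs_small:
  "fps_nth theta_fps 0 = 0" "fps_nth zeta_fps 0 = 0" "fps_nth slope_fps 0 = 2 / a - 1"
  "fps_nth theta_fps 1 = 1" "fps_nth zeta_fps 1 > 0"
proof -
  show "fps_nth theta_fps 0 = 0" "fps_nth zeta_fps 0 = 0" "fps_nth slope_fps 0 = 2 / a - 1"
    and t: "fps_nth theta_fps 1 = 1"
    by (simp_all add: theta_fps_def zeta_fps_def slope_fps_def theta_coeff.simps zeta_coeff.simps)
  have "zeta_coeff a 1 = 2 * a * 1 / (2 * (2 / a - 1) - 1)"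
    using t by (subst zeta_coeff.simps) (simp add: theta_fps_def)
  moreover have "0 < 2 * (2 / a - 1) - 1" using mult_strict_left_mono[OF p0_gt_1, of 2] by linarith
  ultimately show "fps_nth zeta_fps 1 > 0" using a by (simp add: zeta_fps_def)
qed

end

section \<open>The analytic solution near the origin\<close>

lemma eval_fps_square_derivative:
  fixes F :: "real fps"
  assumes "norm (x\<^sup>2) < fps_conv_radius F"
  shows "((\<lambda>x. eval_fps F (x\<^sup>2)) has_real_derivative 2 * x * eval_fps (fps_deriv F) (x\<^sup>2)) (at x)"
proof -
  have "((\<lambda>x. x\<^sup>2) has_real_derivative 2 * x) (at x)" by (auto intro!: derivative_eq_intros)
  from DERIV_chain2[OF has_field_derivative_eval_fps[OF assms] this] show ?thesis
    by (simp add: mult_ac)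
qed

lemma square_less:
  fixes x :: real
  assumes "0 < R" "R \<le> 1" "\<bar>x\<bar> < R"
  shows "x\<^sup>2 < R"
proof -
  have "\<bar>x\<bar> * \<bar>x\<bar> \<le> \<bar>x\<bar> * 1" using assms by (intro mult_left_mono) auto
  then show ?thesis using assms by (simp add: power2_eq_square)
qed

text \<open>
  Functions \<open>F(x\<^sup>2) + x G(x\<^sup>2)\<close> with convergent series \<open>F\<close> and \<open>G\<close> are closed under differentiation.
\<close>

lemma smooth_on_eval_fps_square:
  fixes F G :: "real fps"
  assumes R: "0 < R" "R \<le> 1" and F: "ereal R \<le> fps_conv_radius F" and G: "ereal R \<le> fps_conv_radius G"
  shows "smooth_on (\<lambda>x. eval_fps F (x\<^sup>2) + x * eval_fps G (x\<^sup>2)) {-R<..<R}"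
proof (rule smooth_on_closed_class[of _ _ "{\<lambda>x. eval_fps F (x\<^sup>2) + x * eval_fps G (x\<^sup>2) | F G.
    ereal R \<le> fps_conv_radius F \<and> ereal R \<le> fps_conv_radius G}"])
  fix h assume "h \<in> {\<lambda>x. eval_fps F (x\<^sup>2) + x * eval_fps G (x\<^sup>2) | F G.
    ereal R \<le> fps_conv_radius F \<and> ereal R \<le> fps_conv_radius (G :: real fps)}"
  then obtain F G :: "real fps" where h: "h = (\<lambda>x. eval_fps F (x\<^sup>2) + x * eval_fps G (x\<^sup>2))"
    and FG: "ereal R \<le> fps_conv_radius F" "ereal R \<le> fps_conv_radius G" by blast
  let ?F' = "G + fps_const 2 * (fps_X * fps_deriv G)" and ?G' = "fps_const 2 * fps_deriv F"
  have d: "ereal R \<le> fps_conv_radius (fps_deriv F)" "ereal R \<le> fps_conv_radius (fps_deriv G)"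
    using FG fps_conv_radius_deriv order_trans by blast+
  have X: "ereal R \<le> fps_conv_radius (fps_X * fps_deriv G)"
    by (rule order_trans[OF _ fps_conv_radius_mult]) (use d in simp)
  have c2: "ereal R \<le> fps_conv_radius (fps_const 2 * (fps_X * fps_deriv G))" "ereal R \<le> fps_conv_radius ?G'"
    using X d by (simp_all add: fps_conv_radius_cmult_left)
  have c1: "ereal R \<le> fps_conv_radius ?F'"
    by (rule order_trans[OF _ fps_conv_radius_add]) (use FG c2 in simp)
  show "\<exists>h'\<in>{\<lambda>x. eval_fps F (x\<^sup>2) + x * eval_fps G (x\<^sup>2) | F G.
    ereal R \<le> fps_conv_radius F \<and> ereal R \<le> fps_conv_radius G}. \<forall>x\<in>{-R<..<R}. (h has_real_derivative h' x) (at x)"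
  proof (intro bexI ballI)
    fix x assume x: "x \<in> {-R<..<R}"
    have "x\<^sup>2 < R" using square_less[OF R, of x] x by auto
    then have lt: "norm (x\<^sup>2) < fps_conv_radius H" if "ereal R \<le> fps_conv_radius H" for H :: "real fps"
      using that by (intro less_le_trans[OF _ that]) simp
    have "(h has_real_derivative 2 * x * eval_fps (fps_deriv F) (x\<^sup>2)
        + (1 * eval_fps G (x\<^sup>2) + (2 * x * eval_fps (fps_deriv G) (x\<^sup>2)) * x)) (at x)"
      unfolding h by (intro DERIV_add DERIV_mult DERIV_ident eval_fps_square_derivative lt FG)
    also have "2 * x * eval_fps (fps_deriv F) (x\<^sup>2) + (1 * eval_fps G (x\<^sup>2) + (2 * x * eval_fps (fps_deriv G) (x\<^sup>2)) * x)
       = eval_fps ?F' (x\<^sup>2) + x * eval_fps ?G' (x\<^sup>2)"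
      using lt[OF d(1)] lt[OF d(2)] lt[OF X]
      by (simp add: eval_fps_add[OF lt[OF FG(2)] lt[OF c2(1)]] eval_fps_mult) (simp add: power2_eq_square)
    finally show "(h has_real_derivative eval_fps ?F' (x\<^sup>2) + x * eval_fps ?G' (x\<^sup>2)) (at x)" .
  qed (use c1 c2 in blast)
qed (use F G in auto)

text \<open>
  The orbit that leaves \<open>(y, h) = (2, 0)\<close> along the strong unstable direction: only this one gives functions that
  are smooth in \<open>X\<close>, since the general orbit contains a term proportional to \<open>X\<close> to the power \<open>a / (2 - a)\<close>. The signs near the origin come from
  the leading terms of the series; the last two conclusions are the second derivatives of the series at \<open>0\<close>.
\<close>

theorem local_solution:
  fixes a :: real
  assumes a: "0 < a" "a < 1"
  obtains r V y h where "0 < r" "r \<le> (1::real)"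
    and "reduced_system a {-r<..<r} V y h"
    and "smooth_on V {-r<..<r}" "smooth_on y {-r<..<r}" "smooth_on h {-r<..<r}"
    and "\<And>x. V (- x) = - V x" "\<And>x. y (- x) = y x" "\<And>x. h (- x) = h x"
    and "V 0 = 0" "y 0 = 2" "h 0 = 0"
    and "\<And>x. 0 < x \<Longrightarrow> x < r \<Longrightarrow> 0 < V x \<and> 0 < y x \<and> y x < 2 \<and> 0 < h x"
    and "(deriv h has_real_derivative 2) (at 0)"
    and "\<exists>c>0. (deriv y has_real_derivative - c) (at 0)"
proof -
  define R where "R = rad a"
  have R: "0 < R" "R \<le> 1 / 32" using rad[OF a] by (auto simp: R_def)
  define T Z W where "T = theta_fps a" and "Z = zeta_fps a" and "W = slope_fps a"
  have cr: "ereal R \<le> fps_conv_radius T" "ereal R \<le> fps_conv_radius Z" "ereal R \<le> fps_conv_radius W"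
    using conv_radius_coeffs[OF a] by (auto simp: R_def T_def Z_def W_def)
  have dcr: "ereal R \<le> fps_conv_radius (fps_deriv F)" if "ereal R \<le> fps_conv_radius F" for F :: "real fps"
    using that fps_conv_radius_deriv order_trans by blast
  have Xcr: "ereal R \<le> fps_conv_radius (fps_X * F)" if "ereal R \<le> fps_conv_radius F" for F :: "real fps"
    by (rule order_trans[OF _ fps_conv_radius_mult]) (use that in simp)
  have Ccr: "ereal R \<le> fps_conv_radius (fps_const c * F)" if "ereal R \<le> fps_conv_radius F" for F :: "real fps" and c
    by (rule order_trans[OF _ fps_conv_radius_mult]) (use that in simp)
  have Mcr: "ereal R \<le> fps_conv_radius (F * G)" if "ereal R \<le> fps_conv_radius F" "ereal R \<le> fps_conv_radius G" for F G :: "real fps"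
    by (rule order_trans[OF _ fps_conv_radius_mult]) (use that in simp)
  have lt: "norm s < fps_conv_radius F" if "\<bar>s\<bar> < R" "ereal R \<le> fps_conv_radius F" for F :: "real fps" and s
    by (rule less_le_trans[OF _ that(2)]) (use that in simp)
  have lt': "ereal \<bar>s\<bar> < fps_conv_radius F" if "\<bar>s\<bar> < R" "ereal R \<le> fps_conv_radius F" for F :: "real fps" and s
    using lt[OF that] by simp
  have Dcr: "ereal R \<le> fps_conv_radius (F - G)" if "ereal R \<le> fps_conv_radius F" "ereal R \<le> fps_conv_radius G" for F G :: "real fps"
    by (rule order_trans[OF _ fps_conv_radius_diff]) (use that in simp)
  have cst: "ereal R \<le> fps_conv_radius (fps_const c :: real fps)" for c by simp
  have sq: "x\<^sup>2 < R" if "\<bar>x\<bar> < R" for x :: real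
    using square_less[OF R(1), of x] R that by simp
  define V where "V x = x * eval_fps W (x\<^sup>2)" for x
  define y where "y x = 2 - eval_fps Z (x\<^sup>2)" for x
  define h where "h x = eval_fps T (x\<^sup>2)" for x
  have W_eq: "2 * s * eval_fps (fps_deriv W) s + eval_fps W s = 2 / a - 1 - eval_fps Z s" if "\<bar>s\<bar> < R" for s
  proof -
    have "eval_fps (fps_const 2 * (fps_X * fps_deriv W) + W) s = 2 * s * eval_fps (fps_deriv W) s + eval_fps W s"
      by (subst eval_fps_add) (use cr that in \<open>simp_all add: eval_fps_mult lt' dcr Xcr Ccr\<close>)
    moreover have "eval_fps (fps_const (2 / a - 1) - Z) s = 2 / a - 1 - eval_fps Z s"
      by (subst eval_fps_diff[OF lt[OF that cst] lt[OF that cr(2)]]) (simp only: eval_fps_const)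
    ultimately show ?thesis
      using arg_cong[OF slope_fps_identity[OF a], of "\<lambda>F. eval_fps F s"]
      unfolding Z_def[symmetric] W_def[symmetric] by simp
  qed
  have Z_eq: "eval_fps W s * (2 * s * eval_fps (fps_deriv Z) s)
      = eval_fps Z s - (eval_fps Z s)\<^sup>2 / 2 + 2 * a * eval_fps T s" if "\<bar>s\<bar> < R" for s
    using arg_cong[OF zeta_fps_identity[OF a], of "\<lambda>F. eval_fps F s"] cr that
    unfolding T_def[symmetric] Z_def[symmetric] W_def[symmetric]
    by (simp add: eval_fps_add eval_fps_diff eval_fps_mult lt' dcr Xcr Ccr Mcr Dcr mult.assoc power2_eq_square)
  have T_eq: "eval_fps W s * (2 * s * eval_fps (fps_deriv T) s)
      = 2 * (2 / a - 1) * eval_fps T s - 2 / a * (eval_fps T s * eval_fps Z s)" if "\<bar>s\<bar> < R" for s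
    using arg_cong[OF theta_fps_identity[OF a], of "\<lambda>F. eval_fps F s"] cr that
    unfolding T_def[symmetric] Z_def[symmetric] W_def[symmetric]
    by (simp add: eval_fps_add eval_fps_diff eval_fps_mult lt' dcr Xcr Ccr Mcr Dcr mult.assoc)
  have dV: "(V has_real_derivative coeff_l a + y x) (at x)" if "\<bar>x\<bar> < R" for x
  proof -
    have s: "\<bar>x\<^sup>2\<bar> < R" using sq[OF that] by simp
    have "(V has_real_derivative 1 * eval_fps W (x\<^sup>2) + 2 * x * eval_fps (fps_deriv W) (x\<^sup>2) * x) (at x)"
      unfolding V_def[abs_def] by (intro DERIV_mult DERIV_ident eval_fps_square_derivative lt s cr)
    also have "1 * eval_fps W (x\<^sup>2) + 2 * x * eval_fps (fps_deriv W) (x\<^sup>2) * x = coeff_l a + y x"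
      using W_eq[OF s] by (simp add: y_def coeff_l_def power2_eq_square algebra_simps)
    finally show ?thesis .
  qed
  have dy: "(y has_real_derivative - (2 * x * eval_fps (fps_deriv Z) (x\<^sup>2))) (at x)" if "\<bar>x\<bar> < R" for x
    unfolding y_def[abs_def] using DERIV_diff[OF DERIV_const eval_fps_square_derivative[OF lt[OF _ cr(2)], of x], of 2]
      sq[OF that] by simp
  have dh: "(h has_real_derivative 2 * x * eval_fps (fps_deriv T) (x\<^sup>2)) (at x)" if "\<bar>x\<bar> < R" for x
    unfolding h_def[abs_def] using eval_fps_square_derivative[OF lt[OF _ cr(1)], of x] sq[OF that] by simp
  have V0: "V 0 = 0" "y 0 = 2" "h 0 = 0"
    using coeffs_small[OF a] by (simp_all add: V_def y_def h_def eval_fps_at_0 T_def Z_def)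
  have red: "reduced_system a {-R<..<R} V y h"
    unfolding reduced_system_def
  proof (intro ballI conjI exI)
    fix x assume "x \<in> {-R<..<R}"
    then have x: "\<bar>x\<bar> < R" by auto
    then have s: "\<bar>x\<^sup>2\<bar> < R" using sq by simp
    show "(V has_real_derivative coeff_l a + y x) (at x)" by (rule dV[OF x])
    show "(y has_real_derivative - (2 * x * eval_fps (fps_deriv Z) (x\<^sup>2))) (at x)" by (rule dy[OF x])
    show "(h has_real_derivative 2 * x * eval_fps (fps_deriv T) (x\<^sup>2)) (at x)" by (rule dh[OF x])
    have "V x * - (2 * x * eval_fps (fps_deriv Z) (x\<^sup>2)) = - (eval_fps W (x\<^sup>2) * (2 * x\<^sup>2 * eval_fps (fps_deriv Z) (x\<^sup>2)))"
      by (simp add: V_def power2_eq_square)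
    also have "\<dots> = y x * (y x - 2) / 2 - 2 * a * h x"
      unfolding Z_eq[OF s] by (simp add: y_def h_def power2_eq_square field_simps)
    finally show "V x * - (2 * x * eval_fps (fps_deriv Z) (x\<^sup>2)) = y x * (y x - 2) / 2 - 2 * a * h x" .
    have "V x * (2 * x * eval_fps (fps_deriv T) (x\<^sup>2)) = eval_fps W (x\<^sup>2) * (2 * x\<^sup>2 * eval_fps (fps_deriv T) (x\<^sup>2))"
      by (simp add: V_def power2_eq_square)
    also have "\<dots> = 2 / a * (y x - a) * h x"
      unfolding T_eq[OF s] using a by (simp add: y_def h_def field_simps)
    finally show "V x * (2 * x * eval_fps (fps_deriv T) (x\<^sup>2)) = 2 / a * (y x - a) * h x" .
  qed
  have sm: "smooth_on V {-R<..<R}" "smooth_on y {-R<..<R}" "smooth_on h {-R<..<R}"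
  proof -
    have z: "ereal R \<le> fps_conv_radius (0 :: real fps)" by simp
    show "smooth_on V {-R<..<R}"
      by (rule smooth_on_cong[OF _ _ smooth_on_eval_fps_square[OF R(1) _ z cr(3)]]) (use R in \<open>auto simp: V_def\<close>)
    show "smooth_on h {-R<..<R}"
      by (rule smooth_on_cong[OF _ _ smooth_on_eval_fps_square[OF R(1) _ cr(1) z]]) (use R in \<open>auto simp: h_def\<close>)
    have c: "ereal R \<le> fps_conv_radius (fps_const 2 - Z)" by (intro Dcr cst cr)
    show "smooth_on y {-R<..<R}"
    proof (rule smooth_on_cong[OF _ _ smooth_on_eval_fps_square[OF R(1) _ c z]])
      fix x assume "x \<in> {-R<..<R}"
      then have "\<bar>x\<^sup>2\<bar> < R" using sq[of x] by auto
      from lt[OF this cr(2)] lt[OF this cst[of 2]]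
      show "y x = eval_fps (fps_const 2 - Z) (x\<^sup>2) + x * eval_fps 0 (x\<^sup>2)"
        unfolding y_def by (subst eval_fps_diff) auto
    qed (use R in auto)
  qed
  have z0: "\<bar>0::real\<bar> < R" using R by simp
  have second: "((\<lambda>x. 2 * x * eval_fps (fps_deriv F) (x\<^sup>2)) has_real_derivative 2 * fps_nth F 1) (at 0)"
    if F: "ereal R \<le> fps_conv_radius F" for F :: "real fps"
  proof -
    have n: "norm ((0::real)\<^sup>2) < fps_conv_radius (fps_deriv F)"
      using lt[OF z0 dcr[OF F]] by simp
    have "((\<lambda>x. 2 * x * eval_fps (fps_deriv F) (x\<^sup>2)) has_real_derivative
        2 * eval_fps (fps_deriv F) (0\<^sup>2) + (2 * 0 * eval_fps (fps_deriv (fps_deriv F)) (0\<^sup>2)) * (2 * 0)) (at 0)"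
      by (rule DERIV_mult[OF _ eval_fps_square_derivative[OF n]]) (auto intro!: derivative_eq_intros)
    then show ?thesis by (simp add: eval_fps_at_0)
  qed
  have at0: "0 \<in> {-R<..<R}" using R by auto
  have d2h: "(deriv h has_real_derivative 2) (at 0)"
  proof (rule has_field_derivative_transform_within_open[OF _ open_greaterThanLessThan at0])
    show "((\<lambda>x. 2 * x * eval_fps (fps_deriv T) (x\<^sup>2)) has_real_derivative 2) (at 0)"
      using second[OF cr(1)] coeffs_small(4)[OF a] by (simp add: T_def)
    fix x assume "x \<in> {-R<..<R}"
    then have "\<bar>x\<bar> < R" by auto
    from DERIV_imp_deriv[OF dh[OF this]] show "2 * x * eval_fps (fps_deriv T) (x\<^sup>2) = deriv h x" by simp
  qed
  have d2y: "(deriv y has_real_derivative - (2 * fps_nth Z 1)) (at 0)"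
  proof (rule has_field_derivative_transform_within_open[OF _ open_greaterThanLessThan at0])
    show "((\<lambda>x. - (2 * x * eval_fps (fps_deriv Z) (x\<^sup>2))) has_real_derivative - (2 * fps_nth Z 1)) (at 0)"
      by (rule DERIV_minus[OF second[OF cr(2)]])
    fix x assume "x \<in> {-R<..<R}"
    then have "\<bar>x\<bar> < R" by auto
    from DERIV_imp_deriv[OF dy[OF this]] show "- (2 * x * eval_fps (fps_deriv Z) (x\<^sup>2)) = deriv y x" by simp
  qed
  have pos: "\<exists>d>0. \<forall>s. 0 < s \<and> s < d \<longrightarrow> eval_fps F 0 < eval_fps F s"
    if F: "ereal R \<le> fps_conv_radius F" "0 < fps_nth F 1" for F :: "real fps"
  proof -
    have "(eval_fps F has_real_derivative eval_fps (fps_deriv F) 0) (at 0)"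
      by (rule has_field_derivative_eval_fps) (use lt[OF z0 F(1)] in simp)
    moreover have "0 < eval_fps (fps_deriv F) 0" using F by (simp add: eval_fps_at_0)
    ultimately show ?thesis using DERIV_pos_inc_right[of "eval_fps F" "eval_fps (fps_deriv F) 0" 0] by auto
  qed
  obtain d1 where d1: "0 < d1" "\<And>s. 0 < s \<Longrightarrow> s < d1 \<Longrightarrow> 0 < eval_fps T s"
    using pos[OF cr(1)] coeffs_small[OF a] by (auto simp: eval_fps_at_0 T_def)
  obtain d2 where d2: "0 < d2" "\<And>s. 0 < s \<Longrightarrow> s < d2 \<Longrightarrow> 0 < eval_fps Z s"
    using pos[OF cr(2)] coeffs_small[OF a] by (auto simp: eval_fps_at_0 Z_def)
  have contF: "isCont (eval_fps F) 0" if "ereal R \<le> fps_conv_radius F" for F :: "real fps"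
    by (rule DERIV_isCont[OF has_field_derivative_eval_fps]) (use lt[OF z0 that] in simp)
  have W0: "1 < eval_fps W 0" using coeffs_small(3)[OF a] p0_gt_1[OF a] by (simp add: eval_fps_at_0 W_def)
  have "\<forall>\<^sub>F s in at 0. 0 < eval_fps W s"
    using contF[OF cr(3)] W0 unfolding isCont_def by (intro order_tendstoD(1)) auto
  then obtain d3 where d3: "0 < d3" "\<And>s. s \<noteq> 0 \<Longrightarrow> \<bar>s\<bar> < d3 \<Longrightarrow> 0 < eval_fps W s"
    unfolding eventually_at by (auto simp: dist_real_def)
  have "\<forall>\<^sub>F s in at 0. eval_fps Z s < 2"
    using contF[OF cr(2)] coeffs_small(2)[OF a] unfolding isCont_def
    by (intro order_tendstoD(2)) (auto simp: eval_fps_at_0 Z_def)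
  then obtain d4 where d4: "0 < d4" "\<And>s. s \<noteq> 0 \<Longrightarrow> \<bar>s\<bar> < d4 \<Longrightarrow> eval_fps Z s < 2"
    unfolding eventually_at by (auto simp: dist_real_def)
  define r where "r = Min {R, d1, d2, d3, d4}"
  have r: "0 < r" "r \<le> R" "r \<le> d1" "r \<le> d2" "r \<le> d3" "r \<le> d4"
    using R d1 d2 d3 d4 by (auto simp: r_def)
  show thesis
  proof (rule that[of r V y h])
    show "0 < r" "r \<le> 1" using r R by auto
    have sub: "{-r<..<r} \<subseteq> {-R<..<R}" using r by auto
    show "reduced_system a {-r<..<r} V y h" by (rule reduced_system_subset[OF red sub])
    show "smooth_on V {-r<..<r}" "smooth_on y {-r<..<r}" "smooth_on h {-r<..<r}"
      using sm sub by (auto intro: smooth_on_subset)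
    show "\<exists>c>0. (deriv y has_real_derivative - c) (at 0)"
      using d2y coeffs_small(5)[OF a] by (intro exI[of _ "2 * fps_nth Z 1"]) (auto simp: Z_def)
    fix x assume x: "0 < x" "x < r"
    have "0 < x\<^sup>2" "x\<^sup>2 < r" using square_less[of r x] r R x by auto
    then show "0 < V x \<and> 0 < y x \<and> y x < 2 \<and> 0 < h x"
      using d1(2)[of "x\<^sup>2"] d2(2)[of "x\<^sup>2"] d3(2)[of "x\<^sup>2"] d4(2)[of "x\<^sup>2"] r x
      by (auto simp: V_def y_def h_def)
  qed (use V0 d2h in \<open>auto simp: V_def y_def h_def\<close>)
qed

section \<open>Derivatives along the orbit\<close>

text \<open>
  The ideal generated by \<open>G\<close> in the polynomials in \<open>y\<close> and \<open>h\<close>. By the reduced system \<open>f \<mapsto> V f'\<close> maps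
  polynomials in \<open>y\<close> and \<open>h\<close> to polynomials in \<open>y\<close> and \<open>h\<close>, and it maps the ideals generated by \<open>{y, h}\<close> and by
  \<open>{h}\<close> into themselves. So every element, and every iterate of \<open>f \<mapsto> V f'\<close> on it, inherits the decay rate of the generators.
\<close>

inductive_set orbit_ideal :: "(real \<Rightarrow> real) \<Rightarrow> (real \<Rightarrow> real) \<Rightarrow> (real \<Rightarrow> real) set \<Rightarrow> (real \<Rightarrow> real) set"
  for y h :: "real \<Rightarrow> real" and G :: "(real \<Rightarrow> real) set" where
  gen: "g \<in> G \<Longrightarrow> g \<in> orbit_ideal y h G"
| add: "f \<in> orbit_ideal y h G \<Longrightarrow> g \<in> orbit_ideal y h G \<Longrightarrow> (\<lambda>x. f x + g x) \<in> orbit_ideal y h G"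
| scale: "f \<in> orbit_ideal y h G \<Longrightarrow> (\<lambda>x. c * f x) \<in> orbit_ideal y h G"
| mult_y: "f \<in> orbit_ideal y h G \<Longrightarrow> (\<lambda>x. y x * f x) \<in> orbit_ideal y h G"
| mult_h: "f \<in> orbit_ideal y h G \<Longrightarrow> (\<lambda>x. h x * f x) \<in> orbit_ideal y h G"

lemma orbit_ideal_derivative:
  assumes red: "reduced_system a S V y h" and V: "\<And>x. x \<in> S \<Longrightarrow> V x \<noteq> 0"
    and G: "\<And>g. g \<in> G \<Longrightarrow> \<exists>k\<in>orbit_ideal y h G. \<forall>x\<in>S. (g has_real_derivative k x / V x) (at x)"
    and f: "f \<in> orbit_ideal y h G"
  shows "\<exists>k\<in>orbit_ideal y h G. \<forall>x\<in>S. (f has_real_derivative k x / V x) (at x)"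
  using f
proof induction
  case (gen g)
  then show ?case by (rule G)
next
  case (add f g)
  then obtain k l where kl: "k \<in> orbit_ideal y h G" "l \<in> orbit_ideal y h G"
    "\<forall>x\<in>S. (f has_real_derivative k x / V x) (at x)" "\<forall>x\<in>S. (g has_real_derivative l x / V x) (at x)" by blast
  show ?case
    by (rule bexI[OF _ orbit_ideal.add[OF kl(1,2)]])
       (use kl(3,4) in \<open>auto intro!: derivative_eq_intros simp: add_divide_distrib\<close>)
next
  case (scale f c)
  then obtain k where k: "k \<in> orbit_ideal y h G" "\<forall>x\<in>S. (f has_real_derivative k x / V x) (at x)" by blast
  show ?case
    by (rule bexI[OF _ orbit_ideal.scale[OF k(1), of c]])
       (use k(2) in \<open>auto intro!: derivative_eq_intros\<close>)
next
  case (mult_y f)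
  then obtain k where k: "k \<in> orbit_ideal y h G" "\<forall>x\<in>S. (f has_real_derivative k x / V x) (at x)" by blast
  let ?k = "\<lambda>x. y x * k x + (1 / 2 * (y x * (y x * f x)) + (- 1 * (y x * f x) + - 2 * a * (h x * f x)))"
  have "?k \<in> orbit_ideal y h G"
    using mult_y.hyps k(1) by (intro orbit_ideal.intros(2-5))
  moreover have "\<forall>x\<in>S. ((\<lambda>x. y x * f x) has_real_derivative ?k x / V x) (at x)"
  proof
    fix x assume x: "x \<in> S"
    have "((\<lambda>x. y x * f x) has_real_derivative
        (y x * (y x - 2) / 2 - 2 * a * h x) / V x * f x + k x / V x * y x) (at x)"
      by (rule DERIV_mult[OF reduced_systemD(2)[OF red x V[OF x]]]) (use k(2) x in blast)
    also have "(y x * (y x - 2) / 2 - 2 * a * h x) / V x * f x + k x / V x * y x = ?k x / V x"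
      using V[OF x] by (simp add: field_simps)
    finally show "((\<lambda>x. y x * f x) has_real_derivative ?k x / V x) (at x)" .
  qed
  ultimately show ?case by (intro bexI[of _ ?k])
next
  case (mult_h f)
  then obtain k where k: "k \<in> orbit_ideal y h G" "\<forall>x\<in>S. (f has_real_derivative k x / V x) (at x)" by blast
  let ?k = "\<lambda>x. h x * k x + (2 / a * (y x * (h x * f x)) + (2 / a * - a) * (h x * f x))"
  have "?k \<in> orbit_ideal y h G"
    using mult_h.hyps k(1) by (intro orbit_ideal.intros(2-5))
  moreover have "\<forall>x\<in>S. ((\<lambda>x. h x * f x) has_real_derivative ?k x / V x) (at x)"
  proof
    fix x assume x: "x \<in> S"
    have "((\<lambda>x. h x * f x) has_real_derivative
        (2 / a * (y x - a) * h x) / V x * f x + k x / V x * h x) (at x)"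
      by (rule DERIV_mult[OF reduced_systemD(3)[OF red x V[OF x]]]) (use k(2) x in blast)
    also have "(2 / a * (y x - a) * h x) / V x * f x + k x / V x * h x = ?k x / V x"
      by (simp add: algebra_simps add_divide_distrib diff_divide_distrib)
    finally show "((\<lambda>x. h x * f x) has_real_derivative ?k x / V x) (at x)" .
  qed
  ultimately show ?case by (intro bexI[of _ ?k])
qed

lemma quotient_numerator:
  fixes v :: real
  assumes v: "v \<noteq> 0"
  shows "(k / v * v ^ m - f * (real m * (c * v ^ (m - Suc 0)))) / (v ^ m * v ^ m) = (k - real m * c * f) / v ^ Suc m"
proof (cases m)
  case (Suc n)
  have "k / v * v ^ m - f * (real m * (c * v ^ (m - Suc 0))) = v ^ n * (k - real m * c * f)"
    using v by (simp add: Suc algebra_simps)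
  then show ?thesis using v by (simp add: Suc)
qed simp

text \<open>
  Each differentiation costs one power of \<open>V\<close> and stays in the ideal.
\<close>

lemma orbit_quotient_derivative:
  assumes red: "reduced_system a S V y h" and V: "\<And>x. x \<in> S \<Longrightarrow> V x \<noteq> 0"
    and G: "\<And>g. g \<in> G \<Longrightarrow> \<exists>k\<in>orbit_ideal y h G. \<forall>x\<in>S. (g has_real_derivative k x / V x) (at x)"
    and f: "f \<in> orbit_ideal y h G"
  shows "\<exists>k\<in>orbit_ideal y h G. \<forall>x\<in>S. ((\<lambda>x. f x / V x ^ m) has_real_derivative k x / V x ^ Suc m) (at x)"
proof -
  obtain k where k: "k \<in> orbit_ideal y h G" "\<forall>x\<in>S. (f has_real_derivative k x / V x) (at x)"
    using orbit_ideal_derivative[OF assms] by blast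
  let ?k = "\<lambda>x. k x + (- real m * (coeff_l a * f x) + - real m * (y x * f x))"
  have "?k \<in> orbit_ideal y h G" using f k(1) by (intro orbit_ideal.intros(2-5))
  moreover have "((\<lambda>x. f x / V x ^ m) has_real_derivative ?k x / V x ^ Suc m) (at x)" if x: "x \<in> S" for x
  proof -
    have d1: "(f has_real_derivative k x / V x) (at x)" using k(2) x by blast
    have d2: "((\<lambda>x. V x ^ m) has_real_derivative real m * ((coeff_l a + y x) * V x ^ (m - Suc 0))) (at x)"
      using DERIV_power[OF reduced_systemD(1)[OF red x], of m] by simp
    have "((\<lambda>x. f x / V x ^ m) has_real_derivative
       (k x / V x * V x ^ m - f x * (real m * ((coeff_l a + y x) * V x ^ (m - Suc 0)))) / (V x ^ m * V x ^ m)) (at x)"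
      using DERIV_divide[OF d1 d2] V[OF x] by simp
    also have "(k x / V x * V x ^ m - f x * (real m * ((coeff_l a + y x) * V x ^ (m - Suc 0)))) / (V x ^ m * V x ^ m)
      = ?k x / V x ^ Suc m"
      unfolding quotient_numerator[OF V[OF x]] by (simp add: algebra_simps)
    finally show ?thesis .
  qed
  ultimately show ?thesis by (intro bexI[of _ ?k] ballI)
qed

lemma orbit_quotient_iterated_derivative:
  assumes S: "open S" and red: "reduced_system a S V y h" and V: "\<And>x. x \<in> S \<Longrightarrow> V x \<noteq> 0"
    and G: "\<And>g. g \<in> G \<Longrightarrow> \<exists>k\<in>orbit_ideal y h G. \<forall>x\<in>S. (g has_real_derivative k x / V x) (at x)"
    and f: "f \<in> orbit_ideal y h G" and F: "\<And>x. x \<in> S \<Longrightarrow> F x = f x / V x ^ m"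
  shows "\<exists>k\<in>orbit_ideal y h G. \<forall>x\<in>S. (deriv ^^ j) F x = k x / V x ^ (m + j)"
proof (induction j)
  case 0
  then show ?case using f F by auto
next
  case (Suc j)
  then obtain k where k: "k \<in> orbit_ideal y h G" "\<And>x. x \<in> S \<Longrightarrow> (deriv ^^ j) F x = k x / V x ^ (m + j)" by blast
  obtain l where l: "l \<in> orbit_ideal y h G"
    "\<And>x. x \<in> S \<Longrightarrow> ((\<lambda>x. k x / V x ^ (m + j)) has_real_derivative l x / V x ^ Suc (m + j)) (at x)"
    using orbit_quotient_derivative[OF red V G k(1), of "m + j"] by blast
  have "(deriv ^^ Suc j) F x = l x / V x ^ (m + Suc j)" if x: "x \<in> S" for x
  proof -
    have "((deriv ^^ j) F has_real_derivative l x / V x ^ Suc (m + j)) (at x)"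
      by (rule has_field_derivative_transform_within_open[OF l(2)[OF x] S x]) (simp add: k(2))
    then show ?thesis by (simp add: DERIV_imp_deriv)
  qed
  then show ?case using l(1) by blast
qed

text \<open>
  Where \<open>V\<close> does not vanish, the equations express all derivatives by the functions themselves.
\<close>

lemma reduced_system_smooth:
  assumes S: "open S" and red: "reduced_system a S V y h" and V: "\<And>x. x \<in> S \<Longrightarrow> V x \<noteq> 0"
  shows "smooth_on V S" "smooth_on y S" "smooth_on h S"
proof -
  let ?G = "{\<lambda>x::real. 1::real}"
  let ?I = "orbit_ideal y h ?G"
  have one: "(\<lambda>x. 1) \<in> ?I" by (rule orbit_ideal.gen) simp
  have zero: "(\<lambda>x. 0) \<in> ?I" using orbit_ideal.scale[OF one, of 0] by simp
  have G: "\<exists>k\<in>?I. \<forall>x\<in>S. (g has_real_derivative k x / V x) (at x)" if "g \<in> ?G" for g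
    using that by (intro bexI[OF _ zero]) auto
  have sm: "smooth_on (\<lambda>x. f x / V x ^ m) S" if "f \<in> ?I" for f m
  proof (rule smooth_on_closed_class[OF S, of _ "{\<lambda>x. f x / V x ^ m | f m. f \<in> ?I}"])
    fix F assume "F \<in> {\<lambda>x. f x / V x ^ m | f m. f \<in> ?I}"
    then obtain f m where F: "F = (\<lambda>x. f x / V x ^ m)" "f \<in> ?I" by blast
    obtain k where "k \<in> ?I" "\<forall>x\<in>S. ((\<lambda>x. f x / V x ^ m) has_real_derivative k x / V x ^ Suc m) (at x)"
      using orbit_quotient_derivative[OF red V G F(2)] by blast
    then show "\<exists>h'\<in>{\<lambda>x. f x / V x ^ m | f m. f \<in> ?I}. \<forall>x\<in>S. (F has_real_derivative h' x) (at x)"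
      unfolding F by (intro bexI[of _ "\<lambda>x. k x / V x ^ Suc m"]) (assumption, blast)
  qed (use that in blast)
  show y: "smooth_on y S" using sm[OF orbit_ideal.mult_y[OF one], of 0] by simp
  show "smooth_on h S" using sm[OF orbit_ideal.mult_h[OF one], of 0] by simp
  show "smooth_on V S"
    by (rule smooth_on_antiderivative[OF S reduced_systemD(1)[OF red]])
       (use smooth_on_add[OF S smooth_on_const[OF S, of "coeff_l a"] y] in auto)
qed

lemma reduced_system_reflect:
  assumes red: "reduced_system a S V y h"
    and par: "\<And>x. V (- x) = - V x" "\<And>x. y (- x) = y x" "\<And>x. h (- x) = h x"
  shows "reduced_system a (uminus ` S) V y h"
  unfolding reduced_system_def
proof (intro ballI)
  fix z assume "z \<in> uminus ` S"
  then obtain x where x: "x \<in> S" "z = - x" by auto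
  obtain y' h' where *: "(V has_real_derivative coeff_l a + y x) (at x)"
    "(y has_real_derivative y') (at x)" "V x * y' = y x * (y x - 2) / 2 - 2 * a * h x"
    "(h has_real_derivative h') (at x)" "V x * h' = 2 / a * (y x - a) * h x"
    using red x(1) unfolding reduced_system_def by blast
  have m: "(f has_real_derivative D) (at x) \<Longrightarrow> ((\<lambda>x. f (- x)) has_real_derivative - D) (at z)" for f D
    using DERIV_mirror[of f D z] x by simp
  have "((\<lambda>x. - V (- x)) has_real_derivative coeff_l a + y x) (at z)"
    using DERIV_minus[OF m[OF *(1)]] by (simp add: add.commute)
  moreover have "(y has_real_derivative - y') (at z)" using m[OF *(2)] par by simp
  moreover have "(h has_real_derivative - h') (at z)" using m[OF *(4)] par by simp
  moreover have "V z * - y' = y z * (y z - 2) / 2 - 2 * a * h z" "V z * - h' = 2 / a * (y z - a) * h z"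
    using *(3,5) x par by simp_all
  ultimately show "(V has_real_derivative coeff_l a + y z) (at z) \<and>
     (\<exists>y'. (y has_real_derivative y') (at z) \<and> V z * y' = y z * (y z - 2) / 2 - 2 * a * h z) \<and>
     (\<exists>h'. (h has_real_derivative h') (at z) \<and> V z * h' = 2 / a * (y z - a) * h z)"
    using par x by auto
qed

lemma reduced_system_Un: "reduced_system a S V y h \<Longrightarrow> reduced_system a T V y h \<Longrightarrow> reduced_system a (S \<union> T) V y h"
  unfolding reduced_system_def by blast

lemma reduced_system_cong:
  assumes red: "reduced_system a S V y h" and S: "open S"
    and eq: "\<And>x. x \<in> S \<Longrightarrow> V' x = V x" "\<And>x. x \<in> S \<Longrightarrow> y' x = y x" "\<And>x. x \<in> S \<Longrightarrow> h' x = h x"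
  shows "reduced_system a S V' y' h'"
  unfolding reduced_system_def
proof (intro ballI)
  fix x assume x: "x \<in> S"
  obtain dy dh where *: "(V has_real_derivative coeff_l a + y x) (at x)"
    "(y has_real_derivative dy) (at x)" "V x * dy = y x * (y x - 2) / 2 - 2 * a * h x"
    "(h has_real_derivative dh) (at x)" "V x * dh = 2 / a * (y x - a) * h x"
    using red x unfolding reduced_system_def by blast
  have t: "(f has_real_derivative D) (at x) \<Longrightarrow> (\<And>z. z \<in> S \<Longrightarrow> f' z = f z) \<Longrightarrow> (f' has_real_derivative D) (at x)" for f f' D
    by (rule has_field_derivative_transform_within_open[OF _ S x]) auto
  show "(V' has_real_derivative coeff_l a + y' x) (at x) \<and>
     (\<exists>dy. (y' has_real_derivative dy) (at x) \<and> V' x * dy = y' x * (y' x - 2) / 2 - 2 * a * h' x) \<and>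
     (\<exists>dh. (h' has_real_derivative dh) (at x) \<and> V' x * dh = 2 / a * (y' x - a) * h' x)"
    using t[OF *(1) eq(1)] t[OF *(2) eq(2)] t[OF *(4) eq(3)] *(3,5) eq[OF x] by auto
qed

text \<open>
  The series is continued by the planar orbit from the point \<open>r / 2\<close>, well inside the interval of convergence, and
  reflected to the negative axis. At the two seams the values agree, hence by the equations the derivatives do,
  and smoothness follows from the equations since \<open>V\<close> is positive there.
\<close>

theorem inner_solution:
  fixes a :: real
  assumes a: "0 < a" "a < 1"
  obtains I V y h where "open I" "0 \<in> I" "\<And>x. x \<in> I \<Longrightarrow> - x \<in> I"
    and "reduced_system a I V y h"
    and "smooth_on V I" "smooth_on y I" "smooth_on h I"
    and "\<And>x. V (- x) = - V x" "\<And>x. y (- x) = y x" "\<And>x. h (- x) = h x"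
    and "V 0 = 0" "y 0 = 2" "h 0 = 0"
    and "\<And>x. x \<in> I \<Longrightarrow> 0 < x \<Longrightarrow> 0 < V x \<and> y x < 2 \<and> 0 < h x"
    and "\<exists>c>0. (deriv h has_real_derivative c) (at 0)"
    and "\<exists>c>0. (deriv y has_real_derivative - c) (at 0)"
    and "a \<le> 2 / 3 \<Longrightarrow> I = UNIV \<and> (y \<longlongrightarrow> 0) at_top"
    and "2 / 3 < a \<Longrightarrow> \<exists>L>0. I = {-L<..<L} \<and> (V \<longlongrightarrow> 0) (at_left L) \<and>
            (y \<longlongrightarrow> 0) (at_left L) \<and> (h \<longlongrightarrow> 0) (at_left L)"
proof -
  obtain r V1 y1 h1 where r: "0 < r" "r \<le> (1::real)"
    and red1: "reduced_system a {-r<..<r} V1 y1 h1"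
    and sm1: "smooth_on V1 {-r<..<r}" "smooth_on y1 {-r<..<r}" "smooth_on h1 {-r<..<r}"
    and par1: "\<And>x. V1 (- x) = - V1 x" "\<And>x. y1 (- x) = y1 x" "\<And>x. h1 (- x) = h1 x"
    and init1: "V1 0 = 0" "y1 0 = 2" "h1 0 = 0"
    and pos1: "\<And>x. 0 < x \<Longrightarrow> x < r \<Longrightarrow> 0 < V1 x \<and> 0 < y1 x \<and> y1 x < 2 \<and> 0 < h1 x"
    and d2h: "(deriv h1 has_real_derivative 2) (at 0)"
    and d2y: "\<exists>c>0. (deriv y1 has_real_derivative - c) (at 0)"
    by (rule local_solution[OF a]) (rule that; assumption)
  define X0 where "X0 = r / 2"
  have X0: "0 < X0" "X0 < r" using r by (auto simp: X0_def)
  have p0: "0 < V1 X0" "0 < y1 X0" "y1 X0 < 2" "0 < h1 X0" using pos1[OF X0] by auto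
  obtain J V2 y2 h2 where init2: "V2 X0 = V1 X0" "y2 X0 = y1 X0" "h2 X0 = h1 X0"
    and d2: "\<And>x. x \<in> J \<Longrightarrow> (V2 has_real_derivative coeff_l a + y2 x) (at x within {X0..})"
      "\<And>x. x \<in> J \<Longrightarrow> (y2 has_real_derivative (y2 x * (y2 x - 2) / 2 - 2 * a * h2 x) / V2 x) (at x within {X0..})"
      "\<And>x. x \<in> J \<Longrightarrow> (h2 has_real_derivative (2 / a * (y2 x - a) * h2 x) / V2 x) (at x within {X0..})"
    and pos2: "\<And>x. x \<in> J \<Longrightarrow> 0 < V2 x \<and> 0 < h2 x \<and> y2 x \<le> y1 X0"
    and J1: "a \<le> 2 / 3 \<Longrightarrow> J = {X0..} \<and> (y2 \<longlongrightarrow> 0) at_top"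
    and J2: "2 / 3 < a \<Longrightarrow> \<exists>L>X0. J = {X0..<L} \<and> (V2 \<longlongrightarrow> 0) (at_left L) \<and>
            (y2 \<longlongrightarrow> 0) (at_left L) \<and> (h2 \<longlongrightarrow> 0) (at_left L)"
    by (rule outer_solution[OF a(1) less_imp_le[OF a(2)] p0(1-4), where ?X0.0 = X0]) (rule that; assumption)
  have J: "X0 \<in> J" "J \<subseteq> {X0..}" using J1 J2 by (cases "a \<le> 2 / 3"; force)+
  define P where "P = {0<..X0} \<union> J"
  define Vp yp hp where "Vp x = (if x \<le> X0 then V1 x else V2 x)"
    and "yp x = (if x \<le> X0 then y1 x else y2 x)" and "hp x = (if x \<le> X0 then h1 x else h2 x)" for x
  have glue: "((\<lambda>x. if x \<le> X0 then f1 x else f2 x) has_real_derivative (if x \<le> X0 then e1 x else e2 x)) (at x)"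
    if x: "x \<in> P" and f1: "\<And>x. x \<in> {0<..X0} \<Longrightarrow> (f1 has_real_derivative e1 x) (at x)"
      and f2: "\<And>x. x \<in> J \<Longrightarrow> (f2 has_real_derivative e2 x) (at x within {X0..})"
      and e: "f1 X0 = f2 X0" "e1 X0 = e2 X0" for f1 f2 e1 e2 :: "real \<Rightarrow> real" and x
  proof -
    consider "x < X0" | "x = X0" | "X0 < x" by linarith
    then show ?thesis
    proof cases
      case 1
      have "(f1 has_real_derivative e1 x) (at x)" using x 1 J by (intro f1) (auto simp: P_def)
      then show ?thesis using 1
        by (auto intro: has_field_derivative_transform_within_open[where S = "{..<X0}"])
    next
      case 2
      have "((\<lambda>x. if x \<le> X0 then f1 x else f2 x) has_real_derivative e1 X0) (at X0)"
        by (rule glue_derivative) (use f1[of X0] f2[of X0] e J X0 in \<open>auto intro: DERIV_subset\<close>)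
      then show ?thesis using 2 by simp
    next
      case 3
      have "(f2 has_real_derivative e2 x) (at x)"
        using f2[of x] x 3 at_within_atLeast[OF 3] by (auto simp: P_def)
      then show ?thesis using 3
        by (auto intro: has_field_derivative_transform_within_open[where S = "{X0<..}"])
    qed
  qed
  have V1nz: "V1 x \<noteq> 0" "x \<in> {-r<..<r}" if "x \<in> {0<..X0}" for x using pos1[of x] that X0 by auto
  have red_p: "reduced_system a P Vp yp hp"
  proof (rule reduced_systemI)
    fix x assume x: "x \<in> P"
    show "Vp x \<noteq> 0"
    proof (cases "x \<le> X0")
      case True
      then have "x \<in> {0<..X0}" using x J X0 by (auto simp: P_def)
      from V1nz(1)[OF this] True show ?thesis by (simp add: Vp_def)
    qed (use x pos2[of x] in \<open>auto simp: P_def Vp_def\<close>)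
    have "(Vp has_real_derivative (if x \<le> X0 then coeff_l a + y1 x else coeff_l a + y2 x)) (at x)"
      unfolding Vp_def[abs_def]
      by (rule glue[OF x]) (use reduced_systemD(1)[OF red1] V1nz d2 init2 in auto)
    then show "(Vp has_real_derivative coeff_l a + yp x) (at x)" by (auto simp: yp_def)
    have "(yp has_real_derivative (if x \<le> X0 then (y1 x * (y1 x - 2) / 2 - 2 * a * h1 x) / V1 x
        else (y2 x * (y2 x - 2) / 2 - 2 * a * h2 x) / V2 x)) (at x)"
      unfolding yp_def[abs_def]
      by (rule glue[OF x]) (use reduced_systemD(2)[OF red1] V1nz d2 init2 in auto)
    then show "(yp has_real_derivative (yp x * (yp x - 2) / 2 - 2 * a * hp x) / Vp x) (at x)"
      by (auto simp: yp_def hp_def Vp_def)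
    have "(hp has_real_derivative (if x \<le> X0 then (2 / a * (y1 x - a) * h1 x) / V1 x
        else (2 / a * (y2 x - a) * h2 x) / V2 x)) (at x)"
      unfolding hp_def[abs_def]
      by (rule glue[OF x]) (use reduced_systemD(3)[OF red1] V1nz d2 init2 in auto)
    then show "(hp has_real_derivative (2 / a * (yp x - a) * hp x) / Vp x) (at x)"
      by (auto simp: yp_def hp_def Vp_def)
  qed
  define V y h where "V x = (if 0 \<le> x then Vp x else - Vp (- x))"
    and "y x = yp \<bar>x\<bar>" and "h x = hp \<bar>x\<bar>" for x
  have par: "V (- x) = - V x" "y (- x) = y x" "h (- x) = h x" for x
    using init1 X0 by (auto simp: V_def y_def h_def Vp_def)
  have near: "V x = V1 x" "y x = y1 x" "h x = h1 x" if "x \<in> {-X0<..<X0}" for x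
    using that par1[of x] by (auto simp: V_def y_def h_def Vp_def yp_def hp_def abs_if)
  define I where "I = {-X0<..<X0} \<union> (P \<union> uminus ` P)"
  have oP: "open P" and PI: "P = {0<..} \<or> (\<exists>L>X0. P = {0<..<L})"
  proof -
    have "P = {0<..} \<or> (\<exists>L>X0. P = {0<..<L})"
    proof (cases "a \<le> 2 / 3")
      case True
      then show ?thesis using J1 X0 unfolding P_def by auto
    next
      case False
      then obtain L where "X0 < L" "J = {X0..<L}" using J2 by auto
      then have "P = {0<..<L}" unfolding P_def using X0 by auto
      then show ?thesis using \<open>X0 < L\<close> by blast
    qed
    then show "open P" "P = {0<..} \<or> (\<exists>L>X0. P = {0<..<L})" by auto
  qed
  have Ppos: "0 < x" if "x \<in> P" for x using PI that by auto
  have redP: "reduced_system a P V y h"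
    by (rule reduced_system_cong[OF red_p oP]) (use Ppos in \<open>force simp: V_def y_def h_def\<close>)+
  have red0: "reduced_system a {-X0<..<X0} V y h"
  proof -
    have red1': "reduced_system a {-X0<..<X0} V1 y1 h1"
      by (rule reduced_system_subset[OF red1]) (use X0 in auto)
    show ?thesis by (rule reduced_system_cong[OF red1' open_greaterThanLessThan near])
  qed
  have redN: "reduced_system a (uminus ` P) V y h" 
    by (rule reduced_system_reflect[where V = V and y = y and h = h]) (fact redP par)+
  have redI: "reduced_system a I V y h"
    unfolding I_def by (intro reduced_system_Un red0 redP redN)
  have Vpos: "0 < V x" if "x \<in> P" for x
  proof (cases "x \<le> X0")
    case True
    then show ?thesis using pos1[of x] Ppos[OF that] X0 by (simp add: V_def Vp_def)
  next
    case False
    then have "x \<in> J" using that by (simp add: P_def)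
    from pos2[OF this] False Ppos[OF that] show ?thesis by (simp add: V_def Vp_def)
  qed
  have oN: "open (uminus ` P)" using open_negations[OF oP] by simp
  have smP: "smooth_on V (P \<union> uminus ` P)" "smooth_on y (P \<union> uminus ` P)" "smooth_on h (P \<union> uminus ` P)"
  proof -
    have nz: "V x \<noteq> 0" if "x \<in> P \<union> uminus ` P" for x
      using that
    proof
      assume "x \<in> uminus ` P"
      then have "- x \<in> P" by auto
      from Vpos[OF this] par(1)[of x] show ?thesis by auto
    qed (use Vpos[of x] in auto)
    have o: "open (P \<union> uminus ` P)" using oP oN by auto
    note * = reduced_system_smooth[OF o reduced_system_Un[OF redP redN] nz]
    show "smooth_on V (P \<union> uminus ` P)" "smooth_on y (P \<union> uminus ` P)" "smooth_on h (P \<union> uminus ` P)"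
      by (rule *; assumption)+
  qed
  have sub: "{-X0<..<X0} \<subseteq> {-r<..<r}" using X0 by auto
  have sm0: "smooth_on V {-X0<..<X0}" "smooth_on y {-X0<..<X0}" "smooth_on h {-X0<..<X0}"
    by (rule smooth_on_cong[OF open_greaterThanLessThan near(1) smooth_on_subset[OF sm1(1) sub]]
         smooth_on_cong[OF open_greaterThanLessThan near(2) smooth_on_subset[OF sm1(2) sub]]
         smooth_on_cong[OF open_greaterThanLessThan near(3) smooth_on_subset[OF sm1(3) sub]]; assumption)+
  have second: "(deriv f has_real_derivative D) (at 0)"
    if "(deriv f1 has_real_derivative D) (at 0)" "\<And>x. x \<in> {-X0<..<X0} \<Longrightarrow> f x = f1 x" for f f1 D
  proof (rule has_field_derivative_transform_within_open[OF that(1), of "{-X0<..<X0}"])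
    fix x assume x: "x \<in> {-X0<..<X0}"
    show "deriv f1 x = deriv f x"
      using deriv_funpow_cong[of "{-X0<..<X0}" f f1 x 1] that(2) x by simp
  qed (use X0 in auto)
  show thesis
  proof (rule that[of I V y h])
    show "open I" unfolding I_def using oP oN by auto
    show "0 \<in> I" using X0 by (simp add: I_def)
    show "- x \<in> I" if "x \<in> I" for x using that by (auto simp: I_def)
    show "reduced_system a I V y h" by (rule redI)
    show "smooth_on V I" "smooth_on y I" "smooth_on h I"
      unfolding I_def by (intro smooth_on_Un sm0 smP)+
    show "V 0 = 0" "y 0 = 2" "h 0 = 0" using near[of 0] X0 init1 by auto
    show "0 < V x \<and> y x < 2 \<and> 0 < h x" if "x \<in> I" "0 < x" for x
    proof -
      have x: "x \<in> P"
      proof (rule ccontr)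
        assume n: "x \<notin> P"
        then have "X0 < x" using that(2) by (auto simp: P_def)
        then have "x \<in> uminus ` P" using that(1) n by (auto simp: I_def)
        then have "- x \<in> P" by auto
        then show False using Ppos[of "- x"] that(2) by simp
      qed
      moreover have "y x < 2 \<and> 0 < h x"
      proof (cases "x \<le> X0")
        case True
        then show ?thesis using pos1[of x] that(2) X0 by (simp add: y_def h_def yp_def hp_def)
      next
        case False
        then have "x \<in> J" using x by (simp add: P_def)
        from pos2[OF this] False that(2) p0(3) show ?thesis by (simp add: y_def h_def yp_def hp_def)
      qed
      ultimately show ?thesis using Vpos[OF x] by simp
    qed
    show "\<exists>c>0. (deriv h has_real_derivative c) (at 0)" using second[OF d2h near(3)] by (intro exI[of _ 2]) simp
    show "\<exists>c>0. (deriv y has_real_derivative - c) (at 0)" 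
    proof -
      obtain c where c: "0 < c" "(deriv y1 has_real_derivative - c) (at 0)" using d2y by blast
      show ?thesis using second[OF c(2) near(2)] c(1) by (intro exI[of _ c]) simp
    qed
    have ev: "(f \<longlongrightarrow> l) F" if "(g \<longlongrightarrow> l) F" "\<forall>\<^sub>F x in F. X0 < x" "\<And>x. X0 < x \<Longrightarrow> f x = g x" for f g :: "real \<Rightarrow> real" and l F
      using that(1)
    proof (rule Lim_transform_eventually)
      show "\<forall>\<^sub>F x in F. g x = f x" using that(2) by eventually_elim (simp add: that(3))
    qed
    have far: "V x = V2 x" "y x = y2 x" "h x = h2 x" if "X0 < x" for x
      using that X0 by (auto simp: V_def y_def h_def Vp_def yp_def hp_def)
    show "I = UNIV \<and> (y \<longlongrightarrow> 0) at_top" if "a \<le> 2 / 3"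
    proof
      have P: "P = {0<..}" using J1[OF that] X0 by (auto simp: P_def)
      have "x \<in> I" for x
      proof (cases "x = 0")
        case False
        then have "x \<in> P \<or> - x \<in> P" by (auto simp: P)
        then show ?thesis unfolding I_def by (metis UnI1 UnI2 imageI minus_minus)
      qed (use X0 in \<open>simp add: I_def\<close>)
      then show "I = UNIV" by auto
      show "(y \<longlongrightarrow> 0) at_top"
        by (rule ev[of y2]) (use J1[OF that] far eventually_gt_at_top in auto)
    qed
    show "\<exists>L>0. I = {-L<..<L} \<and> (V \<longlongrightarrow> 0) (at_left L) \<and>
            (y \<longlongrightarrow> 0) (at_left L) \<and> (h \<longlongrightarrow> 0) (at_left L)" if a23: "2 / 3 < a"
    proof -
      obtain L where L: "X0 < L" "J = {X0..<L}" "(V2 \<longlongrightarrow> 0) (at_left L)"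
            "(y2 \<longlongrightarrow> 0) (at_left L)" "(h2 \<longlongrightarrow> 0) (at_left L)" using J2[OF a23] by blast
      have P: "P = {0<..<L}" using L(1,2) X0 by (auto simp: P_def)
      have "uminus ` P = {-L<..<0}" unfolding P by simp
      then have "I = {-L<..<L}" unfolding I_def P using X0 L(1) by auto
      moreover have e: "\<forall>\<^sub>F x in at_left L. X0 < x" using eventually_at_left_real[OF L(1)] by eventually_elim auto
      ultimately show ?thesis
        using X0 L(1) ev[OF L(3) e far(1)] ev[OF L(4) e far(2)] ev[OF L(5) e far(3)]
        by (intro exI[of _ L]) auto
    qed
  qed (use par in auto)
qed

section \<open>Hoelder regularity of zero extensions\<close>

lemma powr_subadditive:
  fixes u w p :: real
  assumes "0 \<le> u" "0 \<le> w" "0 < p" "p \<le> 1"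
  shows "(u + w) powr p \<le> u powr p + w powr p"
proof (cases "u + w = 0")
  case True
  then show ?thesis using assms by (simp add: add_nonneg_eq_0_iff)
next
  case False
  define s where "s = u + w"
  have s: "0 < s" using False assms by (simp add: s_def)
  have *: "z \<le> z powr p" if "0 \<le> z" "z \<le> 1" for z :: real
    using powr_mono'[of p 1 z] assms that by simp
  have "1 = u / s + w / s" using s by (simp add: s_def add_divide_distrib[symmetric])
  also have "\<dots> \<le> (u / s) powr p + (w / s) powr p"
    using s assms by (intro add_mono *) (auto simp: s_def)
  also have "\<dots> = (u powr p + w powr p) / s powr p"
    using s assms by (simp add: powr_divide add_divide_distrib)
  finally show ?thesis using s by (simp add: s_def[symmetric] field_simps)
qed

text \<open>
  Used at the boundary of the support, where a function vanishing faster than linearly is extended by zero.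
\<close>

lemma has_derivative_zero_of_superlinear:
  fixes f :: "real \<Rightarrow> real"
  assumes p: "1 < p" and x: "f x = 0" and bd: "\<And>z. \<bar>f z\<bar> \<le> C * \<bar>z - x\<bar> powr p"
  shows "(f has_real_derivative 0) (at x)"
  unfolding has_field_derivative_iff
proof (rule Lim_null_comparison)
  show "\<forall>\<^sub>F z in at x. norm ((f z - f x) / (z - x)) \<le> C * \<bar>z - x\<bar> powr (p - 1)"
    unfolding eventually_at
  proof (intro exI[of _ 1] conjI ballI impI)
    fix z assume z: "z \<noteq> x \<and> dist z x < 1"
    have "\<bar>f z\<bar> / \<bar>z - x\<bar> \<le> C * \<bar>z - x\<bar> powr p / \<bar>z - x\<bar>"
      using bd by (intro divide_right_mono) auto
    also have "\<dots> = C * \<bar>z - x\<bar> powr (p - 1)" using z by (simp add: powr_diff)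
    finally show "norm ((f z - f x) / (z - x)) \<le> C * \<bar>z - x\<bar> powr (p - 1)" using x by simp
  qed simp
  have "((\<lambda>z. C * \<bar>z - x\<bar> powr (p - 1)) \<longlongrightarrow> C * \<bar>x - x\<bar> powr (p - 1)) (at x)"
    using p by (intro tendsto_intros) auto
  then show "((\<lambda>z. C * \<bar>z - x\<bar> powr (p - 1)) \<longlongrightarrow> 0) (at x)" by simp
qed

text \<open>
  Integrate the bound \<open>C (L - x) powr (p - 1)\<close> of the derivative and use subadditivity of \<open>t \<mapsto> t powr p\<close>.
\<close>

lemma holder_bound_half:
  fixes G :: "real \<Rightarrow> real"
  assumes L: "0 < L" and p: "0 < p" "p \<le> 1" and C: "0 \<le> C"
    and out: "\<And>x. L \<le> \<bar>x\<bar> \<Longrightarrow> G x = 0"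
    and bd: "\<And>x. \<bar>x\<bar> < L \<Longrightarrow> \<bar>G x\<bar> \<le> C / p * (L - \<bar>x\<bar>) powr p"
    and der: "\<And>x. \<bar>x\<bar> < L \<Longrightarrow> \<exists>D. (G has_real_derivative D) (at x) \<and> \<bar>D\<bar> \<le> C * (L - \<bar>x\<bar>) powr (p - 1)"
    and xy: "0 \<le> x" "x \<le> y" "y \<le> L"
  shows "\<bar>G x - G y\<bar> \<le> C / p * (y - x) powr p"
proof (cases "y = L")
  case True
  show ?thesis
  proof (cases "x < L")
    case False
    then show ?thesis using True xy C p out by simp
  qed (use True xy bd[of x] out[of L] L in simp)
next
  case False
  define A where "A t = C / p * (L - t) powr p" for t
  have dA: "(A has_real_derivative - C * (L - t) powr (p - 1)) (at t)" if "t < L" for t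
  proof -
    have "(A has_real_derivative C / p * (p * (L - t) powr (p - of_nat 1) * (0 - 1))) (at t)"
      unfolding A_def[abs_def] using that by (intro DERIV_cmult DERIV_fun_powr DERIV_diff DERIV_const DERIV_ident) auto
    then show ?thesis using p by simp
  qed
  have *: "c * G y + A y \<le> c * G x + A x" if c: "\<bar>c\<bar> = 1" for c
  proof (rule DERIV_nonpos_imp_nonincreasing[OF xy(2)])
    fix t assume t: "x \<le> t" "t \<le> y"
    then have tL: "\<bar>t\<bar> < L" "t < L" "\<bar>t\<bar> = t" using xy False by auto
    obtain D where D: "(G has_real_derivative D) (at t)" "\<bar>D\<bar> \<le> C * (L - t) powr (p - 1)"
      using der[OF tL(1)] tL by auto
    have "((\<lambda>t. c * G t + A t) has_real_derivative c * D + - C * (L - t) powr (p - 1)) (at t)"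
      by (intro DERIV_add DERIV_cmult D dA tL)
    moreover have "\<bar>c * D\<bar> \<le> C * (L - t) powr (p - 1)" using c D by (simp add: abs_mult)
    ultimately show "\<exists>E. ((\<lambda>t. c * G t + A t) has_real_derivative E) (at t) \<and> E \<le> 0"
      by (intro exI conjI) (assumption, linarith)
  qed
  have "\<bar>G x - G y\<bar> \<le> A x - A y" using *[of 1] *[of "-1"] by simp
  also have "\<dots> = C / p * ((L - x) powr p - (L - y) powr p)" by (simp add: A_def algebra_simps)
  also have "\<dots> \<le> C / p * (y - x) powr p"
    using powr_subadditive[of "L - y" "y - x" p] xy p C by (intro mult_left_mono) auto
  finally show ?thesis .
qed

lemma holder_bound_zero_extension:
  fixes G :: "real \<Rightarrow> real"
  assumes L: "0 < L" and p: "0 < p" "p \<le> 1" and C: "0 \<le> C"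
    and out: "\<And>x. L \<le> \<bar>x\<bar> \<Longrightarrow> G x = 0"
    and bd: "\<And>x. \<bar>x\<bar> < L \<Longrightarrow> \<bar>G x\<bar> \<le> C / p * (L - \<bar>x\<bar>) powr p"
    and der: "\<And>x. \<bar>x\<bar> < L \<Longrightarrow> \<exists>D. (G has_real_derivative D) (at x) \<and> \<bar>D\<bar> \<le> C * (L - \<bar>x\<bar>) powr (p - 1)"
  shows "\<bar>G x - G y\<bar> \<le> 2 * (C / p) * \<bar>x - y\<bar> powr p"
proof -
  define K where "K = C / p"
  have K: "0 \<le> K" using C p by (simp add: K_def)
  have right: "\<bar>G x - G y\<bar> \<le> K * (y - x) powr p" if "0 \<le> x" "x \<le> y" "y \<le> L" for x y
    unfolding K_def by (rule holder_bound_half[OF L p C out bd der that])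
  have left: "\<bar>G (- x) - G (- y)\<bar> \<le> K * (y - x) powr p" if "0 \<le> x" "x \<le> y" "y \<le> L" for x y
    unfolding K_def
  proof (rule holder_bound_half[where G = "\<lambda>x. G (- x)", OF L p C _ _ _ that])
    fix z :: real assume z: "\<bar>z\<bar> < L"
    obtain D where D: "(G has_real_derivative D) (at (- z))" "\<bar>D\<bar> \<le> C * (L - \<bar>z\<bar>) powr (p - 1)"
      using der[of "- z"] z by auto
    then have "((\<lambda>x. G (- x)) has_real_derivative - D) (at z)" by (simp add: DERIV_mirror)
    then show "\<exists>D. ((\<lambda>x. G (- x)) has_real_derivative D) (at z) \<and> \<bar>D\<bar> \<le> C * (L - \<bar>z\<bar>) powr (p - 1)"
      using D by (intro exI[of _ "- D"]) simp
    show "\<bar>G (- z)\<bar> \<le> C / p * (L - \<bar>z\<bar>) powr p" using bd[of "- z"] z by simp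
  next
    fix z :: real assume "L \<le> \<bar>z\<bar>"
    then show "G (- z) = 0" using out[of "- z"] by simp
  qed
  have inside: "\<bar>G x - G y\<bar> \<le> 2 * K * (y - x) powr p" if xy: "- L \<le> x" "x \<le> y" "y \<le> L" for x y
  proof -
    have dbl: "K * (y - x) powr p \<le> 2 * K * (y - x) powr p" using K by (intro mult_right_mono) auto
    consider "0 \<le> x" | "y \<le> 0" | "x < 0" "0 < y" by linarith
    then show ?thesis
    proof cases
      case 1
      then show ?thesis using right[of x y] xy dbl by linarith
    next
      case 2
      have "\<bar>G (- (- y)) - G (- (- x))\<bar> \<le> K * (- x - (- y)) powr p" using 2 xy by (intro left) auto
      then show ?thesis using dbl by (simp add: abs_minus_commute)
    next
      case 3
      have "\<bar>G 0 - G y\<bar> \<le> K * (y - 0) powr p" using 3 xy by (intro right) auto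
      also have "\<dots> \<le> K * (y - x) powr p" using 3 K p by (intro mult_left_mono powr_mono2) auto
      finally have A: "\<bar>G 0 - G y\<bar> \<le> K * (y - x) powr p" .
      have "\<bar>G (- 0) - G (- (- x))\<bar> \<le> K * (- x - 0) powr p" using 3 xy by (intro left) auto
      also have "\<dots> \<le> K * (y - x) powr p" using 3 K p by (intro mult_left_mono powr_mono2) auto
      finally have B: "\<bar>G 0 - G x\<bar> \<le> K * (y - x) powr p" by simp
      show ?thesis using A B by linarith
    qed
  qed
  define cl where "cl x = max (- L) (min x L)" for x
  have clb: "- L \<le> cl x" "cl x \<le> L" for x using L by (auto simp: cl_def)
  have Gcl: "G x = G (cl x)" for x
  proof (cases "\<bar>x\<bar> \<le> L")
    case True
    then show ?thesis by (simp add: cl_def abs_le_iff)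
  next
    case False
    then have "L < x \<or> x < - L" by linarith
    then have "cl x = L \<or> cl x = - L" using L by (auto simp: cl_def)
    then have "\<bar>cl x\<bar> = L" using L by auto
    then show ?thesis using False out by simp
  qed
  have main: "\<bar>G x - G y\<bar> \<le> 2 * K * \<bar>x - y\<bar> powr p" if "x \<le> y" for x y
  proof -
    have cxy: "cl x \<le> cl y" "cl y - cl x \<le> \<bar>x - y\<bar>" using that by (auto simp: cl_def)
    have "\<bar>G (cl x) - G (cl y)\<bar> \<le> 2 * K * (cl y - cl x) powr p" by (intro inside clb cxy)
    also have "\<dots> \<le> 2 * K * \<bar>x - y\<bar> powr p" using cxy K p by (intro mult_left_mono powr_mono2) auto
    finally show ?thesis using Gcl by simp
  qed
  show ?thesis
    using main[of x y] main[of y x] unfolding K_def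
    by (cases "x \<le> y") (auto simp: abs_minus_commute)
qed

lemma continuous_on_of_holder:
  fixes f :: "real \<Rightarrow> real"
  assumes p: "0 < p" and bd: "\<And>x y. \<bar>f x - f y\<bar> \<le> C * \<bar>x - y\<bar> powr p"
  shows "continuous_on UNIV f"
  unfolding continuous_on_eq_continuous_at[OF open_UNIV] isCont_def
proof
  fix x
  have "((\<lambda>z. C * \<bar>z - x\<bar> powr p) \<longlongrightarrow> C * \<bar>x - x\<bar> powr p) (at x)"
    using p by (intro tendsto_intros) auto
  then have z: "((\<lambda>z. C * \<bar>z - x\<bar> powr p) \<longlongrightarrow> 0) (at x)" by simp
  have "((\<lambda>z. f z - f x) \<longlongrightarrow> 0) (at x)"
    by (rule Lim_null_comparison[OF _ z]) (use bd in auto)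
  then show "(f \<longlongrightarrow> f x) (at x)" by (simp add: LIM_zero_iff)
qed

text \<open>
  If \<open>f\<close> and its derivatives vanish at \<open>\<plusminus>L\<close> like the corresponding derivatives of \<open>(L - \<bar>x\<bar>) powr (k + p)\<close>, then
  all derivatives up to order \<open>k\<close> extend by zero: those of order below \<open>k\<close> decay superlinearly, so the extension
  is again differentiable at \<open>\<plusminus>L\<close>, and the \<open>k\<close>-th is Hoelder continuous by the integrated bound on the derivative of order \<open>k + 1\<close>.
\<close>

lemma holder_class_zero_extension:
  fixes f :: "real \<Rightarrow> real"
  assumes L: "0 < L" and p: "0 < p" "p \<le> 1" and sm: "smooth_on f {-L<..<L}"
    and out: "\<And>x. L \<le> \<bar>x\<bar> \<Longrightarrow> f x = 0"
    and bd: "\<And>j. j \<le> Suc k \<Longrightarrow>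
               \<exists>C. \<forall>x\<in>{-L<..<L}. \<bar>(deriv ^^ j) f x\<bar> \<le> C * (L - \<bar>x\<bar>) powr (real k + p - real j)"
  shows "holder_class k p f"
proof -
  define F where "F j x = (if \<bar>x\<bar> < L then (deriv ^^ j) f x else 0)" for j x
  have inI: "x \<in> {-L<..<L} \<longleftrightarrow> \<bar>x\<bar> < L" for x by auto
  have dF: "(F j has_real_derivative F (Suc j) x) (at x)" if x: "\<bar>x\<bar> < L" for j x
  proof (rule has_field_derivative_transform_within_open[where f = "(deriv ^^ j) f" and S = "{-L<..<L}"])
    show "((deriv ^^ j) f has_real_derivative F (Suc j) x) (at x)"
      using smooth_on_has_derivative[OF sm, of x j] x inI[of x] by (simp add: F_def del: greaterThanLessThan_iff)
    show "x \<in> {-L<..<L}" using x inI by blast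
    fix z assume "z \<in> {-L<..<L}"
    then show "(deriv ^^ j) f z = F j z" by (auto simp: F_def)
  qed simp
  have Fb: "\<exists>C\<ge>0. \<forall>x. \<bar>x\<bar> < L \<longrightarrow> \<bar>F j x\<bar> \<le> C * (L - \<bar>x\<bar>) powr (real k + p - real j)" if j: "j \<le> Suc k" for j
  proof -
    obtain C where C: "\<forall>x\<in>{-L<..<L}. \<bar>(deriv ^^ j) f x\<bar> \<le> C * (L - \<bar>x\<bar>) powr (real k + p - real j)" using bd[OF j] by blast
    show ?thesis
    proof (intro exI[of _ "\<bar>C\<bar>"] conjI allI impI)
      fix x assume x: "\<bar>x\<bar> < L"
      have "\<bar>F j x\<bar> \<le> C * (L - \<bar>x\<bar>) powr (real k + p - real j)" using C x inI[of x] by (simp add: F_def del: greaterThanLessThan_iff)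
      also have "\<dots> \<le> \<bar>C\<bar> * (L - \<bar>x\<bar>) powr (real k + p - real j)" by (intro mult_right_mono) auto
      finally show "\<bar>F j x\<bar> \<le> \<bar>C\<bar> * (L - \<bar>x\<bar>) powr (real k + p - real j)" .
    qed simp
  qed
  have dFo: "(F j has_real_derivative 0) (at x)" if x: "L \<le> \<bar>x\<bar>" and j: "j < k" for j x
  proof -
    obtain C where C: "0 \<le> C" "\<And>x. \<bar>x\<bar> < L \<Longrightarrow> \<bar>F j x\<bar> \<le> C * (L - \<bar>x\<bar>) powr (real k + p - real j)"
      using Fb[of j] j by auto
    have e: "1 < real k + p - real j" using j p by linarith
    show ?thesis
    proof (rule has_derivative_zero_of_superlinear[OF e, where C = C])
      show "F j x = 0" using x by (simp add: F_def)
      fix z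
      show "\<bar>F j z\<bar> \<le> C * \<bar>z - x\<bar> powr (real k + p - real j)"
      proof (cases "\<bar>z\<bar> < L")
        case True
        have "L - \<bar>z\<bar> \<le> \<bar>z - x\<bar>" using x by linarith
        then have "C * (L - \<bar>z\<bar>) powr (real k + p - real j) \<le> C * \<bar>z - x\<bar> powr (real k + p - real j)"
          using C True e by (intro mult_left_mono powr_mono2) auto
        then show ?thesis using C(2)[OF True] by linarith
      qed (use C in \<open>simp add: F_def\<close>)
    qed
  qed
  have dF': "(F j has_real_derivative F (Suc j) x) (at x)" if "j < k" for j x
    using dF[of x j] dFo[of x j] that by (cases "\<bar>x\<bar> < L") (auto simp: F_def)
  have eq: "(deriv ^^ j) f = F j" if "j \<le> k" for j
    using that
  proof (induction j)
    case 0
    then show ?case using out by (auto simp: F_def fun_eq_iff)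
  next
    case (Suc j)
    then have "(deriv ^^ Suc j) f = deriv (F j)" by simp
    also have "\<dots> = F (Suc j)" using dF'[of j] Suc.prems by (auto simp: fun_eq_iff intro: DERIV_imp_deriv)
    finally show ?case .
  qed
  obtain C1 where C1: "0 \<le> C1" "\<And>x. \<bar>x\<bar> < L \<Longrightarrow> \<bar>F k x\<bar> \<le> C1 * (L - \<bar>x\<bar>) powr p"
    using Fb[of k] by auto
  obtain C2 where C2: "0 \<le> C2" "\<And>x. \<bar>x\<bar> < L \<Longrightarrow> \<bar>F (Suc k) x\<bar> \<le> C2 * (L - \<bar>x\<bar>) powr (p - 1)"
    using Fb[of "Suc k"] by (auto simp: algebra_simps)
  define C where "C = max (C1 * p) C2"
  have C: "0 \<le> C" "C1 \<le> C / p" "C2 \<le> C" using C1 C2 p by (auto simp: C_def field_simps)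
  have H: "\<bar>F k x - F k y\<bar> \<le> 2 * (C / p) * \<bar>x - y\<bar> powr p" for x y
  proof (rule holder_bound_zero_extension[OF L p C(1)])
    show "F k x = 0" if "L \<le> \<bar>x\<bar>" for x using that by (simp add: F_def)
    fix x assume x: "\<bar>x\<bar> < L"
    show "\<bar>F k x\<bar> \<le> C / p * (L - \<bar>x\<bar>) powr p"
      by (rule order_trans[OF C1(2)[OF x]]) (intro mult_right_mono C; simp)
    have "\<bar>F (Suc k) x\<bar> \<le> C * (L - \<bar>x\<bar>) powr (p - 1)"
      by (rule order_trans[OF C2(2)[OF x]]) (intro mult_right_mono C; simp)
    then show "\<exists>D. (F k has_real_derivative D) (at x) \<and> \<bar>D\<bar> \<le> C * (L - \<bar>x\<bar>) powr (p - 1)"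
      using dF[OF x] by blast
  qed
  have "Ck_on k f UNIV"
    unfolding Ck_on_def
  proof (intro conjI allI impI ballI)
    show "(deriv ^^ j) f differentiable at x" if "j < k" for j x
      using dF'[OF that] eq[of j] that real_differentiable_def by (metis less_imp_le)
    show "continuous_on UNIV ((deriv ^^ k) f)"
      unfolding eq[OF order_refl] by (rule continuous_on_of_holder[OF p(1) H])
  qed
  then show ?thesis
    unfolding holder_class_def eq[OF order_refl] using H by blast
qed

lemma orbit_ideal_bound:
  assumes yh: "\<And>x. x \<in> S \<Longrightarrow> \<bar>y x\<bar> \<le> B" "\<And>x. x \<in> S \<Longrightarrow> \<bar>h x\<bar> \<le> B" and w: "\<And>x. x \<in> S \<Longrightarrow> 0 \<le> w x"
    and G: "\<And>g. g \<in> G \<Longrightarrow> \<exists>C. \<forall>x\<in>S. \<bar>g x\<bar> \<le> C * w x"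
    and f: "f \<in> orbit_ideal y h G"
  shows "\<exists>C. \<forall>x\<in>S. \<bar>f x\<bar> \<le> C * w x"
  using f
proof induction
  case (gen g)
  then show ?case by (rule G)
next
  case (add f g)
  then obtain C D where CD: "\<forall>x\<in>S. \<bar>f x\<bar> \<le> C * w x" "\<forall>x\<in>S. \<bar>g x\<bar> \<le> D * w x" by blast
  show ?case
  proof (intro exI[of _ "C + D"] ballI)
    fix x assume "x \<in> S"
    then have "\<bar>f x\<bar> \<le> C * w x" "\<bar>g x\<bar> \<le> D * w x" using CD by auto
    then show "\<bar>f x + g x\<bar> \<le> (C + D) * w x" using abs_triangle_ineq[of "f x" "g x"] by (simp add: distrib_right)
  qed
next
  case (scale f c)
  then obtain C where C: "\<forall>x\<in>S. \<bar>f x\<bar> \<le> C * w x" by blast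
  have "\<bar>c * f x\<bar> \<le> \<bar>c\<bar> * C * w x" if "x \<in> S" for x
    using mult_left_mono[of "\<bar>f x\<bar>" "C * w x" "\<bar>c\<bar>"] C that by (simp add: abs_mult)
  then show ?case by blast
next
  case (mult_y f)
  then obtain C where C: "\<forall>x\<in>S. \<bar>f x\<bar> \<le> C * w x" by blast
  have "\<bar>y x * f x\<bar> \<le> B * C * w x" if "x \<in> S" for x
  proof -
    have "0 \<le> B" using yh(1)[OF that] by linarith
    then show ?thesis
      using mult_mono[of "\<bar>y x\<bar>" B "\<bar>f x\<bar>" "C * w x"] C yh(1)[OF that] that
      by (simp add: abs_mult mult.assoc)
  qed
  then show ?case by blast
next
  case (mult_h f)
  then obtain C where C: "\<forall>x\<in>S. \<bar>f x\<bar> \<le> C * w x" by blast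
  have "\<bar>h x * f x\<bar> \<le> B * C * w x" if "x \<in> S" for x
  proof -
    have "0 \<le> B" using yh(2)[OF that] by linarith
    then show ?thesis
      using mult_mono[of "\<bar>h x\<bar>" B "\<bar>f x\<bar>" "C * w x"] C yh(2)[OF that] that
      by (simp add: abs_mult mult.assoc)
  qed
  then show ?case by blast
qed

lemma bound_up_to_boundary:
  fixes g :: "real \<Rightarrow> real"
  assumes X1: "0 < X1" "X1 < L" and cont: "continuous_on {-L<..<L} g"
    and bd: "\<And>x. X1 < \<bar>x\<bar> \<Longrightarrow> \<bar>x\<bar> < L \<Longrightarrow> \<bar>g x\<bar> \<le> C * (L - \<bar>x\<bar>) powr p"
  shows "\<exists>C. \<forall>x\<in>{-L<..<L}. \<bar>g x\<bar> \<le> C * (L - \<bar>x\<bar>) powr p"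
proof -
  have "continuous_on {-X1..X1} (\<lambda>x. g x / (L - \<bar>x\<bar>) powr p)"
    using X1 by (intro continuous_intros continuous_on_subset[OF cont]) auto
  then have "bounded ((\<lambda>x. g x / (L - \<bar>x\<bar>) powr p) ` {-X1..X1})"
    by (intro compact_imp_bounded compact_continuous_image) auto
  then obtain B where "\<forall>x\<in>{-X1..X1}. norm (g x / (L - \<bar>x\<bar>) powr p) \<le> B"
    unfolding bounded_iff by blast
  then have B: "\<bar>g x / (L - \<bar>x\<bar>) powr p\<bar> \<le> B" if "x \<in> {-X1..X1}" for x
    using that by (metis real_norm_def)
  show ?thesis
  proof (intro exI[of _ "max B C"] ballI)
    fix x assume x: "x \<in> {-L<..<L}"
    show "\<bar>g x\<bar> \<le> max B C * (L - \<bar>x\<bar>) powr p"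
    proof (cases "\<bar>x\<bar> \<le> X1")
      case True
      then have "x \<in> {-X1..X1}" by (simp add: abs_le_iff)
      then have "\<bar>g x / (L - \<bar>x\<bar>) powr p\<bar> \<le> B" by (rule B)
      moreover have "0 < (L - \<bar>x\<bar>) powr p" using True X1 by simp
      ultimately have "\<bar>g x\<bar> \<le> B * (L - \<bar>x\<bar>) powr p" by (simp add: abs_divide divide_le_eq)
      also have "\<dots> \<le> max B C * (L - \<bar>x\<bar>) powr p" by (intro mult_right_mono) auto
      finally show ?thesis .
    next
      case False
      then have "\<bar>g x\<bar> \<le> C * (L - \<bar>x\<bar>) powr p" using x by (intro bd) auto
      also have "\<dots> \<le> max B C * (L - \<bar>x\<bar>) powr p" by (intro mult_right_mono) auto
      finally show ?thesis .
    qed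
  qed
qed

section \<open>Decay at the boundary of the support\<close>

text \<open>
  The vorticity vanishes at \<open>\<plusminus>L\<close> at least like this power of the distance. For \<open>a = 1\<close> the general formula would give
  \<open>beta 1 = 0\<close>, while the vorticity of the explicit orbit vanishes linearly.
\<close>

definition vorticity_exponent :: "real \<Rightarrow> real" where
  "vorticity_exponent a = (if a = 1 then 1 else beta a)"

text \<open>
  All that the regularity proof needs to know about the orbit near \<open>L\<close>. The velocity gradient decays one power of
  \<open>V\<close> better than the vorticity, as \<open>\<Omega>\<close> is a multiple of \<open>(V y') / V\<close>. The bound on \<open>h\<close> occurs twice because in
  the equation for \<open>y\<close> it competes with \<open>y\<close>, whereas the regularity of \<open>\<Theta>\<close> needs its own exponent.
\<close>

definition boundary_bounds where
  "boundary_bounds a L V y h \<longleftrightarrow> (\<exists>X1 C. 0 < X1 \<and> X1 < L \<and> 0 < C \<and> (\<forall>x\<in>{X1<..<L}.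
     V x \<le> C * (L - x) \<and> L - x \<le> C * V x \<and>
     \<bar>y x\<bar> \<le> C * V x powr (vorticity_exponent a + 1) \<and>
     \<bar>h x\<bar> \<le> C * V x powr (vorticity_exponent a + 1) \<and> \<bar>h x\<bar> \<le> C * V x powr gamma a))"

lemma vorticity_exponent_gamma:
  assumes "2 / 3 < a" "a \<le> (1::real)"
  shows "0 < vorticity_exponent a" "2 \<le> gamma a"
proof -
  show "0 < vorticity_exponent a" using assms by (auto simp: vorticity_exponent_def beta_def)
  have "2 / 1 \<le> 2 / a" using assms by (intro divide_left_mono) auto
  moreover have "0 \<le> 2 * (1 - a) / (3 * a - 2)" using assms by simp
  ultimately show "2 \<le> gamma a" unfolding gamma_def by linarith
qed

text \<open>
  Near \<open>L\<close> the derivative of \<open>V\<close> is close to \<open>c\<^sub>l < 0\<close>, so \<open>V\<close> is comparable to the distance to \<open>L\<close>.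
\<close>

lemma linear_at_boundary:
  fixes V :: "real \<Rightarrow> real"
  assumes X1: "X1 < L" and k: "0 < k"
    and dV: "\<And>x. x \<in> {X1<..<L} \<Longrightarrow> \<exists>D. (V has_real_derivative D) (at x) \<and> - 2 * k \<le> D \<and> D \<le> - (k / 2)"
    and lim: "(V \<longlongrightarrow> 0) (at_left L)" and x: "x \<in> {X1<..<L}"
  shows "k / 2 * (L - x) \<le> V x" "V x \<le> 2 * k * (L - x)"
proof -
  have *: "V x' + k / 2 * x' \<le> V x + k / 2 * x" "V x + 2 * k * x \<le> V x' + 2 * k * x'" if xx: "x < x'" "x' < L" for x'
  proof -
    show "V x' + k / 2 * x' \<le> V x + k / 2 * x"
    proof (rule DERIV_nonpos_imp_nonincreasing[of x x' "\<lambda>x. V x + k / 2 * x"])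
      fix z assume "x \<le> z" "z \<le> x'"
      then obtain D where D: "(V has_real_derivative D) (at z)" "D \<le> - (k / 2)" using dV[of z] xx x by auto
      have "((\<lambda>x. V x + k / 2 * x) has_real_derivative D + k / 2) (at z)"
        by (auto intro!: derivative_eq_intros D)
      then show "\<exists>E. ((\<lambda>x. V x + k / 2 * x) has_real_derivative E) (at z) \<and> E \<le> 0" using D(2) by force
    qed (use that in auto)
    show "V x + 2 * k * x \<le> V x' + 2 * k * x'"
    proof (rule DERIV_nonneg_imp_nondecreasing[of x x' "\<lambda>x. V x + 2 * k * x"])
      fix z assume "x \<le> z" "z \<le> x'"
      then obtain D where D: "(V has_real_derivative D) (at z)" "- 2 * k \<le> D" using dV[of z] xx x by auto
      have "((\<lambda>x. V x + 2 * k * x) has_real_derivative D + 2 * k) (at z)"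
        by (auto intro!: derivative_eq_intros D)
      then show "\<exists>E. ((\<lambda>x. V x + 2 * k * x) has_real_derivative E) (at z) \<and> 0 \<le> E" using D(2) by force
    qed (use that in auto)
  qed
  have ev: "\<forall>\<^sub>F x' in at_left L. x < x' \<and> x' < L"
    using x eventually_at_left_real[of x L] by (auto elim: eventually_mono)
  have nb: "at_left L \<noteq> bot" by simp
  have t1: "((\<lambda>x'. V x' + c * x') \<longlongrightarrow> 0 + c * L) (at_left L)" for c by (intro tendsto_intros lim)
  have "0 + k / 2 * L \<le> V x + k / 2 * x"
    by (rule tendsto_upperbound[OF t1 _ nb]) (use ev * in \<open>auto elim: eventually_mono\<close>)
  then show "k / 2 * (L - x) \<le> V x" by (simp add: right_diff_distrib)
  have "V x + 2 * k * x \<le> 0 + 2 * k * L"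
    by (rule tendsto_lowerbound[OF t1 _ nb]) (use ev * in \<open>auto elim: eventually_mono\<close>)
  then show "V x \<le> 2 * k * (L - x)" by (simp add: right_diff_distrib)
qed

text \<open>
  In the time \<open>\<tau>\<close> the linearisation at \<open>(0, 0)\<close> damps \<open>y\<close> at rate \<open>1\<close>, \<open>h\<close> at rate \<open>2\<close> and \<open>V\<close> at rate \<open>k = -c\<^sub>l\<close>. The
  exponents asked for are slightly smaller than the ratios of these rates: with \<open>d = (1 - a) / a > 0\<close> one has
  \<open>q k = 1 - d\<close> for \<open>q = beta a + 1\<close> and \<open>gamma a * k = 2 - 4 d\<^sup>2\<close>. The remaining gap absorbs the nonlinear terms as soon as
  \<open>\<bar>y\<bar>\<close> is small, so that \<open>(y\<^sup>2 + M h\<^sup>2) V powr (- 2 q)\<close> and \<open>h V powr (- gamma a)\<close> are nonincreasing near \<open>L\<close>.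
\<close>

lemma boundary_decay:
  fixes a L :: real
  assumes a: "2 / 3 < a" "a < 1" and L: "0 < L"
    and red: "reduced_system a {0<..<L} V y h"
    and pos: "\<And>x. x \<in> {0<..<L} \<Longrightarrow> 0 < V x \<and> 0 < h x"
    and lim: "(V \<longlongrightarrow> 0) (at_left L)" "(y \<longlongrightarrow> 0) (at_left L)"
  shows "boundary_bounds a L V y h"
proof -
  define k where "k = - coeff_l a"
  define q where "q = beta a + 1"
  define g where "g = gamma a"
  define d where "d = (1 - a) / a"
  define M where "M = 4 * a\<^sup>2 / d"
  have k: "0 < k" using a by (simp add: k_def coeff_l_def field_simps)
  have d: "0 < d" using a by (simp add: d_def)
  have q: "0 < q" using vorticity_exponent_gamma(1)[of a] a by (simp add: q_def vorticity_exponent_def)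
  have g: "0 < g" using vorticity_exponent_gamma[of a] a by (simp add: g_def)
  have M: "0 < M" using d a by (simp add: M_def)
  have qk: "q * k = 1 - d"
    using a by (simp add: q_def k_def d_def beta_def coeff_l_def field_simps)
  have gk: "g * k = 2 - 4 * d\<^sup>2"
  proof -
    have "3 * a - 2 \<noteq> 0" "a \<noteq> 0" using a by auto
    then show ?thesis
      by (simp add: g_def k_def d_def gamma_def coeff_l_def field_simps power2_eq_square)
  qed
  \<comment> \<open>the neighbourhood of \<open>y = 0\<close> in which the gaps \<open>d\<close> and \<open>4 d\<^sup>2\<close> dominate the terms with a factor \<open>y\<close>\<close>
  define e where "e = Min {d / (1 + 2 * q), 1 / (4 / a + 2 * q), 4 * d\<^sup>2 / (2 / a + g), k / 2}"
  have den: "0 < 1 + 2 * q" "0 < 4 / a + 2 * q" "0 < 2 / a + g" using q g a by (auto intro: add_pos_pos)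
  have e: "0 < e" "e * (1 + 2 * q) \<le> d" "e * (4 / a + 2 * q) \<le> 1" "e * (2 / a + g) \<le> 4 * d\<^sup>2" "e \<le> k / 2"
  proof -
    have le: "e \<le> d / (1 + 2 * q)" "e \<le> 1 / (4 / a + 2 * q)" "e \<le> 4 * d\<^sup>2 / (2 / a + g)" "e \<le> k / 2"
      unfolding e_def by (rule Min_le; simp)+
    show "e * (1 + 2 * q) \<le> d" "e * (4 / a + 2 * q) \<le> 1" "e * (2 / a + g) \<le> 4 * d\<^sup>2" "e \<le> k / 2"
      using le den by (simp_all only: pos_le_divide_eq)
    show "0 < e" using den d k by (simp add: e_def)
  qed
  have small: "y x * c \<le> e * \<bar>c\<bar>" if "\<bar>y x\<bar> < e" for x c
  proof -
    have "y x * c \<le> \<bar>y x\<bar> * \<bar>c\<bar>" by (simp add: abs_mult[symmetric])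
    also have "\<dots> \<le> e * \<bar>c\<bar>" using that by (intro mult_right_mono) auto
    finally show ?thesis .
  qed
  have "\<forall>\<^sub>F x in at_left L. \<bar>y x\<bar> < e"
    using tendstoD[OF lim(2) e(1)] by simp
  then obtain X2 where X2: "X2 < L" "\<And>x. X2 < x \<Longrightarrow> x < L \<Longrightarrow> \<bar>y x\<bar> < e"
    using eventually_at_left[of "L - 1" L] by auto
  define X1 where "X1 = max X2 (L / 2)"
  have X1: "0 < X1" "X1 < L" using X2 L by (auto simp: X1_def)
  have ye: "\<bar>y x\<bar> < e" if "x \<in> {X1<..<L}" for x using that X2 by (auto simp: X1_def)
  have in0: "x \<in> {0<..<L}" if "x \<in> {X1<..<L}" for x using that X1 by auto
  note V_pos = pos[OF in0, THEN conjunct1] and h_pos = pos[OF in0, THEN conjunct2]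
  have dV: "(V has_real_derivative y x - k) (at x)" if "x \<in> {X1<..<L}" for x
    using reduced_systemD(1)[OF red in0[OF that]] by (simp add: k_def add.commute)
  have dy: "(y has_real_derivative (y x * (y x - 2) / 2 - 2 * a * h x) / V x) (at x)" if "x \<in> {X1<..<L}" for x
    using reduced_systemD(2)[OF red in0[OF that]] V_pos[OF that] by simp
  have dh: "(h has_real_derivative (2 / a * (y x - a) * h x) / V x) (at x)" if "x \<in> {X1<..<L}" for x
    using reduced_systemD(3)[OF red in0[OF that]] V_pos[OF that] by simp
  have dP: "((\<lambda>x. V x powr r) has_real_derivative r * (y x - k) * (V x powr r / V x)) (at x)" if "x \<in> {X1<..<L}" for x r
    using DERIV_fun_powr[OF dV[OF that] V_pos[OF that], of r] V_pos[OF that] by (simp add: powr_diff mult_ac)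
  have lin: "k / 2 * (L - x) \<le> V x" "V x \<le> 2 * k * (L - x)" if "x \<in> {X1<..<L}" for x
    by (rule linear_at_boundary[OF X1(2) k _ lim(1) that];
        use dV ye e(5) k in \<open>force intro!: exI[of _ "y _ - k"] simp: abs_less_iff\<close>)+
  define E where "E x = ((y x)\<^sup>2 + M * (h x)\<^sup>2) * V x powr (- 2 * q)" for x
  define H where "H x = h x * V x powr (- g)" for x
  have dE: "\<exists>D. (E has_real_derivative D) (at x) \<and> D \<le> 0" if x: "x \<in> {X1<..<L}" for x
  proof -
    let ?A = "2 * y x * ((y x * (y x - 2) / 2 - 2 * a * h x) / V x) + M * (2 * h x * ((2 / a * (y x - a) * h x) / V x))"
    let ?B = "y x * (y x * (y x - 2)) - 4 * a * y x * h x + M * (4 / a * (y x - a) * (h x)\<^sup>2)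
        - 2 * q * (y x - k) * ((y x)\<^sup>2 + M * (h x)\<^sup>2)"
    have "((\<lambda>x. (y x)\<^sup>2 + M * (h x)\<^sup>2) has_real_derivative ?A) (at x)"
      by (auto intro!: derivative_eq_intros dy[OF x] dh[OF x] simp: mult_ac)
    from DERIV_mult[OF this dP[OF x, of "- 2 * q"]]
    have "(E has_real_derivative ?A * V x powr (- 2 * q)
        + - 2 * q * (y x - k) * (V x powr (- 2 * q) / V x) * ((y x)\<^sup>2 + M * (h x)\<^sup>2)) (at x)"
      unfolding E_def[abs_def] .
    also have "?A * V x powr (- 2 * q) + - 2 * q * (y x - k) * (V x powr (- 2 * q) / V x) * ((y x)\<^sup>2 + M * (h x)\<^sup>2)
       = V x powr (- 2 * q) / V x * ?B"
    proof -
      have "?A = (y x * (y x * (y x - 2)) - 4 * a * y x * h x + M * (4 / a * (y x - a) * (h x)\<^sup>2)) / V x"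
        by (simp add: power2_eq_square add_divide_distrib diff_divide_distrib algebra_simps)
      moreover have "N / v * P + - 2 * q * z * (P / v) * S = P / v * (N - 2 * q * z * S)" for N v P z S :: real
        by (simp add: algebra_simps)
      ultimately show ?thesis by (simp only:)
    qed
    finally have D: "(E has_real_derivative V x powr (- 2 * q) / V x * ?B) (at x)" .
    have "?B = (y x)\<^sup>2 * (y x * (1 - 2 * q) - 2 * (1 - q * k)) - 4 * a * y x * h x
        + M * (h x)\<^sup>2 * (y x * (4 / a - 2 * q) - (4 - 2 * (q * k)))"
    proof -
      have "4 / a * (y x - a) = 4 / a * y x - 4" using a by (simp add: field_simps)
      then show ?thesis by (simp only: ) (simp add: power2_eq_square algebra_simps)
    qed
    also have "\<dots> = (y x)\<^sup>2 * (y x * (1 - 2 * q) - 2 * d) - 4 * a * y x * h x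
        + M * (h x)\<^sup>2 * (y x * (4 / a - 2 * q) - (2 + 2 * d))"
      unfolding qk by (simp add: algebra_simps)
    also have "\<dots> \<le> (y x)\<^sup>2 * (- d) - 4 * a * y x * h x + M * (h x)\<^sup>2 * (- 1)"
    proof -
      have "y x * (1 - 2 * q) \<le> e * \<bar>1 - 2 * q\<bar>" by (rule small[OF ye[OF x]])
      also have "\<dots> \<le> e * (1 + 2 * q)" using e q by (intro mult_left_mono) auto
      finally have 1: "y x * (1 - 2 * q) - 2 * d \<le> - d" using e by linarith
      have "y x * (4 / a - 2 * q) \<le> e * \<bar>4 / a - 2 * q\<bar>" by (rule small[OF ye[OF x]])
      also have "\<dots> \<le> e * (4 / a + 2 * q)"
      proof -
        have "0 < 4 / a" using a by simp
        then have "\<bar>4 / a - 2 * q\<bar> \<le> 4 / a + 2 * q" using q by (simp add: abs_le_iff)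
        then show ?thesis using e by (intro mult_left_mono) auto
      qed
      finally have 2: "y x * (4 / a - 2 * q) - (2 + 2 * d) \<le> - 1" using e d by linarith
      have "(y x)\<^sup>2 * (y x * (1 - 2 * q) - 2 * d) \<le> (y x)\<^sup>2 * (- d)"
        by (rule mult_left_mono[OF 1]) simp
      moreover have "M * (h x)\<^sup>2 * (y x * (4 / a - 2 * q) - (2 + 2 * d)) \<le> M * (h x)\<^sup>2 * (- 1)"
        by (rule mult_left_mono[OF 2]) (use M in simp)
      ultimately show ?thesis by linarith
    qed
    also have "\<dots> = - ((d * y x + 2 * a * h x)\<^sup>2 / d)"
      using d by (simp add: M_def field_simps power2_eq_square)
    also have "\<dots> \<le> 0" using d by simp
    finally have "V x powr (- 2 * q) / V x * ?B \<le> 0"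
      using V_pos[OF x] by (intro mult_nonneg_nonpos) auto
    with D show ?thesis by blast
  qed
  have dH: "\<exists>D. (H has_real_derivative D) (at x) \<and> D \<le> 0" if x: "x \<in> {X1<..<L}" for x
  proof -
    have "(H has_real_derivative (2 / a * (y x - a) * h x) / V x * V x powr (- g)
        + - g * (y x - k) * (V x powr (- g) / V x) * h x) (at x)"
      unfolding H_def[abs_def] by (rule DERIV_mult[OF dh[OF x] dP[OF x]])
    also have "(2 / a * (y x - a) * h x) / V x * V x powr (- g) + - g * (y x - k) * (V x powr (- g) / V x) * h x
       = V x powr (- g) / V x * h x * (y x * (2 / a - g) - (2 - g * k))"
      using a by (simp add: algebra_simps diff_divide_distrib add_divide_distrib)
    finally have D: "(H has_real_derivative V x powr (- g) / V x * h x * (y x * (2 / a - g) - (2 - g * k))) (at x)" .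
    have "y x * (2 / a - g) \<le> e * \<bar>2 / a - g\<bar>" by (rule small[OF ye[OF x]])
    also have "\<dots> \<le> e * (2 / a + g)"
    proof -
      have "0 < 2 / a" using a by simp
      then have "\<bar>2 / a - g\<bar> \<le> 2 / a + g" using g by (simp add: abs_le_iff)
      then show ?thesis using e by (intro mult_left_mono) auto
    qed
    finally have "y x * (2 / a - g) - (2 - g * k) \<le> 0" unfolding gk using e by linarith
    then have "V x powr (- g) / V x * h x * (y x * (2 / a - g) - (2 - g * k)) \<le> 0"
      using V_pos[OF x] h_pos[OF x] by (intro mult_nonneg_nonpos) auto
    with D show ?thesis by blast
  qed
  define X3 where "X3 = (X1 + L) / 2"
  have X3: "X1 < X3" "X3 < L" "0 < X3" using X1 by (auto simp: X3_def)
  have mon: "F x \<le> F X3" if "x \<in> {X3<..<L}" "\<And>x. x \<in> {X1<..<L} \<Longrightarrow> \<exists>D. (F has_real_derivative D) (at x) \<and> D \<le> 0"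
    for F :: "real \<Rightarrow> real" and x
    by (rule DERIV_nonpos_imp_nonincreasing) (use that X3 in auto)
  have E0: "0 \<le> E X3" using M by (simp add: E_def)
  have H0: "0 \<le> H X3" using h_pos[of X3] X3 by (simp add: H_def less_imp_le)
  define C where "C = Max {2 * k, 2 / k, sqrt (E X3), sqrt (E X3 / M), H X3}"
  have C: "2 * k \<le> C" "2 / k \<le> C" "sqrt (E X3) \<le> C" "sqrt (E X3 / M) \<le> C" "H X3 \<le> C"
    unfolding C_def by (rule Max_ge; simp)+
  have C0: "0 < C" using C(1) k by linarith
  have pw: "(V x powr q)\<^sup>2 * V x powr (- 2 * q) = 1" if "x \<in> {X1<..<L}" for x
    using V_pos[OF that] by (simp add: power2_eq_square powr_add[symmetric])
  have bound: "\<bar>u\<bar> \<le> sqrt c * V x powr q" if x: "x \<in> {X1<..<L}" and u: "u\<^sup>2 * V x powr (- 2 * q) \<le> c" for u c x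
  proof -
    have "u\<^sup>2 * V x powr (- 2 * q) * (V x powr q)\<^sup>2 \<le> c * (V x powr q)\<^sup>2"
      using u by (intro mult_right_mono) auto
    moreover have "u\<^sup>2 * V x powr (- 2 * q) * (V x powr q)\<^sup>2 = u\<^sup>2 * ((V x powr q)\<^sup>2 * V x powr (- 2 * q))"
      by (simp only: mult_ac)
    ultimately have "u\<^sup>2 \<le> c * (V x powr q)\<^sup>2" unfolding pw[OF x] by linarith
    then have "sqrt (u\<^sup>2) \<le> sqrt (c * (V x powr q)\<^sup>2)" by (rule real_sqrt_le_mono)
    then show ?thesis by (simp add: real_sqrt_mult)
  qed
  have qv: "vorticity_exponent a + 1 = q" using a by (simp add: q_def vorticity_exponent_def)
  show ?thesis
    unfolding boundary_bounds_def qv g_def[symmetric]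
  proof (rule exI[of _ X3], rule exI[of _ C], intro conjI ballI)
    show "0 < X3" "X3 < L" "0 < C" using X3 C0 by auto
    fix x assume x: "x \<in> {X3<..<L}"
    have x1: "x \<in> {X1<..<L}" using x X3 by auto
    have Lx: "0 < L - x" using x by simp
    show "V x \<le> C * (L - x)"
      using lin(2)[OF x1] mult_right_mono[OF C(1), of "L - x"] Lx by linarith
    have "L - x = 2 / k * (k / 2 * (L - x))" using k by simp
    also have "\<dots> \<le> 2 / k * V x" using lin(1)[OF x1] k by (intro mult_left_mono) auto
    also have "\<dots> \<le> C * V x" using C(2) V_pos[OF x1] by (intro mult_right_mono) auto
    finally show "L - x \<le> C * V x" .
    have Ex: "E x \<le> E X3" by (rule mon[OF x dE])
    have n: "0 \<le> M * ((h x)\<^sup>2 * V x powr (- 2 * q))" "0 \<le> (y x)\<^sup>2 * V x powr (- 2 * q)" using M by auto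
    have Es: "E x = (y x)\<^sup>2 * V x powr (- 2 * q) + M * ((h x)\<^sup>2 * V x powr (- 2 * q))"
      by (simp add: E_def algebra_simps)
    have "(y x)\<^sup>2 * V x powr (- 2 * q) \<le> E X3" using Ex n Es by linarith
    from bound[OF x1 this] show "\<bar>y x\<bar> \<le> C * V x powr q"
      by (rule order_trans) (intro mult_right_mono C; simp)
    have "M * ((h x)\<^sup>2 * V x powr (- 2 * q)) \<le> E X3" using Ex n Es by linarith
    then have "(h x)\<^sup>2 * V x powr (- 2 * q) \<le> E X3 / M" using M by (simp add: pos_le_divide_eq mult.commute)
    from bound[OF x1 this] show "\<bar>h x\<bar> \<le> C * V x powr q"
      by (rule order_trans) (intro mult_right_mono C; simp)
    have "h x = H x * V x powr g" using V_pos[OF x1] by (simp add: H_def mult.assoc powr_add[symmetric])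
    also have "\<dots> \<le> C * V x powr g"
      using mon[OF x dH] C(5) by (intro mult_right_mono) auto
    finally show "\<bar>h x\<bar> \<le> C * V x powr g" using h_pos[OF x1] by simp
  qed
qed

section \<open>From the orbit to a profile\<close>

lemma powr_le_of_comparable:
  fixes u v C s :: real
  assumes "0 < u" "0 < v" "0 < C" "u \<le> C * v" "v \<le> C * u"
  shows "u powr s \<le> C powr \<bar>s\<bar> * v powr s"
proof (cases "0 \<le> s")
  case True
  have "u powr s \<le> (C * v) powr s" using assms True by (intro powr_mono2) auto
  then show ?thesis using assms True by (simp add: powr_mult)
next
  case False
  have "v / C \<le> u" using assms by (simp add: pos_divide_le_eq mult.commute)
  then have "u powr s \<le> (v / C) powr s" using assms False by (intro powr_mono2') auto
  also have "\<dots> = v powr s / C powr s" using assms by (simp add: powr_divide)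
  also have "\<dots> = C powr \<bar>s\<bar> * v powr s" using False by (simp add: powr_minus field_simps)
  finally show ?thesis .
qed

text \<open>
  Every derivative is a member of the ideal divided by a power of \<open>V\<close>; near \<open>\<plusminus>L\<close> this decays like the generators
  times that power, and elsewhere continuity suffices.
\<close>

lemma orbit_quotient_boundary_bound:
  fixes F :: "real \<Rightarrow> real"
  assumes X1: "0 < X1" "X1 < L" and C: "0 < C"
    and red: "reduced_system a {-L<..<L} V y h"
    and V: "\<And>x. X1 < \<bar>x\<bar> \<Longrightarrow> \<bar>x\<bar> < L \<Longrightarrow> 0 < \<bar>V x\<bar> \<and> \<bar>V x\<bar> \<le> C * (L - \<bar>x\<bar>) \<and> L - \<bar>x\<bar> \<le> C * \<bar>V x\<bar>"
    and yh: "\<And>x. X1 < \<bar>x\<bar> \<Longrightarrow> \<bar>x\<bar> < L \<Longrightarrow> \<bar>y x\<bar> \<le> B \<and> \<bar>h x\<bar> \<le> B"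
    and GV: "\<And>g x. g \<in> G \<Longrightarrow> X1 < \<bar>x\<bar> \<Longrightarrow> \<bar>x\<bar> < L \<Longrightarrow> \<bar>g x\<bar> \<le> C * \<bar>V x\<bar> powr e"
    and G: "\<And>g. g \<in> G \<Longrightarrow> \<exists>k\<in>orbit_ideal y h G. \<forall>x\<in>{x. X1 < \<bar>x\<bar> \<and> \<bar>x\<bar> < L}. (g has_real_derivative k x / V x) (at x)"
    and f: "f \<in> orbit_ideal y h G"
    and F: "\<And>x. X1 < \<bar>x\<bar> \<Longrightarrow> \<bar>x\<bar> < L \<Longrightarrow> F x = f x / V x ^ m" and sm: "smooth_on F {-L<..<L}"
  shows "\<exists>C. \<forall>x\<in>{-L<..<L}. \<bar>(deriv ^^ j) F x\<bar> \<le> C * (L - \<bar>x\<bar>) powr (e - real m - real j)"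
proof -
  define S where "S = {x. X1 < \<bar>x\<bar> \<and> \<bar>x\<bar> < L}"
  have oS: "open S" unfolding S_def by (intro open_Collect_conj open_Collect_less continuous_intros)
  have redS: "reduced_system a S V y h" by (rule reduced_system_subset[OF red]) (auto simp: S_def)
  have Vnz: "V x \<noteq> 0" if "x \<in> S" for x using V[of x] that by (auto simp: S_def)
  obtain k where k: "k \<in> orbit_ideal y h G" "\<forall>x\<in>S. (deriv ^^ j) F x = k x / V x ^ (m + j)"
    using orbit_quotient_iterated_derivative[OF oS redS Vnz G[folded S_def] f, of F m j] F by (auto simp: S_def)
  obtain D where D: "\<forall>x\<in>S. \<bar>k x\<bar> \<le> D * \<bar>V x\<bar> powr e"
    using orbit_ideal_bound[where S = S and w = "\<lambda>x. \<bar>V x\<bar> powr e" and B = B, OF _ _ _ _ k(1)] yh GV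
    by (auto simp: S_def) blast
  show ?thesis
  proof (rule bound_up_to_boundary[OF X1])
    show "continuous_on {-L<..<L} ((deriv ^^ j) F)" using sm unfolding smooth_on_def Ck_on_def by blast
    fix x assume x: "X1 < \<bar>x\<bar>" "\<bar>x\<bar> < L"
    have xS: "x \<in> S" using x by (simp add: S_def)
    have vx: "0 < \<bar>V x\<bar>" using V[OF x] by blast
    let ?s = "e - real m - real j"
    have "\<bar>(deriv ^^ j) F x\<bar> = \<bar>k x\<bar> / \<bar>V x\<bar> powr (real m + real j)"
      using k(2) xS vx by (simp add: abs_divide power_abs powr_realpow[symmetric])
    also have "\<dots> \<le> D * \<bar>V x\<bar> powr e / \<bar>V x\<bar> powr (real m + real j)"
      using D xS by (intro divide_right_mono) auto
    also have "\<dots> = D * \<bar>V x\<bar> powr ?s" using vx by (simp add: powr_diff powr_add)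
    also have "\<dots> \<le> \<bar>D\<bar> * \<bar>V x\<bar> powr ?s" by (intro mult_right_mono) auto
    also have "\<dots> \<le> \<bar>D\<bar> * (C powr \<bar>?s\<bar> * (L - \<bar>x\<bar>) powr ?s)"
      using V[OF x] x C by (intro mult_left_mono powr_le_of_comparable) auto
    finally show "\<bar>(deriv ^^ j) F x\<bar> \<le> \<bar>D\<bar> * C powr \<bar>?s\<bar> * (L - \<bar>x\<bar>) powr ?s" by (simp add: mult.assoc)
  qed
qed

text \<open>
  The ideal generated by \<open>y\<close> and \<open>h\<close> controls the vorticity, the one generated by \<open>h\<close> alone controls \<open>\<Theta>\<close>.
\<close>

lemma derivative_bounds_up_to_boundary:
  fixes a L :: real
  assumes a: "2 / 3 < a" "a \<le> 1" and L: "0 < L"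
    and red: "reduced_system a {-L<..<L} V y h"
    and sm: "smooth_on y {-L<..<L}" "smooth_on h {-L<..<L}"
    and par: "\<And>x. V (- x) = - V x" "\<And>x. y (- x) = y x" "\<And>x. h (- x) = h x"
    and pos: "\<And>x. 0 < x \<Longrightarrow> x < L \<Longrightarrow> 0 < V x"
    and bb: "boundary_bounds a L V y h"
  shows "\<exists>C. \<forall>x\<in>{-L<..<L}. \<bar>(deriv ^^ j) (deriv y) x\<bar> \<le> C * (L - \<bar>x\<bar>) powr (vorticity_exponent a - real j)"
    and "\<exists>C. \<forall>x\<in>{-L<..<L}. \<bar>(deriv ^^ j) h x\<bar> \<le> C * (L - \<bar>x\<bar>) powr (gamma a - real j)"
    and "\<exists>C. \<forall>x\<in>{-L<..<L}. \<bar>y x\<bar> \<le> C * (L - \<bar>x\<bar>) powr (vorticity_exponent a + 1)"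
proof -
  let ?q = "vorticity_exponent a + 1" and ?S = "\<lambda>X1. {x. X1 < \<bar>x\<bar> \<and> \<bar>x\<bar> < L}"
  obtain X1 C where X1: "0 < X1" "X1 < L" and C: "0 < C" and *: "\<forall>x\<in>{X1<..<L}.
     V x \<le> C * (L - x) \<and> L - x \<le> C * V x \<and> \<bar>y x\<bar> \<le> C * V x powr ?q \<and>
     \<bar>h x\<bar> \<le> C * V x powr ?q \<and> \<bar>h x\<bar> \<le> C * V x powr gamma a"
    using bb unfolding boundary_bounds_def by blast
  have q: "0 < ?q" using vorticity_exponent_gamma[OF a] by simp
  have even: "y \<bar>x\<bar> = y x" "h \<bar>x\<bar> = h x" "\<bar>V \<bar>x\<bar>\<bar> = \<bar>V x\<bar>" for x
    using par by (auto simp: abs_if)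
  have all: "0 < \<bar>V x\<bar> \<and> \<bar>V x\<bar> \<le> C * (L - \<bar>x\<bar>) \<and> L - \<bar>x\<bar> \<le> C * \<bar>V x\<bar> \<and> \<bar>y x\<bar> \<le> C * \<bar>V x\<bar> powr ?q \<and>
     \<bar>h x\<bar> \<le> C * \<bar>V x\<bar> powr ?q \<and> \<bar>h x\<bar> \<le> C * \<bar>V x\<bar> powr gamma a" if "X1 < \<bar>x\<bar>" "\<bar>x\<bar> < L" for x
  proof -
    have "\<bar>x\<bar> \<in> {X1<..<L}" using that by simp
    note b = bspec[OF * this]
    have "0 < V \<bar>x\<bar>" using pos[of "\<bar>x\<bar>"] that X1 by simp
    then have "V \<bar>x\<bar> = \<bar>V x\<bar>" using even(3)[of x] by simp
    with b \<open>0 < V \<bar>x\<bar>\<close> show ?thesis unfolding even by simp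
  qed
  define B where "B = C * (C * L) powr ?q"
  have B: "\<bar>y x\<bar> \<le> B \<and> \<bar>h x\<bar> \<le> B" if x: "X1 < \<bar>x\<bar>" "\<bar>x\<bar> < L" for x
  proof -
    have "C * (L - \<bar>x\<bar>) \<le> C * L" using C by (intro mult_left_mono) auto
    then have "\<bar>V x\<bar> \<le> C * L" using all[OF x] by linarith
    then have "C * \<bar>V x\<bar> powr ?q \<le> B" unfolding B_def using C q by (intro mult_left_mono powr_mono2) auto
    then show ?thesis using all[OF x] by linarith
  qed
  let ?fy = "\<lambda>x. 1 / 2 * (y x * y x) + (- 1 * y x + - 2 * a * h x)"
  let ?fh = "\<lambda>x. 2 / a * (y x * h x) + (2 / a * - a) * h x"
  have Vnz: "V x \<noteq> 0" "x \<in> {-L<..<L}" if "x \<in> ?S X1" for x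
    using all[of x] that by (auto simp: abs_less_iff)
  have dy: "(y has_real_derivative ?fy x / V x) (at x)" if "x \<in> ?S X1" for x
    using reduced_systemD(2)[OF red Vnz(2)[OF that] Vnz(1)[OF that]] by (simp add: field_simps)
  have dh: "(h has_real_derivative ?fh x / V x) (at x)" if "x \<in> ?S X1" for x
  proof -
    have "2 / a * (y x - a) * h x = ?fh x" using a by (simp add: field_simps)
    then show ?thesis using reduced_systemD(3)[OF red Vnz(2)[OF that] Vnz(1)[OF that]] by (simp only:)
  qed
  have Iy: "y \<in> orbit_ideal y h {y, h}" and Ih: "h \<in> orbit_ideal y h {y, h}" and Ih': "h \<in> orbit_ideal y h {h}"
    by (auto intro: orbit_ideal.gen)
  have fy: "?fy \<in> orbit_ideal y h {y, h}" and fh: "?fh \<in> orbit_ideal y h {y, h}" and fh': "?fh \<in> orbit_ideal y h {h}"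
    by (rule Iy Ih Ih' orbit_ideal.add orbit_ideal.scale orbit_ideal.mult_y)+
  have "\<exists>C. \<forall>x\<in>{-L<..<L}. \<bar>(deriv ^^ j) (deriv y) x\<bar> \<le> C * (L - \<bar>x\<bar>) powr (?q - real 1 - real j)"
  proof (rule orbit_quotient_boundary_bound[OF X1 C red _ B, where G = "{y, h}" and f = ?fy])
    show "smooth_on (deriv y) {-L<..<L}" by (rule smooth_on_deriv[OF sm(1)])
    show "?fy \<in> orbit_ideal y h {y, h}" by (rule fy)
    show "deriv y x = ?fy x / V x ^ 1" if "X1 < \<bar>x\<bar>" "\<bar>x\<bar> < L" for x
      using DERIV_imp_deriv[OF dy[of x]] that by simp
    show "\<exists>k\<in>orbit_ideal y h {y, h}. \<forall>x\<in>?S X1. (g has_real_derivative k x / V x) (at x)" if "g \<in> {y, h}" for g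
      using that
    proof (elim insertE emptyE)
      show ?thesis if "g = y" unfolding that using dy fy by (intro bexI[of _ ?fy]) blast+
      show ?thesis if "g = h" unfolding that using dh fh by (intro bexI[of _ ?fh]) blast+
    qed
  qed (use all in auto)
  then show "\<exists>C. \<forall>x\<in>{-L<..<L}. \<bar>(deriv ^^ j) (deriv y) x\<bar> \<le> C * (L - \<bar>x\<bar>) powr (vorticity_exponent a - real j)"
    by simp
  have "\<exists>C. \<forall>x\<in>{-L<..<L}. \<bar>(deriv ^^ j) h x\<bar> \<le> C * (L - \<bar>x\<bar>) powr (gamma a - real 0 - real j)"
  proof (rule orbit_quotient_boundary_bound[OF X1 C red _ B, where G = "{h}" and f = h])
    show "\<exists>k\<in>orbit_ideal y h {h}. \<forall>x\<in>?S X1. (g has_real_derivative k x / V x) (at x)" if "g \<in> {h}" for g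
      using that dh fh' by (intro bexI[of _ ?fh]) auto
  qed (use all sm Ih' in auto)
  then show "\<exists>C. \<forall>x\<in>{-L<..<L}. \<bar>(deriv ^^ j) h x\<bar> \<le> C * (L - \<bar>x\<bar>) powr (gamma a - real j)" by simp
  have "\<exists>C. \<forall>x\<in>{-L<..<L}. \<bar>(deriv ^^ 0) y x\<bar> \<le> C * (L - \<bar>x\<bar>) powr (?q - real 0 - real 0)"
  proof (rule orbit_quotient_boundary_bound[OF X1 C red _ B, where G = "{y, h}" and f = y])
    show "\<exists>k\<in>orbit_ideal y h {y, h}. \<forall>x\<in>?S X1. (g has_real_derivative k x / V x) (at x)" if "g \<in> {y, h}" for g
      using that
    proof (elim insertE emptyE)
      show ?thesis if "g = y" unfolding that using dy fy by (intro bexI[of _ ?fy]) blast+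
      show ?thesis if "g = h" unfolding that using dh fh by (intro bexI[of _ ?fh]) blast+
    qed
  qed (use all sm Iy in auto)
  then show "\<exists>C. \<forall>x\<in>{-L<..<L}. \<bar>y x\<bar> \<le> C * (L - \<bar>x\<bar>) powr ?q" by simp
qed

lemma deriv_even: "(\<And>x::real. f (- x) = f x) \<Longrightarrow> f differentiable (at x) \<Longrightarrow> deriv f (- x) = - deriv f x"
  for f :: "real \<Rightarrow> real"
proof -
  assume e: "\<And>x. f (- x) = f x" and d: "f differentiable (at x)"
  have "(f has_real_derivative deriv f x) (at (- (- x)))" using d DERIV_deriv_iff_real_differentiable by simp
  then have "((\<lambda>x. f (- x)) has_real_derivative - deriv f x) (at (- x))" by (simp only: DERIV_mirror)
  then show ?thesis using e by (simp add: DERIV_imp_deriv)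
qed

lemma deriv_odd: "(\<And>x::real. f (- x) = - f x) \<Longrightarrow> f differentiable (at x) \<Longrightarrow> deriv f (- x) = deriv f x"
  for f :: "real \<Rightarrow> real"
proof -
  assume e: "\<And>x. f (- x) = - f x" and d: "f differentiable (at x)"
  have "(f has_real_derivative deriv f x) (at (- (- x)))" using d DERIV_deriv_iff_real_differentiable by simp
  then have "((\<lambda>x. f (- x)) has_real_derivative - deriv f x) (at (- x))" by (simp only: DERIV_mirror)
  then have "(f has_real_derivative deriv f x) (at (- x))" using DERIV_minus e by fastforce
  then show ?thesis by (simp add: DERIV_imp_deriv)
qed

lemma eq_of_same_derivative:
  fixes f g :: "real \<Rightarrow> real"
  assumes I: "convex I" "c \<in> I" and f: "\<And>x. x \<in> I \<Longrightarrow> (f has_real_derivative d x) (at x)"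
    and g: "\<And>x. x \<in> I \<Longrightarrow> (g has_real_derivative d x) (at x)" and c: "f c = g c" and x: "x \<in> I"
  shows "f x = g x"
proof -
  have "\<exists>k. \<forall>x\<in>I. f x - g x = k"
    by (rule has_field_derivative_zero_constant[OF I(1)])
       (use DERIV_diff[OF f g] in \<open>auto intro: has_field_derivative_at_within\<close>)
  then obtain k where k: "\<And>x. x \<in> I \<Longrightarrow> f x - g x = k" by blast
  show ?thesis using k[OF I(2)] k[OF x] c by simp
qed

text \<open>
  The reduced system is an integrated form of the profile system: the equation for \<open>\<Theta>\<close> is the same in both, and
  the equation for \<open>\<Omega> = - y' / (2 a)\<close> is the derivative of the equation for \<open>y\<close>. The structural condition on \<open>\<Theta>\<close>
  holds because a nonnegative even function vanishing at \<open>0\<close> is the square of an odd one.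
\<close>

lemma profile_from_orbit:
  fixes a L :: real
  assumes a: "0 < a" "a \<le> 1"
    and I: "open I" "0 \<in> I" "\<And>x. x \<in> I \<Longrightarrow> - x \<in> I" "convex I"
    and red: "reduced_system a I V y h" and sm: "smooth_on y I" "smooth_on h I"
    and par: "\<And>x. V (- x) = - V x" "\<And>x. y (- x) = y x" "\<And>x. h (- x) = h x"
    and init: "V 0 = 0" "y 0 = 2" "h 0 = 0"
    and pos: "\<And>x. x \<in> I \<Longrightarrow> 0 < x \<Longrightarrow> 0 < h x"
    and d2h: "\<exists>c>0. (deriv h has_real_derivative c) (at 0)"
    and d2y: "\<exists>c>0. (deriv y has_real_derivative - c) (at 0)"
    and out: "\<And>x. x \<notin> I \<Longrightarrow> y x = 0 \<and> h x = 0 \<and> (y has_real_derivative 0) (at x) \<and> (h has_real_derivative 0) (at x)"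
    and out2: "\<And>x. x \<notin> I \<Longrightarrow> x \<notin> exceptional a L \<Longrightarrow> (deriv y has_real_derivative 0) (at x)"
    and lim: "(y \<longlongrightarrow> 0) at_infinity"
  obtains U where "U 0 = 0" "\<And>x. (U has_real_derivative y x / a) (at x)"
    and "\<And>x. x \<in> I \<Longrightarrow> coeff_l a * x + a * U x = V x"
    and "symmetric_profile a L (\<lambda>x. - deriv y x / (2 * a)) U h"
    and "parity_property (\<lambda>x. - deriv y x / (2 * a)) U h"
    and "origin_property (\<lambda>x. - deriv y x / (2 * a)) U h"
proof -
  have dyI: "((deriv ^^ k) y has_real_derivative (deriv ^^ Suc k) y x) (at x)" if "x \<in> I" for x k
    by (rule smooth_on_has_derivative[OF sm(1) that])
  have dhI: "((deriv ^^ k) h has_real_derivative (deriv ^^ Suc k) h x) (at x)" if "x \<in> I" for x k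
    by (rule smooth_on_has_derivative[OF sm(2) that])
  have dy: "(y has_real_derivative deriv y x) (at x)" for x
    using dyI[of x 0] out[of x] DERIV_imp_deriv[of y 0 x] by (cases "x \<in> I") auto
  have dh: "(h has_real_derivative deriv h x) (at x)" for x
    using dhI[of x 0] out[of x] DERIV_imp_deriv[of h 0 x] by (cases "x \<in> I") auto
  have contya: "continuous_on UNIV (\<lambda>x. y x / a)"
    by (intro continuous_intros DERIV_continuous_on[OF dy[THEN has_field_derivative_at_within]]) (use a in auto)
  obtain U where U: "U 0 = 0" "\<And>x. (U has_real_derivative y x / a) (at x)"
    using continuous_antiderivative[OF contya, of 0 0] by metis
  have dU: "deriv U = (\<lambda>x. y x / a)" using U(2) DERIV_imp_deriv by blast
  have ddU: "((deriv U) has_real_derivative deriv y x / a) (at x)" for x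
    unfolding dU by (rule DERIV_cdivide[OF dy])
  have VU: "coeff_l a * x + a * U x = V x" if x: "x \<in> I" for x
  proof (rule eq_of_same_derivative[OF I(4,2) _ _ _ x])
    show "((\<lambda>x. coeff_l a * x + a * U x) has_real_derivative coeff_l a + y z) (at z)" for z
      using a by (auto intro!: derivative_eq_intros U(2))
    show "(V has_real_derivative coeff_l a + y z) (at z)" if "z \<in> I" for z
      by (rule reduced_systemD(1)[OF red that])
  qed (use U init in simp)
  let ?O = "\<lambda>x. - deriv y x / (2 * a)"
  have oddU: "U (- x) = - U x" for x
  proof -
    have refl: "((\<lambda>x. - U (- x)) has_real_derivative y x / a) (at x)" for x
    proof -
      have "(U has_real_derivative y x / a) (at (- x))" using U(2)[of "- x"] par by simp
      then have "((\<lambda>x. U (- x)) has_real_derivative - (y x / a)) (at x)" by (simp only: DERIV_mirror)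
      from DERIV_minus[OF this] show ?thesis by simp
    qed
    show ?thesis
      using eq_of_same_derivative[of UNIV 0 "\<lambda>x. - U (- x)" "\<lambda>x. y x / a" U x, OF convex_UNIV _ refl U(2)] U(1) by simp
  qed
  have odddy: "deriv y (- x) = - deriv y x" for x
    using deriv_even[of y x] par dy real_differentiable_def by blast
  have h_nonneg: "0 \<le> h x" for x
  proof -
    consider "x \<notin> I" | "x \<in> I" "0 < x" | "x = 0" | "- x \<in> I" "0 < - x" using I(3)[of x] by force
    then show ?thesis using out[of x] pos[of x] pos[of "- x"] par(3)[of x] init by cases auto
  qed
  have ss: "symmetric_structure U h"
    unfolding symmetric_structure_def odd_fun_def
  proof (intro conjI exI[of _ "\<lambda>x. sgn x * sqrt (h x)"] allI)
    fix x
    show "U (- x) = - U x" by (rule oddU)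
    show "sgn (- x) * sqrt (h (- x)) = - (sgn x * sqrt (h x))" using par by (simp add: sgn_minus)
    show "h x = (sgn x * sqrt (h x))\<^sup>2"
      using h_nonneg[of x] init by (cases "x = 0") (auto simp: power_mult_distrib sgn_if)
  qed
  have eq1: "(coeff_l a * x + a * U x) * deriv h x = (coeff_theta + 2 * deriv U x) * h x" for x
  proof (cases "x \<in> I")
    case True
    obtain h' where h': "(h has_real_derivative h') (at x)" "V x * h' = 2 / a * (y x - a) * h x"
      using red True unfolding reduced_system_def by blast
    have "V x * deriv h x = 2 / a * (y x - a) * h x" using h' DERIV_imp_deriv by blast
    then show ?thesis unfolding VU[OF True] dU using a by (simp add: coeff_theta_def field_simps)
  next
    case False
    then show ?thesis using out[of x] DERIV_imp_deriv[of h 0 x] by simp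
  qed
  have eq2: "?O differentiable (at x) \<and> (coeff_l a * x + a * U x) * deriv ?O x = coeff_omega a * ?O x + deriv h x"
    if S: "x \<notin> exceptional a L" for x
  proof (cases "x \<in> I")
    case True
    have d2: "(deriv y has_real_derivative deriv (deriv y) x) (at x)" using dyI[OF True, of 1] by simp
    have dO: "(?O has_real_derivative - deriv (deriv y) x / (2 * a)) (at x)"
      using DERIV_cdivide[OF DERIV_minus[OF d2], of "2 * a"] by simp
    \<comment> \<open>the second equation of the profile system is the derivative of the first equation of the planar system\<close>
    have dl: "((\<lambda>x. V x * deriv y x) has_real_derivative (coeff_l a + y x) * deriv y x + deriv (deriv y) x * V x) (at x)"
      by (rule DERIV_mult[OF reduced_systemD(1)[OF red True] d2])
    have dr: "((\<lambda>x. y x * (y x - 2) / 2 - 2 * a * h x) has_real_derivative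
        (deriv y x * (y x - 2) + deriv y x * y x) / 2 - 2 * a * deriv h x) (at x)"
      by (auto intro!: derivative_eq_intros dy dh)
    have same: "V z * deriv y z = y z * (y z - 2) / 2 - 2 * a * h z" if "z \<in> I" for z
      using red that DERIV_imp_deriv unfolding reduced_system_def by blast
    have "((\<lambda>x. V x * deriv y x) has_real_derivative
        (deriv y x * (y x - 2) + deriv y x * y x) / 2 - 2 * a * deriv h x) (at x)"
      by (rule has_field_derivative_transform_within_open[OF dr I(1) True]) (simp add: same)
    from DERIV_unique[OF dl this]
    have key: "V x * deriv (deriv y) x = (- 1 - coeff_l a) * deriv y x - 2 * a * deriv h x"
      by (simp add: field_simps)
    have "V x * deriv ?O x = - (V x * deriv (deriv y) x) / (2 * a)" using DERIV_imp_deriv[OF dO] by simp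
    also have "\<dots> = coeff_omega a * ?O x + deriv h x"
      unfolding key using a by (simp add: coeff_omega_def coeff_l_def field_simps)
    finally show ?thesis unfolding VU[OF True] using dO real_differentiable_def by blast
  next
    case False
    have "(?O has_real_derivative - 0 / (2 * a)) (at x)"
      by (rule DERIV_cdivide[OF DERIV_minus[OF out2[OF False S]]])
    then have "(?O has_real_derivative 0) (at x)" by simp
    moreover have "deriv y x = 0" "deriv h x = 0" using out[OF False] DERIV_imp_deriv by blast+
    ultimately show ?thesis using DERIV_imp_deriv[of ?O 0 x] real_differentiable_def by auto
  qed
  have sps: "solves_profile_system a (coeff_l a) (coeff_omega a) coeff_theta (exceptional a L) ?O U h"
    unfolding solves_profile_system_def
  proof (intro conjI allI impI)
    fix x
    show "U differentiable at x" "deriv U differentiable at x" "h differentiable at x"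
      using U(2) ddU dh real_differentiable_def by blast+
    show "- deriv (deriv U) x = 2 * ?O x" using DERIV_imp_deriv[OF ddU] a by simp
  qed (use eq1 eq2 U in auto)
  have limU: "(deriv U \<longlongrightarrow> 0) at_infinity"
    unfolding dU using tendsto_divide[OF lim tendsto_const, of a] a by simp
  have org: "origin_property ?O U h"
  proof -
    obtain c where c: "0 < c" "(deriv h has_real_derivative c) (at 0)" using d2h by blast
    obtain d where d: "0 < d" "(deriv y has_real_derivative - d) (at 0)" using d2y by blast
    have "(?O has_real_derivative - (- d) / (2 * a)) (at 0)"
      by (rule DERIV_cdivide[OF DERIV_minus[OF d(2)]])
    then have "deriv ?O 0 = d / (2 * a)" by (simp add: DERIV_imp_deriv)
    then show ?thesis
      unfolding origin_property_def dU using c d a init DERIV_imp_deriv[OF c(2)] by simp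
  qed
  show thesis
  proof (rule that[of U])
    have "deriv U 0 \<noteq> 0" using init a by (simp add: dU)
    then have "\<not> (\<forall>x. U x = 0)" by (metis DERIV_const DERIV_imp_deriv ext)
    then have "nontrivial ?O U h" by (simp add: nontrivial_def)
    then show "symmetric_profile a L ?O U h" unfolding symmetric_profile_def using ss sps limU by blast
    show "parity_property ?O U h"
      unfolding parity_property_def odd_fun_def even_fun_def using oddU odddy par by simp
  qed (use U VU org in auto)
qed

section \<open>Existence\<close>

lemma holder_class_cmult:
  assumes "holder_class k p f"
  shows "holder_class k p (\<lambda>x. c * f x)"
proof -
  have d: "(deriv ^^ j) f differentiable (at x)" if "j < k" for j x
    using assms that unfolding holder_class_def Ck_on_def by blast
  have eq: "(deriv ^^ j) (\<lambda>x. c * f x) = (\<lambda>x. c * (deriv ^^ j) f x)" if "j \<le> k" for j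
    using that
  proof (induction j)
    case (Suc j)
    have "((\<lambda>x. c * (deriv ^^ j) f x) has_real_derivative c * (deriv ^^ Suc j) f x) (at x)" for x
      using d[of j x] Suc.prems by (auto intro!: DERIV_cmult simp: DERIV_deriv_iff_real_differentiable)
    then have "deriv (\<lambda>x. c * (deriv ^^ j) f x) = (\<lambda>x. c * (deriv ^^ Suc j) f x)"
      using DERIV_imp_deriv by blast
    moreover have "(deriv ^^ j) (\<lambda>x. c * f x) = (\<lambda>x. c * (deriv ^^ j) f x)" using Suc by simp
    ultimately show ?case by simp
  qed simp
  obtain C where C: "\<bar>(deriv ^^ k) f x - (deriv ^^ k) f y\<bar> \<le> C * \<bar>x - y\<bar> powr p" for x y
    using assms unfolding holder_class_def by blast
  have "\<bar>c * (deriv ^^ k) f x - c * (deriv ^^ k) f y\<bar> \<le> \<bar>c\<bar> * C * \<bar>x - y\<bar> powr p" for x y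
    using mult_left_mono[OF C[of x y], of "\<bar>c\<bar>"] by (simp add: abs_mult right_diff_distrib[symmetric] mult.assoc)
  moreover have "Ck_on k (\<lambda>x. c * f x) UNIV"
    unfolding Ck_on_def
  proof (intro conjI allI impI ballI)
    show "(deriv ^^ j) (\<lambda>x. c * f x) differentiable at x" if "j < k" for j x
      using d[OF that, of x] eq[of j] that by (auto intro!: derivative_intros)
    show "continuous_on UNIV ((deriv ^^ k) (\<lambda>x. c * f x))"
      unfolding eq[OF order_refl] using assms unfolding holder_class_def Ck_on_def
      by (intro continuous_intros) blast
  qed
  ultimately show ?thesis unfolding holder_class_def eq[OF order_refl] by blast
qed

lemma holder_class_antiderivative:
  assumes f: "\<And>x. (f has_real_derivative g x) (at x)" and g: "holder_class k p g"
  shows "holder_class (Suc k) p f"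
proof -
  have dg: "deriv f = g" using f DERIV_imp_deriv by blast
  have eq: "(deriv ^^ Suc j) f = (deriv ^^ j) g" for j
    by (simp only: funpow_Suc_right comp_apply dg)
  have "Ck_on (Suc k) f UNIV"
    unfolding Ck_on_def
  proof (intro conjI allI impI ballI)
    show "(deriv ^^ j) f differentiable at x" if "j < Suc k" for j x
    proof (cases j)
      case 0
      then show ?thesis using f real_differentiable_def by auto
    next
      case (Suc i)
      then show ?thesis using g that unfolding Suc eq holder_class_def Ck_on_def by auto
    qed
    show "continuous_on UNIV ((deriv ^^ Suc k) f)"
      unfolding eq using g unfolding holder_class_def Ck_on_def by blast
  qed
  then show ?thesis using g unfolding holder_class_def eq by blast
qed

lemma antimono_on_of_derivative:
  fixes f :: "real \<Rightarrow> real"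
  assumes "\<And>x. 0 < x \<Longrightarrow> \<exists>D. (f has_real_derivative D) (at x) \<and> D \<le> 0"
  shows "antimono_on {0<..} f"
proof (rule monotone_onI)
  fix x y :: real assume "x \<in> {0<..}" "y \<in> {0<..}" "x \<le> y"
  then show "f y \<le> f x"
    by (intro DERIV_nonpos_imp_nonincreasing[of x y f]) (use assms in force)+
qed

text \<open>
  The two inequalities are the signs of the derivatives of \<open>U / X\<close> and \<open>\<Theta> / X\<^sup>2\<close>. Where \<open>y < 0\<close> they are
  immediate since the left-hand sides are negative. Where \<open>y \<ge> 0\<close>, the function \<open>y\<close> is nonincreasing, so the differences
  cannot decrease while they are negative; for the second one this uses \<open>(1 - a) (2 - y) \<ge> 0\<close>.
\<close>

lemma orbit_monotonicity:
  fixes a L :: real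
  assumes a: "2 / 3 < a" "a \<le> 1" and red: "reduced_system a {-L<..<L} V y h"
    and init: "V 0 = 0" and pos: "\<And>x. 0 < x \<Longrightarrow> x < L \<Longrightarrow> 0 < V x \<and> y x < 2 \<and> 0 < h x"
    and x: "0 < x" "x < L"
  shows "x * (coeff_l a + y x) \<le> V x" and "x * (y x - a) \<le> a * V x"
proof -
  have cl: "coeff_l a < 0" using a by (simp add: coeff_l_def field_simps)
  have in_I: "z \<in> {-L<..<L}" if "0 \<le> z" "z \<le> x" for z using that x by auto
  have dV: "(V has_real_derivative coeff_l a + y z) (at z)" if "0 \<le> z" "z \<le> x" for z
    by (rule reduced_systemD(1)[OF red in_I[OF that]])
  have dy: "\<exists>D. (y has_real_derivative D) (at z)" if "0 \<le> z" "z \<le> x" for z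
    using red in_I[OF that] unfolding reduced_system_def by blast
  have dy': "\<exists>D. (y has_real_derivative D) (at z) \<and> (0 \<le> y z \<longrightarrow> D \<le> 0)" if z: "0 < z" "z < x" for z
  proof (intro exI conjI impI)
    have p: "0 < V z" "y z < 2" "0 < h z" using pos[of z] z x by auto
    show "(y has_real_derivative (y z * (y z - 2) / 2 - 2 * a * h z) / V z) (at z)"
      by (rule reduced_systemD(2)[OF red in_I]) (use z p in auto)
    assume "0 \<le> y z"
    then have "y z * (y z - 2) \<le> 0" using p by (intro mult_nonneg_nonpos) auto
    moreover have "0 \<le> 2 * a * h z" using p a by simp
    ultimately show "(y z * (y z - 2) / 2 - 2 * a * h z) / V z \<le> 0"
      using p by (intro divide_nonpos_pos) linarith+
  qed
  have cont: "continuous_on {0..x} V" "continuous_on {0..x} y"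
    using dV dy by (auto intro!: continuous_at_imp_continuous_on intro: DERIV_isCont) (meson DERIV_isCont)+
  have "0 \<le> V x - x * (coeff_l a + y x)"
  proof (rule nonneg_barrier[of 0 x "\<lambda>t. V t - t * (coeff_l a + y t)"])
    fix z assume z: "0 < z" "z < x" and neg: "V z - z * (coeff_l a + y z) < 0"
    have "0 \<le> y z"
    proof (rule ccontr)
      assume "\<not> 0 \<le> y z"
      then have "z * (coeff_l a + y z) \<le> 0" using z cl by (intro mult_nonneg_nonpos) auto
      then show False using neg pos[of z] z x by linarith
    qed
    then obtain D where D: "(y has_real_derivative D) (at z)" "D \<le> 0" using dy'[OF z] by blast
    have "((\<lambda>t. V t - t * (coeff_l a + y t)) has_real_derivative
        coeff_l a + y z - (1 * (coeff_l a + y z) + (0 + D) * z)) (at z)"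
      by (intro DERIV_diff DERIV_mult DERIV_ident DERIV_add DERIV_const dV D) (use z in auto)
    moreover have "0 \<le> - (D * z)" using D z by (simp add: mult_nonpos_nonneg)
    ultimately show "\<exists>E. ((\<lambda>t. V t - t * (coeff_l a + y t)) has_real_derivative E) (at z) \<and> 0 \<le> E"
      by (intro exI conjI) (assumption, simp)
  qed (use x init cont in \<open>auto intro!: continuous_intros\<close>)
  then show "x * (coeff_l a + y x) \<le> V x" by simp
  have "0 \<le> a * V x - x * (y x - a)"
  proof (rule nonneg_barrier[of 0 x "\<lambda>t. a * V t - t * (y t - a)"])
    fix z assume z: "0 < z" "z < x" and neg: "a * V z - z * (y z - a) < 0"
    have "0 \<le> y z"
    proof (rule ccontr)
      assume "\<not> 0 \<le> y z"
      then have "z * (y z - a) \<le> 0" using z a by (intro mult_nonneg_nonpos) auto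
      moreover have "0 < a * V z" using pos[of z] z x a by simp
      ultimately show False using neg by linarith
    qed
    then obtain D where D: "(y has_real_derivative D) (at z)" "D \<le> 0" using dy'[OF z] by blast
    have "((\<lambda>t. a * V t - t * (y t - a)) has_real_derivative
        a * (coeff_l a + y z) - (1 * (y z - a) + (D - 0) * z)) (at z)"
      by (intro DERIV_diff DERIV_mult DERIV_cmult DERIV_ident DERIV_const dV D) (use z in auto)
    moreover have "0 \<le> a * (coeff_l a + y z) - (1 * (y z - a) + (D - 0) * z)"
    proof -
      have "a * (coeff_l a + y z) - (1 * (y z - a) + (D - 0) * z) = (1 - a) * (2 - y z) + - (D * z)"
        using a by (simp add: coeff_l_def field_simps)
      moreover have "0 \<le> (1 - a) * (2 - y z)" using a pos[of z] z x by (intro mult_nonneg_nonneg) auto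
      moreover have "0 \<le> - (D * z)" using D z by (simp add: mult_nonpos_nonneg)
      ultimately show ?thesis by linarith
    qed
    ultimately show "\<exists>E. ((\<lambda>t. a * V t - t * (y t - a)) has_real_derivative E) (at z) \<and> 0 \<le> E" by blast
  qed (use x init cont in \<open>auto intro!: continuous_intros\<close>)
  then show "x * (y x - a) \<le> a * V x" by simp
qed

lemma zero_extension_has_derivative_zero:
  fixes F :: "real \<Rightarrow> real"
  assumes p: "1 < p" and out: "\<And>z. L \<le> \<bar>z\<bar> \<Longrightarrow> F z = 0"
    and bd: "\<And>z. \<bar>z\<bar> < L \<Longrightarrow> \<bar>F z\<bar> \<le> C * (L - \<bar>z\<bar>) powr p" and x: "L \<le> \<bar>x\<bar>"
  shows "(F has_real_derivative 0) (at x)"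
proof (rule has_derivative_zero_of_superlinear[OF p, where C = "\<bar>C\<bar>"])
  show "F x = 0" using x out by simp
  fix z
  show "\<bar>F z\<bar> \<le> \<bar>C\<bar> * \<bar>z - x\<bar> powr p"
  proof (cases "\<bar>z\<bar> < L")
    case True
    have "\<bar>F z\<bar> \<le> C * (L - \<bar>z\<bar>) powr p" by (rule bd[OF True])
    also have "\<dots> \<le> \<bar>C\<bar> * (L - \<bar>z\<bar>) powr p" by (intro mult_right_mono) auto
    also have "\<dots> \<le> \<bar>C\<bar> * \<bar>z - x\<bar> powr p" using True x p by (intro mult_left_mono powr_mono2) auto
    finally show ?thesis .
  qed (use out in simp)
qed

lemma smooth_on_locally_constant:
  assumes "open S" "\<And>x. x \<in> S \<Longrightarrow> (f has_real_derivative 0) (at x)"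
  shows "smooth_on f S"
  by (rule smooth_on_antiderivative[OF assms(1), of _ "\<lambda>_. 0"]) (use assms in \<open>auto intro: smooth_on_const\<close>)

text \<open>
  Beyond \<open>\<plusminus>L\<close> the functions \<open>y\<close> and \<open>h\<close> are extended by zero, so the velocity is constant there, and \<open>a U(L) = - c\<^sub>l L\<close>
  because \<open>V\<close> vanishes at \<open>L\<close>. The sign information on \<open>V\<close> is recorded because the uniqueness proof compares an arbitrary profile with this one.
\<close>

theorem compact_profile:
  fixes a L :: real
  assumes a: "2 / 3 < a" "a \<le> 1" and L: "0 < L"
    and red: "reduced_system a {-L<..<L} V y h"
    and sm: "smooth_on y {-L<..<L}" "smooth_on h {-L<..<L}"
    and par: "\<And>x. V (- x) = - V x" "\<And>x. y (- x) = y x" "\<And>x. h (- x) = h x"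
    and init: "V 0 = 0" "y 0 = 2" "h 0 = 0"
    and pos: "\<And>x. 0 < x \<Longrightarrow> x < L \<Longrightarrow> 0 < V x \<and> y x < 2 \<and> 0 < h x"
    and d2h: "\<exists>c>0. (deriv h has_real_derivative c) (at 0)"
    and d2y: "\<exists>c>0. (deriv y has_real_derivative - c) (at 0)"
    and bb: "boundary_bounds a L V y h"
  shows "\<exists>\<Omega> U \<Theta>. admissible_profile a L \<Omega> U \<Theta> \<and>
     (\<forall>x. 0 < x \<and> x < L \<longrightarrow> 0 < coeff_l a * x + a * U x) \<and> coeff_l a * L + a * U L = 0"
proof -
  let ?b = "vorticity_exponent a" and ?I = "{-L<..<L}"
  have a0: "0 < a" "\<not> a \<le> 2 / 3" using a by auto
  have ex: "exceptional a L = {- L, L}" using a by (simp add: exceptional_def)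
  have b: "0 < ?b" "2 \<le> gamma a" by (rule vorticity_exponent_gamma[OF a])+
  have inI: "x \<in> ?I \<longleftrightarrow> \<bar>x\<bar> < L" for x by auto
  define Y where "Y x = (if \<bar>x\<bar> < L then y x else 0)" for x
  define H where "H x = (if \<bar>x\<bar> < L then h x else 0)" for x
  have eqI: "Y x = y x" "H x = h x" if "x \<in> ?I" for x using that by (auto simp: Y_def H_def)
  have outI: "Y x = 0" "H x = 0" if "L \<le> \<bar>x\<bar>" for x using that by (auto simp: Y_def H_def)
  have posV: "0 < V x" if "0 < x" "x < L" for x using pos that by blast
  note bounds = derivative_bounds_up_to_boundary[OF a L red sm par posV bb]
  have dYo: "(Y has_real_derivative 0) (at x)" if x: "L \<le> \<bar>x\<bar>" for x
  proof -
    obtain C where C: "\<forall>x\<in>?I. \<bar>y x\<bar> \<le> C * (L - \<bar>x\<bar>) powr (?b + 1)" using bounds(3) by blast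
    show ?thesis
      by (rule zero_extension_has_derivative_zero[where L = L and C = C and p = "?b + 1"])
         (use b C x inI outI eqI in \<open>simp_all del: greaterThanLessThan_iff\<close>)
  qed
  have dHo: "(H has_real_derivative 0) (at x)" if x: "L \<le> \<bar>x\<bar>" for x
  proof -
    obtain C where C: "\<forall>x\<in>?I. \<bar>(deriv ^^ 0) h x\<bar> \<le> C * (L - \<bar>x\<bar>) powr (gamma a - real 0)" using bounds(2)[of 0] by blast
    show ?thesis
      by (rule zero_extension_has_derivative_zero[where L = L and C = C and p = "gamma a"])
         (use b C x inI outI eqI in \<open>simp_all del: greaterThanLessThan_iff\<close>)
  qed
  have smI: "smooth_on Y ?I" "smooth_on H ?I"
    by (rule smooth_on_cong[OF open_greaterThanLessThan eqI(1) sm(1)]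
         smooth_on_cong[OF open_greaterThanLessThan eqI(2) sm(2)]; assumption)+
  have redI: "reduced_system a ?I V Y H"
    by (rule reduced_system_cong[OF red open_greaterThanLessThan refl eqI])
  have parE: "Y (- x) = Y x" "H (- x) = H x" for x using par by (auto simp: Y_def H_def)
  have near: "deriv Y x = deriv y x" "deriv H x = deriv h x" if "x \<in> ?I" for x
    using deriv_funpow_cong[OF open_greaterThanLessThan eqI(1) that, where k = 1]
      deriv_funpow_cong[OF open_greaterThanLessThan eqI(2) that, where k = 1] by simp_all
  have zI: "0 \<in> ?I" using L by simp
  have second: "(deriv F has_real_derivative D) (at 0)"
    if "(deriv f has_real_derivative D) (at 0)" "\<And>x. x \<in> ?I \<Longrightarrow> deriv F x = deriv f x" for f F :: "real \<Rightarrow> real" and D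
    by (rule has_field_derivative_transform_within_open[OF that(1) open_greaterThanLessThan zI]) (simp add: that(2))
  have d2hE: "\<exists>c>0. (deriv H has_real_derivative c) (at 0)" using d2h second[of h _ H] near by blast
  have d2yE: "\<exists>c>0. (deriv Y has_real_derivative - c) (at 0)" using d2y second[of y _ Y] near by blast
  have oO: "open {x::real. L < \<bar>x\<bar>}" by (intro open_Collect_less continuous_intros)
  have dY0: "deriv Y x = 0" "deriv H x = 0" if "L \<le> \<bar>x\<bar>" for x
    using DERIV_imp_deriv[OF dYo[OF that]] DERIV_imp_deriv[OF dHo[OF that]] by auto
  have ddYo: "(deriv Y has_real_derivative 0) (at x)" if "L < \<bar>x\<bar>" for x
    by (rule has_field_derivative_transform_within_open[of "\<lambda>_. 0" _ _ "{x. L < \<bar>x\<bar>}"])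
       (use that oO dY0 in auto)
  have limY: "(Y \<longlongrightarrow> 0) at_infinity"
  proof (rule tendsto_eventually)
    show "\<forall>\<^sub>F x in at_infinity. Y x = 0"
      unfolding eventually_at_infinity using outI by (intro exI[of _ L]) simp
  qed
  have posE: "0 < H x" if "x \<in> ?I" "0 < x" for x using pos[of x] that by (simp add: H_def)
  have nI: "L \<le> \<bar>x\<bar>" if "x \<notin> ?I" for x using that inI[of x] by linarith
  have out: "Y x = 0 \<and> H x = 0 \<and> (Y has_real_derivative 0) (at x) \<and> (H has_real_derivative 0) (at x)"
    if "x \<notin> ?I" for x using outI dYo dHo nI[OF that] by blast
  have out2: "(deriv Y has_real_derivative 0) (at x)" if "x \<notin> ?I" "x \<notin> exceptional a L" for x
  proof (rule ddYo)
    have "x \<noteq> L" "x \<noteq> - L" using that(2) unfolding ex by auto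
    then show "L < \<bar>x\<bar>" using nI[OF that(1)] L by (auto simp: abs_if split: if_splits)
  qed
  have E0: "Y 0 = 2" "H 0 = 0" using eqI[OF zI] init by auto
  have symI: "- x \<in> ?I" if "x \<in> ?I" for x using that by auto
  have cI: "convex ?I" by (rule convex_real_interval)
  obtain U where U: "U 0 = 0" "\<And>x. (U has_real_derivative Y x / a) (at x)"
    and VU: "\<And>x. x \<in> ?I \<Longrightarrow> coeff_l a * x + a * U x = V x"
    and prof: "symmetric_profile a L (\<lambda>x. - deriv Y x / (2 * a)) U H"
      "parity_property (\<lambda>x. - deriv Y x / (2 * a)) U H" "origin_property (\<lambda>x. - deriv Y x / (2 * a)) U H"
    by (rule profile_from_orbit[OF a0(1) a(2) open_greaterThanLessThan zI symI cI redI smI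
        par(1) parE init(1) E0 posE d2hE d2yE out out2 limY]) (assumption+, (rule that; assumption))
  let ?O = "\<lambda>x. - deriv Y x / (2 * a)"
  have VL: "coeff_l a * L + a * U L = 0"
  proof -
    obtain X1 C where X1: "0 < X1" "X1 < L" "0 < C" "\<forall>x\<in>{X1<..<L}. V x \<le> C * (L - x)"
      using bb unfolding boundary_bounds_def by blast
    have ev: "\<forall>\<^sub>F x in at_left L. x \<in> {X1<..<L}" by (rule eventually_at_left_real[OF X1(2)])
    have "isCont (\<lambda>x. coeff_l a * x + a * U x) L"
      by (intro continuous_intros DERIV_isCont[OF U(2)])
    then have t1: "((\<lambda>x. coeff_l a * x + a * U x) \<longlongrightarrow> coeff_l a * L + a * U L) (at_left L)"
      unfolding isCont_def by (rule tendsto_mono[OF at_le, rotated]) auto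
    have "((\<lambda>x. C * (L - x)) \<longlongrightarrow> C * (L - L)) (at_left L)" by (intro tendsto_intros)
    then have t2: "((\<lambda>x. C * (L - x)) \<longlongrightarrow> 0) (at_left L)" by simp
    have "((\<lambda>x. coeff_l a * x + a * U x) \<longlongrightarrow> 0) (at_left L)"
    proof (rule Lim_null_comparison[OF _ t2])
      show "\<forall>\<^sub>F x in at_left L. norm (coeff_l a * x + a * U x) \<le> C * (L - x)"
        using ev
      proof eventually_elim
        case (elim x)
        then have "x \<in> ?I" "0 < V x" "V x \<le> C * (L - x)" using X1 posV[of x] by auto
        then show ?case using VU by simp
      qed
    qed
    from tendsto_unique[OF _ t1 this] show ?thesis by simp
  qed
  have cl: "coeff_l a < 0" using a by (simp add: coeff_l_def field_simps)
  have UL: "0 < U L"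
  proof -
    have "0 < - (coeff_l a * L)" using cl L by (simp add: mult_neg_pos)
    then have "0 < a * U L" using VL by linarith
    then show ?thesis using a0 by (simp add: zero_less_mult_iff)
  qed
  have Uout: "U x = U L" if "L \<le> x" for x
  proof (rule eq_of_same_derivative[of "{L..}" L U "\<lambda>_. 0" "\<lambda>_. U L"])
    show "(U has_real_derivative 0) (at z)" if "z \<in> {L..}" for z
      using U(2)[of z] outI[of z] that L by simp
  qed (use that in auto)
  have ineqU: "x * Y x \<le> a * U x" and ineqH: "x * deriv H x \<le> 2 * H x" if x: "0 < x" for x
  proof -
    show "x * Y x \<le> a * U x"
    proof (cases "x < L")
      case True
      then have xI: "x \<in> ?I" using x by simp
      show ?thesis
        using orbit_monotonicity(1)[OF a red init(1) pos x True] VU[OF xI] eqI[OF xI] by (simp add: algebra_simps)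
    next
      case False
      then show ?thesis using Uout[of x] UL a0 outI[of x] by simp
    qed
    show "x * deriv H x \<le> 2 * H x"
    proof (cases "x < L")
      case True
      then have xI: "x \<in> ?I" using x by simp
      have p: "0 < V x" "0 < h x" using pos[OF x True] by auto
      have "deriv H x = (2 / a * (y x - a) * h x) / V x"
        unfolding near(2)[OF xI] using reduced_systemD(3)[OF red xI] p by (intro DERIV_imp_deriv) auto
      then have "x * deriv H x = x * (y x - a) * (2 * h x / (a * V x))" using a0 by (simp add: field_simps)
      also have "\<dots> \<le> a * V x * (2 * h x / (a * V x))"
        using orbit_monotonicity(2)[OF a red init(1) pos x True] p a0 by (intro mult_right_mono) auto
      also have "\<dots> = 2 * H x" using p a0 eqI[OF xI] by simp
      finally show ?thesis .
    next
      case False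
      then show ?thesis using dY0[of x] outI[of x] x by simp
    qed
  qed
  have dH: "(H has_real_derivative deriv H x) (at x)" for x
    using smooth_on_has_derivative[OF smI(2), of x 0] dHo[of x] dY0[of x] nI[of x] by (cases "x \<in> ?I") auto
  have dYall: "(Y has_real_derivative deriv Y x) (at x)" for x
    using smooth_on_has_derivative[OF smI(1), of x 0] dYo[of x] dY0[of x] nI[of x] by (cases "x \<in> ?I") auto
  have mono: "monotonicity_property a U H"
    unfolding monotonicity_property_def
  proof (intro impI conjI antimono_on_of_derivative)
    fix x :: real assume x: "0 < x"
    have "((\<lambda>X. U X / X) has_real_derivative (Y x / a * x - U x * 1) / (x * x)) (at x)"
      by (rule DERIV_divide[OF U(2) DERIV_ident]) (use x in simp)
    moreover have "(Y x / a * x - U x * 1) / (x * x) \<le> 0"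
      using ineqU[OF x] a0 x by (intro divide_nonpos_pos) (auto simp: field_simps)
    ultimately show "\<exists>D. ((\<lambda>X. U X / X) has_real_derivative D) (at x) \<and> D \<le> 0" by blast
    have dsq: "((\<lambda>X::real. X\<^sup>2) has_real_derivative 2 * x) (at x)" by (auto intro!: derivative_eq_intros)
    have "((\<lambda>X. H X / X\<^sup>2) has_real_derivative (deriv H x * x\<^sup>2 - H x * (2 * x)) / (x\<^sup>2 * x\<^sup>2)) (at x)"
      by (rule DERIV_divide[OF dH dsq]) (use x in simp)
    moreover have "deriv H x * x\<^sup>2 - H x * (2 * x) = x * (x * deriv H x - 2 * H x)"
      by (simp add: power2_eq_square algebra_simps)
    moreover have "x * (x * deriv H x - 2 * H x) / (x\<^sup>2 * x\<^sup>2) \<le> 0"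
      using ineqH[OF x] x by (intro divide_nonpos_pos mult_nonneg_nonpos) auto
    ultimately show "\<exists>D. ((\<lambda>X. H X / X\<^sup>2) has_real_derivative D) (at x) \<and> D \<le> 0" by auto
  qed
  have sub: "supp ?O \<subseteq> {-L..L}" "supp H \<subseteq> {-L..L}"
  proof -
    have s: "{x. ?O x \<noteq> 0} \<subseteq> {-L..L}" "{x. H x \<noteq> 0} \<subseteq> {-L..L}"
      using dY0(1) outI(2) by (force simp: abs_le_iff)+
    show "supp ?O \<subseteq> {-L..L}" "supp H \<subseteq> {-L..L}"
      unfolding supp_def
      using closure_minimal[OF s(1) closed_real_atLeastAtMost] closure_minimal[OF s(2) closed_real_atLeastAtMost] .
  qed
  have comp: "compact (supp ?O)" "compact (supp H)"
    unfolding compact_eq_bounded_closed using bounded_subset[OF _ sub(1)] bounded_subset[OF _ sub(2)]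
    by (auto simp: supp_def)
  have away: "UNIV - {- L, L} = ?I \<union> {x. L < \<bar>x\<bar>}" using L by (auto simp: abs_if)
  have dI: "smooth_on (deriv Y) ?I" by (rule smooth_on_deriv[OF smI(1)])
  have dO: "smooth_on (deriv Y) {x. L < \<bar>x\<bar>}"
    by (rule smooth_on_locally_constant[OF oO]) (use ddYo in auto)
  have smO: "smooth_on ?O (UNIV - {- L, L})"
  proof -
    have "smooth_on (\<lambda>x. - 1 / (2 * a) * deriv Y x) (?I \<union> {x. L < \<bar>x\<bar>})"
      by (rule smooth_on_cmult) (use oO dI dO in \<open>auto intro: smooth_on_Un\<close>)
    then show ?thesis unfolding away by simp
  qed
  have smH: "smooth_on H (UNIV - {- L, L})"
    unfolding away by (intro smooth_on_Un smI smooth_on_locally_constant[OF oO]) (use dHo in auto)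
  have smY: "smooth_on Y (UNIV - {- L, L})"
    unfolding away by (intro smooth_on_Un smI smooth_on_locally_constant[OF oO]) (use dYo in auto)
  have opA: "open (UNIV - {- L, L})" unfolding away using oO by auto
  have smU: "smooth_on U (UNIV - {- L, L})"
  proof (rule smooth_on_antiderivative[OF opA U(2)])
    show "smooth_on (\<lambda>x. Y x / a) (UNIV - {- L, L})" using smooth_on_cmult[OF opA smY, of "1 / a"] by simp
  qed
  have holdY: "holder_class (nat (\<lceil>?b\<rceil> - 1)) (?b - \<lceil>?b\<rceil> + 1) (deriv Y)"
  proof (rule holder_class_zero_extension[OF L _ _ dI dY0(1)])
    have c: "1 \<le> \<lceil>?b\<rceil>" using b by linarith
    show "0 < ?b - \<lceil>?b\<rceil> + 1" "?b - \<lceil>?b\<rceil> + 1 \<le> 1" by linarith+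
    fix j
    have e: "real (nat (\<lceil>?b\<rceil> - 1)) + (?b - \<lceil>?b\<rceil> + 1) - real j = ?b - real j" using c by simp
    have "(deriv ^^ j) (deriv Y) x = (deriv ^^ j) (deriv y) x" if "x \<in> ?I" for x
      by (rule deriv_funpow_cong[OF open_greaterThanLessThan near(1) that])
    then show "\<exists>C. \<forall>x\<in>?I. \<bar>(deriv ^^ j) (deriv Y) x\<bar> \<le> C * (L - \<bar>x\<bar>) powr (real (nat (\<lceil>?b\<rceil> - 1)) + (?b - \<lceil>?b\<rceil> + 1) - real j)"
      unfolding e using bounds(1)[of j] by (simp del: greaterThanLessThan_iff)
  qed
  have holdH: "holder_class (nat (\<lceil>gamma a\<rceil> - 1)) (gamma a - \<lceil>gamma a\<rceil> + 1) H"
  proof (rule holder_class_zero_extension[OF L _ _ smI(2) outI(2)])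
    have c: "1 \<le> \<lceil>gamma a\<rceil>" using b by linarith
    show "0 < gamma a - \<lceil>gamma a\<rceil> + 1" "gamma a - \<lceil>gamma a\<rceil> + 1 \<le> 1" by linarith+
    fix j
    have e: "real (nat (\<lceil>gamma a\<rceil> - 1)) + (gamma a - \<lceil>gamma a\<rceil> + 1) - real j = gamma a - real j" using c by simp
    have "(deriv ^^ j) H x = (deriv ^^ j) h x" if "x \<in> ?I" for x
      by (rule deriv_funpow_cong[OF open_greaterThanLessThan eqI(2) that])
    then show "\<exists>C. \<forall>x\<in>?I. \<bar>(deriv ^^ j) H x\<bar> \<le> C * (L - \<bar>x\<bar>) powr (real (nat (\<lceil>gamma a\<rceil> - 1)) + (gamma a - \<lceil>gamma a\<rceil> + 1) - real j)"
      unfolding e using bounds(2)[of j] by (simp del: greaterThanLessThan_iff)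
  qed
  have holdO: "holder_class (nat (\<lceil>?b\<rceil> - 1)) (?b - \<lceil>?b\<rceil> + 1) ?O"
    using holder_class_cmult[OF holdY, of "- 1 / (2 * a)"] by simp
  have holdU: "holder_class (nat (1 + \<lceil>?b\<rceil>)) (?b - \<lceil>?b\<rceil> + 1) U"
  proof -
    have c: "1 \<le> \<lceil>?b\<rceil>" using b by linarith
    have "nat (1 + i) = Suc (Suc (nat (i - 1)))" if "1 \<le> i" for i :: int using that by linarith
    note n = this[OF c]
    have "holder_class (nat (\<lceil>?b\<rceil> - 1)) (?b - \<lceil>?b\<rceil> + 1) (\<lambda>x. deriv Y x / a)"
      using holder_class_cmult[OF holdY, of "1 / a"] by simp
    then have "holder_class (Suc (nat (\<lceil>?b\<rceil> - 1))) (?b - \<lceil>?b\<rceil> + 1) (\<lambda>x. Y x / a)"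
      by (rule holder_class_antiderivative[rotated]) (rule DERIV_cdivide[OF dYall])
    then show ?thesis unfolding n by (rule holder_class_antiderivative[OF U(2)])
  qed
  have reg: "regularity_property a L ?O U H"
  proof (cases "a = 1")
    case True
    then have "?b = 1" "gamma a = 2" by (auto simp: vorticity_exponent_def gamma_def)
    then have "holder_class 0 1 ?O" "holder_class 2 1 U" "holder_class 1 1 H"
      using holdO holdU holdH by (simp_all add: numeral_2_eq_2)
    then show ?thesis unfolding regularity_property_def using True smO smU smH by simp
  next
    case False
    then have "?b = beta a" by (simp add: vorticity_exponent_def)
    then show ?thesis unfolding regularity_property_def using False a0 comp holdO holdU holdH smO smU smH by simp
  qed
  have "admissible_profile a L ?O U H"
    unfolding admissible_profile_def support_property_def using prof mono reg sub a0 by blast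
  moreover have "0 < coeff_l a * x + a * U x" if "0 < x" "x < L" for x
  proof -
    have "x \<in> ?I" using that by simp
    then show ?thesis using VU posV[OF that] by simp
  qed
  ultimately show ?thesis using VL by blast
qed

text \<open>
  The support of \<open>\<Omega>\<close> is the whole line: on an interval without vorticity \<open>y\<close> would be constant, and so would \<open>h\<close>
  by the equation for \<open>y\<close>; the equation for \<open>h\<close> then forces \<open>y = a\<close>, and the right-hand side of the equation for \<open>y\<close> is
  negative instead of zero.
\<close>

theorem whole_line_profile:
  fixes a :: real
  assumes a: "0 < a" "a \<le> 2 / 3"
    and red: "reduced_system a UNIV V y h"
    and sm: "smooth_on y UNIV" "smooth_on h UNIV"
    and par: "\<And>x. V (- x) = - V x" "\<And>x. y (- x) = y x" "\<And>x. h (- x) = h x"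
    and init: "V 0 = 0" "y 0 = 2" "h 0 = 0"
    and pos: "\<And>x. 0 < x \<Longrightarrow> 0 < V x \<and> y x < 2 \<and> 0 < h x"
    and d2h: "\<exists>c>0. (deriv h has_real_derivative c) (at 0)"
    and d2y: "\<exists>c>0. (deriv y has_real_derivative - c) (at 0)"
    and lim: "(y \<longlongrightarrow> 0) at_top"
  shows "\<exists>\<Omega> U \<Theta>. admissible_profile a 1 \<Omega> U \<Theta> \<and> (\<forall>x>0. 0 < coeff_l a * x + a * U x)"
proof -
  have a1: "a \<le> 1" using a by simp
  have "(y \<longlongrightarrow> 0) at_bot"
    using lim par(2) by (simp add: filterlim_at_bot_mirror)
  then have limi: "(y \<longlongrightarrow> 0) at_infinity"
    using lim by (simp add: at_infinity_eq_at_top_bot filterlim_sup)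
  have posh: "0 < h x" if "0 < x" for x using pos[OF that] by blast
  obtain U where U: "U 0 = 0" "\<And>x. (U has_real_derivative y x / a) (at x)"
    and VU: "\<And>x. x \<in> UNIV \<Longrightarrow> coeff_l a * x + a * U x = V x"
    and prof: "symmetric_profile a 1 (\<lambda>x. - deriv y x / (2 * a)) U h"
      "parity_property (\<lambda>x. - deriv y x / (2 * a)) U h" "origin_property (\<lambda>x. - deriv y x / (2 * a)) U h"
  proof (rule profile_from_orbit[OF a(1) a1 open_UNIV UNIV_I UNIV_I convex_UNIV red sm par init _ d2h d2y _ _ limi, where L = 1])
    show "0 < h x" if "0 < x" for x by (rule posh[OF that])
  qed (simp, simp, (rule that; assumption))
  let ?O = "\<lambda>x. - deriv y x / (2 * a)"
  have smU: "smooth_on U UNIV"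
    by (rule smooth_on_antiderivative[OF open_UNIV U(2)]) (use smooth_on_cmult[OF open_UNIV sm(1), of "1 / a"] in simp)
  have smO: "smooth_on ?O UNIV"
    using smooth_on_cmult[OF open_UNIV smooth_on_deriv[OF sm(1)], of "- 1 / (2 * a)"] by simp
  have hnz: "h x \<noteq> 0" if "x \<noteq> 0" for x
  proof (cases "0 < x")
    case True
    then show ?thesis using posh[of x] by simp
  next
    case False
    then show ?thesis using posh[of "- x"] par(3)[of x] that by simp
  qed
  have supph: "supp h = UNIV"
  proof -
    have "closure (- {0::real}) \<subseteq> supp h" unfolding supp_def using hnz by (intro closure_mono) auto
    moreover have "closure (- {0::real}) = UNIV" by (simp add: closure_complement)
    ultimately show ?thesis by blast
  qed
  have suppO: "supp ?O = UNIV"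
  proof (rule ccontr)
    assume "supp ?O \<noteq> UNIV"
    define T where "T = - supp ?O"
    have T: "open T" "T \<noteq> {}" using \<open>supp ?O \<noteq> UNIV\<close> by (auto simp: T_def supp_def)
    have flat: "deriv y z = 0" if "z \<in> T" for z
    proof (rule ccontr)
      assume "deriv y z \<noteq> 0"
      then have "z \<in> {x. ?O x \<noteq> 0}" using a by simp
      then have "z \<in> supp ?O" unfolding supp_def by (rule subsetD[OF closure_subset])
      then show False using that by (simp add: T_def)
    qed
    have "T \<noteq> {0}" using T(1) not_open_singleton[of "0::real"] by auto
    then obtain z where z: "z \<in> T" "z \<noteq> 0" using T(2) by blast
    have dy: "(y has_real_derivative deriv y x) (at x)" and dh: "(h has_real_derivative deriv h x) (at x)" for x
      using smooth_on_has_derivative[OF sm(1), of x 0] smooth_on_has_derivative[OF sm(2), of x 0] by auto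
    have eq: "V x * deriv y x = y x * (y x - 2) / 2 - 2 * a * h x" "V x * deriv h x = 2 / a * (y x - a) * h x" for x
      using red DERIV_imp_deriv unfolding reduced_system_def by blast+
    have zero: "y x * (y x - 2) / 2 - 2 * a * h x = 0" if "x \<in> T" for x
      using eq(1)[of x] flat[OF that] by simp
    have "((\<lambda>x. y x * (y x - 2) / 2 - 2 * a * h x) has_real_derivative
        (deriv y z * (y z - 2) + deriv y z * y z) / 2 - 2 * a * deriv h z) (at z)"
      by (auto intro!: derivative_eq_intros dy dh)
    moreover have "((\<lambda>x. y x * (y x - 2) / 2 - 2 * a * h x) has_real_derivative 0) (at z)"
      by (rule has_field_derivative_transform_within_open[of "\<lambda>_. 0" _ _ T]) (use T z zero in auto)
    ultimately have "(deriv y z * (y z - 2) + deriv y z * y z) / 2 - 2 * a * deriv h z = 0"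
      by (rule DERIV_unique)
    then have "deriv h z = 0" using flat[OF z(1)] a by simp
    then have "y z = a" using eq(2)[of z] hnz[OF z(2)] a by simp
    then have "a * (a - 2 - 4 * h z) = 0" using zero[OF z(1)] by (simp add: field_simps)
    then have "4 * h z = a - 2" using a by simp
    moreover have "0 \<le> h z" using posh[of z] posh[of "- z"] par(3)[of z] z(2) by (cases "0 < z") auto
    ultimately show False using a by simp
  qed
  have "admissible_profile a 1 ?O U h"
    unfolding admissible_profile_def monotonicity_property_def support_property_def regularity_property_def
    using prof suppO supph smO smU sm a by simp
  moreover have "0 < coeff_l a * x + a * U x" if "0 < x" for x using VU[of x] pos[OF that] by simp
  ultimately show ?thesis by blast
qed

text \<open>
  For \<open>a = 1\<close> the gap used for general \<open>a\<close> closes, but the orbit is explicit.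
\<close>

lemma boundary_bounds_sin: "boundary_bounds 1 pi sin (\<lambda>x. 1 + cos x) (\<lambda>x. (sin x)\<^sup>2 / 4)"
proof -
  define X1 where "X1 = 2 * pi / 3"
  have X1: "0 < X1" "X1 < pi" by (auto simp: X1_def)
  have c: "cos x \<le> - 1 / 2" if "x \<in> {X1<..<pi}" for x
    using cos_monotone_0_pi[of X1 x] that X1 cos_120 by (simp add: X1_def)
  have "isCont sin pi" by simp
  then have "(sin \<longlongrightarrow> sin pi) (at_left pi)"
    unfolding isCont_def by (rule tendsto_mono[OF at_le, rotated]) auto
  then have lim: "(sin \<longlongrightarrow> 0) (at_left pi)" by simp
  have dsin: "\<exists>D. (sin has_real_derivative D) (at x) \<and> - 2 * 1 \<le> D \<and> D \<le> - (1 / 2)" if "x \<in> {X1<..<pi}" for x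
    using c[OF that] cos_ge_minus_one[of x] by (intro exI[of _ "cos x"] conjI DERIV_sin) linarith+
  have lin: "1 / 2 * (pi - x) \<le> sin x" "sin x \<le> 2 * 1 * (pi - x)" if "x \<in> {X1<..<pi}" for x
    using linear_at_boundary[OF X1(2) zero_less_one dsin lim that] by simp_all
  have e: "vorticity_exponent 1 + 1 = 2" "gamma 1 = 2" by (auto simp: vorticity_exponent_def gamma_def)
  show ?thesis
    unfolding boundary_bounds_def e
  proof (rule exI[of _ X1], rule exI[of _ 2], intro conjI ballI)
    fix x assume x: "x \<in> {X1<..<pi}"
    have s: "0 < sin x" using x X1 by (intro sin_gt_zero) auto
    then have p: "sin x powr 2 = (sin x)\<^sup>2" by simp
    show "sin x \<le> 2 * (pi - x)" "pi - x \<le> 2 * sin x" using lin[OF x] by auto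
    have "(1 + cos x) * 1 \<le> (1 + cos x) * (1 - cos x)"
      using c[OF x] cos_ge_minus_one[of x] by (intro mult_left_mono; linarith)
    also have "\<dots> = (sin x)\<^sup>2" by (simp add: sin_squared_eq power2_eq_square algebra_simps)
    finally have "1 + cos x \<le> (sin x)\<^sup>2" by simp
    moreover have "0 \<le> 1 + cos x" using cos_ge_minus_one[of x] by linarith
    ultimately have "\<bar>1 + cos x\<bar> \<le> (sin x)\<^sup>2" by (simp only: abs_of_nonneg)
    then show "\<bar>1 + cos x\<bar> \<le> 2 * sin x powr 2" unfolding p using zero_le_power2[of "sin x"] by linarith
    show "\<bar>(sin x)\<^sup>2 / 4\<bar> \<le> 2 * sin x powr 2" "\<bar>(sin x)\<^sup>2 / 4\<bar> \<le> 2 * sin x powr 2" unfolding p by auto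
  qed (use X1 in auto)
qed

lemma smooth_on_trigonometric:
  assumes S: "open S"
  shows "smooth_on (\<lambda>x. c + d * cos (k * x)) S"
proof (rule smooth_on_antiderivative[OF S, of _ "\<lambda>x. (- d * k) * sin (k * x)"])
  show "smooth_on (\<lambda>x. (- d * k) * sin (k * x)) S"
  proof (rule smooth_on_closed_class[OF S, of _ "{\<lambda>x. p * sin (k * x) + q * cos (k * x) | p q. True}"])
    show "(\<lambda>x. (- d * k) * sin (k * x)) \<in> {\<lambda>x. p * sin (k * x) + q * cos (k * x) | p q. True}"
      by (rule CollectI, rule exI[of _ "- d * k"], rule exI[of _ 0]) simp
    fix h assume "h \<in> {\<lambda>x. p * sin (k * x) + q * cos (k * x) | p q. True}"
    then obtain p q where h: "h = (\<lambda>x. p * sin (k * x) + q * cos (k * x))" by blast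
    show "\<exists>h'\<in>{\<lambda>x. p * sin (k * x) + q * cos (k * x) | p q. True}. \<forall>x\<in>S. (h has_real_derivative h' x) (at x)"
    proof (rule bexI[of _ "\<lambda>x. (- q * k) * sin (k * x) + (p * k) * cos (k * x)"])
      show "\<forall>x\<in>S. (h has_real_derivative (- q * k) * sin (k * x) + (p * k) * cos (k * x)) (at x)"
        unfolding h by (auto intro!: derivative_eq_intros)
    qed blast
  qed
qed (auto intro!: derivative_eq_intros)

text \<open>
  The positivity of the transport speed is part of the conclusion since the uniqueness proof compares an arbitrary
  profile with this one along the half-line on which the speed is positive.
\<close>

theorem existence_of_profile:
  fixes a :: real
  assumes a: "0 < a" "a \<le> 1"
  shows "\<exists>L>0. \<exists>\<Omega> U \<Theta>. admissible_profile a L \<Omega> U \<Theta> \<and>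
     (a \<le> 2 / 3 \<longrightarrow> (\<forall>x>0. 0 < coeff_l a * x + a * U x)) \<and>
     (2 / 3 < a \<longrightarrow> (\<forall>x. 0 < x \<and> x < L \<longrightarrow> 0 < coeff_l a * x + a * U x) \<and> coeff_l a * L + a * U L = 0)"
proof (cases "a = 1")
  case True
  let ?y = "\<lambda>x::real. 1 + cos x" and ?h = "\<lambda>x::real. (sin x)\<^sup>2 / 4"
  have dy: "(?y has_real_derivative - sin x) (at x)" for x by (auto intro!: derivative_eq_intros)
  have dh: "(?h has_real_derivative sin x * cos x / 2) (at x)" for x
    by (auto intro!: derivative_eq_intros)
  have red: "reduced_system a {-pi<..<pi} sin ?y ?h"
    unfolding reduced_system_def
  proof (intro ballI conjI exI)
    fix x :: real
    show "(sin has_real_derivative coeff_l a + (1 + cos x)) (at x)" by (auto intro!: derivative_eq_intros simp: True coeff_l_def)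
    show "(?y has_real_derivative - sin x) (at x)" by (rule dy)
    show "(?h has_real_derivative sin x * cos x / 2) (at x)" by (rule dh)
    show "sin x * - sin x = (1 + cos x) * (1 + cos x - 2) / 2 - 2 * a * ((sin x)\<^sup>2 / 4)"
      by (simp add: True cos_squared_eq[symmetric] power2_eq_square algebra_simps)
    show "sin x * (sin x * cos x / 2) = 2 / a * (1 + cos x - a) * ((sin x)\<^sup>2 / 4)"
      by (simp add: True power2_eq_square)
  qed
  have smy: "smooth_on ?y {-pi<..<pi}" using smooth_on_trigonometric[of "{-pi<..<pi}" 1 1 1] by simp
  have smh: "smooth_on ?h {-pi<..<pi}"
  proof (rule smooth_on_cong[OF _ _ smooth_on_trigonometric[of "{-pi<..<pi}" "1 / 8" "- 1 / 8" 2]])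
    show "?h x = 1 / 8 + - 1 / 8 * cos (2 * x)" for x using cos_double_sin[of x] by linarith
  qed auto
  have d1: "deriv ?y = (\<lambda>x. - sin x)" "deriv ?h = (\<lambda>x. sin x * cos x / 2)"
    using dy dh DERIV_imp_deriv by blast+
  have pos: "0 < sin x \<and> ?y x < 2 \<and> 0 < ?h x" if "0 < x" "x < pi" for x
    using sin_gt_zero[OF that] cos_monotone_0_pi[of 0 x] that by simp
  have h2: "\<exists>c>0. (deriv ?h has_real_derivative c) (at 0)"
    unfolding d1 by (rule exI[of _ "1 / 2"]) (auto intro!: derivative_eq_intros)
  have y2: "\<exists>c>0. (deriv ?y has_real_derivative - c) (at 0)"
    unfolding d1 by (rule exI[of _ 1]) (auto intro!: derivative_eq_intros)
  have a23: "2 / 3 < a" using True by simp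
  have bb: "boundary_bounds a pi sin ?y ?h" using boundary_bounds_sin True by simp
  have "\<exists>\<Omega> U \<Theta>. admissible_profile a pi \<Omega> U \<Theta> \<and>
     (\<forall>x. 0 < x \<and> x < pi \<longrightarrow> 0 < coeff_l a * x + a * U x) \<and> coeff_l a * pi + a * U pi = 0"
    by (rule compact_profile[OF a23 a(2) pi_gt_zero red smy smh _ _ _ _ _ _ pos h2 y2 bb]) simp_all
  then show ?thesis using True by (intro exI[of _ pi]) auto
next
  case False
  then have a1: "a < 1" using a by simp
  obtain I V y h where I: "open I" "0 \<in> I" "\<And>x. x \<in> I \<Longrightarrow> - x \<in> I"
    and red: "reduced_system a I V y h"
    and sm: "smooth_on V I" "smooth_on y I" "smooth_on h I"
    and par: "\<And>x. V (- x) = - V x" "\<And>x. y (- x) = y x" "\<And>x. h (- x) = h x"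
    and init: "V 0 = 0" "y 0 = 2" "h 0 = 0"
    and pos: "\<And>x. x \<in> I \<Longrightarrow> 0 < x \<Longrightarrow> 0 < V x \<and> y x < 2 \<and> 0 < h x"
    and d2h: "\<exists>c>0. (deriv h has_real_derivative c) (at 0)"
    and d2y: "\<exists>c>0. (deriv y has_real_derivative - c) (at 0)"
    and whole: "a \<le> 2 / 3 \<Longrightarrow> I = UNIV \<and> (y \<longlongrightarrow> 0) at_top"
    and bdd: "2 / 3 < a \<Longrightarrow> \<exists>L>0. I = {-L<..<L} \<and> (V \<longlongrightarrow> 0) (at_left L) \<and>
            (y \<longlongrightarrow> 0) (at_left L) \<and> (h \<longlongrightarrow> 0) (at_left L)"
    by (rule inner_solution[OF a(1) a1]) (rule that; assumption)
  show ?thesis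
  proof (cases "a \<le> 2 / 3")
    case True
    have U: "I = UNIV" and lim: "(y \<longlongrightarrow> 0) at_top" using whole[OF True] by auto
    have "\<exists>\<Omega> U \<Theta>. admissible_profile a 1 \<Omega> U \<Theta> \<and> (\<forall>x>0. 0 < coeff_l a * x + a * U x)"
      by (rule whole_line_profile[OF a(1) True red[unfolded U] sm(2,3)[unfolded U] par init _ d2h d2y lim])
         (use pos U in auto)
    then show ?thesis using True by (intro exI[of _ 1]) auto
  next
    case False
    then have a2: "2 / 3 < a" by simp
    obtain L where L: "0 < L" "I = {-L<..<L}" and lim: "(V \<longlongrightarrow> 0) (at_left L)" "(y \<longlongrightarrow> 0) (at_left L)"
      using bdd[OF a2] by blast
    have "reduced_system a {0<..<L} V y h" by (rule reduced_system_subset[OF red]) (use L in auto)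
    then have bb: "boundary_bounds a L V y h"
      by (rule boundary_decay[OF a2 a1 L(1) _ _ lim]) (use pos L in auto)
    have "\<exists>\<Omega> U \<Theta>. admissible_profile a L \<Omega> U \<Theta> \<and>
     (\<forall>x. 0 < x \<and> x < L \<longrightarrow> 0 < coeff_l a * x + a * U x) \<and> coeff_l a * L + a * U L = 0"
      by (rule compact_profile[OF a2 a(2) L(1) red[unfolded L(2)] sm(2,3)[unfolded L(2)] par init _ d2h d2y bb])
         (use pos L in auto)
    then show ?thesis using False L by (intro exI[of _ L]) auto
  qed
qed

section \<open>Uniqueness at the singular origin\<close>

text \<open>
  The data that select a solution at the singular point \<open>0\<close>; the only free parameter is \<open>m = \<Theta>''(0) / 2\<close>.
\<close>

definition origin_asymptotics ::
  "real \<Rightarrow> real \<Rightarrow> (real \<Rightarrow> real) \<Rightarrow> (real \<Rightarrow> real) \<Rightarrow> (real \<Rightarrow> real) \<Rightarrow> bool" where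
  "origin_asymptotics a m V y h \<longleftrightarrow> (\<exists>C d. 0 < d \<and> (\<forall>x\<in>{0<..<d}.
     \<bar>y x - 2\<bar> \<le> C * x ^ 2 \<and> \<bar>V x - (2 / a - 1) * x\<bar> \<le> C * x ^ 3 \<and> \<bar>h x - m * x ^ 2\<bar> \<le> C * x ^ 3))"

lemma reduced_system_continuous:
  assumes "reduced_system a S V y h"
  shows "continuous_on S V" "continuous_on S y" "continuous_on S h"
proof -
  have "isCont V x \<and> isCont y x \<and> isCont h x" if "x \<in> S" for x
    using assms that DERIV_isCont unfolding reduced_system_def by blast
  then show "continuous_on S V" "continuous_on S y" "continuous_on S h"
    by (simp_all add: continuous_at_imp_continuous_on)
qed

text \<open>
  Extends the local bounds to the interval on which the solutions are compared.
\<close>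

lemma bound_down_to_origin:
  fixes f :: "real \<Rightarrow> real"
  assumes cont: "continuous_on {0<..b} f" and d: "0 < d"
    and bd: "\<And>x. 0 < x \<Longrightarrow> x < d \<Longrightarrow> \<bar>f x\<bar> \<le> C * x ^ k"
  shows "\<exists>C\<ge>0. \<forall>x\<in>{0<..b}. \<bar>f x\<bar> \<le> C * x ^ k"
proof -
  have "continuous_on {d / 2..b} (\<lambda>x. f x / x ^ k)"
    using d by (intro continuous_intros continuous_on_subset[OF cont]) auto
  then have "bounded ((\<lambda>x. f x / x ^ k) ` {d / 2..b})"
    by (intro compact_imp_bounded compact_continuous_image) auto
  then obtain B where "\<forall>x\<in>{d / 2..b}. norm (f x / x ^ k) \<le> B"
    unfolding bounded_iff by blast
  then have B: "\<bar>f x / x ^ k\<bar> \<le> B" if "x \<in> {d / 2..b}" for x using that by (metis real_norm_def)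
  show ?thesis
  proof (intro exI[of _ "max 0 (max B C)"] conjI ballI)
    fix x assume x: "x \<in> {0<..b}"
    then have p: "0 < x ^ k" by simp
    show "\<bar>f x\<bar> \<le> max 0 (max B C) * x ^ k"
    proof (cases "x < d")
      case True
      then have "\<bar>f x\<bar> \<le> C * x ^ k" using bd x by simp
      also have "\<dots> \<le> max 0 (max B C) * x ^ k" using p by (intro mult_right_mono) auto
      finally show ?thesis .
    next
      case False
      then have "\<bar>f x / x ^ k\<bar> \<le> B" using B[of x] x d by simp
      then have "\<bar>f x\<bar> \<le> B * x ^ k" using p by (simp add: abs_divide pos_divide_le_eq)
      also have "\<dots> \<le> max 0 (max B C) * x ^ k" using p by (intro mult_right_mono) auto
      finally show ?thesis .
    qed
  qed simp
qed

lemma quadratic_cross_terms: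
  fixes p q r c K :: real
  assumes "\<bar>c\<bar> \<le> K" "0 \<le> K"
  shows "c * (p * q) \<le> K * (p\<^sup>2 + q\<^sup>2 + r\<^sup>2)"
proof -
  have "2 * (\<bar>p\<bar> * \<bar>q\<bar>) \<le> p\<^sup>2 + q\<^sup>2"
    using sum_squares_bound[of "\<bar>p\<bar>" "\<bar>q\<bar>"] by (simp add: mult.assoc)
  moreover have "0 \<le> \<bar>p\<bar> * \<bar>q\<bar>" "0 \<le> r\<^sup>2" by auto
  ultimately have pq: "\<bar>p * q\<bar> \<le> p\<^sup>2 + q\<^sup>2 + r\<^sup>2" unfolding abs_mult by linarith
  have "c * (p * q) \<le> \<bar>c\<bar> * \<bar>p * q\<bar>" by (simp add: abs_mult[symmetric])
  also have "\<dots> \<le> K * (p\<^sup>2 + q\<^sup>2 + r\<^sup>2)" using assms pq by (intro mult_mono) auto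
  finally show ?thesis .
qed

text \<open>
  Divide the differences of \<open>y\<close>, \<open>h\<close> and \<open>V\<close> by \<open>x\<^sup>2\<close>, \<open>x\<^sup>3\<close> and \<open>x\<^sup>3\<close>; by the asymptotics at \<open>0\<close> the quotients
  are bounded. With \<open>p0 = 2/a - 1 \<ge> 1\<close> the singular coefficients in their equations are \<open>(1/p0 - 2) / x\<close>,
  \<open>- 1 / x\<close> and \<open>- 3 / x\<close>, all at most \<open>- 1 / x\<close>, and the coupling terms are bounded. So the sum \<open>N\<close> of the squared quotients
  satisfies \<open>N' \<le> (K - 1 / x) N\<close>, and the bounded quantity \<open>x N exp (- K x)\<close>, nonincreasing and with limit \<open>0\<close> at the origin, vanishes.
\<close>

theorem unique_from_origin:
  fixes a b m :: real
  assumes a: "0 < a" "a \<le> 1" and b: "0 < b"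
    and red1: "reduced_system a {0<..b} V1 y1 h1" and red2: "reduced_system a {0<..b} V2 y2 h2"
    and pos1: "\<And>x. 0 < x \<Longrightarrow> x \<le> b \<Longrightarrow> 0 < V1 x" and pos2: "\<And>x. 0 < x \<Longrightarrow> x \<le> b \<Longrightarrow> 0 < V2 x"
    and as1: "origin_asymptotics a m V1 y1 h1" and as2: "origin_asymptotics a m V2 y2 h2"
    and x: "0 < x" "x \<le> b"
  shows "V1 x = V2 x" "y1 x = y2 x" "h1 x = h2 x"
proof -
  define p0 where "p0 = 2 / a - 1"
  have p0: "1 \<le> p0" using a by (simp add: p0_def field_simps)
  note cont = reduced_system_continuous
  have bounds: "\<exists>C R. 0 \<le> C \<and> 0 \<le> R \<and> (\<forall>x\<in>{0<..b}. \<bar>y x - 2\<bar> \<le> C * x ^ 2 \<and> \<bar>V x - p0 * x\<bar> \<le> C * x ^ 3 \<and>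
       \<bar>h x - m * x ^ 2\<bar> \<le> C * x ^ 3 \<and> \<bar>x / V x\<bar> \<le> R)"
    if red: "reduced_system a {0<..b} V y h" and as: "origin_asymptotics a m V y h"
      and pos: "\<And>x. 0 < x \<Longrightarrow> x \<le> b \<Longrightarrow> 0 < V x" for V y h
  proof -
    obtain C d where d: "0 < d" and C: "\<And>x. 0 < x \<Longrightarrow> x < d \<Longrightarrow> \<bar>y x - 2\<bar> \<le> C * x ^ 2 \<and>
        \<bar>V x - p0 * x\<bar> \<le> C * x ^ 3 \<and> \<bar>h x - m * x ^ 2\<bar> \<le> C * x ^ 3"
      using as unfolding origin_asymptotics_def p0_def by force
    note c = cont[OF red]
    have cc: "continuous_on {0<..b} (\<lambda>x. y x - 2)" "continuous_on {0<..b} (\<lambda>x. V x - p0 * x)"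
      "continuous_on {0<..b} (\<lambda>x. h x - m * x ^ 2)" by (intro continuous_intros c)+
    obtain C1 where C1: "0 \<le> C1" "\<forall>x\<in>{0<..b}. \<bar>y x - 2\<bar> \<le> C1 * x ^ 2"
      using bound_down_to_origin[OF cc(1) d, where C = C and k = 2] C by blast
    obtain C2 where C2: "0 \<le> C2" "\<forall>x\<in>{0<..b}. \<bar>V x - p0 * x\<bar> \<le> C2 * x ^ 3"
      using bound_down_to_origin[OF cc(2) d, where C = C and k = 3] C by blast
    obtain C3 where C3: "0 \<le> C3" "\<forall>x\<in>{0<..b}. \<bar>h x - m * x ^ 2\<bar> \<le> C3 * x ^ 3"
      using bound_down_to_origin[OF cc(3) d, where C = C and k = 3] C by blast
    define e where "e = min (min b 1) (1 / (2 * (C2 + 1)))"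
    have e: "0 < e" "e \<le> b" "e \<le> 1" "e \<le> 1 / (2 * (C2 + 1))" using b C2 by (auto simp: e_def)
    have "\<bar>x / V x\<bar> \<le> 2 * x ^ 0" if x: "0 < x" "x < e" for x
    proof -
      have "x * x \<le> x * 1" using x e by (intro mult_left_mono) auto
      then have "x * x \<le> 1 / (2 * (C2 + 1))" using x e by linarith
      then have "x * x * (2 * (C2 + 1)) \<le> 1" using C2 by (simp add: pos_le_divide_eq)
      then have k: "C2 * (x * x) \<le> 1 / 2" using x by (simp add: algebra_simps) (smt (verit) zero_le_mult_iff)
      have "C2 * x ^ 3 = C2 * (x * x) * x" by (simp add: power3_eq_cube)
      also have "\<dots> \<le> 1 / 2 * x" using k x by (intro mult_right_mono) auto
      finally have "C2 * x ^ 3 \<le> x / 2" by simp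
      moreover have "x \<in> {0<..b}" using x e by auto
      moreover have "1 * x \<le> p0 * x" using p0 x by (intro mult_right_mono) auto
      ultimately have "x / 2 \<le> V x" using C2(2) by (smt (verit) field_sum_of_halves)
      then show ?thesis using x by (simp add: field_simps)
    qed
    moreover have "continuous_on {0<..b} (\<lambda>x. x / V x)"
      using c pos by (intro continuous_intros) force+
    ultimately obtain R where R: "0 \<le> R" "\<forall>x\<in>{0<..b}. \<bar>x / V x\<bar> \<le> R * x ^ 0"
      using bound_down_to_origin[of b "\<lambda>x. x / V x" e 2 0] e by blast
    have up: "C1 * t \<le> (C1 + C2 + C3) * t" "C2 * t \<le> (C1 + C2 + C3) * t" "C3 * t \<le> (C1 + C2 + C3) * t" if "0 \<le> t" for t
      using that C1(1) C2(1) C3(1) by (auto intro!: mult_right_mono)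
    show ?thesis
    proof (rule exI[of _ "C1 + C2 + C3"], rule exI[of _ R], intro conjI ballI)
      fix x assume x: "x \<in> {0<..b}"
      then have n: "0 \<le> x ^ 2" "0 \<le> x ^ 3" by auto
      show "\<bar>y x - 2\<bar> \<le> (C1 + C2 + C3) * x ^ 2" by (rule order_trans[OF _ up(1)[OF n(1)]]) (use C1(2) x in blast)
      show "\<bar>V x - p0 * x\<bar> \<le> (C1 + C2 + C3) * x ^ 3" by (rule order_trans[OF _ up(2)[OF n(2)]]) (use C2(2) x in blast)
      show "\<bar>h x - m * x ^ 2\<bar> \<le> (C1 + C2 + C3) * x ^ 3" by (rule order_trans[OF _ up(3)[OF n(2)]]) (use C3(2) x in blast)
      show "\<bar>x / V x\<bar> \<le> R" using R(2) x by simp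
    qed (use C1 C2 C3 R in auto)
  qed
  obtain C1 R1 where B1: "0 \<le> C1" "0 \<le> R1" "\<And>x. x \<in> {0<..b} \<Longrightarrow> \<bar>y1 x - 2\<bar> \<le> C1 * x ^ 2 \<and> \<bar>V1 x - p0 * x\<bar> \<le> C1 * x ^ 3 \<and>
       \<bar>h1 x - m * x ^ 2\<bar> \<le> C1 * x ^ 3 \<and> \<bar>x / V1 x\<bar> \<le> R1"
    using bounds[OF red1 as1 pos1] by blast
  obtain C2 R2 where B2: "0 \<le> C2" "0 \<le> R2" "\<And>x. x \<in> {0<..b} \<Longrightarrow> \<bar>y2 x - 2\<bar> \<le> C2 * x ^ 2 \<and> \<bar>V2 x - p0 * x\<bar> \<le> C2 * x ^ 3 \<and>
       \<bar>h2 x - m * x ^ 2\<bar> \<le> C2 * x ^ 3 \<and> \<bar>x / V2 x\<bar> \<le> R2"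
    using bounds[OF red2 as2 pos2] by blast
  define C where "C = C1 + C2"
  define R where "R = R1 + R2"
  have CR: "0 \<le> C" "0 \<le> R" using B1 B2 by (auto simp: C_def R_def)
  have up: "C1 * t \<le> C * t" "C2 * t \<le> C * t" if "0 \<le> t" for t
    using that B1(1) B2(1) by (auto simp: C_def intro!: mult_right_mono)
  have bd: "\<bar>y1 x - 2\<bar> \<le> C * x ^ 2" "\<bar>y2 x - 2\<bar> \<le> C * x ^ 2" "\<bar>V1 x - p0 * x\<bar> \<le> C * x ^ 3" "\<bar>V2 x - p0 * x\<bar> \<le> C * x ^ 3"
     "\<bar>h1 x - m * x ^ 2\<bar> \<le> C * x ^ 3" "\<bar>h2 x - m * x ^ 2\<bar> \<le> C * x ^ 3" "\<bar>x / V1 x\<bar> \<le> R" "\<bar>x / V2 x\<bar> \<le> R"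
    if "x \<in> {0<..b}" for x
  proof -
    have n: "0 \<le> x ^ 2" "0 \<le> x ^ 3" using that by auto
    note b1 = B1(3)[OF that] and b2 = B2(3)[OF that]
    show "\<bar>y1 x - 2\<bar> \<le> C * x ^ 2" by (rule order_trans[OF _ up(1)[OF n(1)]]) (use b1 in blast)
    show "\<bar>y2 x - 2\<bar> \<le> C * x ^ 2" by (rule order_trans[OF _ up(2)[OF n(1)]]) (use b2 in blast)
    show "\<bar>V1 x - p0 * x\<bar> \<le> C * x ^ 3" by (rule order_trans[OF _ up(1)[OF n(2)]]) (use b1 in blast)
    show "\<bar>V2 x - p0 * x\<bar> \<le> C * x ^ 3" by (rule order_trans[OF _ up(2)[OF n(2)]]) (use b2 in blast)
    show "\<bar>h1 x - m * x ^ 2\<bar> \<le> C * x ^ 3" by (rule order_trans[OF _ up(1)[OF n(2)]]) (use b1 in blast)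
    show "\<bar>h2 x - m * x ^ 2\<bar> \<le> C * x ^ 3" by (rule order_trans[OF _ up(2)[OF n(2)]]) (use b2 in blast)
    show "\<bar>x / V1 x\<bar> \<le> R" by (rule order_trans[of _ R1]) (use b1 B2(2) R_def in auto)
    show "\<bar>x / V2 x\<bar> \<le> R" by (rule order_trans[of _ R2]) (use b2 B1(2) R_def in auto)
  qed
  define al where "al x = (y1 x - y2 x) / x ^ 2" for x
  define be where "be x = (h1 x - h2 x) / x ^ 3" for x
  define de where "de x = (V1 x - V2 x) / x ^ 3" for x
  define N where "N x = (al x)\<^sup>2 + (be x)\<^sup>2 + (de x)\<^sup>2" for x
  define ph where "ph x = (y2 x * (y2 x - 2) / 2 - 2 * a * h2 x) / x ^ 2" for x
  define et where "et x = h2 x / x ^ 2" for x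
  have r: "x / V1 x \<le> 1 / p0 + R * C * x ^ 2" if x: "x \<in> {0<..b}" for x
  proof -
    have V: "0 < V1 x" "0 < x" using pos1 x by auto
    have "x / V1 x - 1 / p0 = x / V1 x * ((p0 * x - V1 x) / (p0 * x))" using V p0 by (simp add: field_simps)
    also have "\<dots> \<le> \<bar>x / V1 x\<bar> * \<bar>(p0 * x - V1 x) / (p0 * x)\<bar>" by (simp only: abs_mult[symmetric] abs_ge_self)
    also have "\<dots> \<le> R * (C * x ^ 2)"
    proof (rule mult_mono)
      show "\<bar>x / V1 x\<bar> \<le> R" by (rule bd(7)[OF x])
      have "\<bar>(p0 * x - V1 x) / (p0 * x)\<bar> = \<bar>V1 x - p0 * x\<bar> / (p0 * x)" using V p0 by (simp add: abs_divide abs_minus_commute abs_mult)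
      also have "\<dots> \<le> C * x ^ 3 / (p0 * x)" using bd(3)[OF x] V p0 by (intro divide_right_mono) auto
      also have "\<dots> \<le> C * x ^ 3 / x" using V p0 CR by (intro divide_left_mono) auto
      also have "\<dots> = C * x ^ 2" using V by (simp add: power2_eq_square power3_eq_cube)
      finally show "\<bar>(p0 * x - V1 x) / (p0 * x)\<bar> \<le> C * x ^ 2" .
    qed (use CR in auto)
    finally show ?thesis by (simp add: mult.assoc)
  qed
  define H where "H = \<bar>m\<bar> + C * b"
  define Ph where "Ph = (2 + C * b ^ 2) * C / 2 + 2 * a * H"
  define Ga where "Ga = 2 / a * (2 + C * b ^ 2 + a) * H"
  have H0: "0 \<le> H" using CR b by (simp add: H_def)
  have xb: "x ^ 2 \<le> b * x" "x ^ 2 \<le> b ^ 2" if "x \<in> {0<..b}" for x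
    using that by (auto simp: power2_eq_square intro!: mult_mono)
  have y2b: "\<bar>y2 x\<bar> \<le> 2 + C * b ^ 2" if x: "x \<in> {0<..b}" for x
    using bd(2)[OF x] mult_left_mono[OF xb(2)[OF x] CR(1)] by linarith
  have etb: "\<bar>et x\<bar> \<le> H" if x: "x \<in> {0<..b}" for x
  proof -
    have "\<bar>h2 x\<bar> \<le> \<bar>m\<bar> * x ^ 2 + C * x ^ 3"
    proof -
      have "\<bar>h2 x\<bar> \<le> \<bar>m * x ^ 2\<bar> + \<bar>h2 x - m * x ^ 2\<bar>" by linarith
      then show ?thesis using bd(6)[OF x] by (simp add: abs_mult)
    qed
    also have "\<dots> = (\<bar>m\<bar> + C * x) * x ^ 2" by (simp add: power2_eq_square power3_eq_cube algebra_simps)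
    also have "\<dots> \<le> H * x ^ 2" unfolding H_def using x CR by (intro mult_right_mono add_left_mono mult_left_mono) auto
    finally show ?thesis using x by (simp add: et_def abs_divide pos_divide_le_eq)
  qed
  have phb: "\<bar>ph x\<bar> \<le> Ph" if x: "x \<in> {0<..b}" for x
  proof -
    have x0: "0 < x" using x by simp
    have "ph x = y2 x * ((y2 x - 2) / x ^ 2) / 2 - 2 * a * et x" using x0 by (simp add: ph_def et_def field_simps)
    then have "\<bar>ph x\<bar> \<le> \<bar>y2 x * ((y2 x - 2) / x ^ 2) / 2\<bar> + \<bar>2 * a * et x\<bar>"
      using abs_triangle_ineq4 by (simp only:)
    also have "\<bar>y2 x * ((y2 x - 2) / x ^ 2) / 2\<bar> = \<bar>y2 x\<bar> * \<bar>(y2 x - 2) / x ^ 2\<bar> / 2" by (simp add: abs_mult)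
    also have "\<dots> \<le> (2 + C * b ^ 2) * C / 2"
    proof (intro divide_right_mono mult_mono y2b x)
      show "\<bar>(y2 x - 2) / x\<^sup>2\<bar> \<le> C" using bd(2)[OF x] x0 by (simp add: abs_divide pos_divide_le_eq)
    qed (use CR in auto)
    also have "\<bar>2 * a * et x\<bar> \<le> 2 * a * H" using etb[OF x] a by (simp add: abs_mult)
    finally show ?thesis by (simp add: Ph_def)
  qed
  define ga where "ga x = 2 / a * (y2 x - a) * et x" for x
  have gab: "\<bar>ga x\<bar> \<le> Ga" if x: "x \<in> {0<..b}" for x
  proof -
    have "\<bar>2 / a * (y2 x - a)\<bar> \<le> 2 / a * (2 + C * b ^ 2 + a)"
      unfolding abs_mult using y2b[OF x] a by (intro mult_mono) auto
    then show ?thesis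
      unfolding ga_def Ga_def abs_mult[of _ "et x"] using etb[OF x] H0 a CR
      by (intro mult_mono) auto
  qed
  define r1 where "r1 x = x / V1 x" for x
  define r2 where "r2 x = x / V2 x" for x
  define s where "s x = y1 x + y2 x - 2" for x
  define ax where "ax x = r1 x * (al x * s x / 2 - 2 * a * be x * x) - ph x * de x * r1 x * r2 x * x ^ 2" for x
  define bx where "bx x = r1 x * (2 / a) * ((y1 x - a) * be x + al x * et x * x) - ga x * de x * r1 x * r2 x * x" for x
  define D where "D x = N x + 2 * al x * (ax x - 2 * al x) + 2 * be x * (bx x - 3 * be x) + 2 * de x * (al x - 3 * de x)" for x
  have dE: "((\<lambda>x. x * N x) has_real_derivative D x) (at x)" if x: "x \<in> {0<..b}" for x
  proof -
    have V: "0 < V1 x" "0 < V2 x" "0 < x" using pos1 pos2 x by auto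
    let ?F1 = "y1 x * (y1 x - 2) / 2 - 2 * a * h1 x" and ?F2 = "y2 x * (y2 x - 2) / 2 - 2 * a * h2 x"
    let ?G1 = "2 / a * (y1 x - a) * h1 x" and ?G2 = "2 / a * (y2 x - a) * h2 x"
    have split: "p / u - q / w = (p - q) / u - q * (u - w) / (u * w)" if "0 < u" "0 < w" for p q u w :: real
      using that by (simp add: field_simps)
    have A: "?F1 / V1 x - ?F2 / V2 x = x * ax x"
    proof -
      have "?F1 - ?F2 = al x * x ^ 2 * s x / 2 - 2 * a * (be x * x ^ 3)"
        using V by (simp add: al_def be_def s_def field_simps)
      moreover have "?F2 = ph x * x ^ 2" "V1 x - V2 x = de x * x ^ 3" using V by (simp_all add: ph_def de_def)
      ultimately have "?F1 / V1 x - ?F2 / V2 x = (al x * x ^ 2 * s x / 2 - 2 * a * (be x * x ^ 3)) / V1 x - ph x * x ^ 2 * (de x * x ^ 3) / (V1 x * V2 x)"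
        using split[OF V(1,2), of ?F1 ?F2] by simp
      then show ?thesis using V by (simp add: ax_def r1_def r2_def field_simps power2_eq_square power3_eq_cube)
    qed
    have B: "?G1 / V1 x - ?G2 / V2 x = x ^ 2 * bx x"
    proof -
      have "?G1 - ?G2 = 2 / a * ((y1 x - a) * (be x * x ^ 3) + al x * x ^ 2 * (et x * x ^ 2))"
        using V a by (simp add: al_def be_def et_def field_simps)
      moreover have "?G2 = ga x * x ^ 2" "V1 x - V2 x = de x * x ^ 3" using V by (simp_all add: ga_def et_def de_def)
      ultimately have "?G1 / V1 x - ?G2 / V2 x = 2 / a * ((y1 x - a) * (be x * x ^ 3) + al x * x ^ 2 * (et x * x ^ 2)) / V1 x - ga x * x ^ 2 * (de x * x ^ 3) / (V1 x * V2 x)"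
        using split[OF V(1,2), of ?G1 ?G2] by simp
      then show ?thesis using V a by (simp add: bx_def r1_def r2_def field_simps power2_eq_square power3_eq_cube)
    qed
    have quot: "((\<lambda>x. f x / x ^ Suc k) has_real_derivative (e - real (Suc k) * (f x / x ^ Suc k)) / x) (at x)"
      if "(f has_real_derivative e * x ^ k) (at x)" for f e k
    proof -
      have "((\<lambda>x. x ^ Suc k) has_real_derivative real (Suc k) * x ^ k) (at x)"
        using DERIV_pow[of "Suc k" x UNIV] by simp
      from DERIV_divide[OF that this] V
      have q: "((\<lambda>x. f x / x ^ Suc k) has_real_derivative
          (e * x ^ k * x ^ Suc k - f x * (real (Suc k) * x ^ k)) / (x ^ Suc k * x ^ Suc k)) (at x)" by simp
      have "(e * P * (x * P) - F * (n * P)) / ((x * P) * (x * P)) = (e - n * (F / (x * P))) / x"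
        if "P \<noteq> 0" for P n F :: real using that V by (simp add: field_simps)
      from this[of "x ^ k" "f x" "real (Suc k)"] q V show ?thesis by (simp only: power_Suc) simp
    qed
    have "((\<lambda>x. y1 x - y2 x) has_real_derivative ?F1 / V1 x - ?F2 / V2 x) (at x)"
      using reduced_systemD(2)[OF red1 x] reduced_systemD(2)[OF red2 x] V by (intro DERIV_diff) auto
    then have "((\<lambda>x. y1 x - y2 x) has_real_derivative ax x * x ^ 1) (at x)" unfolding A by (simp add: mult.commute)
    from quot[OF this] have dal: "(al has_real_derivative (ax x - 2 * al x) / x) (at x)"
      by (simp add: al_def[abs_def] numeral_2_eq_2)
    have "((\<lambda>x. h1 x - h2 x) has_real_derivative ?G1 / V1 x - ?G2 / V2 x) (at x)"
      using reduced_systemD(3)[OF red1 x] reduced_systemD(3)[OF red2 x] V by (intro DERIV_diff) auto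
    then have "((\<lambda>x. h1 x - h2 x) has_real_derivative bx x * x ^ 2) (at x)" unfolding B by (simp add: mult.commute)
    from quot[OF this] have dbe: "(be has_real_derivative (bx x - 3 * be x) / x) (at x)"
      by (simp add: be_def[abs_def] numeral_3_eq_3)
    have "((\<lambda>x. V1 x - V2 x) has_real_derivative (coeff_l a + y1 x) - (coeff_l a + y2 x)) (at x)"
      by (intro DERIV_diff reduced_systemD(1)[OF red1 x] reduced_systemD(1)[OF red2 x])
    moreover have "(coeff_l a + y1 x) - (coeff_l a + y2 x) = al x * x ^ 2" using V by (simp add: al_def)
    ultimately have "((\<lambda>x. V1 x - V2 x) has_real_derivative al x * x ^ 2) (at x)" by simp
    from quot[OF this] have dde: "(de has_real_derivative (al x - 3 * de x) / x) (at x)"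
      by (simp add: de_def[abs_def] numeral_3_eq_3)
    have "(N has_real_derivative 2 * al x * ((ax x - 2 * al x) / x) + 2 * be x * ((bx x - 3 * be x) / x)
        + 2 * de x * ((al x - 3 * de x) / x)) (at x)"
      unfolding N_def[abs_def] using dal dbe dde by (auto intro!: derivative_eq_intros simp: mult_ac)
    from DERIV_mult[OF DERIV_ident this]
    have "((\<lambda>x. x * N x) has_real_derivative 1 * N x + (2 * al x * ((ax x - 2 * al x) / x)
        + 2 * be x * ((bx x - 3 * be x) / x) + 2 * de x * ((al x - 3 * de x) / x)) * x) (at x)" .
    also have "1 * N x + (2 * al x * ((ax x - 2 * al x) / x) + 2 * be x * ((bx x - 3 * be x) / x)
        + 2 * de x * ((al x - 3 * de x) / x)) * x = D x"
      using V by (simp add: D_def distrib_right)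
    finally show ?thesis .
  qed
  define K where "K = 4 * R * C * b + (4 * p0 + 4 / a) * R * C * b + (4 * a * R + 4 / a * R * H) + 2 * Ph * R\<^sup>2 * b + 2 * Ga * R\<^sup>2"
  have DE: "D x \<le> K * (x * N x)" if x: "x \<in> {0<..b}" for x
  proof -
    have x0: "0 < x" "x \<le> b" using x by auto
    have V: "0 < V1 x" "0 < V2 x" using pos1 pos2 x by auto
    have r1: "0 \<le> r1 x" "r1 x \<le> R" "0 \<le> r2 x" "r2 x \<le> R"
      using V x0 bd(7,8)[OF x] by (auto simp: r1_def r2_def)
    have p0': "0 < p0" using p0 by simp
    have RC: "R * C * x ^ 2 \<le> R * C * b * x" using mult_left_mono[OF xb(1)[OF x], of "R * C"] CR by (simp add: mult.assoc)
    have r1': "r1 x \<le> 1 / p0 + R * C * b * x" using r[OF x] RC by (simp add: r1_def)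
    have c1: "r1 x * s x \<le> 2 + 4 * R * C * b * x"
    proof -
      have "s x \<le> 2 + 2 * (C * x ^ 2)" using bd(1,2)[OF x] unfolding s_def by linarith
      then have "r1 x * s x \<le> r1 x * (2 + 2 * (C * x ^ 2))" using r1 by (intro mult_left_mono) auto
      also have "\<dots> = 2 * r1 x + 2 * (r1 x * (C * x ^ 2))" by (simp add: algebra_simps)
      also have "r1 x * (C * x ^ 2) \<le> R * (C * x ^ 2)" using r1 CR by (intro mult_right_mono) auto
      also have "2 * r1 x \<le> 2 * (1 + R * C * b * x)"
      proof -
        have "1 / p0 \<le> 1" using p0 by simp
        then show ?thesis using r1' by simp
      qed
      finally show ?thesis using RC by (simp add: mult.assoc algebra_simps)
    qed
    have c2: "4 / a * r1 x * (y1 x - a) \<le> 4 + (4 * p0 + 4 / a) * R * C * b * x"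
    proof -
      have "y1 x - a \<le> (2 - a) + C * x ^ 2" using bd(1)[OF x] by linarith
      then have "4 / a * r1 x * (y1 x - a) \<le> 4 / a * r1 x * ((2 - a) + C * x ^ 2)" using r1 a by (intro mult_left_mono) auto
      also have "\<dots> = 4 * p0 * r1 x + 4 / a * (r1 x * (C * x ^ 2))" using a by (simp add: p0_def field_simps)
      also have "\<dots> \<le> 4 * p0 * (1 / p0 + R * C * b * x) + 4 / a * (R * (C * x ^ 2))"
        using r1 r1' p0' a CR by (intro add_mono mult_left_mono mult_right_mono) auto
      also have "4 / a * (R * (C * x ^ 2)) \<le> 4 / a * (R * C * b * x)"
        using RC a by (intro mult_left_mono) (auto simp: mult.assoc)
      also have "4 * p0 * (1 / p0 + R * C * b * x) = 4 + 4 * p0 * R * C * b * x" using p0' by (simp add: field_simps)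
      finally show ?thesis by (simp add: algebra_simps)
    qed
    have k1: "(- 4 * a * r1 x + 4 / a * r1 x * et x) * (al x * be x) \<le> (4 * a * R + 4 / a * R * H) * ((al x)\<^sup>2 + (be x)\<^sup>2 + (de x)\<^sup>2)"
    proof (rule quadratic_cross_terms)
      have "\<bar>4 / a * r1 x * et x\<bar> \<le> 4 / a * R * H"
        unfolding abs_mult using r1 a etb[OF x] CR H0 by (intro mult_mono) auto
      moreover have "\<bar>- 4 * a * r1 x\<bar> \<le> 4 * a * R" using r1 a by (simp add: abs_mult)
      ultimately show "\<bar>- 4 * a * r1 x + 4 / a * r1 x * et x\<bar> \<le> 4 * a * R + 4 / a * R * H" by linarith
    qed (use a CR H0 in simp)
    have rr: "r1 x * r2 x \<le> R\<^sup>2" "0 \<le> r1 x * r2 x" using r1 CR by (auto simp: power2_eq_square intro!: mult_mono)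
    have k2: "(- 2 * ph x * (r1 x * r2 x) * x) * (al x * de x) \<le> (2 * Ph * R\<^sup>2 * b) * ((al x)\<^sup>2 + (de x)\<^sup>2 + (be x)\<^sup>2)"
    proof (rule quadratic_cross_terms)
      have "\<bar>ph x\<bar> * (r1 x * r2 x) * x \<le> Ph * R\<^sup>2 * b"
        using phb[OF x] rr x0 by (intro mult_mono) (auto intro: order_trans[OF abs_ge_zero])
      then show "\<bar>- 2 * ph x * (r1 x * r2 x) * x\<bar> \<le> 2 * Ph * R\<^sup>2 * b"
        using rr x0 by (simp add: abs_mult r1)
      then show "0 \<le> 2 * Ph * R\<^sup>2 * b" by (rule order_trans[OF abs_ge_zero])
    qed
    have k3: "(- 2 * ga x * (r1 x * r2 x)) * (be x * de x) \<le> (2 * Ga * R\<^sup>2) * ((be x)\<^sup>2 + (de x)\<^sup>2 + (al x)\<^sup>2)"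
    proof (rule quadratic_cross_terms)
      have "\<bar>ga x\<bar> * (r1 x * r2 x) \<le> Ga * R\<^sup>2"
        using gab[OF x] rr by (intro mult_mono) (auto intro: order_trans[OF abs_ge_zero])
      then show "\<bar>- 2 * ga x * (r1 x * r2 x)\<bar> \<le> 2 * Ga * R\<^sup>2"
        using rr by (simp add: abs_mult r1)
      then show "0 \<le> 2 * Ga * R\<^sup>2" by (rule order_trans[OF abs_ge_zero])
    qed
    have N0: "0 \<le> N x" "(al x)\<^sup>2 \<le> N x" "(be x)\<^sup>2 \<le> N x" by (auto simp: N_def)
    have "D x = (al x)\<^sup>2 * (r1 x * s x - 3) + (be x)\<^sup>2 * (4 / a * r1 x * (y1 x - a) - 5) - 5 * (de x)\<^sup>2 + 2 * (al x * de x)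
      + x * ((- 4 * a * r1 x + 4 / a * r1 x * et x) * (al x * be x) + (- 2 * ph x * (r1 x * r2 x) * x) * (al x * de x)
        + (- 2 * ga x * (r1 x * r2 x)) * (be x * de x))"
    proof -
      define w where "w = 2 / a"
      have f4: "4 / a = 2 * w" by (simp add: w_def)
      show ?thesis unfolding D_def N_def ax_def bx_def f4 w_def[symmetric]
        by (simp add: power2_eq_square algebra_simps)
    qed
    also have "\<dots> \<le> (al x)\<^sup>2 * (- 1 + 4 * R * C * b * x) + (be x)\<^sup>2 * (- 1 + (4 * p0 + 4 / a) * R * C * b * x) - 5 * (de x)\<^sup>2 + 2 * (al x * de x)
      + x * ((4 * a * R + 4 / a * R * H) * N x + (2 * Ph * R\<^sup>2 * b) * N x + (2 * Ga * R\<^sup>2) * N x)"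
    proof -
      have "(al x)\<^sup>2 * (r1 x * s x - 3) \<le> (al x)\<^sup>2 * (- 1 + 4 * R * C * b * x)" by (rule mult_left_mono) (use c1 in auto)
      moreover have "(be x)\<^sup>2 * (4 / a * r1 x * (y1 x - a) - 5) \<le> (be x)\<^sup>2 * (- 1 + (4 * p0 + 4 / a) * R * C * b * x)"
        by (rule mult_left_mono) (use c2 in auto)
      moreover have "x * ((- 4 * a * r1 x + 4 / a * r1 x * et x) * (al x * be x) + (- 2 * ph x * (r1 x * r2 x) * x) * (al x * de x)
        + (- 2 * ga x * (r1 x * r2 x)) * (be x * de x)) \<le> x * ((4 * a * R + 4 / a * R * H) * N x + (2 * Ph * R\<^sup>2 * b) * N x + (2 * Ga * R\<^sup>2) * N x)"
        using k1 k2 k3 x0 by (intro mult_left_mono add_mono) (auto simp: N_def add_ac)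
      ultimately show ?thesis by linarith
    qed
    also have "\<dots> \<le> 4 * R * C * b * x * N x + (4 * p0 + 4 / a) * R * C * b * x * N x
      + x * ((4 * a * R + 4 / a * R * H) * N x + (2 * Ph * R\<^sup>2 * b) * N x + (2 * Ga * R\<^sup>2) * N x)"
    proof -
      have "2 * (al x * de x) \<le> (al x)\<^sup>2 + (de x)\<^sup>2" using sum_squares_bound[of "al x" "de x"] by (simp add: mult.assoc)
      moreover have "4 * R * C * b * x * (al x)\<^sup>2 \<le> 4 * R * C * b * x * N x" using N0 CR b x0 by (intro mult_left_mono) auto
      moreover have "(4 * p0 + 4 / a) * R * C * b * x * (be x)\<^sup>2 \<le> (4 * p0 + 4 / a) * R * C * b * x * N x"
        using N0 CR b x0 a p0' by (intro mult_left_mono) auto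
      moreover have "0 \<le> (be x)\<^sup>2" "0 \<le> (de x)\<^sup>2" by auto
      moreover have "(al x)\<^sup>2 * (- 1 + 4 * R * C * b * x) = - (al x)\<^sup>2 + 4 * R * C * b * x * (al x)\<^sup>2"
        "(be x)\<^sup>2 * (- 1 + (4 * p0 + 4 / a) * R * C * b * x) = - (be x)\<^sup>2 + (4 * p0 + 4 / a) * R * C * b * x * (be x)\<^sup>2"
        by (simp_all add: algebra_simps)
      ultimately show ?thesis by linarith
    qed
    also have "\<dots> = K * (x * N x)" by (simp add: K_def algebra_simps)
    finally show ?thesis .
  qed
  have Nb: "N x \<le> 12 * C\<^sup>2" if x: "x \<in> {0<..b}" for x
  proof -
    have x0: "0 < x" using x by simp
    have q: "(u / x ^ k)\<^sup>2 \<le> 4 * C\<^sup>2" if "\<bar>u\<bar> \<le> 2 * (C * x ^ k)" for u k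
    proof -
      have "\<bar>u / x ^ k\<bar> \<le> 2 * C" using that x0 by (simp add: abs_divide pos_divide_le_eq)
      then have "\<bar>u / x ^ k\<bar>\<^sup>2 \<le> (2 * C)\<^sup>2" by (rule power_mono) (rule abs_ge_zero)
      then show ?thesis unfolding power2_abs by (simp add: power_mult_distrib)
    qed
    have "(al x)\<^sup>2 \<le> 4 * C\<^sup>2" unfolding al_def by (rule q) (use bd(1,2)[OF x] in linarith)
    moreover have "(be x)\<^sup>2 \<le> 4 * C\<^sup>2" unfolding be_def by (rule q) (use bd(5,6)[OF x] in linarith)
    moreover have "(de x)\<^sup>2 \<le> 4 * C\<^sup>2" unfolding de_def by (rule q) (use bd(3,4)[OF x] in linarith)
    ultimately show ?thesis by (simp add: N_def)
  qed
  \<comment> \<open>the weighted energy grows at most exponentially from the value 0 that it takes at the origin\<close>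
  have dec: "x * N x * exp (- K * x) \<le> e * N e * exp (- K * e)" if e: "0 < e" "e < x" for e
  proof (rule DERIV_nonpos_imp_nonincreasing[of e x "\<lambda>x. x * N x * exp (- K * x)"])
    fix t assume t: "e \<le> t" "t \<le> x"
    then have tb: "t \<in> {0<..b}" using e x by auto
    have "((\<lambda>x. x * N x * exp (- K * x)) has_real_derivative D t * exp (- K * t) + (exp (- K * t) * (- K)) * (t * N t)) (at t)"
      by (rule DERIV_mult[OF dE[OF tb]]) (auto intro!: derivative_eq_intros)
    moreover have "D t * exp (- K * t) + (exp (- K * t) * (- K)) * (t * N t) = (D t - K * (t * N t)) * exp (- K * t)"
      by (simp add: algebra_simps)
    moreover have "(D t - K * (t * N t)) * exp (- K * t) \<le> 0"
      using DE[OF tb] by (intro mult_nonpos_nonneg) auto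
    ultimately show "\<exists>E. ((\<lambda>x. x * N x * exp (- K * x)) has_real_derivative E) (at t) \<and> E \<le> 0" by auto
  qed (use e in simp)
  have lim: "((\<lambda>e. e * (12 * C\<^sup>2) * exp (- K * e)) \<longlongrightarrow> 0 * (12 * C\<^sup>2) * exp (- K * 0)) (at_right 0)"
    by (intro tendsto_intros)
  have "x * N x * exp (- K * x) \<le> 0 * (12 * C\<^sup>2) * exp (- K * 0)"
  proof (rule tendsto_lowerbound[OF lim])
    show "\<forall>\<^sub>F e in at_right 0. x * N x * exp (- K * x) \<le> e * (12 * C\<^sup>2) * exp (- K * e)"
      using eventually_at_right_real[OF x(1)]
    proof eventually_elim
      case (elim e)
      then have "e \<in> {0<..b}" using x by auto
      then have "e * N e * exp (- K * e) \<le> e * (12 * C\<^sup>2) * exp (- K * e)"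
        using Nb[of e] by (intro mult_right_mono mult_left_mono) auto
      note hi = this
      have "x * N x * exp (- K * x) \<le> e * N e * exp (- K * e)" by (rule dec) (use elim in auto)
      then show ?case using hi by (rule order_trans)
    qed
  qed simp
  then have "x * N x \<le> 0" by (simp add: mult_le_0_iff)
  then have "N x \<le> 0" using x by (simp add: mult_le_0_iff)
  then have "(al x)\<^sup>2 = 0 \<and> (be x)\<^sup>2 = 0 \<and> (de x)\<^sup>2 = 0"
    unfolding N_def using zero_le_power2[of "al x"] zero_le_power2[of "be x"] zero_le_power2[of "de x"] by linarith
  then show "V1 x = V2 x" "y1 x = y2 x" "h1 x = h2 x" using x by (auto simp: al_def be_def de_def)
qed

section \<open>Admissible profiles solve the reduced system\<close>

lemma taylor_bound:
  fixes f :: "real \<Rightarrow> real"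
  assumes r: "0 < r" and sm: "smooth_on f {-r<..<r}" and n: "0 < n"
  shows "\<exists>C. \<forall>x\<in>{0<..<r / 2}. \<bar>f x - (\<Sum>k<n. (deriv ^^ k) f 0 / fact k * x ^ k)\<bar> \<le> C * x ^ n"
proof -
  have "continuous_on {0..r / 2} ((deriv ^^ n) f)"
    using sm r unfolding smooth_on_def Ck_on_def by (auto intro: continuous_on_subset)
  then have "bounded ((deriv ^^ n) f ` {0..r / 2})"
    by (intro compact_imp_bounded compact_continuous_image) auto
  then obtain B where "\<forall>t\<in>{0..r / 2}. norm ((deriv ^^ n) f t) \<le> B"
    unfolding bounded_iff by blast
  then have B: "\<bar>(deriv ^^ n) f t\<bar> \<le> B" if "t \<in> {0..r / 2}" for t using that by (metis real_norm_def)
  show ?thesis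
  proof (intro exI[of _ "B / fact n"] ballI)
    fix x assume x: "x \<in> {0<..<r / 2}"
    have "\<exists>t>0. t < x \<and> f x = (\<Sum>k<n. (deriv ^^ k) f 0 / fact k * x ^ k) + (deriv ^^ n) f t / fact n * x ^ n"
    proof (rule Maclaurin[where diff = "\<lambda>k. (deriv ^^ k) f"])
      show "\<forall>m t. m < n \<and> 0 \<le> t \<and> t \<le> x \<longrightarrow> ((deriv ^^ m) f has_real_derivative (deriv ^^ Suc m) f t) (at t)"
        using x smooth_on_has_derivative[OF sm] by (simp del: funpow.simps)
    qed (use x n in auto)
    then obtain t where t: "0 < t" "t < x" "f x = (\<Sum>k<n. (deriv ^^ k) f 0 / fact k * x ^ k) + (deriv ^^ n) f t / fact n * x ^ n" by blast
    have "\<bar>f x - (\<Sum>k<n. (deriv ^^ k) f 0 / fact k * x ^ k)\<bar> = \<bar>(deriv ^^ n) f t\<bar> / fact n * x ^ n"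
      using t(3) x by (simp add: abs_mult)
    also have "\<dots> \<le> B / fact n * x ^ n"
      using B[of t] t x by (intro mult_right_mono divide_right_mono) auto
    finally show "\<bar>f x - (\<Sum>k<n. (deriv ^^ k) f 0 / fact k * x ^ k)\<bar> \<le> B / fact n * x ^ n" .
  qed
qed

text \<open>
  Gronwall's inequality run backwards.
\<close>

lemma backward_linear_uniqueness:
  fixes u c :: "real \<Rightarrow> real"
  assumes pq: "p \<le> q" and c: "continuous_on {p..q} c"
    and du: "\<And>t. p \<le> t \<Longrightarrow> t \<le> q \<Longrightarrow> (u has_real_derivative c t * u t) (at t)" and uq: "u q = 0"
  shows "u p = 0"
proof -
  have "bounded (c ` {p..q})" by (intro compact_imp_bounded compact_continuous_image c) auto
  then obtain K where "\<forall>t\<in>{p..q}. norm (c t) \<le> K" unfolding bounded_iff by blast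
  then have K: "\<bar>c t\<bar> \<le> K" if "t \<in> {p..q}" for t using that by (metis real_norm_def)
  have "(u p)\<^sup>2 * exp (2 * K * p) \<le> (u q)\<^sup>2 * exp (2 * K * q)"
  proof (rule DERIV_nonneg_imp_nondecreasing[OF pq])
    fix t assume t: "p \<le> t" "t \<le> q"
    have "((\<lambda>t. (u t)\<^sup>2 * exp (2 * K * t)) has_real_derivative
        2 * u t * (c t * u t) * exp (2 * K * t) + exp (2 * K * t) * (2 * K) * (u t)\<^sup>2) (at t)"
      by (auto intro!: derivative_eq_intros du t simp: mult_ac)
    moreover have "2 * u t * (c t * u t) * exp (2 * K * t) + exp (2 * K * t) * (2 * K) * (u t)\<^sup>2
        = 2 * (c t + K) * ((u t)\<^sup>2 * exp (2 * K * t))" by (simp add: power2_eq_square algebra_simps)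
    moreover have "0 \<le> 2 * (c t + K) * ((u t)\<^sup>2 * exp (2 * K * t))"
      using K[of t] t by (intro mult_nonneg_nonneg) auto
    ultimately show "\<exists>D. ((\<lambda>t. (u t)\<^sup>2 * exp (2 * K * t)) has_real_derivative D) (at t) \<and> 0 \<le> D" by auto
  qed
  then have "(u p)\<^sup>2 \<le> 0" using uq by (simp add: mult_le_0_iff)
  then show ?thesis by simp
qed

lemma supp_outside: "supp f \<subseteq> {-L..L} \<Longrightarrow> L < \<bar>x\<bar> \<Longrightarrow> f x = 0"
proof (rule ccontr)
  assume s: "supp f \<subseteq> {-L..L}" "L < \<bar>x\<bar>" and "f x \<noteq> 0"
  then have "x \<in> supp f" unfolding supp_def by (intro subsetD[OF closure_subset]) simp
  then have "x \<in> {-L..L}" using s(1) by blast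
  then show False using s(2) by auto
qed

text \<open>
  The consequences of admissibility that the uniqueness and blowup proofs draw on, in one list.
\<close>

lemma admissible_facts:
  assumes a: "0 < a" "a \<le> 1" and L: "0 < L" and adm: "admissible_profile a L \<Omega> U \<Theta>"
  shows "(U has_real_derivative deriv U x) (at x)" "(deriv U has_real_derivative - 2 * \<Omega> x) (at x)"
    "(\<Theta> has_real_derivative deriv \<Theta> x) (at x)"
    "(coeff_l a * x + a * U x) * deriv \<Theta> x = (- 2 + 2 * deriv U x) * \<Theta> x"
    "x \<notin> exceptional a L \<Longrightarrow> (\<Omega> has_real_derivative deriv \<Omega> x) (at x) \<and>
        (coeff_l a * x + a * U x) * deriv \<Omega> x = coeff_omega a * \<Omega> x + deriv \<Theta> x"
    "U 0 = 0" "\<Theta> 0 = 0" "0 \<le> \<Theta> x" "U (- x) = - U x" "\<Omega> (- x) = - \<Omega> x" "\<Theta> (- x) = \<Theta> x"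
    "0 < deriv U 0" "0 < deriv (deriv \<Theta>) 0"
    "(deriv U \<longlongrightarrow> 0) at_infinity"
    "smooth_on U {-L<..<L}" "smooth_on \<Theta> {-L<..<L}"
    "continuous_on UNIV \<Omega>"
    "a \<le> 2 / 3 \<Longrightarrow> smooth_on U UNIV \<and> smooth_on \<Theta> UNIV"
    "2 / 3 < a \<Longrightarrow> L < \<bar>x\<bar> \<Longrightarrow> \<Omega> x = 0 \<and> \<Theta> x = 0"
    "2 / 3 < a \<Longrightarrow> antimono_on {0<..} (\<lambda>X. U X / X)"
proof -
  have sp: "solves_profile_system a (coeff_l a) (coeff_omega a) coeff_theta (exceptional a L) \<Omega> U \<Theta>"
    and ss: "symmetric_structure U \<Theta>" and lim: "(deriv U \<longlongrightarrow> 0) at_infinity"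
    using adm unfolding admissible_profile_def symmetric_profile_def by auto
  have par: "parity_property \<Omega> U \<Theta>" and org: "origin_property \<Omega> U \<Theta>" and mon: "monotonicity_property a U \<Theta>"
    and sup: "support_property a L \<Omega> \<Theta>" and reg: "regularity_property a L \<Omega> U \<Theta>"
    using adm unfolding admissible_profile_def by auto
  show dU: "(U has_real_derivative deriv U x) (at x)" for x
    using sp unfolding solves_profile_system_def by (simp add: DERIV_deriv_iff_real_differentiable)
  show dT: "(\<Theta> has_real_derivative deriv \<Theta> x) (at x)" for x
    using sp unfolding solves_profile_system_def by (simp add: DERIV_deriv_iff_real_differentiable)
  have "deriv (deriv U) x = - 2 * \<Omega> x" for x
  proof -
    have "- deriv (deriv U) x = 2 * \<Omega> x" using sp unfolding solves_profile_system_def by blast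
    then show ?thesis by simp
  qed
  moreover have "(deriv U has_real_derivative deriv (deriv U) x) (at x)" for x
    using sp unfolding solves_profile_system_def by (simp add: DERIV_deriv_iff_real_differentiable)
  ultimately show "(deriv U has_real_derivative - 2 * \<Omega> x) (at x)" for x by simp
  show "(coeff_l a * x + a * U x) * deriv \<Theta> x = (- 2 + 2 * deriv U x) * \<Theta> x" for x
    using sp unfolding solves_profile_system_def coeff_theta_def by blast
  show dO: "x \<notin> exceptional a L \<Longrightarrow> (\<Omega> has_real_derivative deriv \<Omega> x) (at x) \<and>
        (coeff_l a * x + a * U x) * deriv \<Omega> x = coeff_omega a * \<Omega> x + deriv \<Theta> x" for x
    using sp unfolding solves_profile_system_def by (simp add: DERIV_deriv_iff_real_differentiable)
  show "U 0 = 0" using sp unfolding solves_profile_system_def by blast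
  obtain \<psi> where psi: "odd_fun \<psi>" "\<And>X. \<Theta> X = (\<psi> X)\<^sup>2" using ss unfolding symmetric_structure_def by blast
  have "\<psi> (- 0) = - \<psi> 0" using psi(1) unfolding odd_fun_def by blast
  then have "\<psi> 0 = 0" by simp
  then show "\<Theta> 0 = 0" "0 \<le> \<Theta> x" by (auto simp: psi(2))
  show "U (- x) = - U x" "\<Omega> (- x) = - \<Omega> x" "\<Theta> (- x) = \<Theta> x"
    using par unfolding parity_property_def odd_fun_def even_fun_def by auto
  show "0 < deriv U 0" "0 < deriv (deriv \<Theta>) 0" using org unfolding origin_property_def by auto
  show "(deriv U \<longlongrightarrow> 0) at_infinity" by (rule lim)
  show smU: "a \<le> 2 / 3 \<Longrightarrow> smooth_on U UNIV \<and> smooth_on \<Theta> UNIV"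
    using reg a unfolding regularity_property_def by simp
  have smA: "2 / 3 < a \<Longrightarrow> smooth_on U (UNIV - {- L, L}) \<and> smooth_on \<Theta> (UNIV - {- L, L})"
    using reg a unfolding regularity_property_def by (cases "a = 1") auto
  have I: "{-L<..<L} \<subseteq> UNIV - {- L, L}" by auto
  have "smooth_on U {-L<..<L} \<and> smooth_on \<Theta> {-L<..<L}"
  proof (cases "a \<le> 2 / 3")
    case True
    then show ?thesis using smooth_on_subset[OF _ subset_UNIV] smU by blast
  next
    case False
    then show ?thesis using smooth_on_subset[OF _ I] smA by auto
  qed
  then show "smooth_on U {-L<..<L}" "smooth_on \<Theta> {-L<..<L}" by auto
  show "2 / 3 < a \<Longrightarrow> L < \<bar>x\<bar> \<Longrightarrow> \<Omega> x = 0 \<and> \<Theta> x = 0"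
  proof -
    assume a23: "2 / 3 < a" and x: "L < \<bar>x\<bar>"
    have "supp \<Omega> \<subseteq> {-L..L}" "supp \<Theta> \<subseteq> {-L..L}" using sup a23 a unfolding support_property_def by auto
    then show "\<Omega> x = 0 \<and> \<Theta> x = 0" using supp_outside[OF _ x] by blast
  qed
  show "2 / 3 < a \<Longrightarrow> antimono_on {0<..} (\<lambda>X. U X / X)"
    using mon a unfolding monotonicity_property_def by simp
  show "continuous_on UNIV \<Omega>"
  proof (cases "a \<le> 2 / 3")
    case True
    then have "x \<notin> exceptional a L" for x by (simp add: exceptional_def)
    then show ?thesis using dO DERIV_isCont by (blast intro: continuous_at_imp_continuous_on)
  next
    case False
    then obtain k p where "holder_class k p \<Omega>"
      using reg a unfolding regularity_property_def by (cases "a = 1") auto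
    then have Ck: "Ck_on k \<Omega> UNIV" unfolding holder_class_def by blast
    show ?thesis
    proof (cases k)
      case 0
      then show ?thesis using Ck unfolding Ck_on_def by simp
    next
      case (Suc j)
      then have "\<Omega> differentiable (at x)" for x
        using Ck unfolding Ck_on_def by (metis UNIV_I funpow_0 zero_less_Suc)
      then show ?thesis by (intro continuous_at_imp_continuous_on ballI differentiable_imp_continuous_within)
    qed
  qed
qed

text \<open>
  The conservation law. The quantity \<open>J = V y' - y (y - 2) / 2 + 2 a \<Theta>\<close>, with \<open>y' = - 2 a \<Omega>\<close>, is continuous, and its derivative away from \<open>\<plusminus>L\<close> is
  \<open>- 2 a\<close> times the defect in the equation for \<open>\<Omega>\<close>; here \<open>c\<^sub>\<omega> = - (c\<^sub>l + 1)\<close> enters. Hence \<open>J\<close> is constant, and its value at the origin is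
  \<open>- y (y - 2) / 2\<close> with \<open>y = a U'(0) > 0\<close>. It remains to see that \<open>y(0) = 2\<close>. If \<open>a > 2/3\<close>, then beyond the support \<open>U'\<close> is constant, hence
  \<open>0\<close> by the Neumann condition, and \<open>J = 0\<close> there. If \<open>a \<le> 2/3\<close>, then \<open>\<Theta>\<close> is smooth with \<open>\<Theta>''(0) > 0\<close>, and the
  equation for \<open>\<Theta>\<close> to second order at \<open>0\<close> leaves only \<open>y(0) = 2\<close>, as \<open>a \<noteq> 1\<close>.
\<close>

theorem admissible_reduced_system:
  assumes a: "0 < a" "a \<le> 1" and L: "0 < L" and adm: "admissible_profile a L \<Omega> U \<Theta>"
  shows "reduced_system a UNIV (\<lambda>x. coeff_l a * x + a * U x) (\<lambda>x. a * deriv U x) \<Theta>"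
    and "a * deriv U 0 = 2" and "2 / 3 < a \<Longrightarrow> L < x \<Longrightarrow> deriv U x = 0"
proof -
  note F = admissible_facts[OF a L adm]
  define V where "V x = coeff_l a * x + a * U x" for x
  define y where "y x = a * deriv U x" for x
  have dV: "(V has_real_derivative coeff_l a + y x) (at x)" for x
    unfolding V_def[abs_def] y_def by (auto intro!: derivative_eq_intros F(1))
  have dy: "(y has_real_derivative - 2 * a * \<Omega> x) (at x)" for x
    unfolding y_def[abs_def] using DERIV_cmult[OF F(2), of a] by (simp add: mult_ac)
  have hV: "V x * deriv \<Theta> x = 2 / a * (y x - a) * \<Theta> x" for x
  proof -
    have "2 / a * (y x - a) = - 2 + 2 * deriv U x" using a by (simp add: y_def field_simps)
    then show ?thesis using F(4)[of x] by (simp only: V_def)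
  qed
  define J where "J x = V x * (- 2 * a * \<Omega> x) - y x * (y x - 2) / 2 + 2 * a * \<Theta> x" for x
  have contJ: "continuous_on UNIV J"
    unfolding J_def[abs_def]
    by (intro continuous_intros F(17) DERIV_continuous_on[OF dV[THEN has_field_derivative_at_within]]
        DERIV_continuous_on[OF dy[THEN has_field_derivative_at_within]] DERIV_continuous_on[OF F(3)[THEN has_field_derivative_at_within]]) auto
  have dJ: "(J has_real_derivative 0) (at x)" if x: "x \<notin> exceptional a L" for x
  proof -
    have dO: "(\<Omega> has_real_derivative deriv \<Omega> x) (at x)" and eq: "V x * deriv \<Omega> x = coeff_omega a * \<Omega> x + deriv \<Theta> x"
      using F(5)[OF x] by (auto simp: V_def)
    have "(J has_real_derivative (coeff_l a + y x) * (- 2 * a * \<Omega> x) + - 2 * a * deriv \<Omega> x * V x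
        - (- 2 * a * \<Omega> x * (y x - 2) + - 2 * a * \<Omega> x * y x) / 2 + 2 * a * deriv \<Theta> x) (at x)"
      unfolding J_def[abs_def]
      by (intro DERIV_add DERIV_diff DERIV_mult dV DERIV_cmult DERIV_cdivide dO F(3) dy)
         (auto intro!: derivative_eq_intros dy)
    moreover have "(coeff_l a + y x) * (- 2 * a * \<Omega> x) + - 2 * a * deriv \<Omega> x * V x
        - (- 2 * a * \<Omega> x * (y x - 2) + - 2 * a * \<Omega> x * y x) / 2 + 2 * a * deriv \<Theta> x
      = - 2 * a * (V x * deriv \<Omega> x - deriv \<Theta> x + (coeff_l a + 1) * \<Omega> x)" by (simp add: field_simps)
    moreover have "V x * deriv \<Omega> x - deriv \<Theta> x + (coeff_l a + 1) * \<Omega> x = 0"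
      unfolding eq by (simp add: coeff_omega_def coeff_l_def algebra_simps)
    ultimately show ?thesis by simp
  qed
  have fin: "finite (exceptional a L)" by (simp add: exceptional_def)
  have zero: "(*) (0::real) = (\<lambda>h. 0)" by auto
  have Jc: "J x = J z" for x z
    by (rule has_derivative_zero_unique_strong_convex[OF convex_UNIV fin contJ _ refl])
       (use dJ in \<open>auto simp: has_field_derivative_def zero\<close>)
  have V0: "V 0 = 0" using F(6) by (simp add: V_def)
  have y0: "0 < y 0" using F(12) a by (simp add: y_def)
  have J0: "J 0 = - (y 0 * (y 0 - 2) / 2)" using V0 F(7) by (simp add: J_def)
  have far: "deriv U x = 0" if a23: "2 / 3 < a" and x: "L < x" for x
  proof -
    have c: "deriv U z = deriv U x" if "z \<in> {L<..}" for z
    proof (rule eq_of_same_derivative[of "{L<..}" x "deriv U" "\<lambda>_. 0" "\<lambda>_. deriv U x"])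
      show "(deriv U has_real_derivative 0) (at w)" if "w \<in> {L<..}" for w
        using F(2)[of w] F(19)[OF a23, of w] that L by auto
    qed (use that x in auto)
    have "(deriv U \<longlongrightarrow> 0) at_top"
      by (rule tendsto_mono[OF _ F(14)]) (simp add: at_infinity_eq_at_top_bot)
    moreover have "(deriv U \<longlongrightarrow> deriv U x) at_top"
    proof (rule tendsto_eventually)
      show "\<forall>\<^sub>F z in at_top. deriv U z = deriv U x"
        using eventually_gt_at_top[of L]
      proof eventually_elim
        case (elim z)
        then show ?case using c[of z] by blast
      qed
    qed
    ultimately show ?thesis using tendsto_unique[OF trivial_limit_at_top_linorder] by metis
  qed
  then show "2 / 3 < a \<Longrightarrow> L < x \<Longrightarrow> deriv U x = 0" .
  have y02: "y 0 = 2"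
  proof (cases "a \<le> 2 / 3")
    case False
    then have a23: "2 / 3 < a" by simp
    have "J (L + 1) = 0" using F(19)[OF a23, of "L + 1"] far[OF a23, of "L + 1"] L by (simp add: J_def y_def)
    then show ?thesis using J0 Jc[of 0 "L + 1"] y0 by simp
  next
    case True
    \<comment> \<open>compare the coefficients of \<open>x\<^sup>2\<close> in the equation for \<open>\<Theta>\<close> at the origin\<close>
    have smT: "smooth_on \<Theta> UNIV" and smU: "smooth_on U UNIV" using F(18)[OF True] by auto
    have dT: "(deriv \<Theta> has_real_derivative deriv (deriv \<Theta>) x) (at x)" for x
      using smooth_on_has_derivative[OF smT, of x 1] by simp
    have dT2: "(deriv (deriv \<Theta>) has_real_derivative deriv (deriv (deriv \<Theta>)) x) (at x)" for x
      using smooth_on_has_derivative[OF smT, of x 2] by (simp add: numeral_2_eq_2)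
    have dy2: "(y has_real_derivative deriv y x) (at x)" for x using dy DERIV_imp_deriv by metis
    have "\<Omega> differentiable (at x)" for x
      using F(5)[of x] True real_differentiable_def by (auto simp: exceptional_def)
    moreover have "deriv y = (\<lambda>x. - 2 * a * \<Omega> x)" using dy DERIV_imp_deriv by blast
    ultimately have dy3: "(deriv y has_real_derivative deriv (deriv y) x) (at x)" for x
      by (auto simp: DERIV_deriv_iff_real_differentiable intro!: derivative_intros)
    have T1: "deriv \<Theta> 0 = 0"
    proof -
      have "deriv \<Theta> (- 0) = - deriv \<Theta> 0"
        by (rule deriv_even) (use F(3) F(11) real_differentiable_def in blast)+
      then show ?thesis by simp
    qed
    have e0: "(\<lambda>x. V x * deriv \<Theta> x) = (\<lambda>x. 2 / a * (y x - a) * \<Theta> x)" using hV by blast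
    have l1: "((\<lambda>x. V x * deriv \<Theta> x) has_real_derivative (coeff_l a + y x) * deriv \<Theta> x + deriv (deriv \<Theta>) x * V x) (at x)" for x
      by (rule DERIV_mult[OF dV dT])
    have g: "((\<lambda>x. 2 / a * (y x - a)) has_real_derivative 2 / a * deriv y x) (at x)" for x
      using DERIV_cmult[OF DERIV_diff[OF dy2 DERIV_const], of "2 / a"] by simp
    have r1: "((\<lambda>x. 2 / a * (y x - a) * \<Theta> x) has_real_derivative (2 / a * deriv y x) * \<Theta> x + deriv \<Theta> x * (2 / a * (y x - a))) (at x)" for x
      by (rule DERIV_mult[OF g F(3)])
    have e1: "(\<lambda>x. (coeff_l a + y x) * deriv \<Theta> x + deriv (deriv \<Theta>) x * V x)
       = (\<lambda>x. (2 / a * deriv y x) * \<Theta> x + deriv \<Theta> x * (2 / a * (y x - a)))"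
      using l1 r1 unfolding e0 using DERIV_unique by blast
    have k: "((\<lambda>x. coeff_l a + y x) has_real_derivative deriv y x) (at x)" for x
      using DERIV_add[OF DERIV_const dy2] by simp
    have "((\<lambda>x. (coeff_l a + y x) * deriv \<Theta> x + deriv (deriv \<Theta>) x * V x) has_real_derivative
      (deriv y 0 * deriv \<Theta> 0 + deriv (deriv \<Theta>) 0 * (coeff_l a + y 0)) +
      (deriv (deriv (deriv \<Theta>)) 0 * V 0 + (coeff_l a + y 0) * deriv (deriv \<Theta>) 0)) (at 0)"
      by (intro DERIV_add DERIV_mult k dT dT2 dV)
    moreover have "((\<lambda>x. (2 / a * deriv y x) * \<Theta> x + deriv \<Theta> x * (2 / a * (y x - a))) has_real_derivative
      ((2 / a * deriv (deriv y) 0) * \<Theta> 0 + deriv \<Theta> 0 * (2 / a * deriv y 0)) +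
      (deriv (deriv \<Theta>) 0 * (2 / a * (y 0 - a)) + (2 / a * deriv y 0) * deriv \<Theta> 0)) (at 0)"
      by (intro DERIV_add DERIV_mult[OF DERIV_cmult[OF dy3] F(3)] DERIV_mult[OF dT g])
    ultimately have "2 * (deriv (deriv \<Theta>) 0 * (coeff_l a + y 0)) = deriv (deriv \<Theta>) 0 * (2 / a * (y 0 - a))"
      unfolding e1 using DERIV_unique by (fastforce simp: T1 V0 F(7))
    then have "deriv (deriv \<Theta>) 0 * (2 * (coeff_l a + y 0)) = deriv (deriv \<Theta>) 0 * (2 / a * (y 0 - a))"
      by (simp only: mult.left_commute)
    then have "2 * (coeff_l a + y 0) = 2 / a * (y 0 - a)"
      using F(13) unfolding mult_cancel_left by linarith
    then have "(y 0 - 2) * (1 - a) = 0" using a by (simp add: coeff_l_def field_simps)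
    then show ?thesis using True by simp
  qed
  then show "a * deriv U 0 = 2" by (simp add: y_def)
  have J00: "J x = 0" for x using Jc[of x 0] J0 y02 by simp
  have "reduced_system a UNIV V y \<Theta>"
    unfolding reduced_system_def
  proof (intro ballI conjI exI)
    fix x
    show "(V has_real_derivative coeff_l a + y x) (at x)" by (rule dV)
    show "(y has_real_derivative - 2 * a * \<Omega> x) (at x)" by (rule dy)
    show "V x * (- 2 * a * \<Omega> x) = y x * (y x - 2) / 2 - 2 * a * \<Theta> x" using J00[of x] by (simp add: J_def)
    show "(\<Theta> has_real_derivative deriv \<Theta> x) (at x)" by (rule F(3))
    show "V x * deriv \<Theta> x = 2 / a * (y x - a) * \<Theta> x" by (rule hV)
  qed
  then show "reduced_system a UNIV (\<lambda>x. coeff_l a * x + a * U x) (\<lambda>x. a * deriv U x) \<Theta>"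
    by (simp add: V_def[abs_def] y_def[abs_def])
qed

section \<open>Uniqueness up to scaling\<close>

lemma admissible_origin_asymptotics:
  assumes a: "0 < a" "a \<le> 1" and L: "0 < L" and adm: "admissible_profile a L \<Omega> U \<Theta>"
  shows "origin_asymptotics a (deriv (deriv \<Theta>) 0 / 2) (\<lambda>x. coeff_l a * x + a * U x) (\<lambda>x. a * deriv U x) \<Theta>"
proof -
  note F = admissible_facts[OF a L adm]
  have U1: "deriv U 0 = 2 / a" using admissible_reduced_system(2)[OF a L adm] a by (simp add: field_simps)
  have O0: "\<Omega> 0 = 0" using F(10)[of 0] by simp
  have U2: "deriv (deriv U) 0 = 0" using DERIV_imp_deriv[OF F(2)[of 0]] O0 by simp
  have T1: "deriv \<Theta> 0 = 0"
  proof -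
    have "deriv \<Theta> (- 0) = - deriv \<Theta> 0"
      by (rule deriv_even) (use F(3) F(11) real_differentiable_def in blast)+
    then show ?thesis by simp
  qed
  define m where "m = deriv (deriv \<Theta>) 0 / 2"
  have sums: "(\<Sum>k<3. (deriv ^^ k) U 0 / fact k * x ^ k) = 2 / a * x"
    "(\<Sum>k<2. (deriv ^^ k) (deriv U) 0 / fact k * x ^ k) = 2 / a"
    "(\<Sum>k<3. (deriv ^^ k) \<Theta> 0 / fact k * x ^ k) = m * x ^ 2" for x
    by (simp_all add: numeral_3_eq_3 numeral_2_eq_2 F(6) F(7) U1 U2 T1 m_def)
  obtain C1 where "\<forall>x\<in>{0<..<L / 2}. \<bar>U x - 2 / a * x\<bar> \<le> C1 * x ^ 3"
    using taylor_bound[where n = 3, OF L F(15) zero_less_numeral] unfolding sums by blast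
  note C1 = bspec[OF this]
  obtain C2 where "\<forall>x\<in>{0<..<L / 2}. \<bar>deriv U x - 2 / a\<bar> \<le> C2 * x ^ 2"
    using taylor_bound[where n = 2, OF L smooth_on_deriv[OF F(15)] zero_less_numeral] unfolding sums by blast
  note C2 = bspec[OF this]
  obtain C3 where "\<forall>x\<in>{0<..<L / 2}. \<bar>\<Theta> x - m * x ^ 2\<bar> \<le> C3 * x ^ 3"
    using taylor_bound[where n = 3, OF L F(16) zero_less_numeral] unfolding sums by blast
  note C3 = bspec[OF this]
  define C where "C = max (a * C1) (max (a * C2) C3)"
  have up: "a * C1 * t \<le> C * t" "a * C2 * t \<le> C * t" "C3 * t \<le> C * t" if "0 \<le> t" for t
    using that by (auto simp: C_def intro!: mult_right_mono)
  show ?thesis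
    unfolding origin_asymptotics_def m_def[symmetric]
  proof (rule exI[of _ C], rule exI[of _ "L / 2"], intro conjI ballI)
    fix x assume x: "x \<in> {0<..<L / 2}"
    then have n: "0 \<le> x ^ 2" "0 \<le> x ^ 3" by auto
    have "\<bar>a * deriv U x - 2\<bar> = a * \<bar>deriv U x - 2 / a\<bar>"
    proof -
      have "a * deriv U x - 2 = a * (deriv U x - 2 / a)" using a by (simp add: field_simps)
      then show ?thesis using a by (simp add: abs_mult)
    qed
    also have "\<dots> \<le> a * (C2 * x ^ 2)" using C2[OF x] a by (intro mult_left_mono) auto
    also have "\<dots> \<le> C * x ^ 2" using up(2)[OF n(1)] by (simp add: mult.assoc)
    finally show "\<bar>a * deriv U x - 2\<bar> \<le> C * x ^ 2" .
    have "\<bar>coeff_l a * x + a * U x - (2 / a - 1) * x\<bar> = a * \<bar>U x - 2 / a * x\<bar>"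
    proof -
      have "coeff_l a * x + a * U x - (2 / a - 1) * x = a * (U x - 2 / a * x)"
        using a by (simp add: coeff_l_def field_simps)
      then show ?thesis using a by (simp add: abs_mult)
    qed
    also have "\<dots> \<le> a * (C1 * x ^ 3)" using C1[OF x] a by (intro mult_left_mono) auto
    also have "\<dots> \<le> C * x ^ 3" using up(1)[OF n(2)] by (simp add: mult.assoc)
    finally show "\<bar>coeff_l a * x + a * U x - (2 / a - 1) * x\<bar> \<le> C * x ^ 3" .
    show "\<bar>\<Theta> x - m * x ^ 2\<bar> \<le> C * x ^ 3" by (rule order_trans[OF C3[OF x] up(3)[OF n(2)]])
  qed (use L in auto)
qed

lemma scaling_derivative:
  fixes f :: "real \<Rightarrow> real"
  assumes "(f has_real_derivative D) (at (l * x))"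
  shows "((\<lambda>x. f (l * x)) has_real_derivative D * l) (at x)"
  by (rule DERIV_chain2[where f = f and g = "\<lambda>x. l * x", OF assms]) (auto intro!: derivative_eq_intros)

lemma reduced_system_scale:
  assumes red: "reduced_system a UNIV V y h" and l: "0 < l"
  shows "reduced_system a UNIV (\<lambda>x. V (l * x) / l) (\<lambda>x. y (l * x)) (\<lambda>x. h (l * x))"
  unfolding reduced_system_def
proof (intro ballI)
  fix x
  obtain dy dh where *: "(V has_real_derivative coeff_l a + y (l * x)) (at (l * x))"
    "(y has_real_derivative dy) (at (l * x))" "V (l * x) * dy = y (l * x) * (y (l * x) - 2) / 2 - 2 * a * h (l * x)"
    "(h has_real_derivative dh) (at (l * x))" "V (l * x) * dh = 2 / a * (y (l * x) - a) * h (l * x)"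
    using red unfolding reduced_system_def by blast
  have "((\<lambda>x. V (l * x) / l) has_real_derivative (coeff_l a + y (l * x)) * l / l) (at x)"
    by (rule DERIV_cdivide[OF scaling_derivative[OF *(1)]])
  then have 1: "((\<lambda>x. V (l * x) / l) has_real_derivative coeff_l a + y (l * x)) (at x)" using l by simp
  have 2: "V (l * x) / l * (dy * l) = V (l * x) * dy" "V (l * x) / l * (dh * l) = V (l * x) * dh" using l by auto
  show "((\<lambda>x. V (l * x) / l) has_real_derivative coeff_l a + y (l * x)) (at x) \<and>
    (\<exists>y'. ((\<lambda>x. y (l * x)) has_real_derivative y') (at x) \<and> V (l * x) / l * y' = y (l * x) * (y (l * x) - 2) / 2 - 2 * a * h (l * x)) \<and>
    (\<exists>h'. ((\<lambda>x. h (l * x)) has_real_derivative h') (at x) \<and> V (l * x) / l * h' = 2 / a * (y (l * x) - a) * h (l * x))"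
    using 1 scaling_derivative[OF *(2)] scaling_derivative[OF *(4)] *(3,5)
    by (intro conjI exI[of _ "dy * l"] exI[of _ "dh * l"]) (simp_all add: 2 del: times_divide_eq_left)
qed

lemma origin_asymptotics_scale:
  assumes as: "origin_asymptotics a m V y h" and l: "0 < l"
  shows "origin_asymptotics a (m * l ^ 2) (\<lambda>x. V (l * x) / l) (\<lambda>x. y (l * x)) (\<lambda>x. h (l * x))"
proof -
  obtain C d where d: "0 < d" and C: "\<And>x. x \<in> {0<..<d} \<Longrightarrow>
     \<bar>y x - 2\<bar> \<le> C * x ^ 2 \<and> \<bar>V x - (2 / a - 1) * x\<bar> \<le> C * x ^ 3 \<and> \<bar>h x - m * x ^ 2\<bar> \<le> C * x ^ 3"
    using as unfolding origin_asymptotics_def by blast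
  have C0: "0 \<le> C"
  proof -
    have "0 \<le> C * (d / 2) ^ 2" using C[of "d / 2"] d by (auto intro: order_trans[OF abs_ge_zero])
    then show ?thesis using d by (simp add: zero_le_mult_iff)
  qed
  define B where "B = max (C * l ^ 2) (C * l ^ 3)"
  have up: "C * l ^ 2 * t \<le> B * t" "C * l ^ 3 * t \<le> B * t" if "0 \<le> t" for t
    using that by (auto simp: B_def intro!: mult_right_mono)
  show ?thesis
    unfolding origin_asymptotics_def
  proof (rule exI[of _ B], rule exI[of _ "d / l"], intro conjI ballI)
    fix x assume x: "x \<in> {0<..<d / l}"
    then have n: "0 \<le> x ^ 2" "0 \<le> x ^ 3" by auto
    have lx: "l * x \<in> {0<..<d}" using x l by (auto simp: field_simps)
    note c = C[OF lx]
    have "C * (l * x) ^ 2 \<le> B * x ^ 2" using up(1)[OF n(1)] by (simp add: power_mult_distrib mult.assoc)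
    then show "\<bar>y (l * x) - 2\<bar> \<le> B * x ^ 2" using c by linarith
    have h3: "C * (l * x) ^ 3 \<le> B * x ^ 3" using up(2)[OF n(2)] by (simp add: power_mult_distrib mult.assoc)
    have "m * (l * x) ^ 2 = m * l ^ 2 * x ^ 2" by (simp add: power_mult_distrib)
    then show "\<bar>h (l * x) - m * l ^ 2 * x ^ 2\<bar> \<le> B * x ^ 3" using c h3 by linarith
    have "V (l * x) / l - (2 / a - 1) * x = (V (l * x) - (2 / a - 1) * (l * x)) / l" using l by (simp add: diff_divide_distrib)
    then have "\<bar>V (l * x) / l - (2 / a - 1) * x\<bar> = \<bar>V (l * x) - (2 / a - 1) * (l * x)\<bar> / l" using l by (simp add: abs_divide)
    also have "\<dots> \<le> C * (l * x) ^ 3 / l" using c l by (intro divide_right_mono) auto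
    also have "\<dots> = C * l ^ 2 * x ^ 3" using l by (simp add: power_mult_distrib power2_eq_square power3_eq_cube)
    also have "\<dots> \<le> B * x ^ 3" by (rule up(1)[OF n(2)])
    finally show "\<bar>V (l * x) / l - (2 / a - 1) * x\<bar> \<le> B * x ^ 3" .
  qed (use d l in auto)
qed

text \<open>
  Since \<open>U / X\<close> is nonincreasing, \<open>V\<close> stays nonpositive after its first zero, and it cannot vanish on an interval because
  \<open>y\<close> would be constant with the value \<open>3 - 2/a\<close> in \<open>(0, 2)\<close>, which contradicts the equation for \<open>y\<close>. So \<open>V < 0\<close> beyond the zero, the equations are regular, and the
  zero data far out propagate back to the zero: first for \<open>\<Theta>\<close>, which solves a linear equation, then for \<open>y\<close>.
\<close>

lemma trivial_beyond_zero:
  assumes a: "2 / 3 < a" "a \<le> 1" and L: "0 < L" and adm: "admissible_profile a L \<Omega> U \<Theta>"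
    and z: "0 < z" "coeff_l a * z + a * U z = 0" and x: "z < x"
  shows "deriv U x = 0" "\<Theta> x = 0"
proof -
  have a0: "0 < a" using a by simp
  note F = admissible_facts[OF a0 a(2) L adm]
  note red = admissible_reduced_system(1)[OF a0 a(2) L adm]
  define V where "V x = coeff_l a * x + a * U x" for x
  define y where "y x = a * deriv U x" for x
  have red: "reduced_system a UNIV V y \<Theta>" using red by (simp add: V_def[abs_def] y_def[abs_def])
  have Vx: "V w \<le> V t * (w / t)" if "0 < t" "t \<le> w" for t w
  proof -
    have "U w / w \<le> U t / t" using F(20)[OF a(1)] that by (auto simp: monotone_on_def)
    then have "a * (U w / w) * w \<le> a * (U t / t) * w" using that a0 by (intro mult_right_mono mult_left_mono) auto
    moreover have "V t * (w / t) = coeff_l a * w + a * (U t / t) * w" using that by (simp add: V_def field_simps)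
    moreover have "a * (U w / w) * w = a * U w" using that by simp
    ultimately show ?thesis by (simp add: V_def)
  qed
  have nonpos: "V w \<le> 0" if "z \<le> w" for w using Vx[OF z(1) that] z(2) by (simp add: V_def)
  have neg: "V w < 0" if w: "z < w" for w
  proof (rule ccontr)
    assume "\<not> V w < 0"
    then have Vw: "V w = 0" using nonpos[of w] w by simp
    have zero: "V t = 0" if t: "t \<in> {z<..<w}" for t
    proof -
      have "0 \<le> V t * (w / t)" using Vx[of t w] Vw t z by auto
      then have "0 \<le> V t" using t z w by (simp add: zero_le_mult_iff zero_le_divide_iff)
      then show ?thesis using nonpos[of t] t by simp
    qed
    define t where "t = (z + w) / 2"
    have t: "t \<in> {z<..<w}" using w by (simp add: t_def)
    have "(V has_real_derivative 0) (at t)"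
      by (rule has_field_derivative_transform_within_open[of "\<lambda>_. 0" _ _ "{z<..<w}"]) (use t zero in auto)
    then have "coeff_l a + y t = 0" using reduced_systemD(1)[OF red] DERIV_unique by blast
    then have yt: "y t = 3 - 2 / a" by (simp add: coeff_l_def)
    have "2 / 1 \<le> 2 / a" "2 / a < 3" using a a0 by (auto intro!: divide_left_mono simp: field_simps)
    then have "0 < y t" "y t - 2 < 0" using yt by auto
    then have "y t * (y t - 2) < 0" by (rule mult_pos_neg)
    moreover have "y t * (y t - 2) / 2 - 2 * a * \<Theta> t = 0"
    proof -
      obtain D where "V t * D = y t * (y t - 2) / 2 - 2 * a * \<Theta> t"
        using red unfolding reduced_system_def by blast
      then show ?thesis using zero[OF t] by simp
    qed
    moreover have "0 \<le> 2 * a * \<Theta> t" using F(8)[of t] a0 by simp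
    ultimately show False by linarith
  qed
  define q where "q = max L x + 1"
  have q: "x \<le> q" "L < q" "L < \<bar>q\<bar>" using L by (auto simp: q_def)
  have Tq: "\<Theta> q = 0" using F(19)[OF a(1) q(3)] by simp
  have yq: "y q = 0" using admissible_reduced_system(3)[OF a0 a(2) L adm a(1) q(2)] by (simp add: y_def)
  have Vneg: "V t < 0" if "x \<le> t" for t using neg[of t] that x by simp
  have cont: "continuous_on S V" "continuous_on S y" for S
    using continuous_on_subset[OF reduced_system_continuous(1)[OF red] subset_UNIV]
      continuous_on_subset[OF reduced_system_continuous(2)[OF red] subset_UNIV] by blast+
  have nz: "V s \<noteq> 0" if "x \<le> s" for s using Vneg[OF that] by simp
  have T0: "\<Theta> t = 0" if t: "x \<le> t" "t \<le> q" for t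
  proof (rule backward_linear_uniqueness[where u = \<Theta> and p = t and q = q, OF t(2) _ _ Tq])
    show "continuous_on {t..q} (\<lambda>s. 2 / a * (y s - a) / V s)"
      by (intro continuous_on_divide continuous_on_mult continuous_on_diff continuous_on_const cont ballI nz)
         (use t in auto)
    fix s assume s: "t \<le> s" "s \<le> q"
    show "(\<Theta> has_real_derivative 2 / a * (y s - a) / V s * \<Theta> s) (at s)"
      using reduced_systemD(3)[OF red, of s] Vneg[of s] s t by simp
  qed
  then show "\<Theta> x = 0" using q by simp
  have "y x = 0"
  proof (rule backward_linear_uniqueness[where u = y and p = x and q = q, OF q(1) _ _ yq])
    show "continuous_on {x..q} (\<lambda>s. (y s - 2) / 2 / V s)"
      by (intro continuous_on_divide continuous_on_diff continuous_on_const cont ballI nz) auto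
    fix s assume s: "x \<le> s" "s \<le> q"
    show "(y has_real_derivative (y s - 2) / 2 / V s * y s) (at s)"
      using reduced_systemD(2)[OF red, of s] Vneg[of s] s T0[OF s] by (simp add: mult.commute)
  qed
  then show "deriv U x = 0" using a0 by (simp add: y_def)
qed

text \<open>
  The scaling parameter is chosen so that the second derivatives of \<open>\<Theta>\<close> at \<open>0\<close> agree. After scaling, both profiles solve
  the same singular initial value problem and coincide as long as both transport speeds are positive. Since the speeds coincide too,
  the second one remains positive up to the first zero of the first one, which is reached simultaneously; beyond it both profiles are trivial.
\<close>

theorem profile_unique_up_to_scaling:
  assumes a: "0 < a" "a \<le> 1"
    and L: "0 < L" and adm: "admissible_profile a L \<Omega> U \<Theta>"
    and whole: "a \<le> 2 / 3 \<Longrightarrow> \<forall>x>0. 0 < coeff_l a * x + a * U x"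
    and bdd: "2 / 3 < a \<Longrightarrow> (\<forall>x. 0 < x \<and> x < L \<longrightarrow> 0 < coeff_l a * x + a * U x) \<and> coeff_l a * L + a * U L = 0"
    and L': "0 < L'" and adm': "admissible_profile a L' \<Omega>' U' \<Theta>'"
  shows "\<exists>l>0. \<forall>x. \<Omega>' x = l * \<Omega> (l * x) \<and> U' x = U (l * x) / l \<and> \<Theta>' x = \<Theta> (l * x)"
proof -
  note F = admissible_facts[OF a L adm] and F' = admissible_facts[OF a L' adm']
  define l where "l = sqrt (deriv (deriv \<Theta>') 0 / deriv (deriv \<Theta>) 0)"
  have l: "0 < l" using F(13) F'(13) by (simp add: l_def)
  have m: "deriv (deriv \<Theta>) 0 / 2 * l ^ 2 = deriv (deriv \<Theta>') 0 / 2"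
    using F(13) F'(13) by (simp add: l_def)
  define V where "V x = (coeff_l a * (l * x) + a * U (l * x)) / l" for x
  define y where "y x = a * deriv U (l * x)" for x
  define h where "h x = \<Theta> (l * x)" for x
  define V' where "V' x = coeff_l a * x + a * U' x" for x
  define y' where "y' x = a * deriv U' x" for x
  have red: "reduced_system a UNIV V y h"
    using reduced_system_scale[OF admissible_reduced_system(1)[OF a L adm] l] by (simp add: V_def[abs_def] y_def[abs_def] h_def[abs_def])
  have red': "reduced_system a UNIV V' y' \<Theta>'"
    using admissible_reduced_system(1)[OF a L' adm'] by (simp add: V'_def[abs_def] y'_def[abs_def])
  have as: "origin_asymptotics a (deriv (deriv \<Theta>') 0 / 2) V y h"
    using origin_asymptotics_scale[OF admissible_origin_asymptotics[OF a L adm] l] unfolding m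
    by (simp add: V_def[abs_def] y_def[abs_def] h_def[abs_def])
  have as': "origin_asymptotics a (deriv (deriv \<Theta>') 0 / 2) V' y' \<Theta>'"
    using admissible_origin_asymptotics[OF a L' adm'] by (simp add: V'_def[abs_def] y'_def[abs_def])
  have isV: "isCont V x" "isCont V' x" for x
    using reduced_systemD(1)[OF red, of x] reduced_systemD(1)[OF red', of x] DERIV_isCont by blast+
  have near: "\<exists>d>0. \<forall>x. 0 < x \<and> x < d \<longrightarrow> 0 < V' x"
  proof -
    have "(V' has_real_derivative coeff_l a + y' 0) (at 0)" by (rule reduced_systemD(1)[OF red']) simp
    moreover have "y' 0 = 2" using admissible_reduced_system(2)[OF a L' adm'] by (simp add: y'_def)
    moreover have "0 < coeff_l a + 2"
    proof -
      have "2 / 1 \<le> 2 / a" using a by (intro divide_left_mono) auto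
      then show ?thesis by (simp add: coeff_l_def)
    qed
    moreover have "V' 0 = 0" using F'(6) by (simp add: V'_def)
    ultimately show ?thesis using DERIV_pos_inc_right[of V' _ 0] by fastforce
  qed
  \<comment> \<open>the two solutions agree as long as the first one has positive transport speed\<close>
  have agree: "V x = V' x \<and> y x = y' x \<and> h x = \<Theta>' x" if b: "0 < b" and posV: "\<And>x. 0 < x \<Longrightarrow> x \<le> b \<Longrightarrow> 0 < V x" and x: "0 < x" "x \<le> b" for b x
  proof -
    have upto: "V x = V' x \<and> y x = y' x \<and> h x = \<Theta>' x"
      if c: "0 < c" "c \<le> b" and posV': "\<And>x. 0 < x \<Longrightarrow> x \<le> c \<Longrightarrow> 0 < V' x" and x: "0 < x" "x \<le> c" for c x
      using unique_from_origin[OF a c(1) reduced_system_subset[OF red subset_UNIV] reduced_system_subset[OF red' subset_UNIV] _ posV' as as' x]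
        posV c by force
    have posV': "0 < V' x" if x: "0 < x" "x \<le> b" for x
    proof (rule ccontr)
      assume "\<not> 0 < V' x"
      define Z where "Z = {t \<in> {0<..b}. V' t \<le> 0}"
      have xZ: "x \<in> Z" using x \<open>\<not> 0 < V' x\<close> by (simp add: Z_def)
      obtain d where d: "0 < d" "\<And>t. 0 < t \<Longrightarrow> t < d \<Longrightarrow> 0 < V' t" using near by blast
      define z where "z = Inf Z"
      have bd: "bdd_below Z" by (intro bdd_belowI[of _ 0]) (auto simp: Z_def)
      have "d \<le> z" unfolding z_def
      proof (rule cInf_greatest)
        show "d \<le> t" if "t \<in> Z" for t using d(2)[of t] that by (force simp: Z_def)
      qed (use xZ in auto)
      then have z0: "0 < z" using d by simp
      have zx: "z \<le> x" unfolding z_def by (rule cInf_lower[OF xZ bd])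
      have before: "0 < V' t" if "0 < t" "t < z" for t
      proof (rule ccontr)
        assume "\<not> 0 < V' t"
        then have "t \<in> Z" using that zx x by (simp add: Z_def)
        then have "z \<le> t" unfolding z_def using bd by (rule cInf_lower)
        then show False using that by simp
      qed
      have eq: "V t = V' t" if "t \<in> {0<..<z}" for t
        using upto[of t t] before that zx x by auto
      have ev: "\<forall>\<^sub>F t in at_left z. V t = V' t"
        using eventually_at_left_real[OF z0] by eventually_elim (rule eq)
      have tV: "(V \<longlongrightarrow> V z) (at_left z)" "(V' \<longlongrightarrow> V' z) (at_left z)"
        using isV[of z] unfolding isCont_def by (auto intro: tendsto_mono[OF at_le, rotated])
      have "(V' \<longlongrightarrow> V z) (at_left z)" by (rule Lim_transform_eventually[OF tV(1) ev])
      then have Vz: "V' z = V z" using tendsto_unique[OF _ tV(2)] by simp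
      then have "0 < V' z" using posV[of z] z0 zx x by simp
      then have "\<forall>\<^sub>F t in at z. 0 < V' t"
        using isV(2)[of z] unfolding isCont_def by (intro order_tendstoD(1))
      then obtain e where e: "0 < e" "\<And>t. t \<noteq> z \<Longrightarrow> \<bar>t - z\<bar> < e \<Longrightarrow> 0 < V' t"
        unfolding eventually_at by (auto simp: dist_real_def)
      have "z + e \<le> Inf Z"
      proof (rule cInf_greatest)
        fix t assume t: "t \<in> Z"
        then have "z \<le> t" unfolding z_def using bd by (rule cInf_lower)
        moreover have "V' t \<le> 0" using t by (simp add: Z_def)
        ultimately show "z + e \<le> t" using e(2)[of t] \<open>0 < V' z\<close> by (cases "t = z"; cases "t - z < e") auto
      qed (use xZ in auto)
      then have "z + e \<le> z" by (simp add: z_def)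
      then show False using e by simp
    qed
    show ?thesis by (rule upto[OF b order_refl posV' x])
  qed
  have right: "y x = y' x \<and> h x = \<Theta>' x" if x: "0 < x" for x
  proof (cases "a \<le> 2 / 3")
    case True
    have "0 < V t" if "0 < t" for t
      unfolding V_def using whole[OF True] that l by (intro divide_pos_pos) auto
    then show ?thesis using agree[OF x _ x order_refl] by blast
  next
    case False
    then have a23: "2 / 3 < a" by simp
    define z where "z = L / l"
    have z: "0 < z" "l * z = L" using L l by (auto simp: z_def)
    have Vpos: "0 < V t" if "0 < t" "t < z" for t
    proof -
      have "l * t < L" using that l by (simp add: z_def pos_less_divide_eq mult.commute)
      then show ?thesis unfolding V_def using bdd[OF a23] that l by (intro divide_pos_pos) auto
    qed
    have eq: "V t = V' t \<and> y t = y' t \<and> h t = \<Theta>' t" if "t \<in> {0<..<z}" for t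
      using agree[of t t] Vpos that by auto
    have Vz: "V z = 0" using bdd[OF a23] by (simp add: V_def z(2))
    have lim: "f z = g z" if "isCont f z" "isCont g z" "\<And>t. t \<in> {0<..<z} \<Longrightarrow> f t = g t" for f g :: "real \<Rightarrow> real"
    proof -
      have t: "(f \<longlongrightarrow> f z) (at_left z)" "(g \<longlongrightarrow> g z) (at_left z)"
        using that(1,2) unfolding isCont_def by (auto intro: tendsto_mono[OF at_le, rotated])
      have "\<forall>\<^sub>F t in at_left z. f t = g t"
        using eventually_at_left_real[OF z(1)] by eventually_elim (rule that(3))
      then have "(g \<longlongrightarrow> f z) (at_left z)" by (rule Lim_transform_eventually[OF t(1)])
      then show ?thesis using tendsto_unique[OF _ t(2)] by simp
    qed
    have cont: "isCont y z" "isCont y' z" "isCont h z" "isCont \<Theta>' z"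
      using reduced_system_continuous[OF red] reduced_system_continuous[OF red'] by (auto simp: continuous_on_eq_continuous_at)
    have V'z: "V' z = 0" using lim[OF isV(1)[of z] isV(2)[of z]] eq Vz by simp
    consider "x < z" | "x = z" | "z < x" by linarith
    then show ?thesis
    proof cases
      case 1
      then show ?thesis using eq x by simp
    next
      case 2
      then show ?thesis using lim[OF cont(1,2)] lim[OF cont(3,4)] eq by simp
    next
      case 3
      have "L < l * x" using 3 l by (simp add: z_def pos_divide_less_eq mult.commute)
      then have "deriv U (l * x) = 0" "\<Theta> (l * x) = 0"
        using trivial_beyond_zero[OF a23 a(2) L adm L] bdd[OF a23] by auto
      moreover have "deriv U' x = 0" "\<Theta>' x = 0"
        using trivial_beyond_zero[OF a23 a(2) L' adm' z(1) _ 3] V'z by (auto simp: V'_def)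
      ultimately show ?thesis by (simp add: y_def y'_def h_def)
    qed
  qed
  have dU_even: "deriv U (- x) = deriv U x" "deriv U' (- x) = deriv U' x" for x
    using deriv_odd[of U x] deriv_odd[of U' x] F(1,9) F'(1,9) real_differentiable_def by blast+
  have all: "y x = y' x \<and> h x = \<Theta>' x" for x
  proof -
    consider "0 < x" | "x = 0" | "0 < - x" by linarith
    then show ?thesis
    proof cases
      case 1
      then show ?thesis by (rule right)
    next
      case 2
      then show ?thesis
        using admissible_reduced_system(2)[OF a L adm] admissible_reduced_system(2)[OF a L' adm'] F(7) F'(7)
        by (simp add: y_def y'_def h_def)
    next
      case 3
      from right[OF this] show ?thesis
        using dU_even[of "l * x"] dU_even[of x] F(11)[of "l * x"] F'(11)[of x] by (simp add: y_def y'_def h_def)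
    qed
  qed
  have dU': "deriv U' x = deriv U (l * x)" for x using all[of x] a by (simp add: y_def y'_def)
  have "U' x = U (l * x) / l" for x
  proof (rule eq_of_same_derivative[of UNIV 0 U' "\<lambda>x. deriv U (l * x)" "\<lambda>x. U (l * x) / l"])
    show "(U' has_real_derivative deriv U (l * z)) (at z)" for z using F'(1)[of z] by (simp add: dU')
    show "((\<lambda>x. U (l * x) / l) has_real_derivative deriv U (l * z)) (at z)" for z
      using DERIV_cdivide[OF scaling_derivative[OF F(1)], of l l z] l by simp
  qed (use F(6) F'(6) in auto)
  moreover have "\<Omega>' x = l * \<Omega> (l * x)" for x
  proof -
    have "(deriv U' has_real_derivative - 2 * \<Omega> (l * x) * l) (at x)"
      unfolding dU'[abs_def] by (rule scaling_derivative[OF F(2)])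
    from DERIV_unique[OF this F'(2)] show ?thesis by (simp add: mult.commute)
  qed
  moreover have "\<Theta>' x = \<Theta> (l * x)" for x using all[of x] by (simp add: h_def)
  ultimately show ?thesis using l by blast
qed

section \<open>The self-similar solution and its blowup\<close>

text \<open>
  The chain rule for the self-similar ansatz; the two terms are the prefactor and the moving argument.
\<close>

lemma self_similar_time_derivative:
  assumes t: "t < T" and F: "(F has_real_derivative D) (at (x / (T - t) powr cl))"
  shows "((\<lambda>s. self_similar T c cl F x s) has_real_derivative
     (T - t) powr (c - 1) * (cl * (x / (T - t) powr cl) * D - c * F (x / (T - t) powr cl))) (at t within S)"
proof -
  define p where "p = T - t"
  have p: "0 < p" using t by (simp add: p_def)
  have dp: "((\<lambda>s. (T - s) powr r) has_real_derivative - (r * p powr (r - 1))) (at t)" for r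
    using DERIV_fun_powr[of "\<lambda>s. T - s" "- 1" t r] p by (auto intro!: derivative_eq_intros simp: p_def)
  have "((\<lambda>s. x / (T - s) powr cl) has_real_derivative
      (0 * p powr cl - x * - (cl * p powr (cl - 1))) / (p powr cl * p powr cl)) (at t)"
    using DERIV_divide[OF DERIV_const[of x] dp[of cl]] p by (simp add: p_def)
  also have "(0 * p powr cl - x * - (cl * p powr (cl - 1))) / (p powr cl * p powr cl) = cl * (x / p powr cl) / p"
    using p by (simp add: powr_diff mult_ac)
  finally have dx: "((\<lambda>s. x / (T - s) powr cl) has_real_derivative cl * (x / p powr cl) / p) (at t)" .
  have "((\<lambda>s. F (x / (T - s) powr cl)) has_real_derivative D * (cl * (x / p powr cl) / p)) (at t)"
    by (rule DERIV_chain2[where f = F and g = "\<lambda>s. x / (T - s) powr cl", OF F dx])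
  from DERIV_mult[OF dp[of c] this]
  have "((\<lambda>s. (T - s) powr c * F (x / (T - s) powr cl)) has_real_derivative
     - (c * p powr (c - 1)) * F (x / p powr cl) + D * (cl * (x / p powr cl) / p) * p powr c) (at t)"
    by (simp add: p_def)
  also have "- (c * p powr (c - 1)) * F (x / p powr cl) + D * (cl * (x / p powr cl) / p) * p powr c
     = p powr (c - 1) * (cl * (x / p powr cl) * D - c * F (x / p powr cl))"
    using p by (simp add: powr_diff right_diff_distrib mult_ac)
  finally show ?thesis
    unfolding self_similar_def p_def by (rule has_field_derivative_at_within)
qed

lemma self_similar_space_derivative:
  assumes t: "t < T" and F: "(F has_real_derivative D) (at (x / (T - t) powr cl))"
  shows "((\<lambda>y. self_similar T c cl F y t) has_real_derivative (T - t) powr (c - cl) * D) (at x)"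
proof -
  have "((\<lambda>y. y / (T - t) powr cl) has_real_derivative 1 / (T - t) powr cl) (at x)"
    by (rule DERIV_cdivide[OF DERIV_ident])
  from DERIV_cmult[OF DERIV_chain2[where f = F and g = "\<lambda>y. y / (T - t) powr cl", OF F this], of "(T - t) powr c"]
  show ?thesis by (simp add: self_similar_def powr_diff mult_ac)
qed

lemma self_similar_velocity_gradient:
  assumes t: "t < T" and U: "\<And>x. (U has_real_derivative deriv U x) (at x)"
  shows "deriv (\<lambda>y. self_similar T (cl - 1) cl U y t) = (\<lambda>x. self_similar T (- 1) cl (deriv U) x t)"
proof
  fix x
  show "deriv (\<lambda>y. self_similar T (cl - 1) cl U y t) x = self_similar T (- 1) cl (deriv U) x t"
    using DERIV_imp_deriv[OF self_similar_space_derivative[OF t U, where c = "cl - 1"]]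
    by (simp add: self_similar_def)
qed

text \<open>
  By the chain rule each evolution equation at \<open>(x, t)\<close> is a power of \<open>T - t\<close> times the corresponding profile
  equation at \<open>X = x / (T - t) powr c\<^sub>l\<close>; the exponents match
  because \<open>c\<^sub>\<omega> = - (c\<^sub>l + 1)\<close> and \<open>c\<^sub>\<theta> = - 2\<close>.
\<close>

theorem self_similar_solution:
  assumes a: "0 < a" "a \<le> 1" and L: "0 < L" and adm: "admissible_profile a L \<Omega> U \<Theta>"
  shows "solves_evolution_system a T (\<lambda>t. (\<lambda>y. y * (T - t) powr coeff_l a) ` exceptional a L)
     (self_similar T (coeff_omega a) (coeff_l a) \<Omega>) (self_similar T (coeff_l a - 1) (coeff_l a) U)
     (self_similar T (- 2) (coeff_l a) \<Theta>)"
  unfolding solves_evolution_system_def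
proof (intro ballI)
  note F = admissible_facts[OF a L adm]
  let ?cl = "coeff_l a" and ?co = "coeff_omega a"
  let ?w = "self_similar T ?co ?cl \<Omega>" and ?u = "self_similar T (?cl - 1) ?cl U" and ?h = "self_similar T (- 2) ?cl \<Theta>"
  fix t assume t: "t \<in> {0..<T}"
  then have tT: "t < T" by simp
  define p where "p = T - t"
  have p: "0 < p" using tT by (simp add: p_def)
  have co: "?co = - 1 - ?cl" by (simp add: coeff_omega_def coeff_l_def)
  note du = self_similar_velocity_gradient[OF tT F(1), of ?cl]
  show "(\<forall>x. \<exists>\<theta>t \<theta>x ux. ((\<lambda>s. ?h x s) has_real_derivative \<theta>t) (at t within {0..<T}) \<and>
        ((\<lambda>y. ?h y t) has_real_derivative \<theta>x) (at x) \<and> ((\<lambda>y. ?u y t) has_real_derivative ux) (at x) \<and>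
        \<theta>t + a * ?u x t * \<theta>x = 2 * ux * ?h x t) \<and>
      (\<forall>x. x \<notin> (\<lambda>y. y * (T - t) powr ?cl) ` exceptional a L \<longrightarrow> (\<exists>\<omega>t \<omega>x \<theta>x.
        ((\<lambda>s. ?w x s) has_real_derivative \<omega>t) (at t within {0..<T}) \<and>
        ((\<lambda>y. ?w y t) has_real_derivative \<omega>x) (at x) \<and> ((\<lambda>y. ?h y t) has_real_derivative \<theta>x) (at x) \<and>
        \<omega>t + a * ?u x t * \<omega>x = \<theta>x)) \<and>
      (\<forall>x. deriv (\<lambda>y. ?u y t) differentiable at x \<and> - deriv (deriv (\<lambda>y. ?u y t)) x = 2 * ?w x t) \<and>
      ?u 0 t = 0 \<and> (deriv (\<lambda>y. ?u y t) \<longlongrightarrow> 0) at_infinity"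
  proof (intro conjI allI impI)
    fix x
    define X where "X = x / (T - t) powr ?cl"
    show "\<exists>\<theta>t \<theta>x ux. ((\<lambda>s. ?h x s) has_real_derivative \<theta>t) (at t within {0..<T}) \<and>
        ((\<lambda>y. ?h y t) has_real_derivative \<theta>x) (at x) \<and> ((\<lambda>y. ?u y t) has_real_derivative ux) (at x) \<and>
        \<theta>t + a * ?u x t * \<theta>x = 2 * ux * ?h x t"
    proof (intro exI conjI)
      show "((\<lambda>s. ?h x s) has_real_derivative p powr (- 2 - 1) * (?cl * X * deriv \<Theta> X - (- 2) * \<Theta> X)) (at t within {0..<T})"
        unfolding X_def p_def by (rule self_similar_time_derivative[OF tT F(3)])
      show "((\<lambda>y. ?h y t) has_real_derivative p powr (- 2 - ?cl) * deriv \<Theta> X) (at x)"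
        unfolding X_def p_def by (rule self_similar_space_derivative[OF tT F(3)])
      show "((\<lambda>y. ?u y t) has_real_derivative p powr (?cl - 1 - ?cl) * deriv U X) (at x)"
        unfolding X_def p_def by (rule self_similar_space_derivative[OF tT F(1)])
      have e: "p powr (?cl - 1) * p powr (- 2 - ?cl) = p powr (- 2 - 1)" "p powr (?cl - 1 - ?cl) * p powr (- 2) = p powr (- 2 - 1)"
        by (simp_all only: powr_add[symmetric]) (simp_all add: algebra_simps)
      have "p powr (- 2 - 1) * (?cl * X * deriv \<Theta> X - (- 2) * \<Theta> X) + a * ?u x t * (p powr (- 2 - ?cl) * deriv \<Theta> X)
        = p powr (- 2 - 1) * (?cl * X * deriv \<Theta> X + 2 * \<Theta> X) + a * U X * deriv \<Theta> X * (p powr (?cl - 1) * p powr (- 2 - ?cl))"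
        by (simp add: self_similar_def X_def p_def mult_ac)
      also have "\<dots> = p powr (- 2 - 1) * ((?cl * X + a * U X) * deriv \<Theta> X + 2 * \<Theta> X)"
        unfolding e by (simp add: algebra_simps)
      also have "\<dots> = 2 * deriv U X * \<Theta> X * (p powr (?cl - 1 - ?cl) * p powr (- 2))"
        unfolding F(4) e by (simp add: algebra_simps)
      also have "\<dots> = 2 * (p powr (?cl - 1 - ?cl) * deriv U X) * ?h x t"
        by (simp add: self_similar_def X_def p_def mult_ac)
      finally show "p powr (- 2 - 1) * (?cl * X * deriv \<Theta> X - (- 2) * \<Theta> X) + a * ?u x t * (p powr (- 2 - ?cl) * deriv \<Theta> X)
        = 2 * (p powr (?cl - 1 - ?cl) * deriv U X) * ?h x t" .
    qed
  next
    fix x assume x: "x \<notin> (\<lambda>y. y * (T - t) powr ?cl) ` exceptional a L"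
    define X where "X = x / (T - t) powr ?cl"
    have "x = X * (T - t) powr ?cl" using tT by (simp add: X_def)
    then have "X \<notin> exceptional a L" using x by blast
    from F(5)[OF this] have dO: "(\<Omega> has_real_derivative deriv \<Omega> X) (at X)"
      and eq: "(?cl * X + a * U X) * deriv \<Omega> X = ?co * \<Omega> X + deriv \<Theta> X" by auto
    show "\<exists>\<omega>t \<omega>x \<theta>x. ((\<lambda>s. ?w x s) has_real_derivative \<omega>t) (at t within {0..<T}) \<and>
        ((\<lambda>y. ?w y t) has_real_derivative \<omega>x) (at x) \<and> ((\<lambda>y. ?h y t) has_real_derivative \<theta>x) (at x) \<and>
        \<omega>t + a * ?u x t * \<omega>x = \<theta>x"
    proof (intro exI conjI)
      show "((\<lambda>s. ?w x s) has_real_derivative p powr (?co - 1) * (?cl * X * deriv \<Omega> X - ?co * \<Omega> X)) (at t within {0..<T})"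
        unfolding X_def p_def by (rule self_similar_time_derivative[OF tT dO[unfolded X_def]])
      show "((\<lambda>y. ?w y t) has_real_derivative p powr (?co - ?cl) * deriv \<Omega> X) (at x)"
        unfolding X_def p_def by (rule self_similar_space_derivative[OF tT dO[unfolded X_def]])
      show "((\<lambda>y. ?h y t) has_real_derivative p powr (- 2 - ?cl) * deriv \<Theta> X) (at x)"
        unfolding X_def p_def by (rule self_similar_space_derivative[OF tT F(3)])
      have e: "p powr (?cl - 1) * p powr (?co - ?cl) = p powr (?co - 1)"
        by (simp only: powr_add[symmetric]) (simp add: algebra_simps)
      have "p powr (?co - 1) * (?cl * X * deriv \<Omega> X - ?co * \<Omega> X) + a * ?u x t * (p powr (?co - ?cl) * deriv \<Omega> X)
        = p powr (?co - 1) * (?cl * X * deriv \<Omega> X - ?co * \<Omega> X) + a * U X * deriv \<Omega> X * (p powr (?cl - 1) * p powr (?co - ?cl))"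
        by (simp add: self_similar_def X_def p_def mult_ac)
      also have "\<dots> = p powr (?co - 1) * ((?cl * X + a * U X) * deriv \<Omega> X - ?co * \<Omega> X)"
        unfolding e by (simp add: algebra_simps)
      also have "\<dots> = p powr (?co - 1) * deriv \<Theta> X" unfolding eq by simp
      also have "\<dots> = p powr (- 2 - ?cl) * deriv \<Theta> X" by (simp add: co)
      finally show "p powr (?co - 1) * (?cl * X * deriv \<Omega> X - ?co * \<Omega> X) + a * ?u x t * (p powr (?co - ?cl) * deriv \<Omega> X)
        = p powr (- 2 - ?cl) * deriv \<Theta> X" .
    qed
  next
    fix x
    have d: "(deriv (\<lambda>y. ?u y t) has_real_derivative (T - t) powr (- 1 - ?cl) * (- 2 * \<Omega> (x / (T - t) powr ?cl))) (at x)"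
      unfolding du by (rule self_similar_space_derivative[OF tT F(2)])
    then show "deriv (\<lambda>y. ?u y t) differentiable at x" using real_differentiable_def by blast
    show "- deriv (deriv (\<lambda>y. ?u y t)) x = 2 * ?w x t"
      using DERIV_imp_deriv[OF d] by (simp add: self_similar_def co)
  next
    show "?u 0 t = 0" using F(6) by (simp add: self_similar_def)
    show "(deriv (\<lambda>y. ?u y t) \<longlongrightarrow> 0) at_infinity"
      unfolding du
    proof -
      define c where "c = p powr ?cl"
      have c: "0 < c" using p by (simp add: c_def)
      have "((\<lambda>x. deriv U (x / c)) \<longlongrightarrow> 0) at_infinity"
        unfolding Lim_at_infinity
      proof (intro allI impI)
        fix e :: real assume "0 < e"
        then obtain B where B: "\<And>x. B \<le> norm x \<Longrightarrow> dist (deriv U x) 0 < e"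
          using F(14) unfolding Lim_at_infinity by blast
        show "\<exists>b. \<forall>x. b \<le> norm x \<longrightarrow> dist (deriv U (x / c)) 0 < e"
        proof (intro exI[of _ "B * c"] allI impI B)
          fix x :: real assume "B * c \<le> norm x"
          then show "B \<le> norm (x / c)" using c by (simp add: pos_le_divide_eq abs_divide)
        qed
      qed
      from tendsto_mult_right_zero[OF this, of "p powr (- 1)"]
      show "((\<lambda>x. self_similar T (- 1) ?cl (deriv U) x t) \<longlongrightarrow> 0) at_infinity"
        by (simp add: self_similar_def c_def p_def)
    qed
  qed
qed

text \<open>
  The velocity gradient at the origin is \<open>U'(0) / (T - t)\<close>, and the size of \<open>\<theta>\<close> grows like \<open>(T - t) powr (- 2)\<close>, seen at a
  point that moves with the profile.
\<close>

theorem self_similar_blowup: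
  assumes a: "0 < a" "a \<le> 1" and L: "0 < L" and adm: "admissible_profile a L \<Omega> U \<Theta>"
  shows "blows_up_at T (self_similar T (coeff_l a - 1) (coeff_l a) U) (self_similar T (- 2) (coeff_l a) \<Theta>)"
  unfolding blows_up_at_def
proof
  note F = admissible_facts[OF a L adm]
  fix M :: real
  obtain X where "\<Theta> X \<noteq> 0"
  proof (rule ccontr)
    assume "\<not> thesis"
    then have "\<Theta> = (\<lambda>x. 0)" using that by blast
    then have "deriv (deriv \<Theta>) 0 = 0" by simp
    then show False using F(13) by simp
  qed
  then have X: "0 < \<Theta> X" using F(8)[of X] by simp
  define m where "m = min (deriv U 0) (\<Theta> X)"
  have m: "0 < m" "m \<le> deriv U 0" "m \<le> \<Theta> X" using F(12) X by (auto simp: m_def)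
  define d where "d = min 1 (m / (\<bar>M\<bar> + 1))"
  have d: "0 < d" "d \<le> 1" "d \<le> m / (\<bar>M\<bar> + 1)" using m by (auto simp: d_def)
  show "\<forall>\<^sub>F t in at_left T. (\<exists>x. M < \<bar>deriv (\<lambda>y. self_similar T (coeff_l a - 1) (coeff_l a) U y t) x\<bar>) \<and>
      (\<exists>x. M < \<bar>self_similar T (- 2) (coeff_l a) \<Theta> x t\<bar>)"
  proof (rule eventually_at_leftI)
    show "T - d < T" using d by simp
    fix t assume t: "t \<in> {T - d<..<T}"
    define p where "p = T - t"
    have p: "0 < p" "p < d" "t < T" using t by (auto simp: p_def)
    have "p < m / (\<bar>M\<bar> + 1)" using p d by linarith
    then have pm: "\<bar>M\<bar> + 1 < m / p" using p m by (simp add: field_simps)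
    have 1: "M < p powr (- 1) * deriv U 0"
    proof -
      have "m / p \<le> deriv U 0 / p" using m p by (intro divide_right_mono) auto
      then show ?thesis using pm p by (simp add: powr_minus_divide)
    qed
    have 2: "M < p powr (- 2) * \<Theta> X"
    proof -
      have "m / p \<le> \<Theta> X / p" using m p by (intro divide_right_mono) auto
      also have "\<dots> \<le> \<Theta> X / p / p" using X p d by (simp add: pos_le_divide_eq mult_le_cancel_left1)
      finally show ?thesis using pm p by (simp add: powr_minus_divide power2_eq_square)
    qed
    show "(\<exists>x. M < \<bar>deriv (\<lambda>y. self_similar T (coeff_l a - 1) (coeff_l a) U y t) x\<bar>) \<and>
      (\<exists>x. M < \<bar>self_similar T (- 2) (coeff_l a) \<Theta> x t\<bar>)"
    proof (intro conjI exI)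
      show "M < \<bar>deriv (\<lambda>y. self_similar T (coeff_l a - 1) (coeff_l a) U y t) 0\<bar>"
      proof -
        have "self_similar T (- 1) (coeff_l a) (deriv U) 0 t = p powr (- 1) * deriv U 0"
          by (simp add: self_similar_def p_def)
        then show ?thesis
          unfolding self_similar_velocity_gradient[OF p(3) F(1)] using 1 by linarith
      qed
      show "M < \<bar>self_similar T (- 2) (coeff_l a) \<Theta> (X * p powr coeff_l a) t\<bar>"
        using 2 p by (simp add: self_similar_def p_def[symmetric])
    qed
  qed
qed

lemma length_scale_tends_to_0:
  assumes "0 < c"
  shows "(length_scale T c \<longlongrightarrow> 0) (at_left T)"
  unfolding length_scale_def[abs_def]
proof (rule tendsto_zero_powrI[OF _ tendsto_const _ assms])
  have "((\<lambda>t. T - t) \<longlongrightarrow> T - T) (at_left T)" by (intro tendsto_intros)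
  then show "((\<lambda>t. T - t) \<longlongrightarrow> 0) (at_left T)" by simp
  show "\<forall>\<^sub>F t in at_left T. 0 \<le> T - t"
    by (rule eventually_at_leftI[of "T - 1"]) auto
qed

lemma length_scale_alternatives:
  assumes a: "0 < a"
  shows "a < 2 / 3 \<Longrightarrow> focusing T (coeff_l a)"
    and "a = 2 / 3 \<Longrightarrow> neither_focusing_nor_expanding T (coeff_l a)"
    and "2 / 3 < a \<Longrightarrow> expanding T (coeff_l a)"
proof -
  show "focusing T (coeff_l a)" if "a < 2 / 3"
    unfolding focusing_def using that a by (intro length_scale_tends_to_0) (simp add: coeff_l_def field_simps)
  show "neither_focusing_nor_expanding T (coeff_l a)" if "a = 2 / 3"
  proof -
    have "coeff_l a = 0" unfolding that by (simp add: coeff_l_def)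
    then show ?thesis by (simp add: neither_focusing_nor_expanding_def length_scale_def)
  qed
  show "expanding T (coeff_l a)" if "2 / 3 < a"
  proof -
    have "coeff_l a < 0" using that a by (simp add: coeff_l_def field_simps)
    then have "(length_scale T (- coeff_l a) \<longlongrightarrow> 0) (at_left T)" by (intro length_scale_tends_to_0) simp
    moreover have "\<forall>\<^sub>F t in at_left T. 0 < length_scale T (- coeff_l a) t"
      by (rule eventually_at_leftI[of "T - 1"]) (auto simp: length_scale_def)
    ultimately have "filterlim (\<lambda>t. inverse (length_scale T (- coeff_l a) t)) at_top (at_left T)"
      by (rule filterlim_inverse_at_top)
    then show ?thesis by (simp add: expanding_def length_scale_def[abs_def] powr_minus)
  qed
qed

theorem theorem1p3:
  fixes a :: real
  assumes "0 < a" and "a \<le> 1"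
  shows "\<exists>L \<Omega> U \<Theta>.
    L > 0 \<and> admissible_profile a L \<Omega> U \<Theta> \<and>
    (\<forall>L' \<Omega>' U' \<Theta>'. L' > 0 \<and> admissible_profile a L' \<Omega>' U' \<Theta>' \<longrightarrow>
       (\<exists>lam1 lam2. lam2 > 0 \<and>
          (\<Omega>', U', \<Theta>', coeff_l a, coeff_omega a, coeff_theta) =
            rescale lam1 lam2 (\<Omega>, U, \<Theta>, coeff_l a, coeff_omega a, coeff_theta))) \<and>
    (\<forall>T>0.
       (let \<omega> = self_similar T (coeff_omega a) (coeff_l a) \<Omega>;
            u = self_similar T (coeff_l a - 1) (coeff_l a) U;
            \<theta> = self_similar T (- 2) (coeff_l a) \<Theta>
        in solves_evolution_system a T
             (\<lambda>t. (\<lambda>y. y * (T - t) powr coeff_l a) ` exceptional a L) \<omega> u \<theta> \<and>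
           blows_up_at T u \<theta>) \<and>
       (a < 2 / 3 \<longrightarrow> focusing T (coeff_l a)) \<and>
       (a = 2 / 3 \<longrightarrow> neither_focusing_nor_expanding T (coeff_l a)) \<and>
       (2 / 3 < a \<longrightarrow> expanding T (coeff_l a)))"
proof -
  obtain L \<Omega> U \<Theta> where L: "0 < L" and adm: "admissible_profile a L \<Omega> U \<Theta>"
    and whole: "a \<le> 2 / 3 \<Longrightarrow> \<forall>x>0. 0 < coeff_l a * x + a * U x"
    and bdd: "2 / 3 < a \<Longrightarrow> (\<forall>x. 0 < x \<and> x < L \<longrightarrow> 0 < coeff_l a * x + a * U x) \<and> coeff_l a * L + a * U L = 0"
    using existence_of_profile[OF assms] by blast
  have unique: "\<exists>lam1 lam2. lam2 > 0 \<and> (\<Omega>', U', \<Theta>', coeff_l a, coeff_omega a, coeff_theta) =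
      rescale lam1 lam2 (\<Omega>, U, \<Theta>, coeff_l a, coeff_omega a, coeff_theta)"
    if L': "0 < L'" and adm': "admissible_profile a L' \<Omega>' U' \<Theta>'" for L' \<Omega>' U' \<Theta>'
  proof -
    obtain l where l: "0 < l" "\<And>x. \<Omega>' x = l * \<Omega> (l * x) \<and> U' x = U (l * x) / l \<and> \<Theta>' x = \<Theta> (l * x)"
      using profile_unique_up_to_scaling[OF assms L adm whole bdd L' adm'] by blast
    \<comment> \<open>the constants are kept fixed exactly when both scaling parameters coincide\<close>
    have "(\<Omega>', U', \<Theta>', coeff_l a, coeff_omega a, coeff_theta) =
        rescale l l (\<Omega>, U, \<Theta>, coeff_l a, coeff_omega a, coeff_theta)"
      using l by (auto simp: rescale_def fun_eq_iff power2_eq_square)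
    then show ?thesis using l(1) by blast
  qed
  show ?thesis
    unfolding Let_def
  proof (rule exI[of _ L], rule exI[of _ \<Omega>], rule exI[of _ U], rule exI[of _ \<Theta>], intro conjI allI impI)
    show "0 < L" "admissible_profile a L \<Omega> U \<Theta>" by (fact L adm)+
    show "\<exists>lam1 lam2. lam2 > 0 \<and> (\<Omega>', U', \<Theta>', coeff_l a, coeff_omega a, coeff_theta) =
      rescale lam1 lam2 (\<Omega>, U, \<Theta>, coeff_l a, coeff_omega a, coeff_theta)"
      if "0 < L' \<and> admissible_profile a L' \<Omega>' U' \<Theta>'" for L' \<Omega>' U' \<Theta>'
      using unique that by blast
  qed (use self_similar_solution[OF assms L adm] self_similar_blowup[OF assms L adm]
      length_scale_alternatives[OF assms(1)] in auto)
qed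

end
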